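(* Let $R$ be a commutative ring with unit, $G$ a group and $\mathcal{F}$ a family of finite subgroups of $G$ closed under conjugation and taking subgroups. Induction with the functor $\pi\circ\sigma:\mathcal{O}_{\mathcal{F}}\to\mathcal{H}_{\mathcal{F}}$ takes resolutions of $\underline{R}$ by projective $\mathcal{O}_{\mathcal{F}}$-modules to resolutions of $R^-$ by projective $\mathcal{H}_{\mathcal{F}}$-modules.
   Context: Modules over a small preadditive category are contravariant additive functors from it to left $R$-modules, unless said to be covariant; exactness is objectwise. **Orbit category** $\mathcal{O}_{\mathcal{F}}$: objects $G/H$, $H\in\mathcal{F}$; morphisms $G/H\to G/K$ the free abelian group on the $G$-maps. $\underline{R}$ is the constant $\mathcal{O}_{\mathcal{F}}$-module with value $R$, every $G$-map acting as the identity. **Hecke category** $\mathcal{H}_{\mathcal{F}}$: objects $G/H$, $H\in\mathcal{F}$; morphisms $G/H\to G/K$ are $\mathrm{Hom}_{\mathbb{Z}G}(\mathbb{Z}[G/H],\mathbb{Z}[G/K])$. $R^-$ is the fixed point functor $G/H\mapsto R^H=\mathrm{Hom}_{\mathbb{Z}G}(\mathbb{Z}[G/H],R)$ (trivial action on $R$, morphisms acting by precomposition). **The functor** $\pi\circ\sigma:\mathcal{O}_{\mathcal{F}}\to\mathcal{H}_{\mathcal{F}}$ is the identity on objects and sends a $G$-map $\alpha:G/H\to G/K$ to the induced $\mathbb{Z}G$-homomorphism $\mathbb{Z}[G/H]\to\mathbb{Z}[G/K]$. **Induction:** for an $\mathcal{O}_{\mathcal{F}}$-module $M$, $\mathrm{Ind}_{\pi\circ\sigma}M$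 is the $\mathcal{H}_{\mathcal{F}}$-module $$G/H\mapsto M(?)\otimes_{\mathcal{O}_{\mathcal{F}}}\bigl(R\otimes_{\mathbb{Z}}\mathrm{Hom}_{\mathcal{H}_{\mathcal{F}}}(G/H,(\pi\circ\sigma)(?))\bigr).$$ Here, for $M$ contravariant and $A$ covariant over $\mathcal{O}_{\mathcal{F}}$, $M\otimes_{\mathcal{O}_{\mathcal{F}}}A$ is the quotient of $\bigoplus_{x}M(x)\otimes_RA(x)$ by the relations $M(\alpha)(m)\otimes a\sim m\otimes A(\alpha)(a)$ for all morphisms $\alpha:x\to y$, $m\in M(y)$, $a\in A(x)$. *)

theory Defs
  imports "HOL-Algebra.Free_Abelian_Groups" "HOL-Algebra.Left_Coset" "HOL-Algebra.AbelCoset" "HOL-Algebra.Module" "HOL.Hull"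
begin

section \<open>Modules over a commutative ring\<close>

text \<open>The fields \<open>mult\<close> and \<open>one\<close> that the record type \<open>module\<close> inherits from \<open>ring\<close> carry no
  meaning for modules and are left unspecified.\<close>

definition mod_hom ::
  "('r, 'k) ring_scheme \<Rightarrow> ('r, 'm) module \<Rightarrow> ('r, 'n) module \<Rightarrow> ('m \<Rightarrow> 'n) set" where
  "mod_hom R M N = {f \<in> hom (add_monoid M) (add_monoid N).
     \<forall>r\<in>carrier R. \<forall>m\<in>carrier M. f (r \<odot>\<^bsub>M\<^esub> m) = r \<odot>\<^bsub>N\<^esub> f m}"

definition regular_module :: "('r, 'k) ring_scheme \<Rightarrow> ('r, 'r) module" where
  "regular_module R = \<lparr>carrier = carrier R, monoid.mult = undefined, one = undefined,
     zero = \<zero>\<^bsub>R\<^esub>, add = add R, smult = monoid.mult R\<rparr>"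

definition direct_sum :: "'i set \<Rightarrow> ('i \<Rightarrow> ('r, 'm) module) \<Rightarrow> ('r, 'i \<Rightarrow> 'm) module" where
  "direct_sum I M = \<lparr>carrier = {f \<in> (\<Pi>\<^sub>E i\<in>I. carrier (M i)). finite {i \<in> I. f i \<noteq> \<zero>\<^bsub>M i\<^esub>}},
     monoid.mult = undefined, one = undefined,
     zero = (\<lambda>i\<in>I. \<zero>\<^bsub>M i\<^esub>),
     add = (\<lambda>f g. \<lambda>i\<in>I. f i \<oplus>\<^bsub>M i\<^esub> g i),
     smult = (\<lambda>r f. \<lambda>i\<in>I. r \<odot>\<^bsub>M i\<^esub> f i)\<rparr>"

definition direct_sum_inj :: "'i set \<Rightarrow> ('i \<Rightarrow> ('r, 'm) module) \<Rightarrow> 'i \<Rightarrow> 'm \<Rightarrow> 'i \<Rightarrow> 'm" where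
  "direct_sum_inj I M i m = (\<lambda>j\<in>I. if j = i then m else \<zero>\<^bsub>M j\<^esub>)"

definition span_module :: "('r, 'k) ring_scheme \<Rightarrow> ('r, 'm) module \<Rightarrow> 'm set \<Rightarrow> 'm set" where
  "span_module R M S = (\<lambda>N. submodule N R M) hull S"

definition quot_module :: "('r, 'm) module \<Rightarrow> 'm set \<Rightarrow> ('r, 'm set) module" where
  "quot_module M N = \<lparr>carrier = a_rcosets\<^bsub>M\<^esub> N, monoid.mult = undefined, one = undefined,
     zero = N, add = set_add M,
     smult = (\<lambda>r X. \<Union>m\<in>X. N +>\<^bsub>M\<^esub> (r \<odot>\<^bsub>M\<^esub> m))\<rparr>"


section \<open>Tensor products\<close>

text \<open>\<open>tensor S l l' M B\<close> is the tensor product \<open>M \<otimes>\<^sub>S B\<close> of the module \<open>M\<close> with the abelian group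
  \<open>B\<close> (written multiplicatively), where the scalars in \<open>S\<close> act on \<open>M\<close> by \<open>l\<close> and on \<open>B\<close> by \<open>l'\<close>:
  the quotient of the free abelian group on \<open>M \<times> B\<close> by the biadditivity and balancing relations.
  The ring over which \<open>M\<close> is a module acts through the left factor.\<close>

definition tensor_relations ::
  "'s set \<Rightarrow> ('s \<Rightarrow> 'm \<Rightarrow> 'm) \<Rightarrow> ('s \<Rightarrow> 'b \<Rightarrow> 'b) \<Rightarrow> ('r, 'm) module \<Rightarrow> ('b, 'e) monoid_scheme \<Rightarrow> ('m \<times> 'b \<Rightarrow>\<^sub>0 int) set"
  where
  "tensor_relations S l l' M B = generate (free_Abelian_group (carrier M \<times> carrier B))
     ({frag_of (m \<oplus>\<^bsub>M\<^esub> m', b) - frag_of (m, b) - frag_of (m', b) | m m' b.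
         m \<in> carrier M \<and> m' \<in> carrier M \<and> b \<in> carrier B} \<union>
      {frag_of (m, b \<otimes>\<^bsub>B\<^esub> b') - frag_of (m, b) - frag_of (m, b') | m b b'.
         m \<in> carrier M \<and> b \<in> carrier B \<and> b' \<in> carrier B} \<union>
      {frag_of (l s m, b) - frag_of (m, l' s b) | s m b.
         s \<in> S \<and> m \<in> carrier M \<and> b \<in> carrier B})"

definition tensor ::
  "'s set \<Rightarrow> ('s \<Rightarrow> 'm \<Rightarrow> 'm) \<Rightarrow> ('s \<Rightarrow> 'b \<Rightarrow> 'b) \<Rightarrow> ('r, 'm) module \<Rightarrow> ('b, 'e) monoid_scheme
    \<Rightarrow> ('r, ('m \<times> 'b \<Rightarrow>\<^sub>0 int) set) module" where
  "tensor S l l' M B =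
    (let F = free_Abelian_group (carrier M \<times> carrier B); N = tensor_relations S l l' M B in
     \<lparr>carrier = rcosets\<^bsub>F\<^esub> N, monoid.mult = undefined, one = undefined,
      zero = N, add = set_mult F,
      smult = (\<lambda>r X. \<Union>c\<in>X. N #>\<^bsub>F\<^esub> frag_extend (\<lambda>(m, b). frag_of (r \<odot>\<^bsub>M\<^esub> m, b)) c)\<rparr>)"

definition pure_tensor :: "('r, ('m \<times> 'b \<Rightarrow>\<^sub>0 int) set) module \<Rightarrow> 'm \<Rightarrow> 'b \<Rightarrow> ('m \<times> 'b \<Rightarrow>\<^sub>0 int) set" where
  "pure_tensor T m b = {n + frag_of (m, b) | n. n \<in> \<zero>\<^bsub>T\<^esub>}"

text \<open>\<open>tensor_map T f g\<close> is the map \<open>f \<otimes> g\<close> into the tensor product \<open>T\<close>; the zero element of \<open>T\<close>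
  is the subgroup of relations defining \<open>T\<close>.\<close>

definition tensor_map ::
  "('r, ('n \<times> 'c \<Rightarrow>\<^sub>0 int) set) module \<Rightarrow> ('m \<Rightarrow> 'n) \<Rightarrow> ('b \<Rightarrow> 'c)
    \<Rightarrow> ('m \<times> 'b \<Rightarrow>\<^sub>0 int) set \<Rightarrow> ('n \<times> 'c \<Rightarrow>\<^sub>0 int) set" where
  "tensor_map T f g X =
     {n + frag_extend (\<lambda>(m, b). frag_of (f m, g b)) c | n c. n \<in> \<zero>\<^bsub>T\<^esub> \<and> c \<in> X}"

definition tensor_mod ::
  "('r, 'k) ring_scheme \<Rightarrow> ('r, 'm) module \<Rightarrow> ('r, 'n) module \<Rightarrow> ('r, ('m \<times> 'n \<Rightarrow>\<^sub>0 int) set) module"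
  where
  "tensor_mod R M N = tensor (carrier R) (smult M) (smult N) M (add_monoid N)"

definition scalar_ext ::
  "('r, 'k) ring_scheme \<Rightarrow> 'b monoid \<Rightarrow> ('r, ('r \<times> 'b \<Rightarrow>\<^sub>0 int) set) module" where
  \<comment> \<open>\<open>R \<otimes>\<^sub>\<int> B\<close>\<close>
  "scalar_ext R B = tensor (UNIV :: int set) (\<lambda>k r. [k] \<cdot>\<^bsub>R\<^esub> r) (\<lambda>k b. b [^]\<^bsub>B\<^esub> k) (regular_module R) B"


section \<open>Preadditive categories and their modules\<close>

text \<open>\<open>Comp C x y z g f\<close> is the composite of \<open>f : x \<rightarrow> y\<close> and \<open>g : y \<rightarrow> z\<close>. The abelian groups
  \<open>Hom C x y\<close> are written multiplicatively.\<close>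

record ('o, 'a) precat =
  Ob :: "'o set"
  Hom :: "'o \<Rightarrow> 'o \<Rightarrow> 'a monoid"
  Comp :: "'o \<Rightarrow> 'o \<Rightarrow> 'o \<Rightarrow> 'a \<Rightarrow> 'a \<Rightarrow> 'a"
  Ident :: "'o \<Rightarrow> 'a"

locale preadditive_category =
  fixes C :: "('o, 'a) precat"
  assumes Hom_comm_group: "\<lbrakk>x \<in> Ob C; y \<in> Ob C\<rbrakk> \<Longrightarrow> comm_group (Hom C x y)"
    and Ident_in_Hom: "x \<in> Ob C \<Longrightarrow> Ident C x \<in> carrier (Hom C x x)"
    and Comp_left_hom: "\<lbrakk>x \<in> Ob C; y \<in> Ob C; z \<in> Ob C; f \<in> carrier (Hom C x y)\<rbrakk>
      \<Longrightarrow> (\<lambda>g. Comp C x y z g f) \<in> hom (Hom C y z) (Hom C x z)"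
    and Comp_right_hom: "\<lbrakk>x \<in> Ob C; y \<in> Ob C; z \<in> Ob C; g \<in> carrier (Hom C y z)\<rbrakk>
      \<Longrightarrow> Comp C x y z g \<in> hom (Hom C x y) (Hom C x z)"
    and Comp_Ident_left: "\<lbrakk>x \<in> Ob C; y \<in> Ob C; f \<in> carrier (Hom C x y)\<rbrakk>
      \<Longrightarrow> Comp C x y y (Ident C y) f = f"
    and Comp_Ident_right: "\<lbrakk>x \<in> Ob C; y \<in> Ob C; f \<in> carrier (Hom C x y)\<rbrakk>
      \<Longrightarrow> Comp C x x y f (Ident C x) = f"
    and Comp_assoc: "\<lbrakk>w \<in> Ob C; x \<in> Ob C; y \<in> Ob C; z \<in> Ob C; f \<in> carrier (Hom C w x);
        g \<in> carrier (Hom C x y); h \<in> carrier (Hom C y z)\<rbrakk>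
      \<Longrightarrow> Comp C w x z (Comp C x y z h g) f = Comp C w y z h (Comp C w x y g f)"

text \<open>\<open>Act M x y \<alpha>\<close> is the map induced by \<open>\<alpha> : x \<rightarrow> y\<close>; it goes from \<open>Val M y\<close> to \<open>Val M x\<close> if \<open>M\<close>
  is contravariant and from \<open>Val M x\<close> to \<open>Val M y\<close> if \<open>M\<close> is covariant.\<close>

record ('o, 'a, 'r, 'm) cat_module =
  Val :: "'o \<Rightarrow> ('r, 'm) module"
  Act :: "'o \<Rightarrow> 'o \<Rightarrow> 'a \<Rightarrow> 'm \<Rightarrow> 'm"

definition contra_module ::
  "('r, 'k) ring_scheme \<Rightarrow> ('o, 'a) precat \<Rightarrow> ('o, 'a, 'r, 'm) cat_module \<Rightarrow> bool" where
  "contra_module R C M \<longleftrightarrow>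
     (\<forall>x\<in>Ob C. module R (Val M x)) \<and>
     (\<forall>x\<in>Ob C. \<forall>y\<in>Ob C. \<forall>\<alpha>\<in>carrier (Hom C x y). Act M x y \<alpha> \<in> mod_hom R (Val M y) (Val M x)) \<and>
     (\<forall>x\<in>Ob C. \<forall>y\<in>Ob C. \<forall>\<alpha>\<in>carrier (Hom C x y). \<forall>\<beta>\<in>carrier (Hom C x y). \<forall>m\<in>carrier (Val M y).
        Act M x y (\<alpha> \<otimes>\<^bsub>Hom C x y\<^esub> \<beta>) m = Act M x y \<alpha> m \<oplus>\<^bsub>Val M x\<^esub> Act M x y \<beta> m) \<and>
     (\<forall>x\<in>Ob C. \<forall>m\<in>carrier (Val M x). Act M x x (Ident C x) m = m) \<and>
     (\<forall>x\<in>Ob C. \<forall>y\<in>Ob C. \<forall>z\<in>Ob C. \<forall>\<alpha>\<in>carrier (Hom C x y). \<forall>\<beta>\<in>carrier (Hom C y z).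
        \<forall>m\<in>carrier (Val M z). Act M x z (Comp C x y z \<beta> \<alpha>) m = Act M x y \<alpha> (Act M y z \<beta> m))"

definition cat_hom ::
  "('r, 'k) ring_scheme \<Rightarrow> ('o, 'a) precat \<Rightarrow> ('o, 'a, 'r, 'm) cat_module
    \<Rightarrow> ('o, 'a, 'r, 'n) cat_module \<Rightarrow> ('o \<Rightarrow> 'm \<Rightarrow> 'n) set" where
  "cat_hom R C M N = {\<phi>.
     (\<forall>x\<in>Ob C. \<phi> x \<in> mod_hom R (Val M x) (Val N x)) \<and>
     (\<forall>x\<in>Ob C. \<forall>y\<in>Ob C. \<forall>\<alpha>\<in>carrier (Hom C x y). \<forall>m\<in>carrier (Val M y).
        \<phi> x (Act M x y \<alpha> m) = Act N x y \<alpha> (\<phi> y m))}"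

definition cat_iso ::
  "('r, 'k) ring_scheme \<Rightarrow> ('o, 'a) precat \<Rightarrow> ('o, 'a, 'r, 'm) cat_module
    \<Rightarrow> ('o, 'a, 'r, 'n) cat_module \<Rightarrow> ('o \<Rightarrow> 'm \<Rightarrow> 'n) set" where
  "cat_iso R C M N = {\<phi> \<in> cat_hom R C M N.
     \<forall>x\<in>Ob C. bij_betw (\<phi> x) (carrier (Val M x)) (carrier (Val N x))}"

text \<open>Projectivity is the lifting property against all objectwise surjective homomorphisms. Since a
  formula cannot quantify over types, the type \<open>'u\<close> of the elements of the test modules is a
  parameter. For a module \<open>P\<close> with elements of type \<open>'m\<close>, the type \<open>free_cover\<close> below has room for
  a copy of \<open>P\<close> and for the canonical free module mapping onto \<open>P\<close> (whose value at \<open>x\<close> is the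
  direct sum of the \<open>R \<otimes> Hom(x, y)\<close> over all \<open>y\<close> and \<open>m \<in> P(y)\<close>, that is, a quotient of a set of
  \<open>R\<close>-valued functions of \<open>y\<close>, \<open>m\<close> and a morphism), so that lifting against test modules of this
  type makes \<open>P\<close> a direct summand of a free module, and hence projective with respect to test
  modules of any other type.\<close>

definition projective ::
  "'u itself \<Rightarrow> ('r, 'k) ring_scheme \<Rightarrow> ('o, 'a) precat \<Rightarrow> ('o, 'a, 'r, 'm) cat_module \<Rightarrow> bool" where
  "projective U R C P \<longleftrightarrow> contra_module R C P \<and>
     (\<forall>(M :: ('o, 'a, 'r, 'u) cat_module) (N :: ('o, 'a, 'r, 'u) cat_module) p f.
        contra_module R C M \<and> contra_module R C N \<and>
        p \<in> cat_hom R C M N \<and> (\<forall>x\<in>Ob C. p x ` carrier (Val M x) = carrier (Val N x)) \<and>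
        f \<in> cat_hom R C P N \<longrightarrow>
        (\<exists>h\<in>cat_hom R C P M. \<forall>x\<in>Ob C. \<forall>m\<in>carrier (Val P x). p x (h x m) = f x m))"

type_synonym ('o, 'a, 'r, 'm) free_cover = "('o \<times> 'm \<times> 'a \<Rightarrow> 'r) set"

text \<open>A resolution \<open>\<dots> \<rightarrow> P 1 \<rightarrow> P 0 \<rightarrow> A \<rightarrow> 0\<close> with differentials \<open>d n : P (n + 1) \<rightarrow> P n\<close> and
  augmentation \<open>\<epsilon>\<close>.\<close>

definition resolution ::
  "('r, 'k) ring_scheme \<Rightarrow> ('o, 'a) precat \<Rightarrow> ('o, 'a, 'r, 'n) cat_module
    \<Rightarrow> (nat \<Rightarrow> ('o, 'a, 'r, 'm) cat_module) \<Rightarrow> (nat \<Rightarrow> 'o \<Rightarrow> 'm \<Rightarrow> 'm) \<Rightarrow> ('o \<Rightarrow> 'm \<Rightarrow> 'n) \<Rightarrow> bool" where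
  "resolution R C A P d \<epsilon> \<longleftrightarrow>
     contra_module R C A \<and> (\<forall>n. contra_module R C (P n)) \<and>
     (\<forall>n. d n \<in> cat_hom R C (P (Suc n)) (P n)) \<and> \<epsilon> \<in> cat_hom R C (P 0) A \<and>
     (\<forall>x\<in>Ob C.
        \<epsilon> x ` carrier (Val (P 0) x) = carrier (Val A x) \<and>
        d 0 x ` carrier (Val (P 1) x) = a_kernel (Val (P 0) x) (Val A x) (\<epsilon> x) \<and>
        (\<forall>n. d (Suc n) x ` carrier (Val (P (Suc (Suc n))) x)
           = a_kernel (Val (P (Suc n)) x) (Val (P n) x) (d n x)))"

definition projective_resolution ::
  "'u itself \<Rightarrow> ('r, 'k) ring_scheme \<Rightarrow> ('o, 'a) precat \<Rightarrow> ('o, 'a, 'r, 'n) cat_module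
    \<Rightarrow> (nat \<Rightarrow> ('o, 'a, 'r, 'm) cat_module) \<Rightarrow> (nat \<Rightarrow> 'o \<Rightarrow> 'm \<Rightarrow> 'm) \<Rightarrow> ('o \<Rightarrow> 'm \<Rightarrow> 'n) \<Rightarrow> bool" where
  "projective_resolution U R C A P d \<epsilon> \<longleftrightarrow>
     resolution R C A P d \<epsilon> \<and> (\<forall>n. projective U R C (P n))"


section \<open>Tensor products over a category and induction\<close>

definition cat_tensor_sum ::
  "('r, 'k) ring_scheme \<Rightarrow> ('o, 'a) precat \<Rightarrow> ('o, 'a, 'r, 'm) cat_module
    \<Rightarrow> ('o, 'a, 'r, 'n) cat_module \<Rightarrow> ('r, 'o \<Rightarrow> ('m \<times> 'n \<Rightarrow>\<^sub>0 int) set) module" where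
  "cat_tensor_sum R C M A = direct_sum (Ob C) (\<lambda>x. tensor_mod R (Val M x) (Val A x))"

definition cat_tensor_relations ::
  "('r, 'k) ring_scheme \<Rightarrow> ('o, 'a) precat \<Rightarrow> ('o, 'a, 'r, 'm) cat_module
    \<Rightarrow> ('o, 'a, 'r, 'n) cat_module \<Rightarrow> ('o \<Rightarrow> ('m \<times> 'n \<Rightarrow>\<^sub>0 int) set) set" where
  "cat_tensor_relations R C M A =
    (let T = (\<lambda>x. tensor_mod R (Val M x) (Val A x)); inj = direct_sum_inj (Ob C) T in
     span_module R (cat_tensor_sum R C M A)
      {inj x (pure_tensor (T x) (Act M x y \<alpha> m) a)
         \<ominus>\<^bsub>cat_tensor_sum R C M A\<^esub> inj y (pure_tensor (T y) m (Act A x y \<alpha> a)) | x y \<alpha> m a.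
       x \<in> Ob C \<and> y \<in> Ob C \<and> \<alpha> \<in> carrier (Hom C x y) \<and>
       m \<in> carrier (Val M y) \<and> a \<in> carrier (Val A x)})"

definition cat_tensor ::
  "('r, 'k) ring_scheme \<Rightarrow> ('o, 'a) precat \<Rightarrow> ('o, 'a, 'r, 'm) cat_module
    \<Rightarrow> ('o, 'a, 'r, 'n) cat_module \<Rightarrow> ('r, ('o \<Rightarrow> ('m \<times> 'n \<Rightarrow>\<^sub>0 int) set) set) module" where
  "cat_tensor R C M A = quot_module (cat_tensor_sum R C M A) (cat_tensor_relations R C M A)"

text \<open>The map into \<open>M' \<otimes>\<^sub>C A'\<close> induced by maps \<open>f\<close> into \<open>M'\<close> and \<open>g\<close> into \<open>A'\<close>.\<close>

definition cat_tensor_map ::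
  "('r, 'k) ring_scheme \<Rightarrow> ('o, 'a) precat \<Rightarrow> ('o, 'a, 'r, 'm2) cat_module
    \<Rightarrow> ('o, 'a, 'r, 'n2) cat_module \<Rightarrow> ('o \<Rightarrow> 'm1 \<Rightarrow> 'm2) \<Rightarrow> ('o \<Rightarrow> 'n1 \<Rightarrow> 'n2)
    \<Rightarrow> ('o \<Rightarrow> ('m1 \<times> 'n1 \<Rightarrow>\<^sub>0 int) set) set \<Rightarrow> ('o \<Rightarrow> ('m2 \<times> 'n2 \<Rightarrow>\<^sub>0 int) set) set" where
  "cat_tensor_map R C M' A' f g X =
     (\<Union>c\<in>X. cat_tensor_relations R C M' A' +>\<^bsub>cat_tensor_sum R C M' A'\<^esub>
        (\<lambda>x\<in>Ob C. tensor_map (tensor_mod R (Val M' x) (Val A' x)) (f x) (g x) (c x)))"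

text \<open>A functor \<open>C \<rightarrow> D\<close> is given by its maps \<open>Fo\<close> on objects and \<open>Fm x y\<close> on \<open>Hom C x y\<close>.
  \<open>hom_module R D Fo Fm d\<close> is the covariant module \<open>x \<mapsto> R \<otimes>\<^sub>\<int> Hom\<^sub>D(d, F x)\<close>.\<close>

definition hom_module ::
  "('r, 'k) ring_scheme \<Rightarrow> ('p, 'b) precat \<Rightarrow> ('o \<Rightarrow> 'p) \<Rightarrow> ('o \<Rightarrow> 'o \<Rightarrow> 'a \<Rightarrow> 'b) \<Rightarrow> 'p
    \<Rightarrow> ('o, 'a, 'r, ('r \<times> 'b \<Rightarrow>\<^sub>0 int) set) cat_module" where
  "hom_module R D Fo Fm d =
     \<lparr>Val = (\<lambda>x. scalar_ext R (Hom D d (Fo x))),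
      Act = (\<lambda>x y \<alpha>. tensor_map (scalar_ext R (Hom D d (Fo y))) (\<lambda>r. r)
               (Comp D d (Fo x) (Fo y) (Fm x y \<alpha>)))\<rparr>"

type_synonym ('o, 'r, 'b, 'm) ind_elem = "('o \<Rightarrow> ('m \<times> ('r \<times> 'b \<Rightarrow>\<^sub>0 int) set \<Rightarrow>\<^sub>0 int) set) set"

definition Ind ::
  "('r, 'k) ring_scheme \<Rightarrow> ('o, 'a) precat \<Rightarrow> ('p, 'b) precat \<Rightarrow> ('o \<Rightarrow> 'p) \<Rightarrow> ('o \<Rightarrow> 'o \<Rightarrow> 'a \<Rightarrow> 'b)
    \<Rightarrow> ('o, 'a, 'r, 'm) cat_module \<Rightarrow> ('p, 'b, 'r, ('o, 'r, 'b, 'm) ind_elem) cat_module" where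
  "Ind R C D Fo Fm M =
     \<lparr>Val = (\<lambda>d. cat_tensor R C M (hom_module R D Fo Fm d)),
      Act = (\<lambda>d d' \<beta>. cat_tensor_map R C M (hom_module R D Fo Fm d) (\<lambda>x m. m)
               (\<lambda>x. tensor_map (scalar_ext R (Hom D d (Fo x))) (\<lambda>r. r)
                      (\<lambda>\<gamma>. Comp D d d' (Fo x) \<gamma> \<beta>)))\<rparr>"

text \<open>\<open>Ind_map \<dots> M' \<phi>\<close> is the value of the induction functor on a homomorphism \<open>\<phi>\<close> into \<open>M'\<close>.\<close>

definition Ind_map ::
  "('r, 'k) ring_scheme \<Rightarrow> ('o, 'a) precat \<Rightarrow> ('p, 'b) precat \<Rightarrow> ('o \<Rightarrow> 'p) \<Rightarrow> ('o \<Rightarrow> 'o \<Rightarrow> 'a \<Rightarrow> 'b)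
    \<Rightarrow> ('o, 'a, 'r, 'n) cat_module \<Rightarrow> ('o \<Rightarrow> 'm \<Rightarrow> 'n)
    \<Rightarrow> 'p \<Rightarrow> ('o, 'r, 'b, 'm) ind_elem \<Rightarrow> ('o, 'r, 'b, 'n) ind_elem" where
  "Ind_map R C D Fo Fm M' \<phi> d =
     cat_tensor_map R C M' (hom_module R D Fo Fm d) \<phi> (\<lambda>x a. a)"


section \<open>Orbit and Hecke categories\<close>

definition subgroup_family :: "('g, 'l) monoid_scheme \<Rightarrow> 'g set set \<Rightarrow> bool" where
  "subgroup_family G \<F> \<longleftrightarrow>
     (\<forall>H\<in>\<F>. subgroup H G \<and> finite H) \<and>
     (\<forall>H\<in>\<F>. \<forall>g\<in>carrier G. (g <#\<^bsub>G\<^esub> H) #>\<^bsub>G\<^esub> inv\<^bsub>G\<^esub> g \<in> \<F>) \<and>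
     (\<forall>H\<in>\<F>. \<forall>K. subgroup K G \<and> K \<subseteq> H \<longrightarrow> K \<in> \<F>)"

text \<open>In both categories the object \<open>G/H\<close> is represented by \<open>H\<close>.\<close>

definition G_maps :: "('g, 'l) monoid_scheme \<Rightarrow> 'g set \<Rightarrow> 'g set \<Rightarrow> ('g set \<Rightarrow> 'g set) set" where
  "G_maps G H K = {f \<in> lcosets\<^bsub>G\<^esub> H \<rightarrow>\<^sub>E lcosets\<^bsub>G\<^esub> K.
     \<forall>g\<in>carrier G. \<forall>X\<in>lcosets\<^bsub>G\<^esub> H. f (g <#\<^bsub>G\<^esub> X) = g <#\<^bsub>G\<^esub> f X}"

definition orbit_category ::
  "('g, 'l) monoid_scheme \<Rightarrow> 'g set set \<Rightarrow> ('g set, ('g set \<Rightarrow> 'g set) \<Rightarrow>\<^sub>0 int) precat" where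
  "orbit_category G \<F> =
     \<lparr>Ob = \<F>,
      Hom = (\<lambda>H K. free_Abelian_group (G_maps G H K)),
      Comp = (\<lambda>H K L v u. frag_extend (\<lambda>\<beta>. frag_extend (\<lambda>\<alpha>. frag_of (compose (lcosets\<^bsub>G\<^esub> H) \<beta> \<alpha>)) u) v),
      Ident = (\<lambda>H. frag_of (\<lambda>X\<in>lcosets\<^bsub>G\<^esub> H. X))\<rparr>"

abbreviation perm_module :: "('g, 'l) monoid_scheme \<Rightarrow> 'g set \<Rightarrow> ('g set \<Rightarrow>\<^sub>0 int) monoid" where
  \<comment> \<open>\<open>\<int>[G/H]\<close>\<close>
  "perm_module G H \<equiv> free_Abelian_group (lcosets\<^bsub>G\<^esub> H)"

definition perm_act :: "('g, 'l) monoid_scheme \<Rightarrow> 'g \<Rightarrow> ('g set \<Rightarrow>\<^sub>0 int) \<Rightarrow> ('g set \<Rightarrow>\<^sub>0 int)" where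
  "perm_act G g = frag_extend (\<lambda>X. frag_of (g <#\<^bsub>G\<^esub> X))"

definition hecke_category ::
  "('g, 'l) monoid_scheme \<Rightarrow> 'g set set
    \<Rightarrow> ('g set, ('g set \<Rightarrow>\<^sub>0 int) \<Rightarrow> ('g set \<Rightarrow>\<^sub>0 int)) precat" where
  "hecke_category G \<F> =
     \<lparr>Ob = \<F>,
      Hom = (\<lambda>H K.
        \<lparr>carrier = {f \<in> hom (perm_module G H) (perm_module G K) \<inter> extensional (carrier (perm_module G H)).
           \<forall>g\<in>carrier G. \<forall>v\<in>carrier (perm_module G H). f (perm_act G g v) = perm_act G g (f v)},
         monoid.mult = (\<lambda>f f'. \<lambda>v\<in>carrier (perm_module G H). f v + f' v),
         one = (\<lambda>v\<in>carrier (perm_module G H). 0)\<rparr>),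
      Comp = (\<lambda>H K L. compose (carrier (perm_module G H))),
      Ident = (\<lambda>H. \<lambda>v\<in>carrier (perm_module G H). v)\<rparr>"

text \<open>The functor \<open>\<pi> \<circ> \<sigma>\<close> on morphisms: the additive extension of sending a \<open>G\<close>-map to the
  homomorphism it induces.\<close>

definition pi_sigma ::
  "('g, 'l) monoid_scheme \<Rightarrow> 'g set \<Rightarrow> 'g set \<Rightarrow> (('g set \<Rightarrow> 'g set) \<Rightarrow>\<^sub>0 int)
    \<Rightarrow> ('g set \<Rightarrow>\<^sub>0 int) \<Rightarrow> ('g set \<Rightarrow>\<^sub>0 int)" where
  "pi_sigma G H K u =
     (\<lambda>v\<in>carrier (perm_module G H). frag_extend (\<lambda>\<alpha>. frag_extend (\<lambda>X. frag_of (\<alpha> X)) v) u)"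

definition frag_total :: "('a \<Rightarrow>\<^sub>0 int) \<Rightarrow> int" where
  "frag_total u = (\<Sum>\<alpha>\<in>Poly_Mapping.keys u. Poly_Mapping.lookup u \<alpha>)"

text \<open>Since every \<open>G\<close>-map acts as the identity on the constant module, a morphism \<open>\<Sum> n\<^sub>\<alpha> \<alpha>\<close> acts as
  multiplication by the integer \<open>\<Sum> n\<^sub>\<alpha>\<close>.\<close>

definition const_module ::
  "('r, 'k) ring_scheme \<Rightarrow> ('g set, ('g set \<Rightarrow> 'g set) \<Rightarrow>\<^sub>0 int, 'r, 'r) cat_module" where
  "const_module R =
     \<lparr>Val = (\<lambda>H. regular_module R),
      Act = (\<lambda>H K u r. [frag_total u] \<cdot>\<^bsub>R\<^esub> r)\<rparr>"

definition fixed_point_module ::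
  "('r, 'k) ring_scheme \<Rightarrow> ('g, 'l) monoid_scheme
    \<Rightarrow> ('g set, ('g set \<Rightarrow>\<^sub>0 int) \<Rightarrow> ('g set \<Rightarrow>\<^sub>0 int), 'r, ('g set \<Rightarrow>\<^sub>0 int) \<Rightarrow> 'r) cat_module" where
  "fixed_point_module R G =
     \<lparr>Val = (\<lambda>H.
        \<lparr>carrier = {\<phi> \<in> hom (perm_module G H) (add_monoid R) \<inter> extensional (carrier (perm_module G H)).
           \<forall>g\<in>carrier G. \<forall>v\<in>carrier (perm_module G H). \<phi> (perm_act G g v) = \<phi> v},
         monoid.mult = undefined, one = undefined,
         zero = (\<lambda>v\<in>carrier (perm_module G H). \<zero>\<^bsub>R\<^esub>),
         add = (\<lambda>\<phi> \<psi>. \<lambda>v\<in>carrier (perm_module G H). \<phi> v \<oplus>\<^bsub>R\<^esub> \<psi> v),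
         smult = (\<lambda>r \<phi>. \<lambda>v\<in>carrier (perm_module G H). r \<otimes>\<^bsub>R\<^esub> \<phi> v)\<rparr>),
      Act = (\<lambda>H K f \<phi>. compose (carrier (perm_module G H)) \<phi> f)\<rparr>"

abbreviation Ind_pi_sigma ::
  "('r, 'k) ring_scheme \<Rightarrow> ('g, 'l) monoid_scheme \<Rightarrow> 'g set set
    \<Rightarrow> ('g set, ('g set \<Rightarrow> 'g set) \<Rightarrow>\<^sub>0 int, 'r, 'm) cat_module
    \<Rightarrow> ('g set, ('g set \<Rightarrow>\<^sub>0 int) \<Rightarrow> ('g set \<Rightarrow>\<^sub>0 int), 'r,
        ('g set, 'r, ('g set \<Rightarrow>\<^sub>0 int) \<Rightarrow> ('g set \<Rightarrow>\<^sub>0 int), 'm) ind_elem) cat_module" where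
  "Ind_pi_sigma R G \<F> \<equiv>
     Ind R (orbit_category G \<F>) (hecke_category G \<F>) (\<lambda>H. H) (pi_sigma G)"

abbreviation Ind_pi_sigma_map ::
  "('r, 'k) ring_scheme \<Rightarrow> ('g, 'l) monoid_scheme \<Rightarrow> 'g set set
    \<Rightarrow> ('g set, ('g set \<Rightarrow> 'g set) \<Rightarrow>\<^sub>0 int, 'r, 'n) cat_module \<Rightarrow> ('g set \<Rightarrow> 'm \<Rightarrow> 'n)
    \<Rightarrow> 'g set \<Rightarrow> ('g set, 'r, ('g set \<Rightarrow>\<^sub>0 int) \<Rightarrow> ('g set \<Rightarrow>\<^sub>0 int), 'm) ind_elem
    \<Rightarrow> ('g set, 'r, ('g set \<Rightarrow>\<^sub>0 int) \<Rightarrow> ('g set \<Rightarrow>\<^sub>0 int), 'n) ind_elem" where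
  "Ind_pi_sigma_map R G \<F> \<equiv>
     Ind_map R (orbit_category G \<F>) (hecke_category G \<F>) (\<lambda>H. H) (pi_sigma G)"


section \<open>Basic facts\<close>

lemma frag_extend_add_fun: "frag_extend (\<lambda>b. f b + g b) v = frag_extend f v + frag_extend g v"
  by (simp add: frag_extend_def sum.distrib frag_cmul_distrib2)

lemma frag_extend_diff_fun: "frag_extend (\<lambda>b. f b - g b) v = frag_extend f v - frag_extend g v"
  using frag_extend_add_fun[of "\<lambda>b. f b - g b" g v] by simp

lemma frag_extend_extend:
  "frag_extend f (frag_extend g v) = frag_extend (\<lambda>x. frag_extend f (g x)) v"
  using subset_UNIV[of "Poly_Mapping.keys v"]
  by (induction v rule: frag_induction) (auto simp: frag_extend_diff)

lemma frag_extend_zero_fun: "frag_extend (\<lambda>b. 0) v = 0"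
  by (simp add: frag_extend_eq_0)

lemma frag_extend_closed:
  assumes "Poly_Mapping.keys v \<subseteq> S" "\<And>b. b \<in> S \<Longrightarrow> Poly_Mapping.keys (f b) \<subseteq> T"
  shows "Poly_Mapping.keys (frag_extend f v) \<subseteq> T"
  using keys_frag_extend[of f v] assms by blast

lemma keys_add_closed:
  "Poly_Mapping.keys u \<subseteq> S \<Longrightarrow> Poly_Mapping.keys v \<subseteq> S \<Longrightarrow> Poly_Mapping.keys (u + v) \<subseteq> S"
  using Poly_Mapping.keys_add[of u v] by blast

lemma compose_G_maps:
  assumes "\<alpha> \<in> G_maps G H K" "\<beta> \<in> G_maps G K L" "group G" "H \<subseteq> carrier G"
  shows "compose (lcosets\<^bsub>G\<^esub> H) \<beta> \<alpha> \<in> G_maps G H L"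
proof -
  interpret group G by fact
  have "g <#\<^bsub>G\<^esub> X \<in> lcosets\<^bsub>G\<^esub> H" if "g \<in> carrier G" "X \<in> lcosets\<^bsub>G\<^esub> H" for g X
    using that assms(4) by (auto simp: LCOSETS_def lcos_m_assoc)
  with assms show ?thesis
    unfolding G_maps_def by (auto simp: compose_def PiE_iff)
qed

lemma lcosets_act:
  assumes "group G" "H \<subseteq> carrier G" "g \<in> carrier G" "X \<in> lcosets\<^bsub>G\<^esub> H"
  shows "g <#\<^bsub>G\<^esub> X \<in> lcosets\<^bsub>G\<^esub> H"
proof -
  interpret group G by fact
  show ?thesis using assms by (auto simp: LCOSETS_def lcos_m_assoc)
qed

lemma preadditive_orbit_category:
  assumes "group G" "subgroup_family G \<F>"
  shows "preadditive_category (orbit_category G \<F>)"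
proof -
  have sub: "H \<subseteq> carrier G" if "H \<in> \<F>" for H
    using assms(2) that by (auto simp: subgroup_family_def subgroup_def)
  have cl: "Poly_Mapping.keys (frag_extend (\<lambda>\<beta>. frag_extend (\<lambda>\<alpha>. frag_of (compose (lcosets\<^bsub>G\<^esub> H) \<beta> \<alpha>)) u) v)
      \<subseteq> G_maps G H L" if "H \<in> \<F>" "Poly_Mapping.keys u \<subseteq> G_maps G H K" "Poly_Mapping.keys v \<subseteq> G_maps G K L" for H K L u v
    by (rule frag_extend_closed[OF that(3)], rule frag_extend_closed[OF that(2)])
       (use that compose_G_maps[OF _ _ assms(1) sub] in auto)
  have idm: "(\<lambda>X\<in>lcosets\<^bsub>G\<^esub> H. X) \<in> G_maps G H H" if "H \<in> \<F>" for H
    using lcosets_act[OF assms(1) sub[OF that]] by (auto simp: G_maps_def)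
  have idL: "compose (lcosets\<^bsub>G\<^esub> H) (\<lambda>X\<in>lcosets\<^bsub>G\<^esub> K. X) \<alpha> = \<alpha>" 
    and idR: "compose (lcosets\<^bsub>G\<^esub> H) \<alpha> (\<lambda>X\<in>lcosets\<^bsub>G\<^esub> H. X) = \<alpha>" if "\<alpha> \<in> G_maps G H K" for \<alpha> H K
    using that by (auto simp: G_maps_def PiE_def intro!: Id_compose compose_Id)
  show ?thesis
  proof (rule preadditive_category.intro, goal_cases)
    case (1 x y) then show ?case by (simp add: orbit_category_def abelian_free_Abelian_group)
  next
    case (2 x) then show ?case by (simp add: orbit_category_def idm)
  next
    case (3 x y z f) then show ?case using cl
      by (auto del: subsetI simp: orbit_category_def hom_def keys_add_closed frag_extend_add)
  next
    case (4 x y z g) then show ?case using cl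
      by (auto del: subsetI simp: orbit_category_def hom_def keys_add_closed frag_extend_add frag_extend_add_fun)
  next
    case (5 x y f)
    then have "Poly_Mapping.keys f \<subseteq> G_maps G x y" by (simp add: orbit_category_def)
    then have "frag_extend (\<lambda>\<alpha>. frag_of (compose (lcosets\<^bsub>G\<^esub> x) (\<lambda>X\<in>lcosets\<^bsub>G\<^esub> y. X) \<alpha>)) f = frag_extend frag_of f"
      using idL idR by (intro frag_extend_eq) auto
    then show ?case using frag_expansion[of f] by (simp add: orbit_category_def)
  next
    case (6 x y f)
    then have "Poly_Mapping.keys f \<subseteq> G_maps G x y" by (simp add: orbit_category_def)
    then have "frag_extend (\<lambda>\<beta>. frag_of (compose (lcosets\<^bsub>G\<^esub> x) \<beta> (\<lambda>X\<in>lcosets\<^bsub>G\<^esub> x. X))) f = frag_extend frag_of f"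
      using idL idR by (intro frag_extend_eq) auto
    then show ?case using frag_expansion[of f] by (simp add: orbit_category_def)
  next
    case (7 w x y z f g h)
    then have k: "Poly_Mapping.keys f \<subseteq> G_maps G w x" by (simp add: orbit_category_def)
    have a: "compose (lcosets\<^bsub>G\<^esub> w) (compose (lcosets\<^bsub>G\<^esub> x) \<gamma> \<beta>) \<alpha>
          = compose (lcosets\<^bsub>G\<^esub> w) \<gamma> (compose (lcosets\<^bsub>G\<^esub> w) \<beta> \<alpha>)" if "\<alpha> \<in> G_maps G w x" for \<alpha> \<beta> \<gamma>
      using that by (intro compose_assoc[symmetric]) (auto simp: G_maps_def PiE_def)
    show ?case
      unfolding orbit_category_def precat.simps
      using subset_UNIV[of "Poly_Mapping.keys h"]
    proof (induction h rule: frag_induction)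
      case (one \<gamma>)
      show ?case using subset_UNIV[of "Poly_Mapping.keys g"]
      proof (induction g rule: frag_induction)
        case (one \<beta>)
        show ?case using k
          by (induction f rule: frag_induction) (auto simp: frag_extend_diff a)
      qed (auto simp: frag_extend_diff frag_extend_diff_fun frag_extend_zero_fun)
    qed (auto simp: frag_extend_diff)
  qed
qed

lemma perm_act_closed:
  assumes "group G" "H \<subseteq> carrier G" "g \<in> carrier G" "Poly_Mapping.keys v \<subseteq> lcosets\<^bsub>G\<^esub> H"
  shows "Poly_Mapping.keys (perm_act G g v) \<subseteq> lcosets\<^bsub>G\<^esub> H"
  unfolding perm_act_def using assms by (intro frag_extend_closed[OF assms(4)]) (auto simp: lcosets_act)

lemma perm_act_add: "perm_act G g (u + v) = perm_act G g u + perm_act G g v"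
  by (simp add: perm_act_def frag_extend_add)

lemma preadditive_hecke_category:
  assumes "group G" "subgroup_family G \<F>"
  shows "preadditive_category (hecke_category G \<F>)"
proof -
  have sub: "H \<subseteq> carrier G" if "H \<in> \<F>" for H
    using assms(2) that by (auto simp: subgroup_family_def subgroup_def)
  note pc = perm_act_closed[OF assms(1) sub]
  have Hom: "comm_group (Hom (hecke_category G \<F>) x y)" if "x \<in> \<F>" "y \<in> \<F>" for x y
  proof (rule comm_groupI, goal_cases)
    case (1 f g) then show ?case using pc[OF that(1)]
      by (auto del: subsetI simp: hecke_category_def hom_def keys_add_closed perm_act_add Pi_iff add_ac)
  next
    case 2 then show ?case using pc[OF that(1)]
      by (auto del: subsetI simp: hecke_category_def hom_def keys_add_closed perm_act_def)
  next
    case (6 f)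
    then have "(\<lambda>v\<in>carrier (perm_module G x). - f v) \<in> carrier (Hom (hecke_category G \<F>) x y)"
      using pc[OF that(1)]
      by (simp add: hecke_category_def hom_def keys_add_closed Pi_iff)
         (simp add: perm_act_def frag_extend_minus)
    then show ?case by (rule bexI[rotated]) (auto simp: hecke_category_def)
  qed (auto del: subsetI simp: hecke_category_def hom_def keys_add_closed Pi_iff add_ac fun_eq_iff extensional_def)
  show ?thesis
  proof (rule preadditive_category.intro, goal_cases)
    case (1 x y) then show ?case using Hom by (simp add: hecke_category_def)
  next
    case (2 x) then show ?case using pc
      by (auto del: subsetI simp: hecke_category_def hom_def keys_add_closed)
  next
    case (3 x y z f) then show ?case using pc
      by (auto del: subsetI simp: hecke_category_def hom_def keys_add_closed compose_def Pi_iff fun_eq_iff)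
  next
    case (4 x y z f) then show ?case using pc
      by (auto del: subsetI simp: hecke_category_def hom_def keys_add_closed compose_def Pi_iff fun_eq_iff)
  qed (auto del: subsetI simp: hecke_category_def hom_def compose_def Pi_iff fun_eq_iff extensional_def)
qed

lemma frag_total_alt: "frag_total u = Poly_Mapping.lookup (frag_extend (\<lambda>_. frag_of ()) u) ()"
  by (simp add: frag_total_def frag_extend_def lookup_sum)

lemma frag_total_add: "frag_total (u + v) = frag_total u + frag_total v"
  unfolding frag_total_alt frag_extend_add lookup_add ..

lemma frag_total_diff: "frag_total (u - v) = frag_total u - frag_total v"
  unfolding frag_total_alt frag_extend_diff lookup_minus ..

lemma frag_total_of [simp]: "frag_total (frag_of a) = 1"
  by (simp add: frag_total_def)

lemma frag_total_0 [simp]: "frag_total 0 = 0"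
  by (simp add: frag_total_def)

lemma frag_total_comp:
  "frag_total (frag_extend (\<lambda>\<beta>. frag_extend (\<lambda>\<alpha>. frag_of (h \<beta> \<alpha>)) u) v) = frag_total v * frag_total u"
  using subset_UNIV[of "Poly_Mapping.keys v"]
proof (induction v rule: frag_induction)
  case (one x)
  show ?case using subset_UNIV[of "Poly_Mapping.keys u"]
    by (induction u rule: frag_induction) (auto simp: frag_extend_diff frag_total_diff)
qed (auto simp: frag_extend_diff frag_total_diff left_diff_distrib)

lemma contra_const_module:
  assumes "cring R"
  shows "contra_module R (orbit_category G \<F>) (const_module R)"
proof -
  interpret cring R by fact
  have m: "module R (regular_module R)"
    by (intro moduleI abelian_groupI is_cring)
       (auto simp: regular_module_def l_distr r_distr m_assoc a_assoc a_comm a_lcomm intro: bexI[of _ "\<ominus>\<^bsub>R\<^esub> _"] l_neg)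
  show ?thesis
    unfolding contra_module_def
  proof (intro conjI, goal_cases)
    case 1 then show ?case using m by (simp add: const_module_def)
  next
    case 2 then show ?case
      by (auto simp: const_module_def mod_hom_def hom_def regular_module_def add.int_pow_distrib add_pow_rdistr_int)
  next
    case 3 then show ?case
      by (auto simp: const_module_def orbit_category_def regular_module_def frag_total_add add.int_pow_mult)
  next
    case 4 then show ?case
      by (auto simp: const_module_def orbit_category_def regular_module_def)
  next
    case 5 then show ?case
      by (auto simp: const_module_def orbit_category_def regular_module_def frag_total_comp add.int_pow_pow mult.commute)
  qed
qed

lemma pi_sigma_of: "pi_sigma G H K (frag_of \<alpha>) = (\<lambda>v\<in>carrier (perm_module G H). frag_extend (\<lambda>X. frag_of (\<alpha> X)) v)"
  by (simp add: pi_sigma_def)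

lemma pi_sigma_hom:
  assumes "group G" "subgroup_family G \<F>" "H \<in> \<F>" "K \<in> \<F>"
  shows "pi_sigma G H K \<in> hom (Hom (orbit_category G \<F>) H K) (Hom (hecke_category G \<F>) H K)"
proof -
  have sub: "H \<subseteq> carrier G" if "H \<in> \<F>" for H
    using assms(2) that by (auto simp: subgroup_family_def subgroup_def)
  have eq: "frag_extend (\<lambda>\<alpha>. frag_extend (\<lambda>X. frag_of (\<alpha> X)) (perm_act G g v)) u =
      perm_act G g (frag_extend (\<lambda>\<alpha>. frag_extend (\<lambda>X. frag_of (\<alpha> X)) v) u)"
    if "Poly_Mapping.keys u \<subseteq> G_maps G H K" "g \<in> carrier G" "Poly_Mapping.keys v \<subseteq> lcosets\<^bsub>G\<^esub> H" for u v g
    using that(1)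
  proof (induction u rule: frag_induction)
    case (one \<alpha>) then show ?case using that(3)
      by (auto simp: perm_act_def frag_extend_extend G_maps_def that(2) intro!: frag_extend_eq)
  qed (auto simp: frag_extend_diff perm_act_def)
  have cl: "Poly_Mapping.keys (frag_extend (\<lambda>\<alpha>. frag_extend (\<lambda>X. frag_of (\<alpha> X)) v) u) \<subseteq> lcosets\<^bsub>G\<^esub> K"
    if "Poly_Mapping.keys u \<subseteq> G_maps G H K" "Poly_Mapping.keys v \<subseteq> lcosets\<^bsub>G\<^esub> H" for u v
    by (rule frag_extend_closed[OF that(1)], rule frag_extend_closed[OF that(2)]) (auto simp: G_maps_def)
  show ?thesis
    by (auto del: subsetI simp: hom_def orbit_category_def hecke_category_def pi_sigma_def eq cl keys_add_closed
         perm_act_closed[OF assms(1) sub] frag_extend_add frag_extend_add_fun assms fun_eq_iff)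
qed

lemma pi_sigma_functor:
  assumes "group G" "subgroup_family G \<F>" "H \<in> \<F>" "K \<in> \<F>" "L \<in> \<F>"
    "u \<in> carrier (Hom (orbit_category G \<F>) H K)" "v \<in> carrier (Hom (orbit_category G \<F>) K L)"
  shows "pi_sigma G H L (Comp (orbit_category G \<F>) H K L v u) = Comp (hecke_category G \<F>) H K L (pi_sigma G K L v) (pi_sigma G H K u)"
    "pi_sigma G H H (Ident (orbit_category G \<F>) H) = Ident (hecke_category G \<F>) H"
proof -
  have u: "Poly_Mapping.keys u \<subseteq> G_maps G H K" using assms by (simp add: orbit_category_def)
  have eq: "frag_extend (\<lambda>\<gamma>. frag_extend (\<lambda>X. frag_of (\<gamma> X)) w) (frag_extend (\<lambda>\<beta>. frag_extend (\<lambda>\<alpha>. frag_of (compose (lcosets\<^bsub>G\<^esub> H) \<beta> \<alpha>)) u) v)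
    = frag_extend (\<lambda>\<beta>. frag_extend (\<lambda>X. frag_of (\<beta> X)) (frag_extend (\<lambda>\<alpha>. frag_extend (\<lambda>X. frag_of (\<alpha> X)) w) u)) v"
    if w: "Poly_Mapping.keys w \<subseteq> lcosets\<^bsub>G\<^esub> H" for w
    using subset_UNIV[of "Poly_Mapping.keys v"]
  proof (induction v rule: frag_induction)
    case (one \<beta>)
    show ?case using u
    proof (induction u rule: frag_induction)
      case (one \<alpha>) show ?case using w
        by (auto simp: frag_extend_extend compose_def intro!: frag_extend_eq)
    qed (auto simp: frag_extend_diff)
  qed (auto simp: frag_extend_diff frag_extend_diff_fun)
  have cl: "Poly_Mapping.keys (frag_extend (\<lambda>\<alpha>. frag_extend (\<lambda>X. frag_of (\<alpha> X)) w) u) \<subseteq> lcosets\<^bsub>G\<^esub> K"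
    if "Poly_Mapping.keys w \<subseteq> lcosets\<^bsub>G\<^esub> H" for w
    by (rule frag_extend_closed[OF u], rule frag_extend_closed[OF that(1)]) (auto simp: G_maps_def)
  show "pi_sigma G H L (Comp (orbit_category G \<F>) H K L v u) = Comp (hecke_category G \<F>) H K L (pi_sigma G K L v) (pi_sigma G H K u)"
    using eq cl by (auto simp: orbit_category_def hecke_category_def pi_sigma_def compose_def fun_eq_iff)
  have "frag_extend (\<lambda>X. frag_of (restrict (\<lambda>X. X) (lcosets\<^bsub>G\<^esub> H) X)) v = v" if "Poly_Mapping.keys v \<subseteq> lcosets\<^bsub>G\<^esub> H" for v
    using frag_extend_eq[of v "\<lambda>X. frag_of (restrict (\<lambda>X. X) (lcosets\<^bsub>G\<^esub> H) X)" frag_of] that frag_expansion[of v] by (simp add: subset_iff)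
  then show "pi_sigma G H H (Ident (orbit_category G \<F>) H) = Ident (hecke_category G \<F>) H"
    by (auto simp: orbit_category_def hecke_category_def pi_sigma_def fun_eq_iff)
qed

lemma contra_fixed_point_module:
  assumes "cring R" "group G" "subgroup_family G \<F>"
  shows "contra_module R (hecke_category G \<F>) (fixed_point_module R G)"
proof -
  interpret cring R by fact
  have sub: "H \<subseteq> carrier G" if "H \<in> \<F>" for H
    using assms that by (auto simp: subgroup_family_def subgroup_def)
  note pc = perm_act_closed[OF assms(2) sub]
  have m: "module R (Val (fixed_point_module R G) H)" if "H \<in> \<F>" for H
  proof (intro moduleI abelian_groupI is_cring, goal_cases)
    case (6 f) then show ?case using pc[OF that]
      by (intro bexI[of _ "\<lambda>v\<in>carrier (perm_module G H). \<ominus>\<^bsub>R\<^esub> f v"])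
         (auto del: subsetI simp: fixed_point_module_def hom_def keys_add_closed Pi_iff l_neg r_neg minus_add a_comm fun_eq_iff)
  qed (use pc[OF that] in \<open>auto del: subsetI simp: fixed_point_module_def hom_def keys_add_closed Pi_iff l_distr r_distr m_assoc a_ac
     fun_eq_iff extensional_def\<close>)
  have vadd: "\<phi> (u + v) = \<phi> u \<oplus>\<^bsub>R\<^esub> \<phi> v"
    if "\<phi> \<in> carrier (Val (fixed_point_module R G) H)" "u \<in> carrier (perm_module G H)" "v \<in> carrier (perm_module G H)" for \<phi> u v H
    using that by (simp add: fixed_point_module_def hom_def)
  show ?thesis
    unfolding contra_module_def
  proof (intro conjI ballI, goal_cases)
    case (1 x) then show ?case using m by (simp add: hecke_category_def)
  next
    case (2 x y f) then show ?case using pc[of x] pc[of y]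
      by (simp add: fixed_point_module_def hecke_category_def mod_hom_def hom_def keys_add_closed Pi_iff compose_def fun_eq_iff)
  next
    case (3 x y f g \<phi>) then show ?case 
      by (simp add: fixed_point_module_def hecke_category_def hom_def keys_add_closed Pi_iff compose_def fun_eq_iff)
  next
    case (4 x \<phi>) then show ?case 
      by (auto simp: fixed_point_module_def hecke_category_def compose_def fun_eq_iff extensional_def)
  next
    case (5 x y z f g \<phi>) then show ?case 
      by (simp add: fixed_point_module_def hecke_category_def hom_def Pi_iff compose_def fun_eq_iff)
  qed
qed

end

theory Submission
  imports Defs
begin

text \<open>The value of an induced module at \<open>G/H\<close> is spanned by tensors \<open>m \<otimes> f\<close> with
  \<open>f : \<int>[G/H] \<rightarrow> \<int>[G/K]\<close>. Evaluation at the coset \<open>H\<close> identifies \<open>f\<close> with an \<open>H\<close>-invariant element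
  of \<open>\<int>[G/K]\<close>, that is, with a combination of sums over \<open>H\<close>-orbits, and the orbit of a coset with
  stabiliser \<open>L \<le> H\<close> factors through the transfer \<open>\<int>[G/H] \<rightarrow> \<int>[G/L]\<close>. So this value depends only on the
  restriction of the module to the orbit category of \<open>H\<close>, and homomorphisms between such
  restrictions already induce maps. Over the orbit category of \<open>H\<close> the constant module is free on
  the terminal object \<open>H/H\<close>, and projective modules remain projective. A projective resolution of
  the constant module therefore has a contracting homotopy over the orbit category of \<open>H\<close>, which
  induction turns into a contraction of the induced complex at \<open>G/H\<close>. Induction preserves
  projectivity since it is left adjoint to restriction, and
  \<open>r \<otimes> f \<mapsto> (v \<mapsto> (sum of the coefficients of f v) \<cdot> r)\<close> is an isomorphism from the induced constant
  module to the fixed point functor.\<close>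


section \<open>Module homomorphisms and tensor products\<close>

text \<open>The constant module is in general not projective over the orbit category of G, so its
  resolution has no contraction there, and tensoring is only right exact. A contraction exists after
  restriction to the subgroups of one H, and it is natural only for maps L -> L' given by cosets
  inside H. The work lies in showing that such partial data still act on the induced module at G/H.
  What makes this possible is an index: for L, L' inside H and a coset y inside H fixed by L, the
  transfer to L followed by L |-> y is card L' / card L times the transfer to L'
  (\<open>comp_transfer\<close>). Moving a G-map across the tensor sign changes the stabiliser and
  produces this very index, so the two sides of the balancing relation agree. The divisibility is
  one of integers and no index is inverted in R.

  The other obstacle is the test type in \<open>projective\<close>. A projective module is first
  made a retract of its canonical free module, whose values fit into \<open>free_cover\<close>; from
  then on lifts are prescribed on a basis, which serves both test modules of any other type and
  homomorphisms that are natural only over H.\<close>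

lemma mod_homD:
  assumes "f \<in> mod_hom R M N"
  shows "f \<in> hom (add_monoid M) (add_monoid N)"
    and "m \<in> carrier M \<Longrightarrow> f m \<in> carrier N"
    and "m \<in> carrier M \<Longrightarrow> m' \<in> carrier M \<Longrightarrow> f (m \<oplus>\<^bsub>M\<^esub> m') = f m \<oplus>\<^bsub>N\<^esub> f m'"
    and "r \<in> carrier R \<Longrightarrow> m \<in> carrier M \<Longrightarrow> f (r \<odot>\<^bsub>M\<^esub> m) = r \<odot>\<^bsub>N\<^esub> f m"
  using assms by (auto simp: mod_hom_def hom_def)

lemma mod_homI:
  assumes "\<And>m. m \<in> carrier M \<Longrightarrow> f m \<in> carrier N"
    and "\<And>m m'. m \<in> carrier M \<Longrightarrow> m' \<in> carrier M \<Longrightarrow> f (m \<oplus>\<^bsub>M\<^esub> m') = f m \<oplus>\<^bsub>N\<^esub> f m'"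
    and "\<And>r m. r \<in> carrier R \<Longrightarrow> m \<in> carrier M \<Longrightarrow> f (r \<odot>\<^bsub>M\<^esub> m) = r \<odot>\<^bsub>N\<^esub> f m"
  shows "f \<in> mod_hom R M N"
  using assms by (auto simp: mod_hom_def hom_def)

lemma add_hom_zero:
  assumes "abelian_group M" "abelian_group N" "f \<in> hom (add_monoid M) (add_monoid N)"
  shows "f \<zero>\<^bsub>M\<^esub> = \<zero>\<^bsub>N\<^esub>"
  using hom_one[OF assms(3)] assms(1,2)
  by (simp add: abelian_group.a_group)

lemma add_hom_minus:
  assumes "abelian_group M" "abelian_group N" "f \<in> hom (add_monoid M) (add_monoid N)"
    and "m \<in> carrier M"
  shows "f (\<ominus>\<^bsub>M\<^esub> m) = \<ominus>\<^bsub>N\<^esub> f m"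
proof -
  interpret group_hom "add_monoid M" "add_monoid N" f
    using assms(1-3) by (simp add: group_hom_def group_hom_axioms_def abelian_group.a_group)
  show ?thesis using hom_inv[of m] assms(4) by (simp add: a_inv_def)
qed

lemma mod_hom_zero:
  assumes "module R M" "module R N" "f \<in> mod_hom R M N"
  shows "f \<zero>\<^bsub>M\<^esub> = \<zero>\<^bsub>N\<^esub>"
  using assms by (intro add_hom_zero) (auto simp: module_def mod_hom_def)

lemma mod_hom_minus:
  assumes "module R M" "module R N" "f \<in> mod_hom R M N" "m \<in> carrier M"
  shows "f (\<ominus>\<^bsub>M\<^esub> m) = \<ominus>\<^bsub>N\<^esub> f m"
  using assms by (intro add_hom_minus) (auto simp: module_def mod_hom_def)

lemma mod_hom_diff:
  assumes "module R M" "module R N" "f \<in> mod_hom R M N" "m \<in> carrier M" "m' \<in> carrier M"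
  shows "f (m \<ominus>\<^bsub>M\<^esub> m') = f m \<ominus>\<^bsub>N\<^esub> f m'"
proof -
  interpret M: module R M by fact
  show ?thesis
    using assms mod_hom_minus[OF assms(1-3)] mod_homD[OF assms(3)] by (simp add: a_minus_def)
qed

lemma mod_hom_compose:
  assumes "f \<in> mod_hom R M N" "g \<in> mod_hom R N K"
  shows "(\<lambda>x. g (f x)) \<in> mod_hom R M K"
  by (rule mod_homI) (simp_all add: mod_homD[OF assms(1)] mod_homD[OF assms(2)])

lemma regular_module_simps [simp]:
  "carrier (regular_module R) = carrier R" "add (regular_module R) = add R"
  "zero (regular_module R) = \<zero>\<^bsub>R\<^esub>" "smult (regular_module R) = monoid.mult R"
  by (simp_all add: regular_module_def)

lemma module_regular:
  assumes "cring R" shows "module R (regular_module R)"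
proof -
  interpret cring R by fact
  show ?thesis
    by (intro moduleI abelian_groupI is_cring)
       (auto simp: l_distr r_distr m_assoc a_assoc a_comm a_lcomm intro: bexI[of _ "\<ominus>\<^bsub>R\<^esub> _"] l_neg)
qed

text \<open>The homomorphism is determined by \<open>g\<close> on the carrier of the free group, so
  the choice only concerns arguments outside that carrier.\<close>

definition frag_lift :: "('v, 'e) monoid_scheme \<Rightarrow> 'a set \<Rightarrow> ('a \<Rightarrow> 'v) \<Rightarrow> ('a \<Rightarrow>\<^sub>0 int) \<Rightarrow> 'v" where
  "frag_lift V S g = (SOME h. h \<in> hom (free_Abelian_group S) V \<and> (\<forall>x\<in>S. h (frag_of x) = g x))"

lemma frag_lift:
  assumes "comm_group V" "g \<in> S \<rightarrow> carrier V"
  shows frag_lift_hom: "frag_lift V S g \<in> hom (free_Abelian_group S) V"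
    and frag_lift_of: "x \<in> S \<Longrightarrow> frag_lift V S g (frag_of x) = g x"
proof -
  have "g ` S \<subseteq> carrier V" using assms(2) by auto
  then have "\<exists>h. h \<in> hom (free_Abelian_group S) V \<and> (\<forall>x\<in>S. h (frag_of x) = g x)"
    using comm_group.free_Abelian_group_universal[OF assms(1), of g S] by metis
  from someI_ex[OF this]
  show "frag_lift V S g \<in> hom (free_Abelian_group S) V" "x \<in> S \<Longrightarrow> frag_lift V S g (frag_of x) = g x"
    by (auto simp: frag_lift_def)
qed

lemma hom_free_Abelian_group_diff:
  assumes "group V" "h \<in> hom (free_Abelian_group S) V"
    and "Poly_Mapping.keys a \<subseteq> S" "Poly_Mapping.keys b \<subseteq> S"
  shows "h (a - b) = h a \<otimes>\<^bsub>V\<^esub> inv\<^bsub>V\<^esub> h b"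
proof -
  interpret h: group_hom "free_Abelian_group S" V h
    using assms(1,2) by (simp add: group_hom_def group_hom_axioms_def)
  have "h (a + - b) = h a \<otimes>\<^bsub>V\<^esub> h (- b)"
    using h.hom_mult[of a "- b"] assms(3,4) by simp
  also have "h (- b) = inv\<^bsub>V\<^esub> h b"
    using h.hom_inv[of b] assms(4) by simp
  finally show ?thesis by simp
qed

lemma frag_hom_eqI:
  assumes "group V" "f \<in> hom (free_Abelian_group S) V" "g \<in> hom (free_Abelian_group S) V"
    and "\<And>x. x \<in> S \<Longrightarrow> f (frag_of x) = g (frag_of x)" "Poly_Mapping.keys u \<subseteq> S"
  shows "f u = g u"
proof -
  note f = assms(2) and g = assms(3)
  have "Poly_Mapping.keys u \<subseteq> S \<and> f u = g u"
    using assms(5)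
  proof (induction u rule: frag_induction)
    case zero show ?case using hom_one[OF f] hom_one[OF g] assms(1) by simp
  next
    case (one x) then show ?case using assms(4) by simp
  next
    case (diff a b)
    then show ?case
      using hom_free_Abelian_group_diff[OF assms(1) f] hom_free_Abelian_group_diff[OF assms(1) g] keys_diff[of a b]
      by auto
  qed
  then show ?thesis ..
qed

text \<open>Common setting for the tensor product of modules over R and for the extension of scalars
  from the integers. \<open>l_smult\<close>, the R-linearity of the action of \<open>S\<close> on
  \<open>M\<close>, is what lets R act on the tensor product through the left factor.\<close>

locale tensor_data =
  fixes R :: "('r, 'k) ring_scheme" and S :: "'s set" and l :: "'s \<Rightarrow> 'm \<Rightarrow> 'm" and l' :: "'s \<Rightarrow> 'b \<Rightarrow> 'b"
    and M :: "('r, 'm) module" and B :: "('b, 'e) monoid_scheme"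
  assumes mod: "module R M" and comm: "comm_group B"
    and l_closed: "\<And>s m. s \<in> S \<Longrightarrow> m \<in> carrier M \<Longrightarrow> l s m \<in> carrier M"
    and l'_closed: "\<And>s b. s \<in> S \<Longrightarrow> b \<in> carrier B \<Longrightarrow> l' s b \<in> carrier B"
    and l_smult: "\<And>s r m. s \<in> S \<Longrightarrow> r \<in> carrier R \<Longrightarrow> m \<in> carrier M \<Longrightarrow> l s (r \<odot>\<^bsub>M\<^esub> m) = r \<odot>\<^bsub>M\<^esub> l s m"
begin

interpretation M: module R M by (rule mod)
interpretation B: comm_group B by (rule comm)

abbreviation "T \<equiv> tensor S l l' M B"
abbreviation "FF \<equiv> free_Abelian_group (carrier M \<times> carrier B)"
abbreviation "NN \<equiv> tensor_relations S l l' M B"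
abbreviation "cls c \<equiv> NN #>\<^bsub>FF\<^esub> c"
abbreviation "pure \<equiv> pure_tensor T"
abbreviation "scale r c \<equiv> frag_extend (\<lambda>(m, b). frag_of (r \<odot>\<^bsub>M\<^esub> m, b)) c"

interpretation FF: comm_group FF by (rule abelian_free_Abelian_group)

lemma relations_subset_kernel:
  assumes V: "comm_group V" and h: "h \<in> hom FF V"
    and "\<And>m m' b. m \<in> carrier M \<Longrightarrow> m' \<in> carrier M \<Longrightarrow> b \<in> carrier B \<Longrightarrow>
      h (frag_of (m \<oplus>\<^bsub>M\<^esub> m', b)) = h (frag_of (m, b)) \<otimes>\<^bsub>V\<^esub> h (frag_of (m', b))"
    and "\<And>m b b'. m \<in> carrier M \<Longrightarrow> b \<in> carrier B \<Longrightarrow> b' \<in> carrier B \<Longrightarrow>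
      h (frag_of (m, b \<otimes>\<^bsub>B\<^esub> b')) = h (frag_of (m, b)) \<otimes>\<^bsub>V\<^esub> h (frag_of (m, b'))"
    and "\<And>s m b. s \<in> S \<Longrightarrow> m \<in> carrier M \<Longrightarrow> b \<in> carrier B \<Longrightarrow> h (frag_of (l s m, b)) = h (frag_of (m, l' s b))"
  shows "NN \<subseteq> kernel FF V h"
proof -
  interpret V: comm_group V by (rule V)
  interpret h: group_hom FF V h
    using h by (simp add: group_hom_def group_hom_axioms_def)
  have hd: "h (a - b) = h a \<otimes>\<^bsub>V\<^esub> inv\<^bsub>V\<^esub> h b"
    if "Poly_Mapping.keys a \<subseteq> carrier M \<times> carrier B" "Poly_Mapping.keys b \<subseteq> carrier M \<times> carrier B" for a b
    using hom_free_Abelian_group_diff[OF V.is_group h] that .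
  have cl: "h c \<in> carrier V" if "Poly_Mapping.keys c \<subseteq> carrier M \<times> carrier B" for c
    using that h.hom_closed by simp
  have sub: "Poly_Mapping.keys (p - q) \<subseteq> carrier M \<times> carrier B"
    if "Poly_Mapping.keys p \<subseteq> carrier M \<times> carrier B" "Poly_Mapping.keys q \<subseteq> carrier M \<times> carrier B" for p q :: "'m \<times> 'b \<Rightarrow>\<^sub>0 int"
    using that keys_diff[of p q] by auto
  have cancel: "x \<otimes>\<^bsub>V\<^esub> y \<otimes>\<^bsub>V\<^esub> inv\<^bsub>V\<^esub> x \<otimes>\<^bsub>V\<^esub> inv\<^bsub>V\<^esub> y = \<one>\<^bsub>V\<^esub>" if "x \<in> carrier V" "y \<in> carrier V" for x y
    using that by (metis V.inv_closed V.inv_solve_right' V.l_one V.m_comm V.one_closed V.r_inv V.m_closed V.m_assoc)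
  show ?thesis
    unfolding tensor_relations_def
  proof (rule FF.generate_subgroup_incl[OF _ h.subgroup_kernel], safe)
    fix m m' b assume "m \<in> carrier M" "m' \<in> carrier M" "b \<in> carrier B"
    then show "frag_of (m \<oplus>\<^bsub>M\<^esub> m', b) - frag_of (m, b) - frag_of (m', b) \<in> kernel FF V h"
      using assms(3) cancel cl by (auto simp: kernel_def hd sub)
  next
    fix m b b' assume "m \<in> carrier M" "b \<in> carrier B" "b' \<in> carrier B"
    then show "frag_of (m, b \<otimes>\<^bsub>B\<^esub> b') - frag_of (m, b) - frag_of (m, b') \<in> kernel FF V h"
      using assms(4) cancel cl by (auto simp: kernel_def hd sub)
  next
    fix s m b assume "s \<in> S" "m \<in> carrier M" "b \<in> carrier B"
    then show "frag_of (l s m, b) - frag_of (m, l' s b) \<in> kernel FF V h"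
      using assms(5) cl l_closed l'_closed by (auto simp: kernel_def hd sub)
  qed
qed

lemma subgroup_NN: "subgroup NN FF"
  unfolding tensor_relations_def
  by (rule FF.generate_is_subgroup)
     (auto simp: l_closed l'_closed dest!: subsetD[OF keys_diff])

lemma normal_NN: "NN \<lhd> FF"
  by (rule FF.subgroup_imp_normal) (rule subgroup_NN)

lemma NN_keys: "n \<in> NN \<Longrightarrow> Poly_Mapping.keys n \<subseteq> carrier M \<times> carrier B"
  using subsetD[OF subgroup.subset[OF subgroup_NN], of n] by (simp only: carrier_free_Abelian_group_iff)

lemma NN_gens:
  fixes m m' b b' s
  shows "m \<in> carrier M \<Longrightarrow> m' \<in> carrier M \<Longrightarrow> b \<in> carrier B \<Longrightarrow>
      frag_of (m \<oplus>\<^bsub>M\<^esub> m', b) - frag_of (m, b) - frag_of (m', b) \<in> NN"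
    and "m \<in> carrier M \<Longrightarrow> b \<in> carrier B \<Longrightarrow> b' \<in> carrier B \<Longrightarrow>
      frag_of (m, b \<otimes>\<^bsub>B\<^esub> b') - frag_of (m, b) - frag_of (m, b') \<in> NN"
    and "s \<in> S \<Longrightarrow> m \<in> carrier M \<Longrightarrow> b \<in> carrier B \<Longrightarrow> frag_of (l s m, b) - frag_of (m, l' s b) \<in> NN"
  unfolding tensor_relations_def by (rule generate.incl; blast)+

lemma T_simps:
  "carrier T = rcosets\<^bsub>FF\<^esub> NN" "\<zero>\<^bsub>T\<^esub> = NN" "add T = set_mult FF"
  "smult T = (\<lambda>r X. \<Union>c\<in>X. NN #>\<^bsub>FF\<^esub> scale r c)"
  by (simp_all add: tensor_def Let_def)

lemma carrier_T: "carrier T = cls ` {c. Poly_Mapping.keys c \<subseteq> carrier M \<times> carrier B}"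
  by (auto simp: T_simps RCOSETS_def)

lemma add_cls:
  assumes "Poly_Mapping.keys c \<subseteq> carrier M \<times> carrier B" "Poly_Mapping.keys d \<subseteq> carrier M \<times> carrier B"
  shows "cls c \<oplus>\<^bsub>T\<^esub> cls d = cls (c + d)"
  using normal.rcos_sum[OF normal_NN] assms by (simp add: T_simps)

lemma cls_elem: "c \<in> cls d \<longleftrightarrow> c - d \<in> NN"
proof -
  have "\<exists>x\<in>NN. c = x + d" if "c - d \<in> NN" using that by (rule bexI[rotated]) simp
  then show ?thesis by (auto simp: r_coset_def)
qed

lemma abelian_group_T: "abelian_group T"
proof -
  have "comm_group (FF Mod NN)" by (rule FF.abelian_FactGroup) (rule subgroup_NN)
  then interpret Q: comm_group "FF Mod NN" .
  have Q: "carrier (FF Mod NN) = carrier T" "mult (FF Mod NN) = add T" "one (FF Mod NN) = \<zero>\<^bsub>T\<^esub>"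
    by (simp_all add: T_simps FactGroup_def)
  show ?thesis
  proof (rule abelian_groupI, goal_cases)
    case (1 x y) then show ?case using Q.m_closed unfolding Q by blast
  next
    case 2 then show ?case using Q.one_closed unfolding Q by blast
  next
    case (3 x y z) then show ?case using Q.m_assoc unfolding Q by blast
  next
    case (4 x y) then show ?case using Q.m_comm unfolding Q by blast
  next
    case (5 x) then show ?case using Q.l_one unfolding Q by blast
  next
    case (6 x) then show ?case using Q.l_inv_ex unfolding Q by blast
  qed
qed

lemma cls_hom: "(\<lambda>c. cls c) \<in> hom FF (add_monoid T)"
  by (auto simp: hom_def add_cls carrier_T)

lemma cls_eqI: "c - d \<in> NN \<Longrightarrow> cls c = cls d"
proof -
  assume "c - d \<in> NN"
  show ?thesis
  proof (rule Set.set_eqI, unfold cls_elem)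
    fix x
    have "x - d = (x - c) \<otimes>\<^bsub>FF\<^esub> (c - d)" "x - c = (x - d) \<otimes>\<^bsub>FF\<^esub> inv\<^bsub>FF\<^esub> (c - d)"
      using NN_keys[OF \<open>c - d \<in> NN\<close>] by simp_all
    then show "x - c \<in> NN \<longleftrightarrow> x - d \<in> NN"
      using subgroup.m_closed[OF subgroup_NN] subgroup.m_inv_closed[OF subgroup_NN] \<open>c - d \<in> NN\<close> by metis
  qed
qed

lemma pure_eq_cls: "pure m b = cls (frag_of (m, b))"
  by (auto simp: pure_tensor_def T_simps r_coset_def)

lemma pure_closed [simp]: "m \<in> carrier M \<Longrightarrow> b \<in> carrier B \<Longrightarrow> pure m b \<in> carrier T"
  by (auto simp: pure_eq_cls carrier_T)

lemma pure_bilinear: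
  fixes m m' b b' s
  shows "m \<in> carrier M \<Longrightarrow> m' \<in> carrier M \<Longrightarrow> b \<in> carrier B \<Longrightarrow> pure (m \<oplus>\<^bsub>M\<^esub> m') b = pure m b \<oplus>\<^bsub>T\<^esub> pure m' b"
    and "m \<in> carrier M \<Longrightarrow> b \<in> carrier B \<Longrightarrow> b' \<in> carrier B \<Longrightarrow> pure m (b \<otimes>\<^bsub>B\<^esub> b') = pure m b \<oplus>\<^bsub>T\<^esub> pure m b'"
    and "s \<in> S \<Longrightarrow> m \<in> carrier M \<Longrightarrow> b \<in> carrier B \<Longrightarrow> pure (l s m) b = pure m (l' s b)"
  using NN_gens(1)[of m m' b] NN_gens(2)[of m b b'] NN_gens(3)[of s m b]
  unfolding pure_eq_cls
  by (subst add_cls; simp add: cls_eqI diff_diff_eq; fail | simp add: cls_eqI)+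

lemma scale_keys:
  assumes "r \<in> carrier R" "Poly_Mapping.keys c \<subseteq> carrier M \<times> carrier B"
  shows "Poly_Mapping.keys (scale r c) \<subseteq> carrier M \<times> carrier B"
  using assms by (intro frag_extend_closed[OF assms(2)]) auto

text \<open>The difference of \<open>x\<close> and \<open>d\<close> is a relation, and a biadditive
  balanced \<open>h\<close> kills all relations; hence \<open>h\<close> is constant on cosets.
  Scalar multiplication, \<open>tensor_map\<close> and the universal property are all well defined
  for this reason.\<close>

lemma hom_vanishes:
  assumes V: "comm_group V" and h: "h \<in> hom FF V"
    and "\<And>m m' b. m \<in> carrier M \<Longrightarrow> m' \<in> carrier M \<Longrightarrow> b \<in> carrier B \<Longrightarrow>
      h (frag_of (m \<oplus>\<^bsub>M\<^esub> m', b)) = h (frag_of (m, b)) \<otimes>\<^bsub>V\<^esub> h (frag_of (m', b))"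
    and "\<And>m b b'. m \<in> carrier M \<Longrightarrow> b \<in> carrier B \<Longrightarrow> b' \<in> carrier B \<Longrightarrow>
      h (frag_of (m, b \<otimes>\<^bsub>B\<^esub> b')) = h (frag_of (m, b)) \<otimes>\<^bsub>V\<^esub> h (frag_of (m, b'))"
    and "\<And>s m b. s \<in> S \<Longrightarrow> m \<in> carrier M \<Longrightarrow> b \<in> carrier B \<Longrightarrow> h (frag_of (l s m, b)) = h (frag_of (m, l' s b))"
    and keys: "Poly_Mapping.keys d \<subseteq> carrier M \<times> carrier B" and x: "x \<in> cls d"
  shows "h x = h d"
proof -
  interpret V: comm_group V by (rule V)
  interpret h: group_hom FF V h
    using h by (simp add: group_hom_def group_hom_axioms_def)
  have n: "x - d \<in> NN" using x by (simp add: cls_elem)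
  then have "h (x - d) = \<one>\<^bsub>V\<^esub>" "Poly_Mapping.keys (x - d) \<subseteq> carrier M \<times> carrier B"
    using relations_subset_kernel[OF assms(1-5)] NN_keys by (auto simp: kernel_def)
  then have "h ((x - d) \<otimes>\<^bsub>FF\<^esub> d) = h d"
    using keys h.hom_closed[of d] by (subst h.hom_mult) (simp_all del: mult_free_Abelian_group)
  then show ?thesis by simp
qed

lemma cls_self: "c \<in> cls c"
  using subgroup.one_closed[OF subgroup_NN] by (simp add: cls_elem)

text \<open>A map of generators descends to the quotients once it is biadditive and balanced modulo
  the target relations. The variable \<open>c'\<close> merely names the projection onto
  \<open>T'\<close>. The case \<open>T' = T\<close> gives scalar multiplication, the general case
  gives \<open>tensor_map\<close>.\<close>

lemma cls_extend:
  assumes "tensor_data R' S' k k' M' B'" and T': "T' = tensor S' k k' M' B'"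
    and h: "\<And>m b. m \<in> carrier M \<Longrightarrow> b \<in> carrier B \<Longrightarrow> Poly_Mapping.keys (h (m, b)) \<subseteq> carrier M' \<times> carrier B'"
    and c: "\<And>c. c' c = tensor_relations S' k k' M' B' #>\<^bsub>free_Abelian_group (carrier M' \<times> carrier B')\<^esub> c"
    and "\<And>m m' b. m \<in> carrier M \<Longrightarrow> m' \<in> carrier M \<Longrightarrow> b \<in> carrier B \<Longrightarrow>
      c' (h (m \<oplus>\<^bsub>M\<^esub> m', b)) = c' (h (m, b)) \<oplus>\<^bsub>T'\<^esub> c' (h (m', b))"
    and "\<And>m b b'. m \<in> carrier M \<Longrightarrow> b \<in> carrier B \<Longrightarrow> b' \<in> carrier B \<Longrightarrow>
      c' (h (m, b \<otimes>\<^bsub>B\<^esub> b')) = c' (h (m, b)) \<oplus>\<^bsub>T'\<^esub> c' (h (m, b'))"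
    and "\<And>s m b. s \<in> S \<Longrightarrow> m \<in> carrier M \<Longrightarrow> b \<in> carrier B \<Longrightarrow> c' (h (l s m, b)) = c' (h (m, l' s b))"
    and keys: "Poly_Mapping.keys d \<subseteq> carrier M \<times> carrier B" and x: "x \<in> cls d"
  shows "c' (frag_extend h x) = c' (frag_extend h d)"
proof -
  interpret T': tensor_data R' S' k k' M' B' by fact
  have cl: "Poly_Mapping.keys (frag_extend h c) \<subseteq> carrier M' \<times> carrier B'"
    if "Poly_Mapping.keys c \<subseteq> carrier M \<times> carrier B" for c
    using h by (intro frag_extend_closed[OF that]) auto
  have "(\<lambda>x. c' (frag_extend h x)) x = c' (frag_extend h d)"
  proof (rule hom_vanishes[OF _ _ _ _ _ keys x])
    show "comm_group (add_monoid T')"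
      unfolding T' using T'.abelian_group_T by (rule abelian_group.a_comm_group)
    show "(\<lambda>x. c' (frag_extend h x)) \<in> hom FF (add_monoid T')"
      using cl by (auto simp: hom_def c T' T'.carrier_T frag_extend_add T'.add_cls)
  qed (use assms in auto)
  then show ?thesis .
qed

text \<open>The action is defined as a union over all representatives of a class; by
  \<open>cls_extend\<close> every representative contributes the same coset, so the union
  collapses.\<close>

lemma smult_cls:
  assumes "r \<in> carrier R" "Poly_Mapping.keys c \<subseteq> carrier M \<times> carrier B"
  shows "r \<odot>\<^bsub>T\<^esub> cls c = cls (scale r c)"
proof -
  have "cls (scale r x) = cls (scale r c)" if "x \<in> cls c" for x
    by (rule cls_extend[where c' = cls and h = "\<lambda>(m, b). frag_of (r \<odot>\<^bsub>M\<^esub> m, b)", OF tensor_data_axioms refl _ refl _ _ _ assms(2) that])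
       (use assms(1) in \<open>simp_all add: pure_eq_cls[symmetric] pure_bilinear M.smult_r_distr l_smult[symmetric] l'_closed\<close>)
  then have "(\<Union>x\<in>cls c. cls (scale r x)) = (\<Union>x\<in>cls c. cls (scale r c))"
    by (rule SUP_cong[OF refl])
  then show ?thesis using cls_self[of c] unfolding T_simps by blast
qed

lemma smult_pure:
  assumes "r \<in> carrier R" "m \<in> carrier M" "b \<in> carrier B"
  shows "r \<odot>\<^bsub>T\<^esub> pure m b = pure (r \<odot>\<^bsub>M\<^esub> m) b"
  using assms by (simp add: pure_eq_cls smult_cls)

lemma T_induct [consumes 1, case_names zero pure diff]:
  assumes "w \<in> carrier T" "P \<zero>\<^bsub>T\<^esub>" "\<And>m b. m \<in> carrier M \<Longrightarrow> b \<in> carrier B \<Longrightarrow> P (pure m b)"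
    and "\<And>u v. u \<in> carrier T \<Longrightarrow> v \<in> carrier T \<Longrightarrow> P u \<Longrightarrow> P v \<Longrightarrow> P (u \<ominus>\<^bsub>T\<^esub> v)"
  shows "P w"
proof -
  interpret T: abelian_group T by (rule abelian_group_T)
  obtain c where c: "Poly_Mapping.keys c \<subseteq> carrier M \<times> carrier B" and w: "w = cls c"
    using assms(1) by (auto simp: carrier_T)
  have "Poly_Mapping.keys c \<subseteq> carrier M \<times> carrier B \<and> P (cls c)"
    using c
  proof (induction c rule: frag_induction)
    case zero
    have "cls 0 = NN" using FF.coset_mult_one[of NN] subgroup.subset[OF subgroup_NN] by simp
    then show ?case using assms(2) by (simp add: T_simps)
  next
    case (one x) then show ?case using assms(3) by (cases x) (auto simp: pure_eq_cls)
  next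
    case (diff a b)
    then have "cls (a - b) = cls a \<ominus>\<^bsub>T\<^esub> cls b"
      using hom_free_Abelian_group_diff[OF _ cls_hom, of a b] T.a_group
      by (simp add: a_minus_def a_inv_def)
    moreover have "cls a \<in> carrier T" "cls b \<in> carrier T" using diff by (auto simp: carrier_T)
    ultimately show ?case using diff assms(4) keys_diff[of a b] by auto
  qed
  then show ?thesis using w by simp
qed

lemma module_T: "module R T"
proof (rule moduleI)
  interpret T: abelian_group T by (rule abelian_group_T)
  show "cring R" by (rule M.is_cring)
  show "abelian_group T" by (rule abelian_group_T)
  show sc: "r \<odot>\<^bsub>T\<^esub> x \<in> carrier T" if "r \<in> carrier R" "x \<in> carrier T" for r x
    using that by (auto simp: carrier_T smult_cls scale_keys)
  show ad: "r \<odot>\<^bsub>T\<^esub> (x \<oplus>\<^bsub>T\<^esub> y) = r \<odot>\<^bsub>T\<^esub> x \<oplus>\<^bsub>T\<^esub> r \<odot>\<^bsub>T\<^esub> y" if r: "r \<in> carrier R" and xy: "x \<in> carrier T" "y \<in> carrier T" for r x y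
  proof -
    obtain c d where "x = cls c" "y = cls d" and k: "Poly_Mapping.keys c \<subseteq> carrier M \<times> carrier B"
      "Poly_Mapping.keys d \<subseteq> carrier M \<times> carrier B"
      using xy by (auto simp: carrier_T)
    then show ?thesis
      using r by (simp add: smult_cls scale_keys add_cls frag_extend_add keys_add_closed[OF k])
  qed
  have hom: "(\<lambda>x. r \<odot>\<^bsub>T\<^esub> x) \<in> hom (add_monoid T) (add_monoid T)" if "r \<in> carrier R" for r
    using sc ad that by (auto simp: hom_def)
  have z: "r \<odot>\<^bsub>T\<^esub> \<zero>\<^bsub>T\<^esub> = \<zero>\<^bsub>T\<^esub>" if "r \<in> carrier R" for r
    using add_hom_zero[OF abelian_group_T abelian_group_T hom[OF that]] .
  have d: "r \<odot>\<^bsub>T\<^esub> (u \<ominus>\<^bsub>T\<^esub> v) = r \<odot>\<^bsub>T\<^esub> u \<ominus>\<^bsub>T\<^esub> r \<odot>\<^bsub>T\<^esub> v"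
    if "r \<in> carrier R" "u \<in> carrier T" "v \<in> carrier T" for r u v
    using add_hom_minus[OF abelian_group_T abelian_group_T hom[OF that(1)] that(3)] that
    by (simp add: a_minus_def ad)
  show "(r \<oplus>\<^bsub>R\<^esub> s) \<odot>\<^bsub>T\<^esub> x = r \<odot>\<^bsub>T\<^esub> x \<oplus>\<^bsub>T\<^esub> s \<odot>\<^bsub>T\<^esub> x" if "r \<in> carrier R" "s \<in> carrier R" "x \<in> carrier T" for r s x
    using that(3)
  proof (induction x rule: T_induct)
    case (diff u v)
    have "r \<oplus>\<^bsub>R\<^esub> s \<in> carrier R" using that(1,2) by simp
    then have "(r \<oplus>\<^bsub>R\<^esub> s) \<odot>\<^bsub>T\<^esub> (u \<ominus>\<^bsub>T\<^esub> v) = (r \<odot>\<^bsub>T\<^esub> u \<oplus>\<^bsub>T\<^esub> s \<odot>\<^bsub>T\<^esub> u) \<ominus>\<^bsub>T\<^esub> (r \<odot>\<^bsub>T\<^esub> v \<oplus>\<^bsub>T\<^esub> s \<odot>\<^bsub>T\<^esub> v)"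
      using diff by (simp add: d)
    also have "\<dots> = (r \<odot>\<^bsub>T\<^esub> u \<ominus>\<^bsub>T\<^esub> r \<odot>\<^bsub>T\<^esub> v) \<oplus>\<^bsub>T\<^esub> (s \<odot>\<^bsub>T\<^esub> u \<ominus>\<^bsub>T\<^esub> s \<odot>\<^bsub>T\<^esub> v)"
      using that(1,2) diff(1,2) sc by (simp add: a_minus_def T.minus_add T.a_ac)
    finally show ?case using that(1,2) diff(1,2) by (simp add: d)
  qed (use that(1,2) in \<open>simp_all add: z smult_pure pure_bilinear M.smult_l_distr\<close>)
  show "(r \<otimes>\<^bsub>R\<^esub> s) \<odot>\<^bsub>T\<^esub> x = r \<odot>\<^bsub>T\<^esub> (s \<odot>\<^bsub>T\<^esub> x)" if "r \<in> carrier R" "s \<in> carrier R" "x \<in> carrier T" for r s x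
    using that(3)
    by (induction x rule: T_induct) (use that(1,2) sc in \<open>simp_all add: z d smult_pure M.smult_assoc1\<close>)
  show "\<one>\<^bsub>R\<^esub> \<odot>\<^bsub>T\<^esub> x = x" if "x \<in> carrier T" for x
    using that by (induction x rule: T_induct) (simp_all add: z d smult_pure)
qed

lemma T_universal:
  assumes V: "comm_group V"
    and \<beta>: "\<And>m b. m \<in> carrier M \<Longrightarrow> b \<in> carrier B \<Longrightarrow> \<beta> m b \<in> carrier V"
    and "\<And>m m' b. m \<in> carrier M \<Longrightarrow> m' \<in> carrier M \<Longrightarrow> b \<in> carrier B \<Longrightarrow> \<beta> (m \<oplus>\<^bsub>M\<^esub> m') b = \<beta> m b \<otimes>\<^bsub>V\<^esub> \<beta> m' b"
    and "\<And>m b b'. m \<in> carrier M \<Longrightarrow> b \<in> carrier B \<Longrightarrow> b' \<in> carrier B \<Longrightarrow> \<beta> m (b \<otimes>\<^bsub>B\<^esub> b') = \<beta> m b \<otimes>\<^bsub>V\<^esub> \<beta> m b'"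
    and "\<And>s m b. s \<in> S \<Longrightarrow> m \<in> carrier M \<Longrightarrow> b \<in> carrier B \<Longrightarrow> \<beta> (l s m) b = \<beta> m (l' s b)"
  shows "\<exists>\<Phi>\<in>hom (add_monoid T) V. \<forall>m\<in>carrier M. \<forall>b\<in>carrier B. \<Phi> (pure m b) = \<beta> m b"
proof -
  define h where "h = frag_lift V (carrier M \<times> carrier B) (\<lambda>(m, b). \<beta> m b)"
  have fl: "(\<lambda>(m, b). \<beta> m b) \<in> carrier M \<times> carrier B \<rightarrow> carrier V" using \<beta> by auto
  have h: "h \<in> hom FF V" unfolding h_def by (rule frag_lift_hom[OF V fl])
  have h_of: "h (frag_of (m, b)) = \<beta> m b" if "m \<in> carrier M" "b \<in> carrier B" for m b
    using frag_lift_of[OF V fl, of "(m, b)"] that by (simp add: h_def)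
  \<comment> \<open>An arbitrary representative is evaluated; \<open>hom_vanishes\<close> shows that
    the value does not depend on it.\<close>
  define \<Phi> where "\<Phi> X = h (SOME c. c \<in> X)" for X
  have \<Phi>: "\<Phi> (cls c) = h c" if "Poly_Mapping.keys c \<subseteq> carrier M \<times> carrier B" for c
    unfolding \<Phi>_def
  proof (rule hom_vanishes[OF V h _ _ _ that])
    show "(SOME c'. c' \<in> cls c) \<in> cls c" by (rule someI[of _ c]) (rule cls_self)
  qed (use assms in \<open>simp_all add: h_of l_closed l'_closed\<close>)
  have hm: "h (c + d) = h c \<otimes>\<^bsub>V\<^esub> h d" if "Poly_Mapping.keys c \<subseteq> carrier M \<times> carrier B" "Poly_Mapping.keys d \<subseteq> carrier M \<times> carrier B" for c d
    using hom_mult[OF h] that by simp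
  have "\<Phi> \<in> hom (add_monoid T) V"
    using hom_in_carrier[OF h] by (auto simp: hom_def carrier_T add_cls \<Phi> keys_add_closed hm)
  then show ?thesis using \<Phi> h_of by (intro bexI[of _ \<Phi>]) (auto simp: pure_eq_cls)
qed

lemma T_hom_eqI:
  assumes "abelian_group W" "f \<in> hom (add_monoid T) (add_monoid W)" "g \<in> hom (add_monoid T) (add_monoid W)"
    and "\<And>m b. m \<in> carrier M \<Longrightarrow> b \<in> carrier B \<Longrightarrow> f (pure m b) = g (pure m b)" "w \<in> carrier T"
  shows "f w = g w"
proof -
  interpret T: abelian_group T by (rule abelian_group_T)
  note f = assms(2) and g = assms(3)
  show ?thesis using assms(5)
  proof (induction w rule: T_induct)
    case (diff u v)
    then show ?case
      using hom_mult[OF f, of u "\<ominus>\<^bsub>T\<^esub> v"] hom_mult[OF g, of u "\<ominus>\<^bsub>T\<^esub> v"]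
      by (simp add: a_minus_def add_hom_minus[OF abelian_group_T assms(1) f] add_hom_minus[OF abelian_group_T assms(1) g])
  qed (simp_all add: assms(4) add_hom_zero[OF abelian_group_T assms(1) f] add_hom_zero[OF abelian_group_T assms(1) g])
qed

text \<open>The additive map of \<open>T_universal\<close> is linear because, for fixed
  \<open>r\<close>, both sides of the linearity equation are additive and agree on pure
  tensors.\<close>

lemma T_universal_module:
  assumes W: "module R W"
    and \<beta>: "\<And>m b. m \<in> carrier M \<Longrightarrow> b \<in> carrier B \<Longrightarrow> \<beta> m b \<in> carrier W"
    and "\<And>m m' b. m \<in> carrier M \<Longrightarrow> m' \<in> carrier M \<Longrightarrow> b \<in> carrier B \<Longrightarrow> \<beta> (m \<oplus>\<^bsub>M\<^esub> m') b = \<beta> m b \<oplus>\<^bsub>W\<^esub> \<beta> m' b"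
    and "\<And>m b b'. m \<in> carrier M \<Longrightarrow> b \<in> carrier B \<Longrightarrow> b' \<in> carrier B \<Longrightarrow> \<beta> m (b \<otimes>\<^bsub>B\<^esub> b') = \<beta> m b \<oplus>\<^bsub>W\<^esub> \<beta> m b'"
    and "\<And>s m b. s \<in> S \<Longrightarrow> m \<in> carrier M \<Longrightarrow> b \<in> carrier B \<Longrightarrow> \<beta> (l s m) b = \<beta> m (l' s b)"
    and sm: "\<And>r m b. r \<in> carrier R \<Longrightarrow> m \<in> carrier M \<Longrightarrow> b \<in> carrier B \<Longrightarrow> \<beta> (r \<odot>\<^bsub>M\<^esub> m) b = r \<odot>\<^bsub>W\<^esub> \<beta> m b"
  shows "\<exists>\<Phi>\<in>mod_hom R T W. \<forall>m\<in>carrier M. \<forall>b\<in>carrier B. \<Phi> (pure m b) = \<beta> m b"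
proof -
  interpret W: module R W by (rule W)
  interpret T: module R T by (rule module_T)
  obtain \<Phi> where \<Phi>: "\<Phi> \<in> hom (add_monoid T) (add_monoid W)"
    and \<Phi>_pure: "\<And>m b. m \<in> carrier M \<Longrightarrow> b \<in> carrier B \<Longrightarrow> \<Phi> (pure m b) = \<beta> m b"
    using T_universal[OF W.a_comm_group, of \<beta>] assms by auto
  have cl: "\<Phi> w \<in> carrier W" if "w \<in> carrier T" for w using hom_in_carrier[OF \<Phi>] that by simp
  have ad: "\<Phi> (u \<oplus>\<^bsub>T\<^esub> v) = \<Phi> u \<oplus>\<^bsub>W\<^esub> \<Phi> v" if "u \<in> carrier T" "v \<in> carrier T" for u v
    using hom_mult[OF \<Phi>] that by simp
  have "\<Phi> (r \<odot>\<^bsub>T\<^esub> w) = r \<odot>\<^bsub>W\<^esub> \<Phi> w" if "r \<in> carrier R" "w \<in> carrier T" for r w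
    by (rule T_hom_eqI[OF module.axioms(2)[OF W], where f = "\<lambda>w. \<Phi> (r \<odot>\<^bsub>T\<^esub> w)" and g = "\<lambda>w. r \<odot>\<^bsub>W\<^esub> \<Phi> w"])
       (use that in \<open>auto simp: hom_def cl ad T.smult_r_distr W.smult_r_distr smult_pure \<Phi>_pure sm\<close>)
  then have "\<Phi> \<in> mod_hom R T W" using \<Phi> by (simp add: mod_hom_def)
  then show ?thesis using \<Phi>_pure by blast
qed

text \<open>The scalars \<open>S\<close> and \<open>S'\<close> of the two tensor products may
  differ, so compatibility of \<open>f\<close> and \<open>g\<close> with them is expressed by
  \<open>bal\<close> as an equation between pure tensors of the target.\<close>

lemma tensor_map:
  assumes T'_data: "tensor_data R S' k k' M' B'" and T': "T' = tensor S' k k' M' B'"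
    and f: "f \<in> mod_hom R M M'" and g: "g \<in> hom B B'"
    and bal: "\<And>s m b. s \<in> S \<Longrightarrow> m \<in> carrier M \<Longrightarrow> b \<in> carrier B \<Longrightarrow>
      pure_tensor T' (f (l s m)) (g b) = pure_tensor T' (f m) (g (l' s b))"
  shows tensor_map_hom: "tensor_map T' f g \<in> mod_hom R T T'"
    and tensor_map_pure: "m \<in> carrier M \<Longrightarrow> b \<in> carrier B \<Longrightarrow> tensor_map T' f g (pure m b) = pure_tensor T' (f m) (g b)"
proof -
  interpret T': tensor_data R S' k k' M' B' by fact
  interpret T'm: module R T' unfolding T' by (rule T'.module_T)
  let ?h = "\<lambda>(m, b). frag_of (f m, g b)"
  note pure' = T'.pure_eq_cls[folded T']
  have gc: "g b \<in> carrier B'" if "b \<in> carrier B" for b using hom_in_carrier[OF g that] .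
  have ga: "g (b \<otimes>\<^bsub>B\<^esub> b') = g b \<otimes>\<^bsub>B'\<^esub> g b'" if "b \<in> carrier B" "b' \<in> carrier B" for b b'
    using hom_mult[OF g that] .
  have wd: "T'.cls (frag_extend ?h x) = T'.cls (frag_extend ?h c)"
    if "x \<in> cls c" "Poly_Mapping.keys c \<subseteq> carrier M \<times> carrier B" for x c
    by (rule cls_extend[where c' = T'.cls and h = ?h, OF T'_data T' _ refl _ _ _ that(2,1)])
       (simp_all add: pure'[symmetric] mod_homD[OF f] gc ga T'.pure_bilinear[folded T'] bal)
  have tm: "tensor_map T' f g (cls c) = T'.cls (frag_extend ?h c)"
    if c: "Poly_Mapping.keys c \<subseteq> carrier M \<times> carrier B" for c
  proof -
    have "tensor_map T' f g (cls c) = (\<Union>x\<in>cls c. T'.cls (frag_extend ?h x))"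
      by (auto simp: tensor_map_def T' T'.T_simps r_coset_def)
    also have "\<dots> = (\<Union>x\<in>cls c. T'.cls (frag_extend ?h c))"
      by (rule SUP_cong[OF refl]) (rule wd[OF _ c])
    finally show ?thesis using cls_self[of c] by blast
  qed
  have k: "Poly_Mapping.keys (frag_extend ?h c) \<subseteq> carrier M' \<times> carrier B'"
    if c: "Poly_Mapping.keys c \<subseteq> carrier M \<times> carrier B" for c
    by (rule frag_extend_closed[OF c]) (auto simp: gc mod_homD[OF f])
  show p: "tensor_map T' f g (pure m b) = pure_tensor T' (f m) (g b)" if "m \<in> carrier M" "b \<in> carrier B" for m b
    using that by (simp add: pure_eq_cls tm pure')
  have add: "tensor_map T' f g \<in> hom (add_monoid T) (add_monoid T')"
  proof (rule homI; simp)
    show "tensor_map T' f g u \<in> carrier T'" if "u \<in> carrier T" for u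
    proof -
      obtain c where "u = cls c" "Poly_Mapping.keys c \<subseteq> carrier M \<times> carrier B"
        using \<open>u \<in> carrier T\<close> by (auto simp: carrier_T)
      then show ?thesis using k[of c] tm[of c] by (auto simp: T' T'.carrier_T)
    qed
    show "tensor_map T' f g (u \<oplus>\<^bsub>T\<^esub> v) = tensor_map T' f g u \<oplus>\<^bsub>T'\<^esub> tensor_map T' f g v"
      if uv: "u \<in> carrier T" "v \<in> carrier T" for u v
    proof -
      obtain c d where "u = cls c" "v = cls d" and c: "Poly_Mapping.keys c \<subseteq> carrier M \<times> carrier B"
        "Poly_Mapping.keys d \<subseteq> carrier M \<times> carrier B"
        using uv by (auto simp: carrier_T)
      then show ?thesis
        by (simp add: add_cls tm keys_add_closed[OF c] frag_extend_add T'.add_cls[folded T'] k)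
    qed
  qed
  have cl: "tensor_map T' f g w \<in> carrier T'" if "w \<in> carrier T" for w using hom_in_carrier[OF add] that by simp
  have ad: "tensor_map T' f g (u \<oplus>\<^bsub>T\<^esub> v) = tensor_map T' f g u \<oplus>\<^bsub>T'\<^esub> tensor_map T' f g v"
    if "u \<in> carrier T" "v \<in> carrier T" for u v
    using hom_mult[OF add] that by simp
  interpret T: module R T by (rule module_T)
  have "tensor_map T' f g (r \<odot>\<^bsub>T\<^esub> w) = r \<odot>\<^bsub>T'\<^esub> tensor_map T' f g w" if "r \<in> carrier R" "w \<in> carrier T" for r w
    by (rule T_hom_eqI[OF T'm.M.abelian_group_axioms, where f = "\<lambda>w. tensor_map T' f g (r \<odot>\<^bsub>T\<^esub> w)" and g = "\<lambda>w. r \<odot>\<^bsub>T'\<^esub> tensor_map T' f g w"])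
       (use that in \<open>auto simp: hom_def cl ad T.smult_r_distr T'm.smult_r_distr smult_pure p mod_homD[OF f] gc T'.smult_pure[folded T']\<close>)
  then show "tensor_map T' f g \<in> mod_hom R T T'" using add by (simp add: mod_hom_def)
qed

end


section \<open>Direct sums and quotients\<close>

lemma (in abelian_group) eq_if_minus_zero:
  assumes "x \<ominus> y = \<zero>" "x \<in> carrier G" "y \<in> carrier G"
  shows "x = y"
proof -
  have "x = (x \<ominus> y) \<oplus> y" using assms(2,3) by (simp add: a_minus_def a_assoc l_neg)
  then show ?thesis using assms by simp
qed

lemma direct_sum_simps [simp]:
  "\<zero>\<^bsub>direct_sum I M\<^esub> = (\<lambda>i\<in>I. \<zero>\<^bsub>M i\<^esub>)"
  "add (direct_sum I M) = (\<lambda>f g. \<lambda>i\<in>I. f i \<oplus>\<^bsub>M i\<^esub> g i)"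
  "smult (direct_sum I M) = (\<lambda>r f. \<lambda>i\<in>I. r \<odot>\<^bsub>M i\<^esub> f i)"
  by (simp_all add: direct_sum_def)

lemma carrier_direct_sum:
  "f \<in> carrier (direct_sum I M) \<longleftrightarrow>
     f \<in> extensional I \<and> (\<forall>i\<in>I. f i \<in> carrier (M i)) \<and> finite {i \<in> I. f i \<noteq> \<zero>\<^bsub>M i\<^esub>}"
  by (auto simp: direct_sum_def PiE_iff)

locale module_family =
  fixes R :: "('r, 'k) ring_scheme" and I :: "'i set" and M :: "'i \<Rightarrow> ('r, 'm) module"
  assumes cring: "cring R" and modules: "\<And>i. i \<in> I \<Longrightarrow> module R (M i)"
begin

abbreviation "DS \<equiv> direct_sum I M"

lemma ab: "i \<in> I \<Longrightarrow> abelian_group (M i)"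
  using modules by (simp add: module_def)

lemma DS_closed:
  shows DS_add_closed: "f \<in> carrier DS \<Longrightarrow> g \<in> carrier DS \<Longrightarrow> f \<oplus>\<^bsub>DS\<^esub> g \<in> carrier DS"
    and DS_zero_closed: "\<zero>\<^bsub>DS\<^esub> \<in> carrier DS"
    and DS_smult_closed: "r \<in> carrier R \<Longrightarrow> f \<in> carrier DS \<Longrightarrow> r \<odot>\<^bsub>DS\<^esub> f \<in> carrier DS"
proof -
  note gr = abelian_group.axioms(1)[OF ab]
  show "\<zero>\<^bsub>DS\<^esub> \<in> carrier DS"
    using gr by (auto simp: carrier_direct_sum abelian_monoid.zero_closed cong: conj_cong)
  show "f \<oplus>\<^bsub>DS\<^esub> g \<in> carrier DS" if f: "f \<in> carrier DS" and g: "g \<in> carrier DS"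
  proof -
    have "{i \<in> I. f i \<oplus>\<^bsub>M i\<^esub> g i \<noteq> \<zero>\<^bsub>M i\<^esub>} \<subseteq> {i \<in> I. f i \<noteq> \<zero>\<^bsub>M i\<^esub>} \<union> {i \<in> I. g i \<noteq> \<zero>\<^bsub>M i\<^esub>}"
      using gr by (auto simp: abelian_monoid.l_zero abelian_monoid.zero_closed)
    moreover have "finite ({i \<in> I. f i \<noteq> \<zero>\<^bsub>M i\<^esub>} \<union> {i \<in> I. g i \<noteq> \<zero>\<^bsub>M i\<^esub>})"
      using f g by (simp add: carrier_direct_sum)
    ultimately have "finite {i \<in> I. f i \<oplus>\<^bsub>M i\<^esub> g i \<noteq> \<zero>\<^bsub>M i\<^esub>}" by (rule finite_subset)
    then show ?thesis
      using f g gr by (auto simp: carrier_direct_sum abelian_monoid.a_closed cong: conj_cong)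
  qed
  show "r \<odot>\<^bsub>DS\<^esub> f \<in> carrier DS" if f: "f \<in> carrier DS" and r: "r \<in> carrier R"
  proof -
    have "{i \<in> I. r \<odot>\<^bsub>M i\<^esub> f i \<noteq> \<zero>\<^bsub>M i\<^esub>} \<subseteq> {i \<in> I. f i \<noteq> \<zero>\<^bsub>M i\<^esub>}"
      using r modules by (auto simp: module.smult_r_null[OF modules])
    moreover have "finite {i \<in> I. f i \<noteq> \<zero>\<^bsub>M i\<^esub>}" using f by (simp add: carrier_direct_sum)
    ultimately have "finite {i \<in> I. r \<odot>\<^bsub>M i\<^esub> f i \<noteq> \<zero>\<^bsub>M i\<^esub>}" by (rule finite_subset)
    then show ?thesis
      using f r modules by (auto simp: carrier_direct_sum module.smult_closed[OF modules] cong: conj_cong)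
  qed
qed

lemma module_DS: "module R DS"
proof (intro moduleI abelian_groupI cring, goal_cases)
  \<comment> \<open>The additive inverse is taken to be -1 times \<open>f\<close>, so that its
    finite support comes from closure under scalars.\<close>
  case (6 f)
  have "\<ominus>\<^bsub>R\<^esub> \<one>\<^bsub>R\<^esub> \<odot>\<^bsub>DS\<^esub> f \<in> carrier DS" using 6 cring DS_closed(3)
    by (simp add: cring.cring_simprules)
  moreover have "(\<ominus>\<^bsub>R\<^esub> \<one>\<^bsub>R\<^esub> \<odot>\<^bsub>DS\<^esub> f) \<oplus>\<^bsub>DS\<^esub> f = \<zero>\<^bsub>DS\<^esub>"
  proof -
    have "\<ominus>\<^bsub>R\<^esub> \<one>\<^bsub>R\<^esub> \<odot>\<^bsub>M i\<^esub> f i \<oplus>\<^bsub>M i\<^esub> f i = \<zero>\<^bsub>M i\<^esub>" if "i \<in> I" for i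
    proof -
      interpret module R "M i" by (rule modules[OF that])
      show ?thesis using 6 that by (simp add: carrier_direct_sum smult_l_minus M.l_neg)
    qed
    then show ?thesis by auto
  qed
  ultimately show ?case by blast
next
  case (1 x y) then show ?case by (rule DS_closed)
next
  case 2 then show ?case by (rule DS_closed)
next
  case (7 r x) then show ?case by (rule DS_closed)
next
  case (4 x y) then show ?case
    using abelian_group.axioms(1)[OF ab] by (auto simp: carrier_direct_sum abelian_monoid.a_comm)
qed (use abelian_group.axioms(1)[OF ab] modules in
    \<open>auto simp: carrier_direct_sum fun_eq_iff extensional_def abelian_monoid.a_assoc
      abelian_monoid.l_zero module.smult_l_distr[OF modules] module.smult_r_distr[OF modules] module.smult_assoc1[OF modules] module.smult_one[OF modules]
      abelian_monoid.a_closed module.smult_closed[OF modules]\<close>)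

lemma inj_hom: "i \<in> I \<Longrightarrow> direct_sum_inj I M i \<in> mod_hom R (M i) DS"
proof (rule mod_homI)
  assume i: "i \<in> I"
  note z = abelian_monoid.zero_closed[OF abelian_group.axioms(1)[OF ab]]
    abelian_monoid.l_zero[OF abelian_group.axioms(1)[OF ab]]
  fix m m' r assume m: "m \<in> carrier (M i)"
  have "{j \<in> I. (if j = i then m else \<zero>\<^bsub>M j\<^esub>) \<noteq> \<zero>\<^bsub>M j\<^esub>} \<subseteq> {i}" by auto
  then show "direct_sum_inj I M i m \<in> carrier DS"
    using m z finite_subset by (auto simp: direct_sum_inj_def carrier_direct_sum cong: conj_cong)
  show "direct_sum_inj I M i (m \<oplus>\<^bsub>M i\<^esub> m') = direct_sum_inj I M i m \<oplus>\<^bsub>DS\<^esub> direct_sum_inj I M i m'"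
    using z by (auto simp: direct_sum_inj_def fun_eq_iff)
  show "direct_sum_inj I M i (r \<odot>\<^bsub>M i\<^esub> m) = r \<odot>\<^bsub>DS\<^esub> direct_sum_inj I M i m" if "r \<in> carrier R"
    using modules that by (auto simp: direct_sum_inj_def fun_eq_iff module.smult_r_null[OF modules])
qed

lemma DS_induct [consumes 1, case_names zero inj add]:
  assumes "w \<in> carrier DS" "P \<zero>\<^bsub>DS\<^esub>"
    and "\<And>i m. i \<in> I \<Longrightarrow> m \<in> carrier (M i) \<Longrightarrow> P (direct_sum_inj I M i m)"
    and "\<And>u v. u \<in> carrier DS \<Longrightarrow> v \<in> carrier DS \<Longrightarrow> P u \<Longrightarrow> P v \<Longrightarrow> P (u \<oplus>\<^bsub>DS\<^esub> v)"
  shows "P w"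
proof -
  note z = abelian_monoid.zero_closed[OF abelian_group.axioms(1)[OF ab]]
    abelian_monoid.l_zero[OF abelian_group.axioms(1)[OF ab]]
    abelian_monoid.r_zero[OF abelian_group.axioms(1)[OF ab]]
  have fin: "finite {i \<in> I. w i \<noteq> \<zero>\<^bsub>M i\<^esub>}" using assms(1) by (simp add: carrier_direct_sum)
  have "w \<in> carrier DS \<Longrightarrow> {i \<in> I. w i \<noteq> \<zero>\<^bsub>M i\<^esub>} = J \<Longrightarrow> P w" if "finite J" for J w
    using that
  proof (induction J arbitrary: w rule: finite_induct)
    case empty
    then have "w = \<zero>\<^bsub>DS\<^esub>" by (auto simp: carrier_direct_sum fun_eq_iff extensional_def)
    then show ?case using assms(2) by (simp only:)
  next
    case (insert i J)
    define v where "v = (\<lambda>j\<in>I. if j = i then \<zero>\<^bsub>M j\<^esub> else w j)"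
    have i: "i \<in> I" "w i \<in> carrier (M i)" using insert by (auto simp: carrier_direct_sum)
    have J: "{j \<in> I. v j \<noteq> \<zero>\<^bsub>M j\<^esub>} = J" using insert by (auto simp: v_def)
    then have v: "v \<in> carrier DS" using insert z unfolding carrier_direct_sum by (auto simp: v_def)
    have "w = direct_sum_inj I M i (w i) \<oplus>\<^bsub>DS\<^esub> v"
      using insert(4) z by (auto simp: direct_sum_inj_def v_def fun_eq_iff carrier_direct_sum extensional_def)
    moreover have "P v" using insert.IH[OF v J] .
    ultimately show ?case using assms(3)[OF i] assms(4) mod_homD(2)[OF inj_hom[OF i(1)] i(2)] v by metis
  qed
  then show ?thesis using assms(1) fin by blast
qed

lemma DS_hom_eqI:
  assumes "abelian_group W" "f \<in> hom (add_monoid DS) (add_monoid W)" "g \<in> hom (add_monoid DS) (add_monoid W)"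
    and "\<And>i m. i \<in> I \<Longrightarrow> m \<in> carrier (M i) \<Longrightarrow> f (direct_sum_inj I M i m) = g (direct_sum_inj I M i m)"
    and "w \<in> carrier DS"
  shows "f w = g w"
proof -
  interpret DS: module R DS by (rule module_DS)
  note f = assms(2) and g = assms(3)
  show ?thesis using assms(5)
  proof (induction w rule: DS_induct)
    case zero
    show ?case
      using add_hom_zero[OF DS.M.abelian_group_axioms assms(1) f] add_hom_zero[OF DS.M.abelian_group_axioms assms(1) g]
      by metis
  next
    case (add u v)
    then show ?case using hom_mult[OF f, of u v] hom_mult[OF g, of u v] by (simp del: direct_sum_simps)
  qed (rule assms(4))
qed

lemma DS_universal:
  assumes W: "module R W" and \<phi>: "\<And>i. i \<in> I \<Longrightarrow> \<phi> i \<in> mod_hom R (M i) W"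
  shows "\<exists>\<Phi>\<in>mod_hom R DS W. \<forall>i\<in>I. \<forall>m\<in>carrier (M i). \<Phi> (direct_sum_inj I M i m) = \<phi> i m"
proof -
  interpret W: module R W by (rule W)
  define \<Phi> where "\<Phi> f = (\<Oplus>\<^bsub>W\<^esub>i\<in>{i \<in> I. f i \<noteq> \<zero>\<^bsub>M i\<^esub>}. \<phi> i (f i))" for f
  \<comment> \<open>The sum over the support may be taken over any larger finite index set, which
    allows two elements to be compared on a common one.\<close>
  have \<Phi>: "\<Phi> f = (\<Oplus>\<^bsub>W\<^esub>i\<in>J. \<phi> i (f i))"
    if "f \<in> carrier DS" "finite J" "J \<subseteq> I" "{i \<in> I. f i \<noteq> \<zero>\<^bsub>M i\<^esub>} \<subseteq> J" for f J
    unfolding \<Phi>_def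
    using that \<phi> mod_hom_zero[OF modules W \<phi>]
    by (intro W.add.finprod_mono_neutral_cong_left) (auto simp: carrier_direct_sum Pi_iff intro!: mod_homD(2)[OF \<phi>])
  have fin: "finite {i \<in> I. f i \<noteq> \<zero>\<^bsub>M i\<^esub>}" if "f \<in> carrier DS" for f using that by (simp add: carrier_direct_sum)
  have cl: "\<phi> i (f i) \<in> carrier W" if "f \<in> carrier DS" "i \<in> I" for f i
    using that by (intro mod_homD(2)[OF \<phi>]) (auto simp: carrier_direct_sum)
  have "\<Phi> \<in> mod_hom R DS W"
  proof (rule mod_homI)
    fix f assume f: "f \<in> carrier DS"
    show "\<Phi> f \<in> carrier W" unfolding \<Phi>_def using cl[OF f] by (auto intro!: W.finsum_closed)
    show "\<Phi> (f \<oplus>\<^bsub>DS\<^esub> g) = \<Phi> f \<oplus>\<^bsub>W\<^esub> \<Phi> g" if g: "g \<in> carrier DS" for g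
    proof -
      define J where "J = {i \<in> I. f i \<noteq> \<zero>\<^bsub>M i\<^esub>} \<union> {i \<in> I. g i \<noteq> \<zero>\<^bsub>M i\<^esub>}"
      have J: "finite J" "J \<subseteq> I" using fin[OF f] fin[OF g] by (auto simp: J_def)
      have sub: "{i \<in> I. (f \<oplus>\<^bsub>DS\<^esub> g) i \<noteq> \<zero>\<^bsub>M i\<^esub>} \<subseteq> J"
        using abelian_monoid.zero_closed[OF abelian_group.axioms(1)[OF ab]]
          abelian_monoid.l_zero[OF abelian_group.axioms(1)[OF ab]] by (auto simp: J_def)
      have "\<Phi> (f \<oplus>\<^bsub>DS\<^esub> g) = (\<Oplus>\<^bsub>W\<^esub>i\<in>J. \<phi> i ((f \<oplus>\<^bsub>DS\<^esub> g) i))"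
        by (rule \<Phi>[OF DS_closed(1)[OF f g] J sub])
      also have "\<dots> = (\<Oplus>\<^bsub>W\<^esub>i\<in>J. \<phi> i (f i) \<oplus>\<^bsub>W\<^esub> \<phi> i (g i))"
        using J cl[OF f] cl[OF g] f g
        by (intro W.finsum_cong') (auto simp: carrier_direct_sum subset_iff mod_homD(3)[OF \<phi>])
      also have "\<dots> = (\<Oplus>\<^bsub>W\<^esub>i\<in>J. \<phi> i (f i)) \<oplus>\<^bsub>W\<^esub> (\<Oplus>\<^bsub>W\<^esub>i\<in>J. \<phi> i (g i))"
        using J cl[OF f] cl[OF g] by (intro W.finsum_addf) auto
      also have "\<dots> = \<Phi> f \<oplus>\<^bsub>W\<^esub> \<Phi> g"
        using \<Phi>[OF f J] \<Phi>[OF g J] by (auto simp: J_def)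
      finally show ?thesis .
    qed
    show "\<Phi> (r \<odot>\<^bsub>DS\<^esub> f) = r \<odot>\<^bsub>W\<^esub> \<Phi> f" if r: "r \<in> carrier R" for r
    proof -
      define J where "J = {i \<in> I. f i \<noteq> \<zero>\<^bsub>M i\<^esub>}"
      have J: "finite J" "J \<subseteq> I" using fin[OF f] by (auto simp: J_def)
      have sub: "{i \<in> I. (r \<odot>\<^bsub>DS\<^esub> f) i \<noteq> \<zero>\<^bsub>M i\<^esub>} \<subseteq> J"
        using modules r by (auto simp: J_def module.smult_r_null[OF modules])
      have "\<Phi> (r \<odot>\<^bsub>DS\<^esub> f) = (\<Oplus>\<^bsub>W\<^esub>i\<in>J. \<phi> i ((r \<odot>\<^bsub>DS\<^esub> f) i))"
        by (rule \<Phi>[OF DS_closed(3)[OF r f] J sub])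
      also have "\<dots> = (\<Oplus>\<^bsub>W\<^esub>i\<in>J. r \<odot>\<^bsub>W\<^esub> \<phi> i (f i))"
        using J cl[OF f] f r
        by (intro W.finsum_cong') (auto simp: carrier_direct_sum subset_iff mod_homD(4)[OF \<phi>])
      also have "\<dots> = r \<odot>\<^bsub>W\<^esub> \<Phi> f"
        unfolding \<Phi>_def using J cl[OF f] r by (subst W.finsum_smult_ldistr) (auto simp: J_def)
      finally show ?thesis .
    qed
  qed
  moreover have "\<Phi> (direct_sum_inj I M i m) = \<phi> i m" if i: "i \<in> I" and m: "m \<in> carrier (M i)" for i m
  proof -
    have "\<Phi> (direct_sum_inj I M i m) = (\<Oplus>\<^bsub>W\<^esub>j\<in>{i}. \<phi> j (direct_sum_inj I M i m j))"
      by (rule \<Phi>[OF mod_homD(2)[OF inj_hom[OF i] m]]) (use i in \<open>auto simp: direct_sum_inj_def\<close>)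
    also have "\<dots> = \<phi> i m" using i m mod_homD(2)[OF \<phi>[OF i] m] by (simp add: direct_sum_inj_def)
    finally show ?thesis .
  qed
  ultimately show ?thesis by blast
qed

end

lemma direct_sum_map:
  assumes "module_family R I M" "module_family R I M'" "\<And>i. i \<in> I \<Longrightarrow> h i \<in> mod_hom R (M i) (M' i)"
  shows "(\<lambda>c. \<lambda>i\<in>I. h i (c i)) \<in> mod_hom R (direct_sum I M) (direct_sum I M')"
    and "i \<in> I \<Longrightarrow> (\<lambda>j\<in>I. h j (direct_sum_inj I M i m j)) = direct_sum_inj I M' i (h i m)"
proof -
  interpret M: module_family R I M by fact
  interpret M': module_family R I M' by fact
  have z: "h i \<zero>\<^bsub>M i\<^esub> = \<zero>\<^bsub>M' i\<^esub>" if "i \<in> I" for i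
    using mod_hom_zero[OF M.modules M'.modules assms(3)] that by simp
  show "(\<lambda>c. \<lambda>i\<in>I. h i (c i)) \<in> mod_hom R (direct_sum I M) (direct_sum I M')"
  proof (rule mod_homI)
    fix c assume c: "c \<in> carrier (direct_sum I M)"
    have "{i \<in> I. h i (c i) \<noteq> \<zero>\<^bsub>M' i\<^esub>} \<subseteq> {i \<in> I. c i \<noteq> \<zero>\<^bsub>M i\<^esub>}" using z by auto
    moreover have "finite {i \<in> I. c i \<noteq> \<zero>\<^bsub>M i\<^esub>}" using c by (simp add: carrier_direct_sum)
    ultimately have "finite {i \<in> I. h i (c i) \<noteq> \<zero>\<^bsub>M' i\<^esub>}" by (rule finite_subset)
    then show "(\<lambda>i\<in>I. h i (c i)) \<in> carrier (direct_sum I M')"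
      using c by (auto simp: carrier_direct_sum intro!: mod_homD(2)[OF assms(3)] cong: conj_cong)
  qed (auto simp: carrier_direct_sum fun_eq_iff mod_homD[OF assms(3)])
  show "i \<in> I \<Longrightarrow> (\<lambda>j\<in>I. h j (direct_sum_inj I M i m j)) = direct_sum_inj I M' i (h i m)"
    using z by (auto simp: direct_sum_inj_def fun_eq_iff)
qed

declare direct_sum_simps [simp del]

section \<open>Spans and quotient modules\<close>

lemma submodule_span:
  assumes "module R M" "S \<subseteq> carrier M"
  shows "submodule (span_module R M S) R M"
proof -
  interpret module R M by fact
  have c: "submodule (carrier M) R M" by (rule carrier_is_submodule)
  show ?thesis
    unfolding span_module_def hull_def
  proof (rule submoduleI)
    show "\<Inter>{N. submodule N R M \<and> S \<subseteq> N} \<subseteq> carrier M" using c assms(2) by blast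
    show "\<zero>\<^bsub>M\<^esub> \<in> \<Inter>{N. submodule N R M \<and> S \<subseteq> N}"
      using subgroup.one_closed[OF submodule.axioms(1)] by fastforce
  qed (use submoduleE(3-5) in auto)
qed

lemma span_minimal: "submodule N R M \<Longrightarrow> S \<subseteq> N \<Longrightarrow> span_module R M S \<subseteq> N"
  unfolding span_module_def by (rule hull_minimal)

lemma submodule_vimage:
  assumes "module R M" "module R W" "f \<in> mod_hom R M W" "submodule N R W"
  shows "submodule {m \<in> carrier M. f m \<in> N} R M"
proof -
  interpret M: module R M by fact
  interpret W: module R W by fact
  have z: "\<zero>\<^bsub>W\<^esub> \<in> N" using subgroup.one_closed[OF submodule.axioms(1)[OF assms(4)]] by simp
  show ?thesis
    by (rule M.submoduleI)
       (use W.submoduleE[OF assms(4)] z in \<open>auto simp: mod_homD[OF assms(3)] mod_hom_zero[OF assms(1-3)] mod_hom_minus[OF assms(1-3)]\<close>)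
qed

lemma submodule_zero:
  assumes "module R W" shows "submodule {\<zero>\<^bsub>W\<^esub>} R W"
proof -
  interpret module R W by fact
  show ?thesis by (rule submoduleI) auto
qed

locale quotient_module =
  fixes R :: "('r, 'k) ring_scheme" and M :: "('r, 'm) module" and N :: "'m set"
  assumes mod: "module R M" and sub: "submodule N R M"
begin

interpretation M: module R M by (rule mod)
interpretation N: abelian_subgroup N M
  using submodule.axioms(1)[OF sub] M.a_comm_group M.abelian_group_axioms
  by (intro abelian_subgroupI3) (auto simp: additive_subgroup_def)

abbreviation "Q \<equiv> quot_module M N"
abbreviation "proj m \<equiv> N +>\<^bsub>M\<^esub> m"

lemma Q_simps:
  "carrier Q = proj ` carrier M" "\<zero>\<^bsub>Q\<^esub> = N" "add Q = set_add M"
  "smult Q = (\<lambda>r X. \<Union>m\<in>X. proj (r \<odot>\<^bsub>M\<^esub> m))"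
  by (auto simp: quot_module_def A_RCOSETS_def')

lemma proj_eqI:
  assumes "m \<in> carrier M" "m' \<in> carrier M" "m \<ominus>\<^bsub>M\<^esub> m' \<in> N"
  shows "proj m = proj m'"
proof -
  have "m = (m \<ominus>\<^bsub>M\<^esub> m') \<oplus>\<^bsub>M\<^esub> m'" using assms by (simp add: a_minus_def M.a_assoc M.l_neg)
  then have "m \<in> proj m'" using M.a_rcosI[OF assms(3) N.a_subset assms(2)] by simp
  then show ?thesis using M.a_repr_independence[OF _ assms(2) N.a_subgroup] by simp
qed

lemma proj_elem:
  assumes "m' \<in> carrier M" "m \<in> proj m'"
  shows "m \<in> carrier M" "m \<ominus>\<^bsub>M\<^esub> m' \<in> N"
proof -
  obtain n where n: "n \<in> N" "m = n \<oplus>\<^bsub>M\<^esub> m'" using assms(2) by (auto simp: a_r_coset_def')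
  then have "n \<in> carrier M" using N.a_subset by auto
  then show "m \<in> carrier M" "m \<ominus>\<^bsub>M\<^esub> m' \<in> N"
    using n assms(1) by (simp_all add: a_minus_def M.a_assoc M.r_neg)
qed

lemma proj_self: "m \<in> carrier M \<Longrightarrow> m \<in> proj m"
  by (rule N.a_rcos_self)

lemma N_smult: "r \<in> carrier R \<Longrightarrow> n \<in> N \<Longrightarrow> r \<odot>\<^bsub>M\<^esub> n \<in> N"
  using sub by (rule submodule.smult_closed)

text \<open>Scalar multiplication on a quotient and \<open>cat_tensor_map\<close> are defined as
  unions over representatives; this turns independence of the representative into a formula for the
  value.\<close>

lemma UN_const:
  assumes "\<And>x. x \<in> proj m \<Longrightarrow> f x = f m" "m \<in> carrier M"
  shows "(\<Union>x\<in>proj m. f x) = f m"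
proof -
  have "(\<Union>x\<in>proj m. f x) = (\<Union>x\<in>proj m. f m)" by (rule SUP_cong[OF refl]) (rule assms(1))
  then show ?thesis using proj_self[OF assms(2)] by blast
qed

lemma smult_proj:
  assumes "r \<in> carrier R" "m \<in> carrier M"
  shows "r \<odot>\<^bsub>Q\<^esub> proj m = proj (r \<odot>\<^bsub>M\<^esub> m)"
  unfolding Q_simps
proof (rule UN_const[OF _ assms(2)], rule proj_eqI)
  fix x assume "x \<in> proj m"
  note x = proj_elem[OF assms(2) this]
  show "r \<odot>\<^bsub>M\<^esub> x \<in> carrier M" "r \<odot>\<^bsub>M\<^esub> m \<in> carrier M" using x assms by auto
  have "r \<odot>\<^bsub>M\<^esub> x \<ominus>\<^bsub>M\<^esub> r \<odot>\<^bsub>M\<^esub> m = r \<odot>\<^bsub>M\<^esub> (x \<ominus>\<^bsub>M\<^esub> m)"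
    using x assms by (simp add: a_minus_def M.smult_r_distr M.smult_r_minus)
  then show "r \<odot>\<^bsub>M\<^esub> x \<ominus>\<^bsub>M\<^esub> r \<odot>\<^bsub>M\<^esub> m \<in> N" using N_smult x assms by simp
qed

lemma add_proj: "m \<in> carrier M \<Longrightarrow> m' \<in> carrier M \<Longrightarrow> proj m \<oplus>\<^bsub>Q\<^esub> proj m' = proj (m \<oplus>\<^bsub>M\<^esub> m')"
  by (simp add: Q_simps N.a_rcos_sum)

lemma zero_proj: "\<zero>\<^bsub>Q\<^esub> = proj \<zero>\<^bsub>M\<^esub>"
  using N.a_subset by (simp add: Q_simps)

lemma proj_closed: "m \<in> carrier M \<Longrightarrow> proj m \<in> carrier Q"
  by (simp add: Q_simps)

lemma Q_cases:
  assumes "X \<in> carrier Q" obtains m where "m \<in> carrier M" "X = proj m"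
  using assms by (auto simp: Q_simps)

lemma module_Q: "module R Q"
proof (intro moduleI abelian_groupI M.is_cring, goal_cases)
  case (6 X)
  then obtain m where m: "m \<in> carrier M" "X = proj m" by (rule Q_cases)
  then have "proj (\<ominus>\<^bsub>M\<^esub> m) \<oplus>\<^bsub>Q\<^esub> X = \<zero>\<^bsub>Q\<^esub>" by (simp add: add_proj zero_proj M.l_neg)
  then show ?case using m proj_closed M.a_inv_closed by blast
qed (auto elim!: Q_cases simp: add_proj zero_proj smult_proj proj_closed M.a_assoc M.smult_l_distr M.smult_r_distr M.smult_assoc1,
     auto simp: M.a_comm)

lemma proj_hom: "(\<lambda>m. proj m) \<in> mod_hom R M Q"
  by (rule mod_homI) (simp_all add: add_proj smult_proj proj_closed)

lemma Q_universal:
  assumes "module R W" "\<phi> \<in> mod_hom R M W" "\<And>n. n \<in> N \<Longrightarrow> \<phi> n = \<zero>\<^bsub>W\<^esub>"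
  shows "\<exists>\<Phi>\<in>mod_hom R Q W. \<forall>m\<in>carrier M. \<Phi> (proj m) = \<phi> m"
proof -
  interpret W: module R W by fact
  define \<Phi> where "\<Phi> X = \<phi> (SOME m. m \<in> X)" for X
  have \<Phi>: "\<Phi> (proj m) = \<phi> m" if m: "m \<in> carrier M" for m
  proof -
    have "(SOME x. x \<in> proj m) \<in> proj m" by (rule someI[of _ m]) (rule proj_self[OF m])
    then obtain x where x: "x \<in> proj m" "\<Phi> (proj m) = \<phi> x" by (simp add: \<Phi>_def)
    note x' = proj_elem[OF m x(1)]
    have "\<phi> x \<ominus>\<^bsub>W\<^esub> \<phi> m = \<zero>\<^bsub>W\<^esub>"
      using mod_hom_diff[OF mod assms(1,2) x'(1) m] assms(3)[OF x'(2)] by simp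
    then show ?thesis
      using W.eq_if_minus_zero[of "\<phi> x" "\<phi> m"] x(2) mod_homD(2)[OF assms(2)] x' m by simp
  qed
  have "\<Phi> \<in> mod_hom R Q W"
    by (rule mod_homI) (auto elim!: Q_cases simp: add_proj smult_proj \<Phi> mod_homD[OF assms(2)])
  then show ?thesis using \<Phi> by blast
qed

end


section \<open>Tensor products over a category\<close>

locale category_tensor =
  fixes R :: "('r, 'k) ring_scheme" and C :: "('o, 'a) precat"
    and M :: "('o, 'a, 'r, 'm) cat_module" and A :: "('o, 'a, 'r, 'n) cat_module"
  assumes cring: "cring R"
    and mod_M: "\<And>x. x \<in> Ob C \<Longrightarrow> module R (Val M x)"
    and mod_A: "\<And>x. x \<in> Ob C \<Longrightarrow> module R (Val A x)"
    and act_M: "\<And>x y \<alpha>. x \<in> Ob C \<Longrightarrow> y \<in> Ob C \<Longrightarrow> \<alpha> \<in> carrier (Hom C x y) \<Longrightarrow> Act M x y \<alpha> \<in> mod_hom R (Val M y) (Val M x)"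
    and act_A: "\<And>x y \<alpha>. x \<in> Ob C \<Longrightarrow> y \<in> Ob C \<Longrightarrow> \<alpha> \<in> carrier (Hom C x y) \<Longrightarrow> Act A x y \<alpha> \<in> mod_hom R (Val A x) (Val A y)"
begin

abbreviation "TT x \<equiv> tensor_mod R (Val M x) (Val A x)"
abbreviation "CS \<equiv> cat_tensor_sum R C M A"
abbreviation "CR \<equiv> cat_tensor_relations R C M A"
abbreviation "CT \<equiv> cat_tensor R C M A"
abbreviation "\<iota> \<equiv> direct_sum_inj (Ob C) TT"

definition tens :: "'o \<Rightarrow> 'm \<Rightarrow> 'n \<Rightarrow> ('o \<Rightarrow> ('m \<times> 'n \<Rightarrow>\<^sub>0 int) set) set" where
  "tens x m a = CR +>\<^bsub>CS\<^esub> \<iota> x (pure_tensor (TT x) m a)"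

lemma tensor_data: "x \<in> Ob C \<Longrightarrow> tensor_data R (carrier R) (smult (Val M x)) (smult (Val A x)) (Val M x) (add_monoid (Val A x))"
proof (rule tensor_data.intro, goal_cases)
  case 1 then show ?case by (rule mod_M)
next
  case 2 then show ?case using mod_A by (simp add: module_def abelian_group.a_comm_group)
next
  case (5 s r m)
  interpret module R "Val M x" using 5 mod_M by simp
  show ?case using 5 by (simp add: smult_assoc1[symmetric] R.m_comm)
qed (use mod_M mod_A module.smult_closed in \<open>auto intro: module.smult_closed\<close>)

lemma module_TT: "x \<in> Ob C \<Longrightarrow> module R (TT x)"
  unfolding tensor_mod_def by (rule tensor_data.module_T[OF tensor_data])

lemmas TT_pure_closed = tensor_data.pure_closed[OF tensor_data, folded tensor_mod_def, simplified]
lemmas TT_bilinear = tensor_data.pure_bilinear[OF tensor_data, folded tensor_mod_def, simplified]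
lemmas TT_smult_pure = tensor_data.smult_pure[OF tensor_data, folded tensor_mod_def, simplified]
lemmas TT_universal = tensor_data.T_universal_module[OF tensor_data, folded tensor_mod_def, simplified]
lemmas TT_eqI = tensor_data.T_hom_eqI[OF tensor_data, folded tensor_mod_def, simplified]

sublocale fam: module_family R "Ob C" TT
  by (rule module_family.intro) (simp_all add: cring module_TT)

lemma CS_eq: "CS = fam.DS"
  by (simp add: cat_tensor_sum_def)

lemma module_CS: "module R CS"
  unfolding CS_eq by (rule fam.module_DS)

lemma \<iota>_hom: "x \<in> Ob C \<Longrightarrow> \<iota> x \<in> mod_hom R (TT x) CS"
  unfolding CS_eq by (rule fam.inj_hom)

definition rels :: "('o \<Rightarrow> ('m \<times> 'n \<Rightarrow>\<^sub>0 int) set) set" where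
  "rels = {\<iota> x (pure_tensor (TT x) (Act M x y \<alpha> m) a) \<ominus>\<^bsub>CS\<^esub> \<iota> y (pure_tensor (TT y) m (Act A x y \<alpha> a)) | x y \<alpha> m a.
       x \<in> Ob C \<and> y \<in> Ob C \<and> \<alpha> \<in> carrier (Hom C x y) \<and> m \<in> carrier (Val M y) \<and> a \<in> carrier (Val A x)}"

lemma CR_eq: "CR = span_module R CS rels"
  by (simp add: cat_tensor_relations_def Let_def rels_def)

lemma pure_inj_closed: "x \<in> Ob C \<Longrightarrow> m \<in> carrier (Val M x) \<Longrightarrow> a \<in> carrier (Val A x) \<Longrightarrow> \<iota> x (pure_tensor (TT x) m a) \<in> carrier CS"
  by (intro mod_homD(2)[OF \<iota>_hom] TT_pure_closed)

lemma rels_closed: "rels \<subseteq> carrier CS"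
proof -
  interpret CS: module R CS by (rule module_CS)
  show ?thesis
    unfolding rels_def
    by (auto intro!: CS.M.minus_closed pure_inj_closed mod_homD(2)[OF act_M] mod_homD(2)[OF act_A])
qed

sublocale quo: quotient_module R CS CR
  by (rule quotient_module.intro) (auto simp: CR_eq module_CS intro!: submodule_span rels_closed)

lemma CT_eq: "CT = quo.Q"
  by (simp add: cat_tensor_def)

lemma module_CT: "module R CT"
  unfolding CT_eq by (rule quo.module_Q)

lemma tens_hom: "x \<in> Ob C \<Longrightarrow> (\<lambda>t. quo.proj (\<iota> x t)) \<in> mod_hom R (TT x) CT"
  unfolding CT_eq by (rule mod_hom_compose[OF \<iota>_hom quo.proj_hom])

lemma tens:
  assumes "x \<in> Ob C"
  shows tens_closed: "m \<in> carrier (Val M x) \<Longrightarrow> a \<in> carrier (Val A x) \<Longrightarrow> tens x m a \<in> carrier CT"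
    and tens_add_left: "m \<in> carrier (Val M x) \<Longrightarrow> m' \<in> carrier (Val M x) \<Longrightarrow> a \<in> carrier (Val A x) \<Longrightarrow>
      tens x (m \<oplus>\<^bsub>Val M x\<^esub> m') a = tens x m a \<oplus>\<^bsub>CT\<^esub> tens x m' a"
    and tens_add_right: "m \<in> carrier (Val M x) \<Longrightarrow> a \<in> carrier (Val A x) \<Longrightarrow> a' \<in> carrier (Val A x) \<Longrightarrow>
      tens x m (a \<oplus>\<^bsub>Val A x\<^esub> a') = tens x m a \<oplus>\<^bsub>CT\<^esub> tens x m a'"
    and tens_smult: "r \<in> carrier R \<Longrightarrow> m \<in> carrier (Val M x) \<Longrightarrow> a \<in> carrier (Val A x) \<Longrightarrow>
      tens x (r \<odot>\<^bsub>Val M x\<^esub> m) a = r \<odot>\<^bsub>CT\<^esub> tens x m a"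
    and tens_smult_right: "r \<in> carrier R \<Longrightarrow> m \<in> carrier (Val M x) \<Longrightarrow> a \<in> carrier (Val A x) \<Longrightarrow>
      tens x m (r \<odot>\<^bsub>Val A x\<^esub> a) = r \<odot>\<^bsub>CT\<^esub> tens x m a"
  using TT_pure_closed[OF assms] mod_homD[OF tens_hom[OF assms]]
  unfolding tens_def
  by (simp_all add: TT_bilinear(1,2)[OF assms] TT_smult_pure[OF assms, symmetric] TT_bilinear(3)[OF assms, symmetric])

lemma tens_balanced:
  assumes "x \<in> Ob C" "y \<in> Ob C" "\<alpha> \<in> carrier (Hom C x y)" "m \<in> carrier (Val M y)" "a \<in> carrier (Val A x)"
  shows "tens x (Act M x y \<alpha> m) a = tens y m (Act A x y \<alpha> a)"
  unfolding tens_def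
proof (rule quo.proj_eqI)
  show "\<iota> x (pure_tensor (TT x) (Act M x y \<alpha> m) a) \<in> carrier CS" "\<iota> y (pure_tensor (TT y) m (Act A x y \<alpha> a)) \<in> carrier CS"
    using assms by (auto intro!: pure_inj_closed mod_homD(2)[OF act_M] mod_homD(2)[OF act_A])
  show "\<iota> x (pure_tensor (TT x) (Act M x y \<alpha> m) a) \<ominus>\<^bsub>CS\<^esub> \<iota> y (pure_tensor (TT y) m (Act A x y \<alpha> a)) \<in> CR"
    unfolding CR_eq span_module_def
    by (rule hull_inc) (unfold rels_def, use assms in blast)
qed

text \<open>The quotient map is onto, the direct sum is generated by its summands, and each summand
  is generated by pure tensors.\<close>

lemma CT_hom_eqI:
  assumes W: "module R W" and "f \<in> mod_hom R CT W" "g \<in> mod_hom R CT W"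
    and eq: "\<And>x m a. x \<in> Ob C \<Longrightarrow> m \<in> carrier (Val M x) \<Longrightarrow> a \<in> carrier (Val A x) \<Longrightarrow> f (tens x m a) = g (tens x m a)"
    and "w \<in> carrier CT"
  shows "f w = g w"
proof -
  interpret W: module R W by (rule W)
  obtain c where c: "c \<in> carrier CS" "w = quo.proj c"
    using assms(5) unfolding CT_eq by (rule quo.Q_cases)
  note pr = quo.proj_hom[folded CT_eq]
  note fp = mod_hom_compose[OF pr assms(2)] and gp = mod_hom_compose[OF pr assms(3)]
  have "f (quo.proj c) = g (quo.proj c)"
  proof (rule fam.DS_hom_eqI[OF W.M.abelian_group_axioms mod_homD(1)[OF fp, unfolded CS_eq] mod_homD(1)[OF gp, unfolded CS_eq] _ c(1)[unfolded CS_eq], folded CS_eq])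
    fix x t assume x: "x \<in> Ob C" and t: "t \<in> carrier (TT x)"
    show "f (quo.proj (\<iota> x t)) = g (quo.proj (\<iota> x t))"
      by (rule TT_eqI[OF x W.M.abelian_group_axioms mod_homD(1)[OF mod_hom_compose[OF tens_hom[OF x] assms(2)]]
            mod_homD(1)[OF mod_hom_compose[OF tens_hom[OF x] assms(3)]] _ t])
         (rule eq[unfolded tens_def, OF x])
  qed
  then show ?thesis using c by simp
qed

text \<open>The universal properties of the tensor product at each object, of the direct sum and of
  the quotient are applied in turn. The hypothesis \<open>bal\<close> makes the map on the direct
  sum vanish on the generating relations.\<close>

lemma CT_universal:
  assumes W: "module R W"
    and cl: "\<And>x m a. x \<in> Ob C \<Longrightarrow> m \<in> carrier (Val M x) \<Longrightarrow> a \<in> carrier (Val A x) \<Longrightarrow> \<beta> x m a \<in> carrier W"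
    and "\<And>x m m' a. x \<in> Ob C \<Longrightarrow> m \<in> carrier (Val M x) \<Longrightarrow> m' \<in> carrier (Val M x) \<Longrightarrow> a \<in> carrier (Val A x) \<Longrightarrow>
      \<beta> x (m \<oplus>\<^bsub>Val M x\<^esub> m') a = \<beta> x m a \<oplus>\<^bsub>W\<^esub> \<beta> x m' a"
    and "\<And>x m a a'. x \<in> Ob C \<Longrightarrow> m \<in> carrier (Val M x) \<Longrightarrow> a \<in> carrier (Val A x) \<Longrightarrow> a' \<in> carrier (Val A x) \<Longrightarrow>
      \<beta> x m (a \<oplus>\<^bsub>Val A x\<^esub> a') = \<beta> x m a \<oplus>\<^bsub>W\<^esub> \<beta> x m a'"
    and "\<And>x r m a. x \<in> Ob C \<Longrightarrow> r \<in> carrier R \<Longrightarrow> m \<in> carrier (Val M x) \<Longrightarrow> a \<in> carrier (Val A x) \<Longrightarrow>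
      \<beta> x (r \<odot>\<^bsub>Val M x\<^esub> m) a = r \<odot>\<^bsub>W\<^esub> \<beta> x m a"
    and "\<And>x r m a. x \<in> Ob C \<Longrightarrow> r \<in> carrier R \<Longrightarrow> m \<in> carrier (Val M x) \<Longrightarrow> a \<in> carrier (Val A x) \<Longrightarrow>
      \<beta> x m (r \<odot>\<^bsub>Val A x\<^esub> a) = r \<odot>\<^bsub>W\<^esub> \<beta> x m a"
    and bal: "\<And>x y \<alpha> m a. x \<in> Ob C \<Longrightarrow> y \<in> Ob C \<Longrightarrow> \<alpha> \<in> carrier (Hom C x y) \<Longrightarrow> m \<in> carrier (Val M y) \<Longrightarrow> a \<in> carrier (Val A x) \<Longrightarrow>
      \<beta> x (Act M x y \<alpha> m) a = \<beta> y m (Act A x y \<alpha> a)"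
  shows "\<exists>\<Phi>\<in>mod_hom R CT W. \<forall>x\<in>Ob C. \<forall>m\<in>carrier (Val M x). \<forall>a\<in>carrier (Val A x). \<Phi> (tens x m a) = \<beta> x m a"
proof -
  interpret W: module R W by (rule W)
  have "\<exists>\<phi>\<in>mod_hom R (TT x) W. \<forall>m\<in>carrier (Val M x). \<forall>a\<in>carrier (Val A x). \<phi> (pure_tensor (TT x) m a) = \<beta> x m a"
    if "x \<in> Ob C" for x
    using that assms by (intro TT_universal) auto
  then obtain \<phi> where \<phi>: "\<And>x. x \<in> Ob C \<Longrightarrow> \<phi> x \<in> mod_hom R (TT x) W"
    and \<phi>_pure: "\<And>x m a. x \<in> Ob C \<Longrightarrow> m \<in> carrier (Val M x) \<Longrightarrow> a \<in> carrier (Val A x) \<Longrightarrow> \<phi> x (pure_tensor (TT x) m a) = \<beta> x m a"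
    by metis
  obtain \<Psi> where \<Psi>: "\<Psi> \<in> mod_hom R CS W" and \<Psi>_inj: "\<And>x t. x \<in> Ob C \<Longrightarrow> t \<in> carrier (TT x) \<Longrightarrow> \<Psi> (\<iota> x t) = \<phi> x t"
    using fam.DS_universal[OF W \<phi>] unfolding CS_eq by blast
  have "\<Psi> c = \<zero>\<^bsub>W\<^esub>" if "c \<in> rels" for c
  proof -
    obtain x y \<alpha> m a where *: "x \<in> Ob C" "y \<in> Ob C" "\<alpha> \<in> carrier (Hom C x y)" "m \<in> carrier (Val M y)" "a \<in> carrier (Val A x)"
      and c_eq: "c = \<iota> x (pure_tensor (TT x) (Act M x y \<alpha> m) a) \<ominus>\<^bsub>CS\<^esub> \<iota> y (pure_tensor (TT y) m (Act A x y \<alpha> a))"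
      using \<open>c \<in> rels\<close> unfolding rels_def by blast
    note M' = mod_homD(2)[OF act_M[OF *(1-3)] *(4)] and A' = mod_homD(2)[OF act_A[OF *(1-3)] *(5)]
    have "\<Psi> c = \<Psi> (\<iota> x (pure_tensor (TT x) (Act M x y \<alpha> m) a)) \<ominus>\<^bsub>W\<^esub> \<Psi> (\<iota> y (pure_tensor (TT y) m (Act A x y \<alpha> a)))"
      unfolding c_eq
      by (rule mod_hom_diff[OF module_CS W \<Psi> pure_inj_closed[OF *(1) M' *(5)] pure_inj_closed[OF *(2,4) A']])
    also have "\<dots> = \<beta> x (Act M x y \<alpha> m) a \<ominus>\<^bsub>W\<^esub> \<beta> y m (Act A x y \<alpha> a)"
      by (simp only: \<Psi>_inj[OF *(1) TT_pure_closed[OF *(1) M' *(5)]] \<Psi>_inj[OF *(2) TT_pure_closed[OF *(2,4) A']]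
          \<phi>_pure[OF *(1) M' *(5)] \<phi>_pure[OF *(2,4) A'])
    also have "\<dots> = \<zero>\<^bsub>W\<^esub>"
      using bal[OF *] cl[OF *(2,4) A'] by (simp add: a_minus_def W.M.r_neg)
    finally show ?thesis .
  qed
  \<comment> \<open>The elements sent to zero form a submodule, so vanishing on the generators
    passes to their span.\<close>
  then have "rels \<subseteq> {c \<in> carrier CS. \<Psi> c \<in> {\<zero>\<^bsub>W\<^esub>}}"
    using rels_closed by blast
  then have "CR \<subseteq> {c \<in> carrier CS. \<Psi> c \<in> {\<zero>\<^bsub>W\<^esub>}}"
    unfolding CR_eq by (intro span_minimal submodule_vimage[OF module_CS W \<Psi>] submodule_zero[OF W])
  then have "\<exists>\<Phi>\<in>mod_hom R CT W. \<forall>m\<in>carrier CS. \<Phi> (quo.proj m) = \<Psi> m"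
    unfolding CT_eq using \<Psi> by (intro quo.Q_universal[OF W]) auto
  then obtain \<Phi> where \<Phi>: "\<Phi> \<in> mod_hom R CT W" and \<Phi>_proj: "\<And>m. m \<in> carrier CS \<Longrightarrow> \<Phi> (quo.proj m) = \<Psi> m"
    by blast
  have "\<Phi> (tens x m a) = \<beta> x m a" if "x \<in> Ob C" "m \<in> carrier (Val M x)" "a \<in> carrier (Val A x)" for x m a
    unfolding tens_def
    by (simp only: \<Phi>_proj[OF pure_inj_closed[OF that]] \<Psi>_inj[OF that(1) TT_pure_closed[OF that]] \<phi>_pure[OF that])
  then show ?thesis using \<Phi> by blast
qed

end

text \<open>Naturality of \<open>f\<close> and \<open>g\<close> carries each generating relation of
  the source to a generating relation of the target, so the map on direct sums respects the spans
  that are factored out.\<close>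

lemma cat_tensor_map:
  assumes T: "category_tensor R C M A" and T': "category_tensor R C M' A'"
    and f: "\<And>x. x \<in> Ob C \<Longrightarrow> f x \<in> mod_hom R (Val M x) (Val M' x)"
    and g: "\<And>x. x \<in> Ob C \<Longrightarrow> g x \<in> mod_hom R (Val A x) (Val A' x)"
    and f_nat: "\<And>x y \<alpha> m. x \<in> Ob C \<Longrightarrow> y \<in> Ob C \<Longrightarrow> \<alpha> \<in> carrier (Hom C x y) \<Longrightarrow> m \<in> carrier (Val M y) \<Longrightarrow>
      f x (Act M x y \<alpha> m) = Act M' x y \<alpha> (f y m)"
    and g_nat: "\<And>x y \<alpha> a. x \<in> Ob C \<Longrightarrow> y \<in> Ob C \<Longrightarrow> \<alpha> \<in> carrier (Hom C x y) \<Longrightarrow> a \<in> carrier (Val A x) \<Longrightarrow>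
      g y (Act A x y \<alpha> a) = Act A' x y \<alpha> (g x a)"
  shows cat_tensor_map_hom: "cat_tensor_map R C M' A' f g \<in> mod_hom R (cat_tensor R C M A) (cat_tensor R C M' A')"
    and cat_tensor_map_tens: "x \<in> Ob C \<Longrightarrow> m \<in> carrier (Val M x) \<Longrightarrow> a \<in> carrier (Val A x) \<Longrightarrow>
      cat_tensor_map R C M' A' f g (category_tensor.tens R C M A x m a) = category_tensor.tens R C M' A' x (f x m) (g x a)"
proof -
  interpret T: category_tensor R C M A by fact
  interpret T': category_tensor R C M' A' by fact
  let ?h = "\<lambda>x. tensor_map (T'.TT x) (f x) (g x)"
  let ?D = "\<lambda>c. \<lambda>x\<in>Ob C. ?h x (c x)"
  have tm: "?h x \<in> mod_hom R (T.TT x) (T'.TT x)"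
    "\<And>m a. m \<in> carrier (Val M x) \<Longrightarrow> a \<in> carrier (Val A x) \<Longrightarrow> ?h x (pure_tensor (T.TT x) m a) = pure_tensor (T'.TT x) (f x m) (g x a)"
    if x: "x \<in> Ob C" for x
    using tensor_data.tensor_map[OF T.tensor_data[OF x] T'.tensor_data[OF x] refl f[OF x], of "g x"]
      g[OF x] mod_homD[OF f[OF x]] mod_homD[OF g[OF x]] T'.TT_bilinear(3)[OF x]
    by (simp_all add: tensor_mod_def mod_homD(1))
  have D: "?D \<in> mod_hom R T.CS T'.CS"
    unfolding T.CS_eq T'.CS_eq
    by (rule direct_sum_map(1)[OF T.fam.module_family_axioms T'.fam.module_family_axioms tm(1)])
  have D_inj: "?D (T.\<iota> x t) = T'.\<iota> x (?h x t)" if "x \<in> Ob C" for x t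
    by (rule direct_sum_map(2)[OF T.fam.module_family_axioms T'.fam.module_family_axioms tm(1) that])
  have D_pure: "?D (T.\<iota> x (pure_tensor (T.TT x) m a)) = T'.\<iota> x (pure_tensor (T'.TT x) (f x m) (g x a))"
    if "x \<in> Ob C" "m \<in> carrier (Val M x)" "a \<in> carrier (Val A x)" for x m a
    using that by (simp add: D_inj[OF that(1)] tm(2))
  have "T.rels \<subseteq> {c \<in> carrier T.CS. ?D c \<in> T'.CR}"
  proof
    fix c assume c: "c \<in> T.rels"
    then obtain x y \<alpha> m a where *: "x \<in> Ob C" "y \<in> Ob C" "\<alpha> \<in> carrier (Hom C x y)" "m \<in> carrier (Val M y)" "a \<in> carrier (Val A x)"
      and c_eq: "c = T.\<iota> x (pure_tensor (T.TT x) (Act M x y \<alpha> m) a) \<ominus>\<^bsub>T.CS\<^esub> T.\<iota> y (pure_tensor (T.TT y) m (Act A x y \<alpha> a))"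
      unfolding T.rels_def by blast
    have "?D c = ?D (T.\<iota> x (pure_tensor (T.TT x) (Act M x y \<alpha> m) a)) \<ominus>\<^bsub>T'.CS\<^esub> ?D (T.\<iota> y (pure_tensor (T.TT y) m (Act A x y \<alpha> a)))"
      unfolding c_eq
      by (rule mod_hom_diff[OF T.module_CS T'.module_CS D])
         (use * in \<open>auto intro!: T.pure_inj_closed mod_homD(2)[OF T.act_M] mod_homD(2)[OF T.act_A]\<close>)
    also have "\<dots> = T'.\<iota> x (pure_tensor (T'.TT x) (Act M' x y \<alpha> (f y m)) (g x a)) \<ominus>\<^bsub>T'.CS\<^esub> T'.\<iota> y (pure_tensor (T'.TT y) (f y m) (Act A' x y \<alpha> (g x a)))"
      using * mod_homD(2)[OF T.act_M] mod_homD(2)[OF T.act_A] by (simp only: D_pure f_nat g_nat)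
    also have "\<dots> \<in> T'.CR"
      unfolding T'.CR_eq span_module_def
      by (rule hull_inc) (unfold T'.rels_def, use * mod_homD(2)[OF f[OF *(2)] *(4)] mod_homD(2)[OF g[OF *(1)] *(5)] in blast)
    finally show "c \<in> {c \<in> carrier T.CS. ?D c \<in> T'.CR}" using c T.rels_closed by blast
  qed
  then have "T.CR \<subseteq> {c \<in> carrier T.CS. ?D c \<in> T'.CR}"
    unfolding T.CR_eq by (rule span_minimal[OF submodule_vimage[OF T.module_CS T'.module_CS D T'.quo.sub]])
  then have D_CR: "?D n \<in> T'.CR" if "n \<in> T.CR" for n using that by auto
  have map: "cat_tensor_map R C M' A' f g (T.quo.proj c) = T'.quo.proj (?D c)" if c: "c \<in> carrier T.CS" for c
    unfolding cat_tensor_map_def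
  proof (rule T.quo.UN_const[OF _ c], rule T'.quo.proj_eqI)
    fix x assume "x \<in> T.quo.proj c"
    note x = T.quo.proj_elem[OF c this]
    show "?D x \<in> carrier T'.CS" "?D c \<in> carrier T'.CS" using mod_homD(2)[OF D] x c by auto
    show "?D x \<ominus>\<^bsub>T'.CS\<^esub> ?D c \<in> T'.CR"
      using D_CR[OF x(2)] mod_hom_diff[OF T.module_CS T'.module_CS D x(1) c] by simp
  qed
  interpret CS: module R T.CS by (rule T.module_CS)
  note D' = mod_homD[OF mod_hom_compose[OF D T'.quo.proj_hom]]
  show "cat_tensor_map R C M' A' f g \<in> mod_hom R (cat_tensor R C M A) (cat_tensor R C M' A')"
    unfolding T.CT_eq T'.CT_eq
    by (rule mod_homI) (auto elim!: T.quo.Q_cases simp: T.quo.add_proj T.quo.smult_proj map D'(2-4))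
  show "cat_tensor_map R C M' A' f g (T.tens x m a) = T'.tens x (f x m) (g x a)"
    if "x \<in> Ob C" "m \<in> carrier (Val M x)" "a \<in> carrier (Val A x)"
    unfolding T.tens_def T'.tens_def using that by (simp only: map T.pure_inj_closed D_pure)
qed


section \<open>Induction along an additive functor\<close>

lemma mod_hom_id: "(\<lambda>m. m) \<in> mod_hom R M M"
  by (rule mod_homI) simp_all

section \<open>Extension of scalars from the integers\<close>

lemma add_pow_eq: "[k] \<cdot>\<^bsub>R\<^esub> r = r [^]\<^bsub>add_monoid R\<^esub> (k :: int)"
  by (simp add: add_pow_def)

lemma tensor_data_scalar_ext:
  assumes "cring R" "comm_group B"
  shows "tensor_data R (UNIV :: int set) (\<lambda>k r. [k] \<cdot>\<^bsub>R\<^esub> r) (\<lambda>k b. b [^]\<^bsub>B\<^esub> k) (regular_module R) B"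
proof -
  interpret cring R by fact
  interpret B: comm_group B by fact
  show ?thesis
    by (rule tensor_data.intro)
       (use assms in \<open>auto simp: module_regular add_pow_rdistr_int\<close>)
qed

lemma scalar_ext:
  assumes R: "cring R" and B: "comm_group B"
  shows module_scalar_ext: "module R (scalar_ext R B)"
    and scalar_ext_closed: "r \<in> carrier R \<Longrightarrow> b \<in> carrier B \<Longrightarrow> pure_tensor (scalar_ext R B) r b \<in> carrier (scalar_ext R B)"
    and scalar_ext_add_left: "r \<in> carrier R \<Longrightarrow> r' \<in> carrier R \<Longrightarrow> b \<in> carrier B \<Longrightarrow>
      pure_tensor (scalar_ext R B) (r \<oplus>\<^bsub>R\<^esub> r') b = pure_tensor (scalar_ext R B) r b \<oplus>\<^bsub>scalar_ext R B\<^esub> pure_tensor (scalar_ext R B) r' b"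
    and scalar_ext_add_right: "r \<in> carrier R \<Longrightarrow> b \<in> carrier B \<Longrightarrow> b' \<in> carrier B \<Longrightarrow>
      pure_tensor (scalar_ext R B) r (b \<otimes>\<^bsub>B\<^esub> b') = pure_tensor (scalar_ext R B) r b \<oplus>\<^bsub>scalar_ext R B\<^esub> pure_tensor (scalar_ext R B) r b'"
    and scalar_ext_int: "r \<in> carrier R \<Longrightarrow> b \<in> carrier B \<Longrightarrow>
      pure_tensor (scalar_ext R B) ([k] \<cdot>\<^bsub>R\<^esub> r) b = pure_tensor (scalar_ext R B) r (b [^]\<^bsub>B\<^esub> (k::int))"
    and scalar_ext_smult: "r \<in> carrier R \<Longrightarrow> s \<in> carrier R \<Longrightarrow> b \<in> carrier B \<Longrightarrow>
      r \<odot>\<^bsub>scalar_ext R B\<^esub> pure_tensor (scalar_ext R B) s b = pure_tensor (scalar_ext R B) (r \<otimes>\<^bsub>R\<^esub> s) b"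
    and scalar_ext_eqI: "abelian_group W \<Longrightarrow> f \<in> hom (add_monoid (scalar_ext R B)) (add_monoid W) \<Longrightarrow>
      g \<in> hom (add_monoid (scalar_ext R B)) (add_monoid W) \<Longrightarrow>
      (\<And>r b. r \<in> carrier R \<Longrightarrow> b \<in> carrier B \<Longrightarrow> f (pure_tensor (scalar_ext R B) r b) = g (pure_tensor (scalar_ext R B) r b)) \<Longrightarrow>
      w \<in> carrier (scalar_ext R B) \<Longrightarrow> f w = g w"
proof -
  interpret tensor_data R "UNIV :: int set" "\<lambda>k r. [k] \<cdot>\<^bsub>R\<^esub> r" "\<lambda>k b. b [^]\<^bsub>B\<^esub> k" "regular_module R" B
    by (rule tensor_data_scalar_ext[OF R B])
  note f = scalar_ext_def[symmetric]
  show "module R (scalar_ext R B)"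
    "r \<in> carrier R \<Longrightarrow> b \<in> carrier B \<Longrightarrow> pure_tensor (scalar_ext R B) r b \<in> carrier (scalar_ext R B)"
    "r \<in> carrier R \<Longrightarrow> r' \<in> carrier R \<Longrightarrow> b \<in> carrier B \<Longrightarrow>
      pure_tensor (scalar_ext R B) (r \<oplus>\<^bsub>R\<^esub> r') b = pure_tensor (scalar_ext R B) r b \<oplus>\<^bsub>scalar_ext R B\<^esub> pure_tensor (scalar_ext R B) r' b"
    "r \<in> carrier R \<Longrightarrow> b \<in> carrier B \<Longrightarrow> b' \<in> carrier B \<Longrightarrow>
      pure_tensor (scalar_ext R B) r (b \<otimes>\<^bsub>B\<^esub> b') = pure_tensor (scalar_ext R B) r b \<oplus>\<^bsub>scalar_ext R B\<^esub> pure_tensor (scalar_ext R B) r b'"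
    "r \<in> carrier R \<Longrightarrow> b \<in> carrier B \<Longrightarrow>
      pure_tensor (scalar_ext R B) ([k] \<cdot>\<^bsub>R\<^esub> r) b = pure_tensor (scalar_ext R B) r (b [^]\<^bsub>B\<^esub> k)"
    "r \<in> carrier R \<Longrightarrow> s \<in> carrier R \<Longrightarrow> b \<in> carrier B \<Longrightarrow>
      r \<odot>\<^bsub>scalar_ext R B\<^esub> pure_tensor (scalar_ext R B) s b = pure_tensor (scalar_ext R B) (r \<otimes>\<^bsub>R\<^esub> s) b"
    using module_T pure_closed[of r b] pure_bilinear(1)[of r r' b] pure_bilinear(2)[of r b b'] pure_bilinear(3)[of k r b]
      smult_pure[of r s b]
    by (simp_all add: f)
  show "f w = g w" if "abelian_group W" "f \<in> hom (add_monoid (scalar_ext R B)) (add_monoid W)"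
      "g \<in> hom (add_monoid (scalar_ext R B)) (add_monoid W)"
      "\<And>r b. r \<in> carrier R \<Longrightarrow> b \<in> carrier B \<Longrightarrow> f (pure_tensor (scalar_ext R B) r b) = g (pure_tensor (scalar_ext R B) r b)"
      "w \<in> carrier (scalar_ext R B)"
    using T_hom_eqI[OF that(1), of f g w] that by (simp add: f)
qed

lemma scalar_ext_map:
  assumes R: "cring R" and A: "comm_group A" and B: "comm_group B" and g: "g \<in> hom A B"
  shows scalar_ext_map_hom: "tensor_map (scalar_ext R B) (\<lambda>r. r) g \<in> mod_hom R (scalar_ext R A) (scalar_ext R B)"
    and scalar_ext_map_pure: "r \<in> carrier R \<Longrightarrow> a \<in> carrier A \<Longrightarrow>
      tensor_map (scalar_ext R B) (\<lambda>r. r) g (pure_tensor (scalar_ext R A) r a) = pure_tensor (scalar_ext R B) r (g a)"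
proof -
  have id: "(\<lambda>r. r) \<in> mod_hom R (regular_module R) (regular_module R)" by (rule mod_hom_id)
  have bal: "pure_tensor (scalar_ext R B) ([k] \<cdot>\<^bsub>R\<^esub> m) (g b) = pure_tensor (scalar_ext R B) m (g (b [^]\<^bsub>A\<^esub> k))"
    if "m \<in> carrier R" "b \<in> carrier A" for m b and k :: int
    using scalar_ext_int[OF R B that(1) hom_in_carrier[OF g that(2)]]
      hom_int_pow[OF g that(2) comm_group.axioms(2)[OF A] comm_group.axioms(2)[OF B]] by (simp add: that)
  note tm = tensor_data.tensor_map[OF tensor_data_scalar_ext[OF R A] tensor_data_scalar_ext[OF R B] scalar_ext_def id g, folded scalar_ext_def]
  show "tensor_map (scalar_ext R B) (\<lambda>r. r) g \<in> mod_hom R (scalar_ext R A) (scalar_ext R B)"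
    by (rule tm(1)) (simp add: bal)
  show "tensor_map (scalar_ext R B) (\<lambda>r. r) g (pure_tensor (scalar_ext R A) r a) = pure_tensor (scalar_ext R B) r (g a)"
    if "r \<in> carrier R" "a \<in> carrier A"
    by (rule tm(2)) (simp_all add: bal that)
qed

locale additive_functor = C: preadditive_category C + D: preadditive_category D
  for C :: "('o, 'a) precat" and D :: "('p, 'b) precat" +
  fixes R :: "('r, 'k) ring_scheme" and Fo :: "'o \<Rightarrow> 'p" and Fm :: "'o \<Rightarrow> 'o \<Rightarrow> 'a \<Rightarrow> 'b"
  assumes cring: "cring R"
    and Fo: "\<And>x. x \<in> Ob C \<Longrightarrow> Fo x \<in> Ob D"
    and Fm: "\<And>x y. x \<in> Ob C \<Longrightarrow> y \<in> Ob C \<Longrightarrow> Fm x y \<in> hom (Hom C x y) (Hom D (Fo x) (Fo y))"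
    and Fm_Comp: "\<And>x y z f g. x \<in> Ob C \<Longrightarrow> y \<in> Ob C \<Longrightarrow> z \<in> Ob C \<Longrightarrow> f \<in> carrier (Hom C x y) \<Longrightarrow> g \<in> carrier (Hom C y z) \<Longrightarrow>
      Fm x z (Comp C x y z g f) = Comp D (Fo x) (Fo y) (Fo z) (Fm y z g) (Fm x y f)"
    and Fm_Ident: "\<And>x. x \<in> Ob C \<Longrightarrow> Fm x x (Ident C x) = Ident D (Fo x)"
begin

interpretation R: cring R by (rule cring)

lemma Fm_closed: "x \<in> Ob C \<Longrightarrow> y \<in> Ob C \<Longrightarrow> \<alpha> \<in> carrier (Hom C x y) \<Longrightarrow> Fm x y \<alpha> \<in> carrier (Hom D (Fo x) (Fo y))"
  using hom_in_carrier[OF Fm] by blast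

lemma Comp_closed:
  assumes "x \<in> Ob D" "y \<in> Ob D" "z \<in> Ob D" "f \<in> carrier (Hom D x y)" "g \<in> carrier (Hom D y z)"
  shows "Comp D x y z g f \<in> carrier (Hom D x z)"
  using hom_in_carrier[OF D.Comp_right_hom[OF assms(1-3,5)] assms(4)] .

abbreviation "HM d \<equiv> hom_module R D Fo Fm d"
abbreviation "SE d x \<equiv> scalar_ext R (Hom D d (Fo x))"
abbreviation "IV M d \<equiv> Val (Ind R C D Fo Fm M) d"

lemma comm_Hom: "d \<in> Ob D \<Longrightarrow> x \<in> Ob C \<Longrightarrow> comm_group (Hom D d (Fo x))"
  by (rule D.Hom_comm_group[OF _ Fo])

lemma HM_simps:
  "Val (HM d) x = SE d x"
  "Act (HM d) x y \<alpha> = tensor_map (SE d y) (\<lambda>r. r) (Comp D d (Fo x) (Fo y) (Fm x y \<alpha>))"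
  by (simp_all add: hom_module_def)

lemma HM_act:
  assumes "d \<in> Ob D" "x \<in> Ob C" "y \<in> Ob C" "\<alpha> \<in> carrier (Hom C x y)"
  shows "Act (HM d) x y \<alpha> \<in> mod_hom R (SE d x) (SE d y)"
    and "r \<in> carrier R \<Longrightarrow> f \<in> carrier (Hom D d (Fo x)) \<Longrightarrow>
      Act (HM d) x y \<alpha> (pure_tensor (SE d x) r f) = pure_tensor (SE d y) r (Comp D d (Fo x) (Fo y) (Fm x y \<alpha>) f)"
  unfolding HM_simps
  using scalar_ext_map[OF cring comm_Hom[OF assms(1,2)] comm_Hom[OF assms(1,3)]
      D.Comp_right_hom[OF assms(1) Fo[OF assms(2)] Fo[OF assms(3)] Fm_closed[OF assms(2-4)]]]
  by auto

lemma category_tensor: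
  assumes "contra_module R C M" "d \<in> Ob D"
  shows "category_tensor R C M (HM d)"
  using assms HM_act(1)[OF assms(2)]
  by (intro category_tensor.intro) (auto simp: contra_module_def HM_simps cring intro!: module_scalar_ext comm_Hom)

text \<open>Only the scalar one occurs: a scalar \<open>r\<close> in the second factor can be moved
  out of the scalar extension and into \<open>m\<close>, so these elements already generate the
  induced module (\<open>Ind_hom_eqI\<close>).\<close>

definition ind_tensor :: "('o, 'a, 'r, 'm) cat_module \<Rightarrow> 'p \<Rightarrow> 'o \<Rightarrow> 'm \<Rightarrow> 'b \<Rightarrow> ('o, 'r, 'b, 'm) ind_elem" where
  "ind_tensor M d x m f = category_tensor.tens R C M (HM d) x m (pure_tensor (SE d x) \<one>\<^bsub>R\<^esub> f)"

lemma IV_eq: "IV M d = cat_tensor R C M (HM d)"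
  by (simp add: Ind_def)

context
  fixes M :: "('o, 'a, 'r, 'm) cat_module" and d
  assumes M: "contra_module R C M" and d: "d \<in> Ob D"
begin

interpretation category_tensor R C M "HM d" by (rule category_tensor[OF M d])

lemma module_IV: "module R (IV M d)"
  unfolding IV_eq by (rule module_CT)

lemma ind_tensor:
  assumes x: "x \<in> Ob C"
  shows ind_tensor_closed: "m \<in> carrier (Val M x) \<Longrightarrow> f \<in> carrier (Hom D d (Fo x)) \<Longrightarrow> ind_tensor M d x m f \<in> carrier (IV M d)"
    and ind_tensor_add_left: "m \<in> carrier (Val M x) \<Longrightarrow> m' \<in> carrier (Val M x) \<Longrightarrow> f \<in> carrier (Hom D d (Fo x)) \<Longrightarrow>
      ind_tensor M d x (m \<oplus>\<^bsub>Val M x\<^esub> m') f = ind_tensor M d x m f \<oplus>\<^bsub>IV M d\<^esub> ind_tensor M d x m' f"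
    and ind_tensor_add_right: "m \<in> carrier (Val M x) \<Longrightarrow> f \<in> carrier (Hom D d (Fo x)) \<Longrightarrow> f' \<in> carrier (Hom D d (Fo x)) \<Longrightarrow>
      ind_tensor M d x m (f \<otimes>\<^bsub>Hom D d (Fo x)\<^esub> f') = ind_tensor M d x m f \<oplus>\<^bsub>IV M d\<^esub> ind_tensor M d x m f'"
    and ind_tensor_smult: "r \<in> carrier R \<Longrightarrow> m \<in> carrier (Val M x) \<Longrightarrow> f \<in> carrier (Hom D d (Fo x)) \<Longrightarrow>
      ind_tensor M d x (r \<odot>\<^bsub>Val M x\<^esub> m) f = r \<odot>\<^bsub>IV M d\<^esub> ind_tensor M d x m f"
  using tens[OF x] scalar_ext[OF cring comm_Hom[OF d x]]
  unfolding ind_tensor_def IV_eq HM_simps by simp_all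

lemma ind_tensor_balanced:
  assumes "x \<in> Ob C" "y \<in> Ob C" "\<alpha> \<in> carrier (Hom C x y)" "m \<in> carrier (Val M y)" "f \<in> carrier (Hom D d (Fo x))"
  shows "ind_tensor M d x (Act M x y \<alpha> m) f = ind_tensor M d y m (Comp D d (Fo x) (Fo y) (Fm x y \<alpha>) f)"
  using tens_balanced[OF assms(1-4), of "pure_tensor (SE d x) \<one>\<^bsub>R\<^esub> f"] HM_act(2)[OF d assms(1-3) _ assms(5), of "\<one>\<^bsub>R\<^esub>"]
    scalar_ext_closed[OF cring comm_Hom[OF d assms(1)] _ assms(5), of "\<one>\<^bsub>R\<^esub>"]
  unfolding ind_tensor_def by (simp add: HM_simps(1))

lemma Ind_hom_eqI:
  assumes W: "module R W" and f: "f \<in> mod_hom R (IV M d) W" and g: "g \<in> mod_hom R (IV M d) W"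
    and eq: "\<And>x m h. x \<in> Ob C \<Longrightarrow> m \<in> carrier (Val M x) \<Longrightarrow> h \<in> carrier (Hom D d (Fo x)) \<Longrightarrow>
      f (ind_tensor M d x m h) = g (ind_tensor M d x m h)"
    and w: "w \<in> carrier (IV M d)"
  shows "f w = g w"
proof (rule CT_hom_eqI[OF W f[unfolded IV_eq] g[unfolded IV_eq] _ w[unfolded IV_eq]])
  interpret W: module R W by (rule W)
  fix x m a assume x: "x \<in> Ob C" and m: "m \<in> carrier (Val M x)" and a: "a \<in> carrier (Val (HM d) x)"
  note f' = mod_homD[OF f[unfolded IV_eq]] and g' = mod_homD[OF g[unfolded IV_eq]]
  show "f (tens x m a) = g (tens x m a)"
  proof (rule scalar_ext_eqI[OF cring comm_Hom[OF d x] W.M.abelian_group_axioms, where f = "\<lambda>a. f (tens x m a)" and g = "\<lambda>a. g (tens x m a)"])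
    show "(\<lambda>a. f (tens x m a)) \<in> hom (add_monoid (SE d x)) (add_monoid W)"
      "(\<lambda>a. g (tens x m a)) \<in> hom (add_monoid (SE d x)) (add_monoid W)"
      using tens[OF x, unfolded HM_simps] m by (auto simp: hom_def f' g')
    show "a \<in> carrier (SE d x)" using a by (simp add: HM_simps)
    fix r h assume r: "r \<in> carrier R" and h: "h \<in> carrier (Hom D d (Fo x))"
    have c1: "pure_tensor (SE d x) \<one>\<^bsub>R\<^esub> h \<in> carrier (Val (HM d) x)"
      using scalar_ext_closed[OF cring comm_Hom[OF d x] R.one_closed h] by (simp add: HM_simps)
    \<comment> \<open>Pulling \<open>r\<close> out by linearity leaves a tensor with scalar one,
      where the hypothesis \<open>eq\<close> applies.\<close>
    have "pure_tensor (SE d x) r h = r \<odot>\<^bsub>Val (HM d) x\<^esub> pure_tensor (SE d x) \<one>\<^bsub>R\<^esub> h"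
      using scalar_ext_smult[OF cring comm_Hom[OF d x] r _ h, of "\<one>\<^bsub>R\<^esub>"] r by (simp add: HM_simps)
    then show "f (tens x m (pure_tensor (SE d x) r h)) = g (tens x m (pure_tensor (SE d x) r h))"
      using eq[OF x m h] tens_smult_right[OF x r m c1] f'(4)[OF r tens_closed[OF x m c1]] g'(4)[OF r tens_closed[OF x m c1]]
      by (simp add: ind_tensor_def)
  qed
qed

text \<open>A map out of the induced module is prescribed on \<open>m\<close> and \<open>f\<close>
  alone; on the scalar extension it is completed by sending \<open>r\<close> tensor \<open>f\<close>
  to \<open>r\<close> times the value at \<open>f\<close>.\<close>

lemma Ind_universal:
  assumes W: "module R W"
    and cl: "\<And>x m f. x \<in> Ob C \<Longrightarrow> m \<in> carrier (Val M x) \<Longrightarrow> f \<in> carrier (Hom D d (Fo x)) \<Longrightarrow> \<beta> x m f \<in> carrier W"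
    and al: "\<And>x m m' f. x \<in> Ob C \<Longrightarrow> m \<in> carrier (Val M x) \<Longrightarrow> m' \<in> carrier (Val M x) \<Longrightarrow> f \<in> carrier (Hom D d (Fo x)) \<Longrightarrow>
      \<beta> x (m \<oplus>\<^bsub>Val M x\<^esub> m') f = \<beta> x m f \<oplus>\<^bsub>W\<^esub> \<beta> x m' f"
    and ar: "\<And>x m f f'. x \<in> Ob C \<Longrightarrow> m \<in> carrier (Val M x) \<Longrightarrow> f \<in> carrier (Hom D d (Fo x)) \<Longrightarrow> f' \<in> carrier (Hom D d (Fo x)) \<Longrightarrow>
      \<beta> x m (f \<otimes>\<^bsub>Hom D d (Fo x)\<^esub> f') = \<beta> x m f \<oplus>\<^bsub>W\<^esub> \<beta> x m f'"
    and sm: "\<And>x r m f. x \<in> Ob C \<Longrightarrow> r \<in> carrier R \<Longrightarrow> m \<in> carrier (Val M x) \<Longrightarrow> f \<in> carrier (Hom D d (Fo x)) \<Longrightarrow>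
      \<beta> x (r \<odot>\<^bsub>Val M x\<^esub> m) f = r \<odot>\<^bsub>W\<^esub> \<beta> x m f"
    and bal: "\<And>x y \<alpha> m f. x \<in> Ob C \<Longrightarrow> y \<in> Ob C \<Longrightarrow> \<alpha> \<in> carrier (Hom C x y) \<Longrightarrow> m \<in> carrier (Val M y) \<Longrightarrow> f \<in> carrier (Hom D d (Fo x)) \<Longrightarrow>
      \<beta> x (Act M x y \<alpha> m) f = \<beta> y m (Comp D d (Fo x) (Fo y) (Fm x y \<alpha>) f)"
  shows "\<exists>\<Phi>\<in>mod_hom R (IV M d) W. \<forall>x\<in>Ob C. \<forall>m\<in>carrier (Val M x). \<forall>f\<in>carrier (Hom D d (Fo x)). \<Phi> (ind_tensor M d x m f) = \<beta> x m f"
proof -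
  interpret W: module R W by (rule W)
  \<comment> \<open>Additivity in \<open>f\<close> turns integer powers of \<open>f\<close> into
    integer multiples, which is the balancing over the integers that the scalar extension
    demands.\<close>
  have int: "r \<odot>\<^bsub>W\<^esub> \<beta> x m (f [^]\<^bsub>Hom D d (Fo x)\<^esub> k) = ([k] \<cdot>\<^bsub>R\<^esub> r) \<odot>\<^bsub>W\<^esub> \<beta> x m f"
    if "x \<in> Ob C" "m \<in> carrier (Val M x)" "r \<in> carrier R" "f \<in> carrier (Hom D d (Fo x))" for x m r f and k :: int
  proof -
    interpret H: comm_group "Hom D d (Fo x)" by (rule comm_Hom[OF d that(1)])
    have h1: "(\<lambda>f. r \<odot>\<^bsub>W\<^esub> \<beta> x m f) \<in> hom (Hom D d (Fo x)) (add_monoid W)"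
      using that by (auto simp: hom_def cl ar W.smult_r_distr)
    have h2: "(\<lambda>r. r \<odot>\<^bsub>W\<^esub> \<beta> x m f) \<in> hom (add_monoid R) (add_monoid W)"
      using that by (auto simp: hom_def cl W.smult_l_distr)
    show ?thesis
      using hom_int_pow[OF h1 that(4) H.is_group W.M.a_group, of k]
        hom_int_pow[OF h2 _ R.a_group W.M.a_group, of r k] that(3) by (simp add: add_pow_eq)
  qed
  have "\<exists>\<phi>\<in>mod_hom R (SE d x) W. \<forall>r\<in>carrier R. \<forall>f\<in>carrier (Hom D d (Fo x)). \<phi> (pure_tensor (SE d x) r f) = r \<odot>\<^bsub>W\<^esub> \<beta> x m f"
    if x: "x \<in> Ob C" and m: "m \<in> carrier (Val M x)" for x m
    using tensor_data.T_universal_module[OF tensor_data_scalar_ext[OF cring comm_Hom[OF d x]] W, of "\<lambda>r f. r \<odot>\<^bsub>W\<^esub> \<beta> x m f", folded scalar_ext_def]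
    using x m by (simp add: cl ar W.smult_l_distr W.smult_r_distr W.smult_assoc1 int)
  then obtain \<phi> where \<phi>: "\<And>x m. x \<in> Ob C \<Longrightarrow> m \<in> carrier (Val M x) \<Longrightarrow> \<phi> x m \<in> mod_hom R (SE d x) W"
    and \<phi>_pure: "\<And>x m r f. x \<in> Ob C \<Longrightarrow> m \<in> carrier (Val M x) \<Longrightarrow> r \<in> carrier R \<Longrightarrow> f \<in> carrier (Hom D d (Fo x)) \<Longrightarrow>
      \<phi> x m (pure_tensor (SE d x) r f) = r \<odot>\<^bsub>W\<^esub> \<beta> x m f"
    by metis
  have mM: "module R (Val M x)" if "x \<in> Ob C" for x using M that by (simp add: contra_module_def)
  note SEeq = scalar_ext_eqI[OF cring comm_Hom[OF d] W.M.abelian_group_axioms]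
  have "\<exists>\<Phi>\<in>mod_hom R CT W. \<forall>x\<in>Ob C. \<forall>m\<in>carrier (Val M x). \<forall>a\<in>carrier (Val (HM d) x). \<Phi> (tens x m a) = \<phi> x m a"
  proof (rule CT_universal[OF W])
    fix x m a assume x: "x \<in> Ob C" and m: "m \<in> carrier (Val M x)" and a: "a \<in> carrier (Val (HM d) x)"
    have a': "a \<in> carrier (SE d x)" using a by (simp add: HM_simps)
    show "\<phi> x m a \<in> carrier W" using mod_homD(2)[OF \<phi>[OF x m] a'] .
    show "\<phi> x m (a \<oplus>\<^bsub>Val (HM d) x\<^esub> b) = \<phi> x m a \<oplus>\<^bsub>W\<^esub> \<phi> x m b" if "b \<in> carrier (Val (HM d) x)" for b
      using mod_homD(3)[OF \<phi>[OF x m] a'] that by (simp add: HM_simps)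
    show "\<phi> x m (r \<odot>\<^bsub>Val (HM d) x\<^esub> a) = r \<odot>\<^bsub>W\<^esub> \<phi> x m a" if "r \<in> carrier R" for r
      using mod_homD(4)[OF \<phi>[OF x m] that a'] by (simp add: HM_simps)
    show "\<phi> x (r \<odot>\<^bsub>Val M x\<^esub> m) a = r \<odot>\<^bsub>W\<^esub> \<phi> x m a" if r: "r \<in> carrier R" for r
      by (rule SEeq[OF x, where f = "\<phi> x (r \<odot>\<^bsub>Val M x\<^esub> m)" and g = "\<lambda>a. r \<odot>\<^bsub>W\<^esub> \<phi> x m a"])
         (use x m r a' module.smult_closed[OF mM[OF x] r m] in \<open>auto intro!: mod_homD(1)[OF \<phi>]
            simp: \<phi>_pure sm cl W.smult_assoc1[symmetric] R.m_comm mod_homD[OF \<phi>] hom_def[of "add_monoid (SE d x)"] W.smult_r_distr\<close>)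
    show "\<phi> x (m \<oplus>\<^bsub>Val M x\<^esub> m') a = \<phi> x m a \<oplus>\<^bsub>W\<^esub> \<phi> x m' a" if m': "m' \<in> carrier (Val M x)" for m'
    proof (rule SEeq[OF x, where f = "\<phi> x (m \<oplus>\<^bsub>Val M x\<^esub> m')" and g = "\<lambda>a. \<phi> x m a \<oplus>\<^bsub>W\<^esub> \<phi> x m' a"])
      interpret Mx: module R "Val M x" by (rule mM[OF x])
      show "\<phi> x (m \<oplus>\<^bsub>Val M x\<^esub> m') \<in> hom (add_monoid (SE d x)) (add_monoid W)"
        using mod_homD(1)[OF \<phi>[OF x]] m m' by simp
      show "(\<lambda>a. \<phi> x m a \<oplus>\<^bsub>W\<^esub> \<phi> x m' a) \<in> hom (add_monoid (SE d x)) (add_monoid W)"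
        by (auto simp: hom_def mod_homD[OF \<phi>] x m m' W.M.a_ac)
    qed (use x m m' a' mM in \<open>auto simp: \<phi>_pure al cl W.smult_r_distr module_def abelian_group_def abelian_monoid.a_closed\<close>)
  next
    fix x y \<alpha> m a assume *: "x \<in> Ob C" "y \<in> Ob C" "\<alpha> \<in> carrier (Hom C x y)" "m \<in> carrier (Val M y)" and a: "a \<in> carrier (Val (HM d) x)"
    have A: "Act M x y \<alpha> m \<in> carrier (Val M x)" by (rule mod_homD(2)[OF act_M[OF *(1-3)] *(4)])
    show "\<phi> x (Act M x y \<alpha> m) a = \<phi> y m (Act (HM d) x y \<alpha> a)"
    proof (rule SEeq[OF *(1), where f = "\<phi> x (Act M x y \<alpha> m)" and g = "\<lambda>a. \<phi> y m (Act (HM d) x y \<alpha> a)"])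
      show "\<phi> x (Act M x y \<alpha> m) \<in> hom (add_monoid (SE d x)) (add_monoid W)" by (rule mod_homD(1)[OF \<phi>[OF *(1) A]])
      show "(\<lambda>a. \<phi> y m (Act (HM d) x y \<alpha> a)) \<in> hom (add_monoid (SE d x)) (add_monoid W)"
        by (rule mod_homD(1)[OF mod_hom_compose[OF HM_act(1)[OF d *(1-3)] \<phi>[OF *(2,4)]]])
      show "a \<in> carrier (SE d x)" using a by (simp add: HM_simps)
      fix r f assume rf: "r \<in> carrier R" "f \<in> carrier (Hom D d (Fo x))"
      have "Comp D d (Fo x) (Fo y) (Fm x y \<alpha>) f \<in> carrier (Hom D d (Fo y))"
        using * rf d by (intro Comp_closed Fo Fm_closed)
      then show "\<phi> x (Act M x y \<alpha> m) (pure_tensor (SE d x) r f) = \<phi> y m (Act (HM d) x y \<alpha> (pure_tensor (SE d x) r f))"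
        using HM_act(2)[OF d *(1-3) rf] bal[OF * rf(2)] by (simp add: \<phi>_pure *(1,2,4) A rf)
    qed
  qed
  then obtain \<Phi> where \<Phi>: "\<Phi> \<in> mod_hom R CT W"
    and \<Phi>_tens: "\<And>x m a. x \<in> Ob C \<Longrightarrow> m \<in> carrier (Val M x) \<Longrightarrow> a \<in> carrier (SE d x) \<Longrightarrow> \<Phi> (tens x m a) = \<phi> x m a"
    unfolding HM_simps by blast
  have "\<Phi> (ind_tensor M d x m f) = \<beta> x m f" if "x \<in> Ob C" "m \<in> carrier (Val M x)" "f \<in> carrier (Hom D d (Fo x))" for x m f
    using that \<Phi>_tens[OF that(1,2)] scalar_ext_closed[OF cring comm_Hom[OF d that(1)] R.one_closed that(3)] cl[OF that]
    by (simp add: ind_tensor_def \<phi>_pure)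
  then show ?thesis using \<Phi> unfolding IV_eq by blast
qed

end

lemma Ind_Act:
  assumes M: "contra_module R C M" and d: "d \<in> Ob D" "d' \<in> Ob D" "\<beta> \<in> carrier (Hom D d d')"
  shows Ind_Act_hom: "Act (Ind R C D Fo Fm M) d d' \<beta> \<in> mod_hom R (IV M d') (IV M d)"
    and Ind_Act_tensor: "x \<in> Ob C \<Longrightarrow> m \<in> carrier (Val M x) \<Longrightarrow> f \<in> carrier (Hom D d' (Fo x)) \<Longrightarrow>
      Act (Ind R C D Fo Fm M) d d' \<beta> (ind_tensor M d' x m f) = ind_tensor M d x m (Comp D d d' (Fo x) f \<beta>)"
proof -
  let ?g = "\<lambda>x. tensor_map (SE d x) (\<lambda>r. r) (\<lambda>\<gamma>. Comp D d d' (Fo x) \<gamma> \<beta>)"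
  have act: "Act (Ind R C D Fo Fm M) d d' \<beta> = cat_tensor_map R C M (HM d) (\<lambda>x m. m) ?g"
    by (simp add: Ind_def)
  note se = scalar_ext_map[OF cring comm_Hom[OF d(2)] comm_Hom[OF d(1)] D.Comp_left_hom[OF d(1,2) Fo d(3)]]
  have g: "?g x \<in> mod_hom R (Val (HM d') x) (Val (HM d) x)" if "x \<in> Ob C" for x
    using se(1)[OF that that that] by (simp add: HM_simps)
  \<comment> \<open>Precomposition with \<open>\<beta>\<close> commutes with postcomposition by the
    image of \<open>\<alpha>\<close>; on generators this is associativity in
    \<open>D\<close>.\<close>
  have nat: "?g y (Act (HM d') x y \<alpha> a) = Act (HM d) x y \<alpha> (?g x a)"
    if *: "x \<in> Ob C" "y \<in> Ob C" "\<alpha> \<in> carrier (Hom C x y)" and a: "a \<in> carrier (Val (HM d') x)" for x y \<alpha> a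
  proof (rule scalar_ext_eqI[OF cring comm_Hom[OF d(2) *(1)], where f = "\<lambda>a. ?g y (Act (HM d') x y \<alpha> a)" and g = "\<lambda>a. Act (HM d) x y \<alpha> (?g x a)"])
    show "abelian_group (SE d y)" using module_scalar_ext[OF cring comm_Hom[OF d(1) *(2)]] by (simp add: module_def)
    show "(\<lambda>a. ?g y (Act (HM d') x y \<alpha> a)) \<in> hom (add_monoid (SE d' x)) (add_monoid (SE d y))"
      by (rule mod_homD(1)[OF mod_hom_compose[OF HM_act(1)[OF d(2) *] g[OF *(2), unfolded HM_simps]]])
    show "(\<lambda>a. Act (HM d) x y \<alpha> (?g x a)) \<in> hom (add_monoid (SE d' x)) (add_monoid (SE d y))"
      by (rule mod_homD(1)[OF mod_hom_compose[OF g[OF *(1), unfolded HM_simps] HM_act(1)[OF d(1) *]]])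
    show "a \<in> carrier (SE d' x)" using a by (simp add: HM_simps)
    fix r f assume r: "r \<in> carrier R" and f: "f \<in> carrier (Hom D d' (Fo x))"
    have c: "Comp D d' (Fo x) (Fo y) (Fm x y \<alpha>) f \<in> carrier (Hom D d' (Fo y))" "Comp D d d' (Fo x) f \<beta> \<in> carrier (Hom D d (Fo x))"
      using * d f by (auto intro!: Comp_closed Fo Fm_closed)
    show "?g y (Act (HM d') x y \<alpha> (pure_tensor (SE d' x) r f)) = Act (HM d) x y \<alpha> (?g x (pure_tensor (SE d' x) r f))"
      using D.Comp_assoc[OF d(1,2) Fo[OF *(1)] Fo[OF *(2)] d(3) f Fm_closed[OF *]]
      by (simp add: HM_act(2)[OF d(2) * r f] se(2)[OF *(1) *(1) *(1) r f] se(2)[OF *(2) *(2) *(2) r c(1)] HM_act(2)[OF d(1) * r c(2)])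
  qed
  have id: "(\<lambda>m. m) \<in> mod_hom R (Val M x) (Val M x)" for x by (rule mod_hom_id)
  note cm = cat_tensor_map[OF category_tensor[OF M d(2)] category_tensor[OF M d(1)] id g _ nat]
  show "Act (Ind R C D Fo Fm M) d d' \<beta> \<in> mod_hom R (IV M d') (IV M d)"
    unfolding act IV_eq by (rule cm(1)) simp_all
  show "Act (Ind R C D Fo Fm M) d d' \<beta> (ind_tensor M d' x m f) = ind_tensor M d x m (Comp D d d' (Fo x) f \<beta>)"
    if x: "x \<in> Ob C" and m: "m \<in> carrier (Val M x)" and f: "f \<in> carrier (Hom D d' (Fo x))"
  proof -
    let ?p = "pure_tensor (SE d' x) \<one>\<^bsub>R\<^esub> f"
    have p: "?p \<in> carrier (Val (HM d') x)"
      using scalar_ext_closed[OF cring comm_Hom[OF d(2) x] R.one_closed f] by (simp add: HM_simps)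
    have "cat_tensor_map R C M (HM d) (\<lambda>x m. m) ?g (category_tensor.tens R C M (HM d') x m ?p)
        = category_tensor.tens R C M (HM d) x m (?g x ?p)"
      by (rule cm(2)) (simp_all add: x m p)
    then show ?thesis
      by (simp add: act ind_tensor_def se(2)[OF x x x R.one_closed f])
  qed
qed

lemma Ind_map:
  assumes M: "contra_module R C M" and M': "contra_module R C M'" and \<phi>: "\<phi> \<in> cat_hom R C M M'" and d: "d \<in> Ob D"
  shows Ind_map_hom: "Ind_map R C D Fo Fm M' \<phi> d \<in> mod_hom R (IV M d) (IV M' d)"
    and Ind_map_tensor: "x \<in> Ob C \<Longrightarrow> m \<in> carrier (Val M x) \<Longrightarrow> f \<in> carrier (Hom D d (Fo x)) \<Longrightarrow>
      Ind_map R C D Fo Fm M' \<phi> d (ind_tensor M d x m f) = ind_tensor M' d x (\<phi> x m) f"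
proof -
  have id: "(\<lambda>m. m) \<in> mod_hom R (Val (HM d) x) (Val (HM d) x)" for x by (rule mod_hom_id)
  have \<phi>1: "\<phi> x \<in> mod_hom R (Val M x) (Val M' x)" if "x \<in> Ob C" for x using \<phi> that by (simp add: cat_hom_def)
  have \<phi>2: "\<phi> x (Act M x y \<alpha> m) = Act M' x y \<alpha> (\<phi> y m)"
    if "x \<in> Ob C" "y \<in> Ob C" "\<alpha> \<in> carrier (Hom C x y)" "m \<in> carrier (Val M y)" for x y \<alpha> m
    using \<phi> that by (simp add: cat_hom_def)
  note cm = cat_tensor_map[OF category_tensor[OF M d] category_tensor[OF M' d] \<phi>1 id \<phi>2 refl]
  show "Ind_map R C D Fo Fm M' \<phi> d \<in> mod_hom R (IV M d) (IV M' d)"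
    unfolding Ind_map_def IV_eq by (rule cm(1))
  show "Ind_map R C D Fo Fm M' \<phi> d (ind_tensor M d x m f) = ind_tensor M' d x (\<phi> x m) f"
    if x: "x \<in> Ob C" and m: "m \<in> carrier (Val M x)" and f: "f \<in> carrier (Hom D d (Fo x))"
    using scalar_ext_closed[OF cring comm_Hom[OF d x] R.one_closed f]
    unfolding Ind_map_def ind_tensor_def by (intro cm(2)) (simp_all add: HM_simps x m)
qed

text \<open>All axioms are equations between linear maps and are checked on
  \<open>ind_tensor\<close>, where they become the axioms for composition in
  \<open>D\<close>.\<close>

lemma contra_module_Ind:
  assumes M: "contra_module R C M"
  shows "contra_module R D (Ind R C D Fo Fm M)"
  unfolding contra_module_def
proof (intro conjI ballI)
  let ?I = "Ind R C D Fo Fm M"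
  fix d assume d: "d \<in> Ob D"
  show I: "module R (IV M d)" by (rule module_IV[OF M d])
  show "Act ?I d d (Ident D d) w = w" if "w \<in> carrier (IV M d)" for w
    by (rule Ind_hom_eqI[OF M d I Ind_Act_hom[OF M d d D.Ident_in_Hom[OF d]] mod_hom_id _ that])
       (simp add: Ind_Act_tensor[OF M d d D.Ident_in_Hom[OF d]] D.Comp_Ident_right[OF d Fo])
  fix d' assume d': "d' \<in> Ob D"
  fix \<beta> assume \<beta>: "\<beta> \<in> carrier (Hom D d d')"
  note A = Ind_Act_hom[OF M d d' \<beta>] Ind_Act_tensor[OF M d d' \<beta>]
  show "Act ?I d d' \<beta> \<in> mod_hom R (IV M d') (IV M d)" by (rule A)
  show "Act ?I d d' (\<beta> \<otimes>\<^bsub>Hom D d d'\<^esub> \<gamma>) w = Act ?I d d' \<beta> w \<oplus>\<^bsub>IV M d\<^esub> Act ?I d d' \<gamma> w"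
    if \<gamma>: "\<gamma> \<in> carrier (Hom D d d')" and w: "w \<in> carrier (IV M d')" for \<gamma> w
  proof -
    interpret H: comm_group "Hom D d d'" by (rule D.Hom_comm_group[OF d d'])
    interpret I: module R "IV M d" by (rule I)
    have \<beta>\<gamma>: "\<beta> \<otimes>\<^bsub>Hom D d d'\<^esub> \<gamma> \<in> carrier (Hom D d d')" using \<beta> \<gamma> by simp
    note B = Ind_Act_hom[OF M d d' \<gamma>] Ind_Act_tensor[OF M d d' \<gamma>]
    have sum: "(\<lambda>w. Act ?I d d' \<beta> w \<oplus>\<^bsub>IV M d\<^esub> Act ?I d d' \<gamma> w) \<in> mod_hom R (IV M d') (IV M d)"
      by (rule mod_homI) (simp_all add: mod_homD[OF A(1)] mod_homD[OF B(1)] I.smult_r_distr I.M.a_ac)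
    show ?thesis
    proof (rule Ind_hom_eqI[OF M d' I Ind_Act_hom[OF M d d' \<beta>\<gamma>] sum _ w])
      fix x m f assume *: "x \<in> Ob C" "m \<in> carrier (Val M x)" "f \<in> carrier (Hom D d' (Fo x))"
      have "Comp D d d' (Fo x) f (\<beta> \<otimes>\<^bsub>Hom D d d'\<^esub> \<gamma>) = Comp D d d' (Fo x) f \<beta> \<otimes>\<^bsub>Hom D d (Fo x)\<^esub> Comp D d d' (Fo x) f \<gamma>"
        using hom_mult[OF D.Comp_right_hom[OF d d' Fo[OF *(1)] *(3)] \<beta> \<gamma>] .
      then show "Act ?I d d' (\<beta> \<otimes>\<^bsub>Hom D d d'\<^esub> \<gamma>) (ind_tensor M d' x m f) =
          Act ?I d d' \<beta> (ind_tensor M d' x m f) \<oplus>\<^bsub>IV M d\<^esub> Act ?I d d' \<gamma> (ind_tensor M d' x m f)"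
        using Comp_closed[OF d d' Fo[OF *(1)] \<beta> *(3)] Comp_closed[OF d d' Fo[OF *(1)] \<gamma> *(3)]
        by (simp add: A(2)[OF *] B(2)[OF *] Ind_Act_tensor[OF M d d' \<beta>\<gamma> *] ind_tensor_add_right[OF M d *(1,2)])
    qed
  qed
  fix d'' assume d'': "d'' \<in> Ob D"
  show "Act ?I d d'' (Comp D d d' d'' \<gamma> \<beta>) w = Act ?I d d' \<beta> (Act ?I d' d'' \<gamma> w)"
    if \<gamma>: "\<gamma> \<in> carrier (Hom D d' d'')" and w: "w \<in> carrier (IV M d'')" for \<gamma> w
  proof -
    have \<gamma>\<beta>: "Comp D d d' d'' \<gamma> \<beta> \<in> carrier (Hom D d d'')" by (rule Comp_closed[OF d d' d'' \<beta> \<gamma>])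
    note B = Ind_Act_hom[OF M d' d'' \<gamma>] Ind_Act_tensor[OF M d' d'' \<gamma>]
    show ?thesis
    proof (rule Ind_hom_eqI[OF M d'' I Ind_Act_hom[OF M d d'' \<gamma>\<beta>] mod_hom_compose[OF B(1) A(1)] _ w])
      fix x m f assume *: "x \<in> Ob C" "m \<in> carrier (Val M x)" "f \<in> carrier (Hom D d'' (Fo x))"
      show "Act ?I d d'' (Comp D d d' d'' \<gamma> \<beta>) (ind_tensor M d'' x m f) = Act ?I d d' \<beta> (Act ?I d' d'' \<gamma> (ind_tensor M d'' x m f))"
        using Comp_closed[OF d' d'' Fo[OF *(1)] \<gamma> *(3)] D.Comp_assoc[OF d d' d'' Fo[OF *(1)] \<beta> \<gamma> *(3)]
        by (simp add: A(2)[OF *(1,2)] B(2)[OF *] Ind_Act_tensor[OF M d d'' \<gamma>\<beta> *])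
    qed
  qed
qed

lemma cat_hom_Ind_map:
  assumes M: "contra_module R C M" and M': "contra_module R C M'" and \<phi>: "\<phi> \<in> cat_hom R C M M'"
  shows "Ind_map R C D Fo Fm M' \<phi> \<in> cat_hom R D (Ind R C D Fo Fm M) (Ind R C D Fo Fm M')"
  unfolding cat_hom_def mem_Collect_eq
proof (intro conjI ballI)
  note I = Ind_map_hom[OF M M' \<phi>]
  fix d assume d: "d \<in> Ob D"
  show "Ind_map R C D Fo Fm M' \<phi> d \<in> mod_hom R (IV M d) (IV M' d)" by (rule I[OF d])
  fix d' \<beta> w assume d': "d' \<in> Ob D" and \<beta>: "\<beta> \<in> carrier (Hom D d d')" and w: "w \<in> carrier (IV M d')"
  show "Ind_map R C D Fo Fm M' \<phi> d (Act (Ind R C D Fo Fm M) d d' \<beta> w) = Act (Ind R C D Fo Fm M') d d' \<beta> (Ind_map R C D Fo Fm M' \<phi> d' w)"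
  proof (rule Ind_hom_eqI[OF M d' module_IV[OF M' d] mod_hom_compose[OF Ind_Act_hom[OF M d d' \<beta>] I[OF d]]
        mod_hom_compose[OF I[OF d'] Ind_Act_hom[OF M' d d' \<beta>]] _ w])
    fix x m f assume *: "x \<in> Ob C" "m \<in> carrier (Val M x)" "f \<in> carrier (Hom D d' (Fo x))"
    have "\<phi> x m \<in> carrier (Val M' x)" using \<phi> * by (auto simp: cat_hom_def dest: mod_homD(2))
    then show "Ind_map R C D Fo Fm M' \<phi> d (Act (Ind R C D Fo Fm M) d d' \<beta> (ind_tensor M d' x m f)) =
        Act (Ind R C D Fo Fm M') d d' \<beta> (Ind_map R C D Fo Fm M' \<phi> d' (ind_tensor M d' x m f))"
      using Comp_closed[OF d d' Fo[OF *(1)] \<beta> *(3)] *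
      by (simp add: Ind_Act_tensor[OF M d d' \<beta>] Ind_Act_tensor[OF M' d d' \<beta>] Ind_map_tensor[OF M M' \<phi> d] Ind_map_tensor[OF M M' \<phi> d'])
  qed
qed

section \<open>Restriction along the functor and projectivity of induced modules\<close>

definition restriction :: "('p, 'b, 'r, 'm) cat_module \<Rightarrow> ('o, 'a, 'r, 'm) cat_module" where
  "restriction N = \<lparr>Val = (\<lambda>x. Val N (Fo x)), Act = (\<lambda>x y \<alpha>. Act N (Fo x) (Fo y) (Fm x y \<alpha>))\<rparr>"

lemma contra_module_restriction: "contra_module R D N \<Longrightarrow> contra_module R C (restriction N)"
  unfolding contra_module_def restriction_def cat_module.simps
  by (simp add: Fo Fm_closed Fm_Comp Fm_Ident hom_mult[OF Fm])

lemma cat_hom_restriction: "p \<in> cat_hom R D M N \<Longrightarrow> (\<lambda>x. p (Fo x)) \<in> cat_hom R C (restriction M) (restriction N)"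
  by (simp add: cat_hom_def restriction_def Fo Fm_closed)

text \<open>Induction is left adjoint to restriction, which preserves surjections.\<close>

lemma projective_Ind:
  fixes P :: "('o, 'a, 'r, 'm) cat_module"
  assumes P: "projective TYPE('w) R C P"
  shows "projective TYPE('w) R D (Ind R C D Fo Fm P)"
proof -
  have cP: "contra_module R C P" using P by (simp add: projective_def)
  have lift: "\<exists>h\<in>cat_hom R D (Ind R C D Fo Fm P) M. \<forall>d\<in>Ob D. \<forall>w\<in>carrier (IV P d). p d (h d w) = f d w"
    if M: "contra_module R D M" and N: "contra_module R D N" and p: "p \<in> cat_hom R D M N"
      and sur: "\<And>d. d \<in> Ob D \<Longrightarrow> p d ` carrier (Val M d) = carrier (Val N d)"
      and f: "f \<in> cat_hom R D (Ind R C D Fo Fm P) N"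
    for M N :: "('p, 'b, 'r, 'w) cat_module" and p f
  proof -
    have mP: "module R (Val P x)" if "x \<in> Ob C" for x using cP that by (simp add: contra_module_def)
    have fh: "f d \<in> mod_hom R (IV P d) (Val N d)" if "d \<in> Ob D" for d using f that by (simp add: cat_hom_def)
    have fn: "f d (Act (Ind R C D Fo Fm P) d d' \<beta> w) = Act N d d' \<beta> (f d' w)"
      if "d \<in> Ob D" "d' \<in> Ob D" "\<beta> \<in> carrier (Hom D d d')" "w \<in> carrier (IV P d')" for d d' \<beta> w
      using f that by (simp add: cat_hom_def)
    have ph: "p d \<in> mod_hom R (Val M d) (Val N d)" if "d \<in> Ob D" for d using p that by (simp add: cat_hom_def)
    have pn: "p d (Act M d d' \<beta> w) = Act N d d' \<beta> (p d' w)"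
      if "d \<in> Ob D" "d' \<in> Ob D" "\<beta> \<in> carrier (Hom D d d')" "w \<in> carrier (Val M d')" for d d' \<beta> w
      using p that by (simp add: cat_hom_def)
    \<comment> \<open>The adjoint transpose of \<open>f\<close>: its composite with the unit, which
      sends \<open>m\<close> to \<open>m\<close> tensor the identity. The lift of \<open>f'\<close>
      over \<open>C\<close> is later transposed back.\<close>
    define f' where "f' x m = f (Fo x) (ind_tensor P (Fo x) x m (Ident D (Fo x)))" for x m
    note Id = D.Ident_in_Hom[OF Fo]
    \<comment> \<open>Naturality of the unit: balancing moves \<open>\<alpha>\<close> to the second
      factor, and the image of \<open>\<alpha>\<close> commutes with identities.\<close>
    have it_nat: "ind_tensor P (Fo x) x (Act P x y \<alpha> m) (Ident D (Fo x)) =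
        Act (Ind R C D Fo Fm P) (Fo x) (Fo y) (Fm x y \<alpha>) (ind_tensor P (Fo y) y m (Ident D (Fo y)))"
      if *: "x \<in> Ob C" "y \<in> Ob C" "\<alpha> \<in> carrier (Hom C x y)" "m \<in> carrier (Val P y)" for x y \<alpha> m
      using ind_tensor_balanced[OF cP Fo[OF *(1)] * Id[OF *(1)]]
        Ind_Act_tensor[OF cP Fo[OF *(1)] Fo[OF *(2)] Fm_closed[OF *(1-3)] *(2,4) Id[OF *(2)]]
      by (simp add: D.Comp_Ident_left D.Comp_Ident_right Fo Fm_closed *)
    have "f' \<in> cat_hom R C P (restriction N)"
      unfolding cat_hom_def mem_Collect_eq
    proof (intro conjI ballI)
      fix x assume x: "x \<in> Ob C"
      show "f' x \<in> mod_hom R (Val P x) (Val (restriction N) x)"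
        unfolding f'_def
        by (rule mod_homI) (simp_all add: restriction_def ind_tensor[OF cP Fo[OF x] x] Id x mod_homD[OF fh[OF Fo[OF x]]])
      fix y \<alpha> m assume y: "y \<in> Ob C" and \<alpha>: "\<alpha> \<in> carrier (Hom C x y)" and m: "m \<in> carrier (Val P y)"
      show "f' x (Act P x y \<alpha> m) = Act (restriction N) x y \<alpha> (f' y m)"
        using fn[OF Fo[OF x] Fo[OF y] Fm_closed[OF x y \<alpha>] ind_tensor_closed[OF cP Fo[OF y] y m Id[OF y]]]
        by (simp add: f'_def it_nat[OF x y \<alpha> m] restriction_def)
    qed
    moreover have "\<forall>x\<in>Ob C. p (Fo x) ` carrier (Val (restriction M) x) = carrier (Val (restriction N) x)"
      using sur[OF Fo] by (simp add: restriction_def)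
    ultimately have "\<exists>h'\<in>cat_hom R C P (restriction M). \<forall>x\<in>Ob C. \<forall>m\<in>carrier (Val P x). p (Fo x) (h' x m) = f' x m"
      using P[unfolded projective_def, THEN conjunct2, rule_format, of "restriction M" "restriction N" "\<lambda>x. p (Fo x)" f']
        contra_module_restriction[OF M] contra_module_restriction[OF N] cat_hom_restriction[OF p] by blast
    then obtain h' where h': "h' \<in> cat_hom R C P (restriction M)"
      and ph': "\<And>x m. x \<in> Ob C \<Longrightarrow> m \<in> carrier (Val P x) \<Longrightarrow> p (Fo x) (h' x m) = f' x m"
      by blast
    have h'h: "h' x \<in> mod_hom R (Val P x) (Val M (Fo x))" if "x \<in> Ob C" for x
      using h' that by (simp add: cat_hom_def restriction_def)
    have h'n: "h' x (Act P x y \<alpha> m) = Act M (Fo x) (Fo y) (Fm x y \<alpha>) (h' y m)"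
      if "x \<in> Ob C" "y \<in> Ob C" "\<alpha> \<in> carrier (Hom C x y)" "m \<in> carrier (Val P y)" for x y \<alpha> m
      using h' that by (simp add: cat_hom_def restriction_def)
    have mM: "module R (Val M d)" if "d \<in> Ob D" for d using M that by (simp add: contra_module_def)
    have mN: "module R (Val N d)" if "d \<in> Ob D" for d using N that by (simp add: contra_module_def)
    have M1: "Act M d d' \<beta> \<in> mod_hom R (Val M d') (Val M d)" if "d \<in> Ob D" "d' \<in> Ob D" "\<beta> \<in> carrier (Hom D d d')" for d d' \<beta>
      using M that by (simp add: contra_module_def)
    have M2: "Act M d d' (\<beta> \<otimes>\<^bsub>Hom D d d'\<^esub> \<gamma>) m = Act M d d' \<beta> m \<oplus>\<^bsub>Val M d\<^esub> Act M d d' \<gamma> m"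
      if "d \<in> Ob D" "d' \<in> Ob D" "\<beta> \<in> carrier (Hom D d d')" "\<gamma> \<in> carrier (Hom D d d')" "m \<in> carrier (Val M d')" for d d' \<beta> \<gamma> m
      using M that by (simp add: contra_module_def)
    have M3: "Act M d d'' (Comp D d d' d'' \<gamma> \<beta>) m = Act M d d' \<beta> (Act M d' d'' \<gamma> m)"
      if "d \<in> Ob D" "d' \<in> Ob D" "d'' \<in> Ob D" "\<beta> \<in> carrier (Hom D d d')" "\<gamma> \<in> carrier (Hom D d' d'')" "m \<in> carrier (Val M d'')" for d d' d'' \<beta> \<gamma> m
      using M that by (simp add: contra_module_def)
    have "\<exists>h\<in>mod_hom R (IV P d) (Val M d). \<forall>x\<in>Ob C. \<forall>m\<in>carrier (Val P x). \<forall>\<gamma>\<in>carrier (Hom D d (Fo x)).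
        h (ind_tensor P d x m \<gamma>) = Act M d (Fo x) \<gamma> (h' x m)" if d: "d \<in> Ob D" for d
    proof (rule Ind_universal[OF cP d mM[OF d]])
      fix x y \<alpha> m \<gamma> assume *: "x \<in> Ob C" "y \<in> Ob C" "\<alpha> \<in> carrier (Hom C x y)" "m \<in> carrier (Val P y)" "\<gamma> \<in> carrier (Hom D d (Fo x))"
      show "Act M d (Fo x) \<gamma> (h' x (Act P x y \<alpha> m)) = Act M d (Fo y) (Comp D d (Fo x) (Fo y) (Fm x y \<alpha>) \<gamma>) (h' y m)"
        by (simp add: h'n * M3 d Fo Fm_closed mod_homD(2)[OF h'h])
    qed (simp_all add: mod_homD[OF M1] mod_homD[OF h'h] M2 d Fo)
    then obtain h where h: "\<And>d. d \<in> Ob D \<Longrightarrow> h d \<in> mod_hom R (IV P d) (Val M d)"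
      and h_it: "\<And>d x m \<gamma>. d \<in> Ob D \<Longrightarrow> x \<in> Ob C \<Longrightarrow> m \<in> carrier (Val P x) \<Longrightarrow> \<gamma> \<in> carrier (Hom D d (Fo x)) \<Longrightarrow>
        h d (ind_tensor P d x m \<gamma>) = Act M d (Fo x) \<gamma> (h' x m)"
      by metis
    have "h \<in> cat_hom R D (Ind R C D Fo Fm P) M"
      unfolding cat_hom_def mem_Collect_eq
    proof (intro conjI ballI)
      fix d assume d: "d \<in> Ob D"
      show "h d \<in> mod_hom R (IV P d) (Val M d)" by (rule h[OF d])
      fix d' \<beta> w assume d': "d' \<in> Ob D" and \<beta>: "\<beta> \<in> carrier (Hom D d d')" and w: "w \<in> carrier (IV P d')"
      show "h d (Act (Ind R C D Fo Fm P) d d' \<beta> w) = Act M d d' \<beta> (h d' w)"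
        by (rule Ind_hom_eqI[OF cP d' mM[OF d] mod_hom_compose[OF Ind_Act_hom[OF cP d d' \<beta>] h[OF d]] mod_hom_compose[OF h[OF d'] M1[OF d d' \<beta>]] _ w])
           (simp add: Ind_Act_tensor[OF cP d d' \<beta>] h_it d d' \<beta> Comp_closed Fo M3 mod_homD(2)[OF h'h])
    qed
    moreover have "p d (h d w) = f d w" if d: "d \<in> Ob D" and w: "w \<in> carrier (IV P d)" for d w
    proof (rule Ind_hom_eqI[OF cP d mN[OF d] mod_hom_compose[OF h[OF d] ph[OF d]] fh[OF d] _ w])
      fix x m \<gamma> assume *: "x \<in> Ob C" "m \<in> carrier (Val P x)" "\<gamma> \<in> carrier (Hom D d (Fo x))"
      have "p d (h d (ind_tensor P d x m \<gamma>)) = Act N d (Fo x) \<gamma> (f' x m)"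
        by (simp add: h_it d * pn Fo mod_homD(2)[OF h'h] ph')
      also have "\<dots> = f d (ind_tensor P d x m \<gamma>)"
        using fn[OF d Fo[OF *(1)] *(3) ind_tensor_closed[OF cP Fo[OF *(1)] *(1,2) Id[OF *(1)]]]
          Ind_Act_tensor[OF cP d Fo[OF *(1)] *(3) *(1,2) Id[OF *(1)]] D.Comp_Ident_left[OF d Fo[OF *(1)] *(3)]
        by (simp add: f'_def)
      finally show "p d (h d (ind_tensor P d x m \<gamma>)) = f d (ind_tensor P d x m \<gamma>)" .
    qed
    ultimately show ?thesis by blast
  qed
  show ?thesis
    unfolding projective_def
  proof (intro conjI allI impI; (elim conjE)?)
    show "contra_module R D (Ind R C D Fo Fm P)" by (rule contra_module_Ind[OF cP])
  qed (rule lift; blast)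
qed

end


section \<open>Orbits of finite subgroups on cosets\<close>

lemma lookup_frag_extend_inj:
  assumes "inj_on \<pi> S" "Poly_Mapping.keys u \<subseteq> S" "z \<in> S"
  shows "Poly_Mapping.lookup (frag_extend (\<lambda>x. frag_of (\<pi> x)) u) (\<pi> z) = Poly_Mapping.lookup u z"
proof -
  have "z \<in> S \<longrightarrow> Poly_Mapping.lookup (frag_extend (\<lambda>x. frag_of (\<pi> x)) u) (\<pi> z) = Poly_Mapping.lookup u z"
    using assms(2)
  proof (induction u rule: frag_induction)
    case (one x) then show ?case using assms(1) by (auto simp: inj_on_eq_iff)
  qed (auto simp: frag_extend_diff lookup_minus)
  then show ?thesis using assms(3) by simp
qed

locale subgroup_family_group = group G for G :: "('g, 'l) monoid_scheme" (structure) +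
  fixes \<F> :: "'g set set"
  assumes family: "subgroup_family G \<F>"
begin

abbreviation "OC \<equiv> orbit_category G \<F>"
abbreviation "HC \<equiv> hecke_category G \<F>"

definition coset_map :: "'g set \<Rightarrow> 'g set \<Rightarrow> 'g set \<Rightarrow> 'g set" where
  \<comment> \<open>the \<open>G\<close>-map on \<open>G/L\<close> with \<open>L \<mapsto> z\<close>, for a coset \<open>z\<close> that \<open>L\<close> fixes\<close>
  "coset_map L z = (\<lambda>Y\<in>lcosets L. Y <#> z)"

definition stab :: "'g set \<Rightarrow> 'g set \<Rightarrow> 'g set" where
  "stab H z = {h \<in> H. h <# z = z}"

text \<open>For a proper subgroup L of a finite H there is no G-map G/H -> G/L; the transfer is the
  wrong-way morphism that the Hecke category adds.\<close>

definition transfer :: "'g set \<Rightarrow> 'g set \<Rightarrow> ('g set \<Rightarrow>\<^sub>0 int) \<Rightarrow> ('g set \<Rightarrow>\<^sub>0 int)" where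
  "transfer H L = (\<lambda>v\<in>carrier (perm_module G H). frag_extend (\<lambda>X. \<Sum>Y | Y \<in> lcosets L \<and> Y \<subseteq> X. frag_of Y) v)"

section \<open>Cosets, G-maps between coset spaces, and stabilisers\<close>

lemma fam_sub: "H \<in> \<F> \<Longrightarrow> subgroup H G" and fam_fin: "H \<in> \<F> \<Longrightarrow> finite H"
  and fam_le: "H \<in> \<F> \<Longrightarrow> subgroup L G \<Longrightarrow> L \<subseteq> H \<Longrightarrow> L \<in> \<F>"
  using family unfolding subgroup_family_def by blast+

lemma fam_carrier: "H \<in> \<F> \<Longrightarrow> H \<subseteq> carrier G"
  using fam_sub subgroup.subset by blast

lemma lcosets_cases:
  assumes "X \<in> lcosets H" obtains g where "g \<in> carrier G" "X = g <# H"
  using assms by (auto simp: LCOSETS_def)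

lemma lcosets_I: "g \<in> carrier G \<Longrightarrow> g <# H \<in> lcosets H"
  by (auto simp: LCOSETS_def)

lemma sub_lcosets: "subgroup H G \<Longrightarrow> H \<in> lcosets H"
  using lcosets_I[OF one_closed, of H] lcos_mult_one[of H] subgroup.subset[of H G] by simp

lemma lcosets_sub: "X \<in> lcosets H \<Longrightarrow> subgroup H G \<Longrightarrow> X \<subseteq> carrier G"
  using subgroup.lcosets_carrier is_group by blast

lemma lcos_set_mult: "g \<in> carrier G \<Longrightarrow> A \<subseteq> carrier G \<Longrightarrow> B \<subseteq> carrier G \<Longrightarrow> (g <# A) <#> B = g <# (A <#> B)"
  by (simp add: l_coset_eq_set_mult set_mult_assoc)

lemma set_mult_fixed:
  assumes "L \<noteq> {}" "\<And>l. l \<in> L \<Longrightarrow> l <# z = z"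
  shows "L <#> z = z"
proof -
  have "L <#> z = (\<Union>l\<in>L. l <# z)" by (auto simp: set_mult_def l_coset_def)
  then show ?thesis using assms by auto
qed

text \<open>Defining the map by the set product of \<open>Y\<close> and \<open>z\<close> avoids
  choosing a representative of \<open>Y\<close>; since \<open>L <#> z = z\<close>, any
  representative \<open>g\<close> gives the value \<open>g <# z\<close>.\<close>

lemma coset_map_apply:
  assumes "subgroup L G" "z \<subseteq> carrier G" "\<And>l. l \<in> L \<Longrightarrow> l <# z = z" "g \<in> carrier G"
  shows "coset_map L z (g <# L) = g <# z"
proof -
  have "L <#> z = z" using subgroup.one_closed[OF assms(1)] assms(3) by (intro set_mult_fixed) auto
  then show ?thesis
    using lcosets_I[OF assms(4), of L] assms(2,4) subgroup.subset[OF assms(1)] by (simp add: coset_map_def lcos_set_mult)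
qed

lemma coset_map_base:
  assumes "subgroup L G" "z \<subseteq> carrier G" "\<And>l. l \<in> L \<Longrightarrow> l <# z = z"
  shows "coset_map L z L = z"
  using coset_map_apply[OF assms one_closed] assms(2) subgroup.subset[OF assms(1)] by (simp add: lcos_mult_one)

lemma coset_map_G_maps:
  assumes "subgroup L G" "subgroup K G" "z \<in> lcosets K" "\<And>l. l \<in> L \<Longrightarrow> l <# z = z"
  shows "coset_map L z \<in> G_maps G L K"
proof -
  have z: "z \<subseteq> carrier G" by (rule lcosets_sub[OF assms(3,2)])
  note ap = coset_map_apply[OF assms(1) z assms(4)]
  have L: "L \<subseteq> carrier G" by (rule subgroup.subset[OF assms(1)])
  show ?thesis
    unfolding G_maps_def
    using lcosets_act[OF is_group subgroup.subset[OF assms(2)] _ assms(3)] z L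
    by (auto elim!: lcosets_cases simp: ap lcos_m_assoc) (auto simp: coset_map_def)
qed

text \<open>G acts transitively on G/L, so a G-map is determined by the image of the base coset,
  which must be fixed by L.\<close>

lemma G_maps_coset_map:
  assumes "\<alpha> \<in> G_maps G L K" "subgroup L G" "subgroup K G"
  shows "\<alpha> L \<in> lcosets K" "l \<in> L \<Longrightarrow> l <# \<alpha> L = \<alpha> L" "\<alpha> = coset_map L (\<alpha> L)"
proof -
  have L: "L \<in> lcosets L" by (rule sub_lcosets[OF assms(2)])
  have eq: "\<alpha> (g <# X) = g <# \<alpha> X" if "g \<in> carrier G" "X \<in> lcosets L" for g X
    using assms(1) that by (auto simp: G_maps_def)
  show z: "\<alpha> L \<in> lcosets K" using assms(1) L by (auto simp: G_maps_def)
  show stb: "l <# \<alpha> L = \<alpha> L" if "l \<in> L" for l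
  proof -
    have l: "l \<in> carrier G" using that subgroup.subset[OF assms(2)] by auto
    show ?thesis using eq[OF l L] coset_join3[OF l assms(2) that] by simp
  qed
  show "\<alpha> = coset_map L (\<alpha> L)"
  proof (rule extensionalityI[of _ "lcosets L"])
    show "\<alpha> \<in> extensional (lcosets L)" using assms(1) by (auto simp: G_maps_def PiE_def)
    show "coset_map L (\<alpha> L) \<in> extensional (lcosets L)" by (simp add: coset_map_def)
    fix X assume "X \<in> lcosets L"
    then show "\<alpha> X = coset_map L (\<alpha> L) X"
      by (elim lcosets_cases) (simp add: eq L coset_map_apply[OF assms(2) lcosets_sub[OF z assms(3)] stb])
  qed
qed

text \<open>In terms of set products, composition of G-maps is associativity of
  multiplication.\<close>

lemma compose_coset_map:
  assumes "subgroup L G" "subgroup L' G" "subgroup K G" "z' \<in> lcosets L'" "\<And>l. l \<in> L \<Longrightarrow> l <# z' = z'"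
    and "z \<in> lcosets K" "\<And>l. l \<in> L' \<Longrightarrow> l <# z = z"
  shows "compose (lcosets L) (coset_map L' z) (coset_map L z') = coset_map L (z' <#> z)"
proof -
  note s = lcosets_sub[OF assms(4,2)] lcosets_sub[OF assms(6,3)]
  have "coset_map L z' \<in> G_maps G L L'" by (rule coset_map_G_maps) (use assms in auto)
  then show ?thesis
    using s lcosets_sub[OF _ assms(1)]
    by (auto simp: compose_def fun_eq_iff coset_map_def G_maps_def set_mult_assoc)
qed

lemma set_mult_coset:
  assumes "subgroup L' G" "z \<subseteq> carrier G" "\<And>l. l \<in> L' \<Longrightarrow> l <# z = z" "k \<in> carrier G"
  shows "(k <# L') <#> z = k <# z"
proof -
  have "L' <#> z = z" using subgroup.one_closed[OF assms(1)] assms(3) by (intro set_mult_fixed) auto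
  then show ?thesis using assms(2,4) subgroup.subset[OF assms(1)] by (simp add: lcos_set_mult)
qed

lemma stab_sub:
  assumes "H \<in> \<F>" "subgroup K G" "z \<in> lcosets K"
  shows "subgroup (stab H z) G" "stab H z \<subseteq> H" "stab H z \<in> \<F>"
proof -
  have z: "z \<subseteq> carrier G" by (rule lcosets_sub[OF assms(3,2)])
  note H = fam_sub[OF assms(1)] and Hc = fam_carrier[OF assms(1)]
  show "stab H z \<subseteq> H" by (auto simp: stab_def)
  show sg: "subgroup (stab H z) G"
  proof (rule subgroupI)
    show "stab H z \<subseteq> carrier G" using Hc by (auto simp: stab_def)
    show "stab H z \<noteq> {}" using subgroup.one_closed[OF H] z by (auto simp: stab_def lcos_mult_one)
    fix a assume a: "a \<in> stab H z"
    then have aH: "a \<in> H" "a \<in> carrier G" and az: "a <# z = z" using Hc by (auto simp: stab_def)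
    have "inv a <# z = inv a <# (a <# z)" by (simp add: az)
    also have "\<dots> = z" using aH z by (simp add: lcos_m_assoc lcos_mult_one)
    finally show "inv a \<in> stab H z" using aH subgroup.m_inv_closed[OF H] by (simp add: stab_def)
    fix b assume b: "b \<in> stab H z"
    have "b \<in> carrier G" "b <# z = z" using b Hc by (auto simp: stab_def)
    then have "a \<otimes> b <# z = z" using lcos_m_assoc[OF z aH(2), of b] az by simp
    then show "a \<otimes> b \<in> stab H z" using a b subgroup.m_closed[OF H] by (simp add: stab_def)
  qed
  show "stab H z \<in> \<F>" by (rule fam_le[OF assms(1) sg]) (auto simp: stab_def)
qed

lemma sub_cosets_eq:
  assumes "H \<in> \<F>" "L \<in> \<F>" "L \<subseteq> H" "g \<in> carrier G"
  shows "{Y. Y \<in> lcosets L \<and> Y \<subseteq> g <# H} = (\<lambda>h. (g \<otimes> h) <# L) ` H"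
proof (intro Set.set_eqI iffI)
  note H = fam_sub[OF assms(1)] and Hc = fam_carrier[OF assms(1)] and L = fam_sub[OF assms(2)]
  fix Y
  assume "Y \<in> {Y. Y \<in> lcosets L \<and> Y \<subseteq> g <# H}"
  then obtain a where a: "a \<in> carrier G" "Y = a <# L" "a <# L \<subseteq> g <# H" by (auto elim: lcosets_cases)
  then have "a \<in> g <# H" using lcos_self[OF a(1) L] by blast
  then show "Y \<in> (\<lambda>h. (g \<otimes> h) <# L) ` H" using a by (auto simp: l_coset_def)
next
  note H = fam_sub[OF assms(1)] and Hc = fam_carrier[OF assms(1)] and L = fam_sub[OF assms(2)]
  fix Y assume "Y \<in> (\<lambda>h. (g \<otimes> h) <# L) ` H"
  then obtain h where h: "h \<in> H" "Y = (g \<otimes> h) <# L" by auto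
  have "Y \<subseteq> g <# H"
    using h assms(3,4) Hc subgroup.m_closed[OF H h(1)] by (auto simp: l_coset_def m_assoc subset_iff)
  then show "Y \<in> {Y. Y \<in> lcosets L \<and> Y \<subseteq> g <# H}" using h assms(4) Hc by (auto intro!: lcosets_I)
qed

lemma sub_cosets_base:
  assumes "H \<in> \<F>" "L \<in> \<F>" "L \<subseteq> H"
  shows "{Y. Y \<in> lcosets L \<and> Y \<subseteq> H} = (\<lambda>h. h <# L) ` H"
proof -
  have "(\<lambda>h. (\<one> \<otimes> h) <# L) ` H = (\<lambda>h. h <# L) ` H"
    using fam_carrier[OF assms(1)] by (intro image_cong) auto
  then show ?thesis
    using sub_cosets_eq[OF assms one_closed] fam_carrier[OF assms(1)] by (simp add: lcos_mult_one)
qed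

section \<open>Hecke morphisms: evaluation at the base coset, transfers and orbit sums\<close>

lemma carrier_Hom_HC:
  "f \<in> carrier (Hom HC H K) \<longleftrightarrow> f \<in> hom (perm_module G H) (perm_module G K) \<and> f \<in> extensional (carrier (perm_module G H)) \<and>
     (\<forall>g\<in>carrier G. \<forall>v\<in>carrier (perm_module G H). f (perm_act G g v) = perm_act G g (f v))"
  by (simp add: hecke_category_def)

lemma HC_simps [simp]: "Ob HC = \<F>" "Ob OC = \<F>"
  by (simp_all add: hecke_category_def orbit_category_def)

lemma Hom_OC [simp]: "Hom OC H K = free_Abelian_group (G_maps G H K)"
  by (simp add: orbit_category_def)

lemma Comp_OC_of: "Comp OC H K L (frag_of \<beta>) (frag_of \<alpha>) = frag_of (compose (lcosets H) \<beta> \<alpha>)"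
  by (simp add: orbit_category_def)

lemma additive_functor_pi_sigma: "cring R \<Longrightarrow> additive_functor OC HC R (\<lambda>H. H) (pi_sigma G)"
proof (intro additive_functor.intro additive_functor_axioms.intro)
  show "preadditive_category OC" "preadditive_category HC"
    using preadditive_orbit_category preadditive_hecke_category is_group family by auto
  show "pi_sigma G x y \<in> hom (Hom OC x y) (Hom HC x y)" if "x \<in> Ob OC" "y \<in> Ob OC" for x y
    using pi_sigma_hom[OF is_group family] that by (simp del: Hom_OC)
  show "pi_sigma G x z (Comp OC x y z g f) = Comp HC x y z (pi_sigma G y z g) (pi_sigma G x y f)"
    if "x \<in> Ob OC" "y \<in> Ob OC" "z \<in> Ob OC" "f \<in> carrier (Hom OC x y)" "g \<in> carrier (Hom OC y z)" for x y z f g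
    using pi_sigma_functor(1)[OF is_group family _ _ _ that(4,5)] that by simp
  show "pi_sigma G x x (Ident OC x) = Ident HC x" if "x \<in> Ob OC" for x
    using pi_sigma_functor(2)[OF is_group family, of x x x] that preadditive_category.Ident_in_Hom[OF preadditive_orbit_category[OF is_group family], of x]
    by simp
qed simp_all

lemma HC_value_hom:
  assumes "v \<in> carrier (perm_module G H)"
  shows "(\<lambda>f. f v) \<in> hom (Hom HC H K) (perm_module G K)"
  using assms by (auto simp: hom_def hecke_category_def Pi_iff)

text \<open>The base coset generates the permutation module over the group ring.\<close>

lemma HC_eqI:
  assumes "H \<in> \<F>" "K \<in> \<F>" "f \<in> carrier (Hom HC H K)" "f' \<in> carrier (Hom HC H K)" "f (frag_of H) = f' (frag_of H)"
  shows "f = f'"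
proof (rule extensionalityI[of _ "carrier (perm_module G H)"])
  show "f \<in> extensional (carrier (perm_module G H))" "f' \<in> extensional (carrier (perm_module G H))"
    using assms by (simp_all add: carrier_Hom_HC)
  have gen: "f (frag_of X) = f' (frag_of X)" if "X \<in> lcosets H" for X
  proof -
    obtain g where g: "g \<in> carrier G" "X = g <# H" using \<open>X \<in> lcosets H\<close> by (rule lcosets_cases)
    have "frag_of H \<in> carrier (perm_module G H)" using sub_lcosets[OF fam_sub[OF assms(1)]] by simp
    then have "f (perm_act G g (frag_of H)) = f' (perm_act G g (frag_of H))"
      using assms(3-5) g(1) by (simp add: carrier_Hom_HC)
    then show ?thesis by (simp add: perm_act_def g)
  qed
  fix v assume v: "v \<in> carrier (perm_module G H)"
  show "f v = f' v"
    by (rule frag_hom_eqI[where S = "lcosets H" and V = "perm_module G K"]) (use assms(3,4) gen v in \<open>simp_all add: carrier_Hom_HC\<close>)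
qed

lemma fin_sub_cosets:
  assumes "H \<in> \<F>" "L \<in> \<F>" "L \<subseteq> H" "X \<in> lcosets H"
  shows "finite {Y. Y \<in> lcosets L \<and> Y \<subseteq> X}"
  using assms(4) fam_fin[OF assms(1)] sub_cosets_eq[OF assms(1-3)] by (auto elim!: lcosets_cases)

lemma transfer_closed:
  assumes "H \<in> \<F>" "L \<in> \<F>" "L \<subseteq> H"
  shows "transfer H L \<in> carrier (Hom HC H L)"
proof -
  let ?c = "\<lambda>X. \<Sum>Y | Y \<in> lcosets L \<and> Y \<subseteq> X. frag_of Y"
  note fin = fin_sub_cosets[OF assms]
  have c: "Poly_Mapping.keys (?c X) \<subseteq> lcosets L" if "X \<in> lcosets H" for X
    by (rule order_trans[OF keys_sum]) auto
  have cl: "Poly_Mapping.keys (frag_extend ?c v) \<subseteq> lcosets L" if "Poly_Mapping.keys v \<subseteq> lcosets H" for v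
    by (rule frag_extend_closed[OF that c])
  have act: "?c (g <# X) = frag_extend (\<lambda>X. frag_of (g <# X)) (?c X)" if g: "g \<in> carrier G" and X: "X \<in> lcosets H" for g X
  proof -
    obtain a where a: "a \<in> carrier G" "X = a <# H" using X by (rule lcosets_cases)
    have gX: "g <# X = (g \<otimes> a) <# H" using a g fam_carrier[OF assms(1)] by (simp add: lcos_m_assoc)
    \<comment> \<open>Translation by \<open>g\<close> is a bijection from the cosets of L inside X
      to those inside gX; this gives the equivariance of the transfer.\<close>
    have im: "{Y. Y \<in> lcosets L \<and> Y \<subseteq> g <# X} = (\<lambda>Y. g <# Y) ` {Y. Y \<in> lcosets L \<and> Y \<subseteq> X}"
    proof -
      have "g \<otimes> a \<otimes> h <# L = g <# (a \<otimes> h <# L)" if "h \<in> H" for h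
        using that g a(1) fam_carrier[OF assms(1)] fam_carrier[OF assms(2)] by (simp add: lcos_m_assoc m_assoc subset_iff)
      then show ?thesis
        using sub_cosets_eq[OF assms m_closed[OF g a(1)]] sub_cosets_eq[OF assms a(1)]
        by (simp add: gX a(2)[symmetric] image_image)
    qed
    have inj: "inj_on (\<lambda>Y. g <# Y) {Y. Y \<in> lcosets L \<and> Y \<subseteq> X}"
    proof (rule inj_on_inverseI[where g = "\<lambda>Y. inv g <# Y"])
      fix Y assume "Y \<in> {Y. Y \<in> lcosets L \<and> Y \<subseteq> X}"
      then have "Y \<subseteq> carrier G" using lcosets_sub fam_sub[OF assms(2)] by blast
      then show "inv g <# (g <# Y) = Y" using g by (simp add: lcos_m_assoc lcos_mult_one)
    qed
    show ?thesis unfolding im by (simp add: sum.reindex[OF inj] frag_extend_sum[OF fin[OF X]])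
  qed
  have eq: "frag_extend ?c (perm_act G g v) = perm_act G g (frag_extend ?c v)"
    if "g \<in> carrier G" "Poly_Mapping.keys v \<subseteq> lcosets H" for g v
    unfolding perm_act_def frag_extend_extend using that act by (intro frag_extend_eq) (auto simp: subset_iff)
  show ?thesis
    using cl eq perm_act_closed[OF is_group fam_carrier[OF assms(1)]]
    by (auto del: subsetI simp: transfer_def hecke_category_def hom_def keys_add_closed frag_extend_add)
qed

lemma transfer_base: "H \<in> \<F> \<Longrightarrow> transfer H L (frag_of H) = (\<Sum>Y | Y \<in> lcosets L \<and> Y \<subseteq> H. frag_of Y)"
  using sub_lcosets[OF fam_sub] by (simp add: transfer_def)

lemma pi_sigma_closed:
  assumes "\<alpha> \<in> G_maps G L K" "L \<in> \<F>" "K \<in> \<F>"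
  shows "pi_sigma G L K (frag_of \<alpha>) \<in> carrier (Hom HC L K)"
  using hom_in_carrier[OF pi_sigma_hom[OF is_group family assms(2,3)], of "frag_of \<alpha>"] assms(1) by simp

lemma HC_Comp_closed:
  assumes "H \<in> \<F>" "L \<in> \<F>" "K \<in> \<F>" "f \<in> carrier (Hom HC H L)" "f' \<in> carrier (Hom HC L K)"
  shows "Comp HC H L K f' f \<in> carrier (Hom HC H K)"
  using hom_in_carrier[OF preadditive_category.Comp_right_hom[OF preadditive_hecke_category[OF is_group family], of H L K f']] assms by simp

text \<open>The choice is made from the orbit as a set, so it is the same for all of its points
  (\<open>orbit_rep_act\<close>).\<close>

definition orbit_rep :: "'g set \<Rightarrow> 'g set \<Rightarrow> 'g set" where
  "orbit_rep H z = (SOME z'. z' \<in> (\<lambda>h. h <# z) ` H)"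

lemma orbit_rep_in: "H \<in> \<F> \<Longrightarrow> orbit_rep H z \<in> (\<lambda>h. h <# z) ` H"
  unfolding orbit_rep_def by (rule someI[of _ "\<one> <# z"]) (use subgroup.one_closed[OF fam_sub] in auto)

lemma orbit_rep_act:
  assumes "H \<in> \<F>" "k \<in> H" "z \<subseteq> carrier G"
  shows "orbit_rep H (k <# z) = orbit_rep H z"
proof -
  have "(\<lambda>h. h <# (k <# z)) ` H = (\<lambda>h. h <# z) ` (\<lambda>h. h \<otimes> k) ` H"
    unfolding image_image using assms fam_carrier[OF assms(1)] by (intro image_cong refl) (simp add: lcos_m_assoc subset_iff)
  also have "(\<lambda>h. h \<otimes> k) ` H = H"
    using coset_join2[OF _ fam_sub[OF assms(1)] assms(2)] assms(2) fam_carrier[OF assms(1)] by (auto simp: r_coset_def)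
  finally show ?thesis by (simp add: orbit_rep_def)
qed

definition orbit_hom :: "'g set \<Rightarrow> 'g set \<Rightarrow> 'g set \<Rightarrow> ('g set \<Rightarrow>\<^sub>0 int) \<Rightarrow> ('g set \<Rightarrow>\<^sub>0 int)" where
  \<comment> \<open>maps \<open>H\<close> to the sum of the \<open>H\<close>-orbit of the coset \<open>z\<close>\<close>
  "orbit_hom H K z = Comp HC H (stab H z) K (pi_sigma G (stab H z) K (frag_of (coset_map (stab H z) z))) (transfer H (stab H z))"

lemma stab_map: "H \<in> \<F> \<Longrightarrow> K \<in> \<F> \<Longrightarrow> z \<in> lcosets K \<Longrightarrow> coset_map (stab H z) z \<in> G_maps G (stab H z) K"
  using stab_sub(1)[OF _ fam_sub] fam_sub by (intro coset_map_G_maps) (auto simp: stab_def)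

lemma orbit_hom_closed:
  assumes "H \<in> \<F>" "K \<in> \<F>" "z \<in> lcosets K"
  shows "orbit_hom H K z \<in> carrier (Hom HC H K)"
  unfolding orbit_hom_def
  using stab_sub[OF assms(1) fam_sub[OF assms(2)] assms(3)]
  by (intro HC_Comp_closed assms transfer_closed pi_sigma_closed stab_map) auto

lemma comp_transfer_base:
  assumes "H \<in> \<F>" "L \<in> \<F>" "L \<subseteq> H" "subgroup K G" "z \<in> lcosets K" "\<And>l. l \<in> L \<Longrightarrow> l <# z = z"
  shows "Comp HC H L K (pi_sigma G L K (frag_of (coset_map L z))) (transfer H L) (frag_of H)
    = (\<Sum>Y\<in>(\<lambda>h. h <# L) ` H. frag_of (coset_map L z Y))"
proof -
  have "frag_of H \<in> carrier (perm_module G H)" using sub_lcosets[OF fam_sub[OF assms(1)]] by simp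
  moreover have "transfer H L (frag_of H) \<in> carrier (perm_module G L)"
    using hom_in_carrier[OF HC_value_hom[OF calculation] transfer_closed[OF assms(1-3)]] .
  ultimately show ?thesis
    using fam_fin[OF assms(1)]
    by (simp add: hecke_category_def compose_def pi_sigma_of transfer_base[OF assms(1)] sub_cosets_base[OF assms(1-3)] frag_extend_sum)
qed

text \<open>Orbit-stabiliser: the cosets of the stabiliser in H correspond bijectively to the points
  of the orbit, so each point occurs with coefficient one.\<close>

lemma orbit_hom_base:
  assumes "H \<in> \<F>" "K \<in> \<F>" "z \<in> lcosets K"
  shows "orbit_hom H K z (frag_of H) = (\<Sum>z'\<in>(\<lambda>h. h <# z) ` H. frag_of z')"
proof -
  let ?S = "stab H z"
  note S = stab_sub[OF assms(1) fam_sub[OF assms(2)] assms(3)] and Hc = fam_carrier[OF assms(1)]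
  have z: "z \<subseteq> carrier G" by (rule lcosets_sub[OF assms(3) fam_sub[OF assms(2)]])
  have stb: "l <# z = z" if "l \<in> ?S" for l using that by (simp add: stab_def)
  have ap: "coset_map ?S z (h <# ?S) = h <# z" if "h \<in> H" for h
    using coset_map_apply[OF S(1) z stb] that Hc by auto
  have inj: "inj_on (coset_map ?S z) ((\<lambda>h. h <# ?S) ` H)"
  proof (rule inj_onI, clarify)
    fix h h' assume h: "h \<in> H" "h' \<in> H" "coset_map ?S z (h <# ?S) = coset_map ?S z (h' <# ?S)"
    then have hz: "h <# z = h' <# z" by (simp add: ap)
    have c: "h \<in> carrier G" "h' \<in> carrier G" using h Hc by auto
    have "inv h \<otimes> h' <# z = inv h <# (h' <# z)" using c z by (simp add: lcos_m_assoc)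
    also have "\<dots> = z" using c z by (simp add: hz[symmetric] lcos_m_assoc lcos_mult_one)
    finally have "inv h \<otimes> h' \<in> ?S"
      using h fam_sub[OF assms(1)] by (simp add: stab_def subgroup.m_closed subgroup.m_inv_closed)
    then have "h' \<in> h <# ?S" using c by (auto simp: l_coset_def m_assoc[symmetric] intro!: bexI[of _ "inv h \<otimes> h'"])
    then show "h <# ?S = h' <# ?S" by (rule l_repr_independence[OF _ c(1) S(1)])
  qed
  have "orbit_hom H K z (frag_of H) = (\<Sum>Y\<in>(\<lambda>h. h <# ?S) ` H. frag_of (coset_map ?S z Y))"
    unfolding orbit_hom_def by (rule comp_transfer_base[OF assms(1) S(3,2) fam_sub[OF assms(2)] assms(3) stb])
  also have "\<dots> = (\<Sum>z'\<in>coset_map ?S z ` (\<lambda>h. h <# ?S) ` H. frag_of z')"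
    by (simp add: sum.reindex[OF inj])
  also have "coset_map ?S z ` (\<lambda>h. h <# ?S) ` H = (\<lambda>h. h <# z) ` H"
    by (auto simp: image_image ap)
  finally show ?thesis .
qed

text \<open>The value of \<open>f\<close> at the base point is an \<open>H\<close>-invariant element of \<open>\<int>[G/K]\<close>, hence a
  combination of orbit sums.\<close>

lemma orbit_homs_generate:
  assumes H: "H \<in> \<F>" and K: "K \<in> \<F>" and E: "subgroup E (Hom HC H K)"
    and gen: "\<And>z. z \<in> lcosets K \<Longrightarrow> orbit_hom H K z \<in> E" and f: "f \<in> carrier (Hom HC H K)"
  shows "f \<in> E"
  using f
proof (induction "card (Poly_Mapping.keys (f (frag_of H)))" arbitrary: f rule: less_induct)
  case less
  interpret HK: comm_group "Hom HC H K"
    using preadditive_category.Hom_comm_group[OF preadditive_hecke_category[OF is_group family]] H K by simp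
  note Hc = fam_carrier[OF H]
  have b: "frag_of H \<in> carrier (perm_module G H)" using sub_lcosets[OF fam_sub[OF H]] by simp
  note ev = HC_value_hom[OF b, of K]
  let ?u = "f (frag_of H)"
  have u: "Poly_Mapping.keys ?u \<subseteq> lcosets K" using hom_in_carrier[OF ev less.prems] by simp
  \<comment> \<open>H fixes its own base coset, so the value of \<open>f\<close> there is
    H-invariant and its coefficients are constant along H-orbits.\<close>
  have inv: "Poly_Mapping.lookup ?u (h <# z) = Poly_Mapping.lookup ?u z" if h: "h \<in> H" and z: "z \<in> lcosets K" for h z
  proof -
    have hc: "h \<in> carrier G" using h Hc by auto
    have "perm_act G h ?u = f (perm_act G h (frag_of H))" using less.prems hc b by (simp add: carrier_Hom_HC)
    also have "perm_act G h (frag_of H) = frag_of H"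
      using coset_join3[OF hc fam_sub[OF H] h] by (simp add: perm_act_def)
    finally have "perm_act G h ?u = ?u" .
    moreover have "inj_on (\<lambda>X. h <# X) (lcosets K)"
    proof (rule inj_on_inverseI[where g = "\<lambda>Y. inv h <# Y"])
      fix Y assume "Y \<in> lcosets K"
      then show "inv h <# (h <# Y) = Y" using hc lcosets_sub[OF _ fam_sub[OF K]] by (simp add: lcos_m_assoc lcos_mult_one)
    qed
    ultimately show ?thesis using lookup_frag_extend_inj[OF _ u z] by (metis perm_act_def)
  qed
  show ?case
  proof (cases "?u = 0")
    case True
    then have "f = \<one>\<^bsub>Hom HC H K\<^esub>"
      using b by (intro HC_eqI[OF H K less.prems HK.one_closed]) (simp add: hecke_category_def)
    then show ?thesis using subgroup.one_closed[OF E] by simp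
  next
    case False
    then obtain z where z: "z \<in> Poly_Mapping.keys ?u" by (metis all_not_in_conv keys_eq_empty)
    then have zK: "z \<in> lcosets K" using u by auto
    let ?n = "orbit_hom H K z" and ?c = "Poly_Mapping.lookup ?u z" and ?O = "(\<lambda>h. h <# z) ` H"
    have n: "?n \<in> carrier (Hom HC H K)" by (rule orbit_hom_closed[OF H K zK])
    \<comment> \<open>All coefficients on the orbit of \<open>z\<close> equal \<open>?c\<close>, so
      subtracting \<open>?c\<close> times the orbit sum clears the whole orbit and strictly shrinks
      the support.\<close>
    define f' where "f' = f \<otimes>\<^bsub>Hom HC H K\<^esub> ?n [^]\<^bsub>Hom HC H K\<^esub> (- ?c)"
    have f': "f' \<in> carrier (Hom HC H K)" using less.prems n by (simp add: f'_def)
    have nb: "?n (frag_of H) = (\<Sum>z'\<in>?O. frag_of z')" by (rule orbit_hom_base[OF H K zK])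
    have "f' (frag_of H) = ?u + frag_cmul (- ?c) (\<Sum>z'\<in>?O. frag_of z')"
      using hom_mult[OF ev less.prems HK.int_pow_closed[OF n]] hom_int_pow[OF ev n HK.is_group group_free_Abelian_group]
        hom_in_carrier[OF ev n] by (simp add: f'_def nb)
    then have lk: "Poly_Mapping.lookup (f' (frag_of H)) w = (if w \<in> ?O then 0 else Poly_Mapping.lookup ?u w)" for w
      using inv[OF _ zK] fam_fin[OF H] by (auto simp: lookup_add lookup_sum lookup_frag_of sum.delta' if_distrib cong: if_cong)
    have "z \<in> ?O" using subgroup.one_closed[OF fam_sub[OF H]] lcos_mult_one[OF lcosets_sub[OF zK fam_sub[OF K]]] by (metis imageI)
    then have "Poly_Mapping.keys (f' (frag_of H)) \<subset> Poly_Mapping.keys ?u"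
      using z by (auto simp: lk in_keys_iff psubset_eq set_eq_iff split: if_splits)
    then have "f' \<in> E" by (intro less.hyps f' psubset_card_mono) auto
    moreover have "?n [^]\<^bsub>Hom HC H K\<^esub> ?c \<in> E" using HK.subgroup_int_pow_closed[OF E gen[OF zK]] .
    ultimately have "f' \<otimes>\<^bsub>Hom HC H K\<^esub> ?n [^]\<^bsub>Hom HC H K\<^esub> ?c \<in> E" by (rule subgroup.m_closed[OF E])
    also have "f' \<otimes>\<^bsub>Hom HC H K\<^esub> ?n [^]\<^bsub>Hom HC H K\<^esub> ?c = f"
      using n less.prems by (simp add: f'_def HK.m_assoc HK.int_pow_mult[symmetric])
    finally show ?thesis .
  qed
qed

end


section \<open>Maps induced by homomorphisms over the orbit category of a subgroup\<close>

lemma hom_chain: "h \<in> hom A B \<Longrightarrow> i \<in> hom B C \<Longrightarrow> (\<lambda>x. i (h x)) \<in> hom A C"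
  by (simp add: hom_def Pi_iff)

text \<open>Combined with \<open>orbit_homs_generate\<close>, this reduces the equality of two
  homomorphisms on a morphism group to the orbit sums.\<close>

lemma subgroup_equalizer:
  assumes "group A" "group B" "f \<in> hom A B" "g \<in> hom A B"
  shows "subgroup {x \<in> carrier A. f x = g x} A"
proof -
  interpret f: group_hom A B f using assms by (simp add: group_hom_def group_hom_axioms_def)
  interpret g: group_hom A B g using assms by (simp add: group_hom_def group_hom_axioms_def)
  show ?thesis
    by (rule group.subgroupI[OF assms(1)]) auto
qed

context subgroup_family_group
begin

lemma orbit_module:
  assumes "contra_module R OC P"
  shows orbit_module_mod: "L \<in> \<F> \<Longrightarrow> module R (Val P L)"
    and orbit_act: "L \<in> \<F> \<Longrightarrow> K \<in> \<F> \<Longrightarrow> \<alpha> \<in> G_maps G L K \<Longrightarrow> Act P L K (frag_of \<alpha>) \<in> mod_hom R (Val P K) (Val P L)"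
    and orbit_act_hom: "L \<in> \<F> \<Longrightarrow> K \<in> \<F> \<Longrightarrow> m \<in> carrier (Val P K) \<Longrightarrow>
      (\<lambda>u. Act P L K u m) \<in> hom (free_Abelian_group (G_maps G L K)) (add_monoid (Val P L))"
    and orbit_act_id: "L \<in> \<F> \<Longrightarrow> m \<in> carrier (Val P L) \<Longrightarrow> Act P L L (frag_of (\<lambda>X\<in>lcosets L. X)) m = m"
    and orbit_act_comp: "L \<in> \<F> \<Longrightarrow> K \<in> \<F> \<Longrightarrow> K' \<in> \<F> \<Longrightarrow> \<alpha> \<in> G_maps G L K \<Longrightarrow> \<beta> \<in> G_maps G K K' \<Longrightarrow> m \<in> carrier (Val P K') \<Longrightarrow>
      Act P L K (frag_of \<alpha>) (Act P K K' (frag_of \<beta>) m) = Act P L K' (frag_of (compose (lcosets L) \<beta> \<alpha>)) m"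
proof -
  have act: "Act P L K \<alpha> \<in> mod_hom R (Val P K) (Val P L)" if "L \<in> \<F>" "K \<in> \<F>" "\<alpha> \<in> carrier (Hom OC L K)" for \<alpha> L K
    using assms that by (simp add: contra_module_def)
  show "L \<in> \<F> \<Longrightarrow> module R (Val P L)" using assms by (simp add: contra_module_def)
  show "L \<in> \<F> \<Longrightarrow> K \<in> \<F> \<Longrightarrow> \<alpha> \<in> G_maps G L K \<Longrightarrow> Act P L K (frag_of \<alpha>) \<in> mod_hom R (Val P K) (Val P L)"
    using act[of L K "frag_of \<alpha>"] by simp
  show "(\<lambda>u. Act P L K u m) \<in> hom (free_Abelian_group (G_maps G L K)) (add_monoid (Val P L))"
    if "L \<in> \<F>" "K \<in> \<F>" "m \<in> carrier (Val P K)"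
  proof (rule homI)
    show "Act P L K u m \<in> carrier (add_monoid (Val P L))" if "u \<in> carrier (free_Abelian_group (G_maps G L K))" for u
      using mod_homD(2)[OF act] \<open>L \<in> \<F>\<close> \<open>K \<in> \<F>\<close> \<open>m \<in> _\<close> that by simp
    show "Act P L K (u \<otimes>\<^bsub>free_Abelian_group (G_maps G L K)\<^esub> v) m = Act P L K u m \<otimes>\<^bsub>add_monoid (Val P L)\<^esub> Act P L K v m"
      if "u \<in> carrier (free_Abelian_group (G_maps G L K))" "v \<in> carrier (free_Abelian_group (G_maps G L K))" for u v
      using assms that \<open>L \<in> \<F>\<close> \<open>K \<in> \<F>\<close> \<open>m \<in> _\<close> unfolding contra_module_def by simp
  qed
  show "L \<in> \<F> \<Longrightarrow> m \<in> carrier (Val P L) \<Longrightarrow> Act P L L (frag_of (\<lambda>X\<in>lcosets L. X)) m = m"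
    using assms unfolding contra_module_def by (simp add: orbit_category_def)
  show "Act P L K (frag_of \<alpha>) (Act P K K' (frag_of \<beta>) m) = Act P L K' (frag_of (compose (lcosets L) \<beta> \<alpha>)) m"
    if "L \<in> \<F>" "K \<in> \<F>" "K' \<in> \<F>" "\<alpha> \<in> G_maps G L K" "\<beta> \<in> G_maps G K K'" "m \<in> carrier (Val P K')"
  proof -
    have "frag_of \<alpha> \<in> carrier (Hom OC L K)" "frag_of \<beta> \<in> carrier (Hom OC K K')" using that by simp_all
    then have "Act P L K' (Comp OC L K K' (frag_of \<beta>) (frag_of \<alpha>)) m = Act P L K (frag_of \<alpha>) (Act P K K' (frag_of \<beta>) m)"
      using assms that(1-3,6) unfolding contra_module_def HC_simps by blast
    then show ?thesis by (simp add: Comp_OC_of)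
  qed
qed

lemma id_G_map: "H \<in> \<F> \<Longrightarrow> (\<lambda>X\<in>lcosets H. X) \<in> G_maps G H H"
  using lcosets_act[OF is_group fam_carrier] by (auto simp: G_maps_def)

lemma compose_coset_map_left:
  assumes "subgroup L G" "subgroup K G" "subgroup K' G" "\<beta> \<in> G_maps G K K'" "z \<in> lcosets K" "\<And>l. l \<in> L \<Longrightarrow> l <# z = z"
  shows "compose (lcosets L) \<beta> (coset_map L z) = coset_map L (\<beta> z)"
proof -
  have "coset_map L z \<in> G_maps G L K" by (rule coset_map_G_maps[OF assms(1,2,5,6)])
  then have c: "compose (lcosets L) \<beta> (coset_map L z) \<in> G_maps G L K'"
    by (rule compose_G_maps[OF _ assms(4) is_group subgroup.subset[OF assms(1)]])
  have "compose (lcosets L) \<beta> (coset_map L z) L = \<beta> z"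
    using coset_map_base[OF assms(1) lcosets_sub[OF assms(5,2)] assms(6)] sub_lcosets[OF assms(1)] by (simp add: compose_def)
  then show ?thesis using G_maps_coset_map(3)[OF c assms(1,3)] by simp
qed

lemma G_maps_act:
  assumes "\<beta> \<in> G_maps G K K'" "z \<in> lcosets K"
  shows "\<beta> z \<in> lcosets K'" "g \<in> carrier G \<Longrightarrow> g <# z = z \<Longrightarrow> g <# \<beta> z = \<beta> z"
proof -
  have \<beta>: "\<beta> \<in> lcosets K \<rightarrow>\<^sub>E lcosets K'" "\<And>g X. g \<in> carrier G \<Longrightarrow> X \<in> lcosets K \<Longrightarrow> \<beta> (g <# X) = g <# \<beta> X"
    using assms(1) by (auto simp: G_maps_def)
  show "\<beta> z \<in> lcosets K'" using \<beta>(1) assms(2) by auto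
  show "g <# \<beta> z = \<beta> z" if "g \<in> carrier G" "g <# z = z" using \<beta>(2)[OF that(1) assms(2)] that(2) by simp
qed

text \<open>An element fixing z also fixes its image under \<beta>, so conjugation by h carries the
  stabiliser S of z into the stabiliser T of w. Hence S fixes the coset y of T, and the map S |-> y
  followed by T |-> w equals S |-> z followed by \<beta>. Since y lies inside H, the first of these
  maps belongs to the orbit category of H, where \<open>H_natural\<close> applies.\<close>

lemma stab_translate:
  assumes H: "H \<in> \<F>" and K: "K \<in> \<F>" "K' \<in> \<F>" and \<beta>: "\<beta> \<in> G_maps G K K'" and h: "h \<in> H" and z: "z \<in> lcosets K"
  defines "w \<equiv> h <# \<beta> z" and "y \<equiv> inv h <# stab H (h <# \<beta> z)"
  shows "w \<in> lcosets K'" "y \<in> lcosets (stab H w)" "y \<subseteq> H" "\<And>l. l \<in> stab H z \<Longrightarrow> l <# y = y"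
    and "compose (lcosets (stab H z)) (coset_map (stab H w) w) (coset_map (stab H z) y) = compose (lcosets (stab H z)) \<beta> (coset_map (stab H z) z)"
proof -
  have hc: "h \<in> carrier G" "inv h \<in> carrier G" "inv h \<in> H"
    using h fam_carrier[OF H] subgroup.m_inv_closed[OF fam_sub[OF H] h] by auto
  have bz: "\<beta> z \<in> lcosets K'" "\<beta> z \<subseteq> carrier G"
    using G_maps_act(1)[OF \<beta> z] lcosets_sub fam_sub[OF K(2)] by auto
  show w: "w \<in> lcosets K'" unfolding w_def by (rule lcosets_act[OF is_group fam_carrier[OF K(2)] hc(1) bz(1)])
  have ws: "w \<subseteq> carrier G" using w lcosets_sub fam_sub[OF K(2)] by blast
  note S = stab_sub[OF H fam_sub[OF K(1)] z] and Sw = stab_sub[OF H fam_sub[OF K(2)] w]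
  have Swc: "stab H w \<subseteq> carrier G" using subgroup.subset[OF Sw(1)] .
  show y: "y \<in> lcosets (stab H w)" using lcosets_I[OF hc(2)] by (simp add: y_def w_def)
  show "y \<subseteq> H" using Sw(2) hc(3) subgroup.m_closed[OF fam_sub[OF H]] by (auto simp: y_def w_def l_coset_def)
  have iw: "inv h <# w = \<beta> z" unfolding w_def using hc bz by (simp add: lcos_m_assoc lcos_mult_one)
  show ly: "l <# y = y" if l: "l \<in> stab H z" for l
  proof -
    have lH: "l \<in> H" "l \<in> carrier G" "l <# z = z" using l fam_carrier[OF H] by (auto simp: stab_def)
    have "(h \<otimes> l \<otimes> inv h) <# w = h <# (l <# (inv h <# w))" using hc lH ws by (simp add: lcos_m_assoc l_coset_subset_G m_assoc)
    also have "\<dots> = w" unfolding iw by (simp add: G_maps_act(2)[OF \<beta> z lH(2,3)] w_def)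
    finally have "h \<otimes> l \<otimes> inv h \<in> stab H w"
      using h lH(1) hc(3) subgroup.m_closed[OF fam_sub[OF H]] by (simp add: stab_def)
    then have "(h \<otimes> l \<otimes> inv h) <# stab H w = stab H w" using hc lH by (intro coset_join3[OF _ Sw(1)]) auto
    moreover have "l <# y = inv h <# ((h \<otimes> l \<otimes> inv h) <# stab H w)"
      unfolding y_def w_def[symmetric] using hc lH Swc by (simp add: lcos_m_assoc m_assoc[symmetric])
    ultimately show ?thesis by (simp add: y_def w_def)
  qed
  have y_eq: "y = inv h <# stab H w" by (simp add: y_def w_def)
  have "y <#> w = inv h <# w"
    unfolding y_eq by (rule set_mult_coset[OF Sw(1) ws _ hc(2)]) (simp add: stab_def)
  then have "y <#> w = \<beta> z" by (simp add: iw)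
  then show "compose (lcosets (stab H z)) (coset_map (stab H w) w) (coset_map (stab H z) y) = compose (lcosets (stab H z)) \<beta> (coset_map (stab H z) z)"
    using compose_coset_map[OF S(1) Sw(1) fam_sub[OF K(2)] y ly w]
      compose_coset_map_left[OF S(1) fam_sub[OF K(1)] fam_sub[OF K(2)] \<beta> z]
    by (simp add: stab_def)
qed

text \<open>\<open>A\<close> is a disjoint union of left cosets of L, and each of them is met by
  \<open>card L\<close> summands.\<close>

lemma sum_over_cosets:
  fixes F :: "'g set \<Rightarrow> int"
  assumes "finite A" "A \<subseteq> carrier G" "subgroup L G" "finite L" "\<And>a l. a \<in> A \<Longrightarrow> l \<in> L \<Longrightarrow> a \<otimes> l \<in> A"
  shows "(\<Sum>a\<in>A. F (a <# L)) = int (card L) * (\<Sum>Y\<in>(\<lambda>a. a <# L) ` A. F Y)"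
proof -
  have fib: "{b \<in> A. b <# L = a <# L} = a <# L" if a: "a \<in> A" for a
  proof -
    have ac: "a \<in> carrier G" using a assms(2) by auto
    have "a <# L \<subseteq> A" using assms(5)[OF a] by (auto simp: l_coset_def)
    moreover have "b <# L = a <# L \<longleftrightarrow> b \<in> a <# L" if "b \<in> A" for b
      using that assms(2) ac lcos_self[OF _ assms(3)] l_repr_independence[OF _ ac assms(3)] by blast
    ultimately show ?thesis by blast
  qed
  have card: "card (a <# L) = card L" if "a \<in> A" for a
  proof -
    have "a <# L = (\<lambda>l. a \<otimes> l) ` L" by (auto simp: l_coset_def)
    moreover have "inj_on (\<lambda>l. a \<otimes> l) L"
      using that assms(2) subgroup.subset[OF assms(3)] by (auto simp: inj_on_def subset_iff)
    ultimately show ?thesis by (simp add: card_image)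
  qed
  have "(\<Sum>a\<in>A. F (a <# L)) = (\<Sum>Y\<in>(\<lambda>a. a <# L) ` A. \<Sum>b\<in>{b \<in> A. b <# L = Y}. F (b <# L))"
    by (rule sum.image_gen[OF assms(1)])
  also have "\<dots> = (\<Sum>Y\<in>(\<lambda>a. a <# L) ` A. int (card L) * F Y)"
    by (rule sum.cong[OF refl]) (auto simp: fib card)
  finally show ?thesis by (simp add: sum_distrib_left)
qed

text \<open>If L fixes the coset kL', then L lies in the conjugate of L' by k. The set
  \<open>?A\<close> in the proof is this conjugate, and cutting it into cosets of L gives the
  divisibility as in Lagrange's theorem.\<close>

lemma card_dvd_fixed:
  assumes "L \<in> \<F>" "L' \<in> \<F>" "k \<in> carrier G" "\<And>l. l \<in> L \<Longrightarrow> l <# (k <# L') = k <# L'"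
  shows "card L dvd card L'"
proof -
  note L = fam_sub[OF assms(1)] and L' = fam_sub[OF assms(2)] and Lc = fam_carrier[OF assms(1)] fam_carrier[OF assms(2)]
  let ?A = "(\<lambda>l. k \<otimes> l \<otimes> inv k) ` L'"
  have "(\<Sum>a\<in>?A. (\<lambda>_. 1) (a <# L)) = int (card L) * (\<Sum>Y\<in>(\<lambda>a. a <# L) ` ?A. (\<lambda>_. 1) Y)"
  proof (rule sum_over_cosets)
    show "finite ?A" using fam_fin[OF assms(2)] by simp
    show "?A \<subseteq> carrier G" using Lc assms(3) by auto
    fix a l assume "a \<in> ?A" and l: "l \<in> L"
    then obtain l' where l': "l' \<in> L'" "a = k \<otimes> l' \<otimes> inv k" by auto
    have c: "l \<in> carrier G" "l' \<in> carrier G" using l l' Lc by auto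
    have "l \<otimes> k \<in> k <# L'"
      using assms(4)[OF l] lcos_self[OF _ L', of "l \<otimes> k"] c assms(3) Lc by (simp add: lcos_m_assoc)
    then obtain l'' where l'': "l'' \<in> L'" "l \<otimes> k = k \<otimes> l''" by (auto simp: l_coset_def)
    have c'': "l'' \<in> carrier G" using l'' Lc by auto
    have "inv k \<otimes> l = l'' \<otimes> inv k"
      using l''(2) c c'' assms(3) by (metis inv_closed inv_solve_left inv_solve_right' m_assoc m_closed)
    then have "a \<otimes> l = k \<otimes> (l' \<otimes> l'') \<otimes> inv k"
      using c c'' assms(3) by (simp add: l'(2) m_assoc)
    then show "a \<otimes> l \<in> ?A" using subgroup.m_closed[OF L' l'(1) l''(1)] by blast
  qed (use L fam_fin assms(1) in auto)
  moreover have "card ?A = card L'"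
    by (rule card_image) (use Lc assms(3) in \<open>auto simp: inj_on_def subset_iff\<close>)
  ultimately have "int (card L') = int (card L) * int (card ((\<lambda>a. a <# L) ` ?A))" by simp
  then show ?thesis by (metis dvd_triv_left of_nat_eq_iff of_nat_mult)
qed

text \<open>With y = kL', the composite sends the base coset to the sum of the cosets hkL' over all
  hL in H/L. The map from H/L to H/L' is equivariant and onto, and each of its fibres has card L' /
  card L elements.\<close>

lemma comp_transfer:
  assumes H: "H \<in> \<F>" and L: "L \<in> \<F>" "L \<subseteq> H" and L': "L' \<in> \<F>" "L' \<subseteq> H"
    and y: "y \<in> lcosets L'" "y \<subseteq> H" "\<And>l. l \<in> L \<Longrightarrow> l <# y = y"
  shows "card L dvd card L'"
    and "Comp HC H L L' (pi_sigma G L L' (frag_of (coset_map L y))) (transfer H L)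
      = transfer H L' [^]\<^bsub>Hom HC H L'\<^esub> int (card L' div card L)"
proof -
  note Hs = fam_sub[OF H] and Hc = fam_carrier[OF H] and Lc = fam_carrier[OF L(1)] fam_carrier[OF L'(1)]
  obtain k where k: "k \<in> carrier G" "y = k <# L'" using y(1) by (rule lcosets_cases)
  then have kH: "k \<in> H" using lcos_self[OF k(1) fam_sub[OF L'(1)]] y(2) by auto
  show dvd: "card L dvd card L'" by (rule card_dvd_fixed[OF L(1) L'(1) k(1)]) (use y(3) k(2) in auto)
  interpret HK: comm_group "Hom HC H L'"
    using preadditive_category.Hom_comm_group[OF preadditive_hecke_category[OF is_group family]] H L' by simp
  have ysub: "y \<subseteq> carrier G" by (rule lcosets_sub[OF y(1) fam_sub[OF L'(1)]])
  have cm: "coset_map L y (h <# L) = (h \<otimes> k) <# L'" if "h \<in> H" for h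
    using coset_map_apply[OF fam_sub[OF L(1)] ysub y(3)] that Hc k Lc by (auto simp: lcos_m_assoc)
  have b: "frag_of H \<in> carrier (perm_module G H)" using sub_lcosets[OF Hs] by simp
  note tr = transfer_closed[OF H L] and tr' = transfer_closed[OF H L']
  have cl: "Comp HC H L L' (pi_sigma G L L' (frag_of (coset_map L y))) (transfer H L) \<in> carrier (Hom HC H L')"
    by (intro HC_Comp_closed[OF H L(1) L'(1) tr] pi_sigma_closed[OF _ L(1) L'(1)] coset_map_G_maps fam_sub L(1) L'(1) y)
  have bij: "bij_betw (\<lambda>h. h \<otimes> k) H H"
  proof (rule bij_betwI[where g = "\<lambda>h. h \<otimes> inv k"])
    show "(\<lambda>h. h \<otimes> k) \<in> H \<rightarrow> H" "(\<lambda>h. h \<otimes> inv k) \<in> H \<rightarrow> H"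
      using kH subgroup.m_closed[OF Hs] subgroup.m_inv_closed[OF Hs] by auto
  qed (use Hc k in \<open>auto simp: m_assoc\<close>)
  \<comment> \<open>After multiplication by \<open>card L\<close> both sides become sums over the elements of \<open>H\<close>, where right
    translation by \<open>k\<close> identifies them.\<close>
  let ?u = "\<Sum>Y\<in>(\<lambda>h. h <# L) ` H. frag_of (coset_map L y Y)" and ?v = "\<Sum>Y\<in>(\<lambda>h. h <# L') ` H. frag_of Y"
  have "?u = frag_cmul (int (card L' div card L)) ?v"
  proof (rule poly_mapping_eqI)
    fix w :: "'g set"
    let ?\<delta> = "\<lambda>Y. Poly_Mapping.lookup (frag_of Y) w :: int"
    have "int (card L) * Poly_Mapping.lookup ?u w = int (card L) * (\<Sum>Y\<in>(\<lambda>h. h <# L) ` H. ?\<delta> (coset_map L y Y))"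
      by (simp add: lookup_sum)
    also have "\<dots> = (\<Sum>h\<in>H. ?\<delta> (coset_map L y (h <# L)))"
      by (rule sum_over_cosets[symmetric]) (use Hs Hc L fam_fin H subgroup.m_closed[OF Hs] in \<open>auto intro: fam_sub\<close>)
    also have "\<dots> = (\<Sum>h\<in>H. ?\<delta> ((h \<otimes> k) <# L'))"
      by (simp add: cm)
    also have "\<dots> = (\<Sum>h\<in>H. ?\<delta> (h <# L'))"
      by (rule sum.reindex_bij_betw[OF bij, of "\<lambda>h. ?\<delta> (h <# L')"])
    also have "\<dots> = int (card L') * (\<Sum>Y\<in>(\<lambda>h. h <# L') ` H. ?\<delta> Y)"
      by (rule sum_over_cosets) (use Hs Hc L' fam_fin H subgroup.m_closed[OF Hs] in \<open>auto intro: fam_sub\<close>)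
    also have "\<dots> = int (card L) * (int (card L' div card L) * Poly_Mapping.lookup ?v w)"
    proof -
      have "int (card L') = int (card L) * int (card L' div card L)"
        using dvd by (metis dvd_mult_div_cancel of_nat_mult)
      then show ?thesis by (simp add: lookup_sum)
    qed
    finally show "Poly_Mapping.lookup ?u w = Poly_Mapping.lookup (frag_cmul (int (card L' div card L)) ?v) w"
      using fam_fin[OF L(1)] subgroup.one_closed[OF fam_sub[OF L(1)]] by (auto simp: card_eq_0_iff)
  qed
  moreover have "transfer H L' (frag_of H) = ?v"
    by (simp add: transfer_base[OF H] sub_cosets_base[OF H L'])
  moreover have "(transfer H L' [^]\<^bsub>Hom HC H L'\<^esub> n) (frag_of H) = frag_cmul n (transfer H L' (frag_of H))" for n :: int
    using hom_int_pow[OF HC_value_hom[OF b] tr' HK.is_group group_free_Abelian_group] hom_in_carrier[OF HC_value_hom[OF b] tr']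
    by simp
  ultimately show "Comp HC H L L' (pi_sigma G L L' (frag_of (coset_map L y))) (transfer H L)
      = transfer H L' [^]\<^bsub>Hom HC H L'\<^esub> int (card L' div card L)"
    using comp_transfer_base[OF H L fam_sub[OF L'(1)] y(1,3)] tr'
    by (intro HC_eqI[OF H L'(1) cl]) simp_all
qed

definition H_natural ::
  "('r, 'k) ring_scheme \<Rightarrow> 'g set \<Rightarrow> ('g set, ('g set \<Rightarrow> 'g set) \<Rightarrow>\<^sub>0 int, 'r, 'm) cat_module
    \<Rightarrow> ('g set, ('g set \<Rightarrow> 'g set) \<Rightarrow>\<^sub>0 int, 'r, 'n) cat_module \<Rightarrow> ('g set \<Rightarrow> 'm \<Rightarrow> 'n) \<Rightarrow> bool" where
  \<comment> \<open>homomorphisms between the restrictions to the orbit category of \<open>H\<close>, whose morphisms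
    are the \<open>G\<close>-maps \<open>L \<mapsto> y\<close> with \<open>y \<subseteq> H\<close>\<close>
  "H_natural R H P Q s \<longleftrightarrow>
     (\<forall>L\<in>\<F>. L \<subseteq> H \<longrightarrow> s L \<in> mod_hom R (Val P L) (Val Q L)) \<and>
     (\<forall>L\<in>\<F>. \<forall>L'\<in>\<F>. \<forall>y\<in>lcosets L'. L \<subseteq> H \<and> L' \<subseteq> H \<and> y \<subseteq> H \<and> (\<forall>l\<in>L. l <# y = y) \<longrightarrow>
        (\<forall>m\<in>carrier (Val P L'). s L (Act P L L' (frag_of (coset_map L y)) m) = Act Q L L' (frag_of (coset_map L y)) (s L' m)))"

end

locale orbit_to_hecke = subgroup_family_group G \<F> + additive_functor "orbit_category G \<F>" "hecke_category G \<F>" R "\<lambda>H. H" "pi_sigma G"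
  for G :: "('g, 'l) monoid_scheme" (structure) and \<F> :: "'g set set" and R :: "('r, 'k) ring_scheme"
begin

lemma pi_sigma_compose:
  assumes "L \<in> \<F>" "K \<in> \<F>" "K' \<in> \<F>" "\<alpha> \<in> G_maps G L K" "\<beta> \<in> G_maps G K K'"
  shows "pi_sigma G L K' (frag_of (compose (lcosets L) \<beta> \<alpha>)) = Comp HC L K K' (pi_sigma G K K' (frag_of \<beta>)) (pi_sigma G L K (frag_of \<alpha>))"
  using Fm_Comp[of L K K' "frag_of \<alpha>" "frag_of \<beta>"] assms by (simp add: Comp_OC_of)

lemma coset_map_self: "L \<in> \<F> \<Longrightarrow> coset_map L L = (\<lambda>X\<in>lcosets L. X)"
  using G_maps_coset_map(3)[OF id_G_map fam_sub fam_sub, of L] sub_lcosets[OF fam_sub, of L] by simp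

lemma stab_self:
  assumes "H \<in> \<F>" "L \<in> \<F>" "L \<subseteq> H"
  shows "stab H L = L"
proof -
  have "h \<in> L" if "h \<in> H" "h <# L = L" for h
    using lcos_self[OF _ fam_sub[OF assms(2)], of h] that fam_carrier[OF assms(1)] by auto
  moreover have "h <# L = L" if "h \<in> L" for h
    using coset_join3[OF _ fam_sub[OF assms(2)] that] that fam_carrier[OF assms(2)] by auto
  ultimately show ?thesis using assms(3) by (auto simp: stab_def)
qed

text \<open>As a point of G/L, the coset L has stabiliser L in H. Transfers are therefore among the
  orbit sums, and a formula for an induced map on orbit sums can be read off at transfers.\<close>

lemma orbit_hom_self:
  assumes "H \<in> \<F>" "L \<in> \<F>" "L \<subseteq> H"
  shows "orbit_hom H L L = transfer H L"
proof -
  have "pi_sigma G L L (frag_of (\<lambda>X\<in>lcosets L. X)) = Ident HC L"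
    using Fm_Ident[of L] assms(2) by (simp add: orbit_category_def)
  then show ?thesis
    using D.Comp_Ident_left[OF _ _ transfer_closed[OF assms]] assms
    by (simp add: orbit_hom_def stab_self[OF assms] coset_map_self)
qed

text \<open>\<beta> maps the orbit of z onto the orbit of \<beta> z, and the index of the
  stabilisers counts the preimages of a point. The proof first moves \<beta> past the coset map and
  then applies \<open>comp_transfer\<close>.\<close>

lemma pi_sigma_orbit_hom:
  assumes H: "H \<in> \<F>" and K: "K \<in> \<F>" "K' \<in> \<F>" and \<beta>: "\<beta> \<in> G_maps G K K'" and z: "z \<in> lcosets K"
  shows "Comp HC H K K' (pi_sigma G K K' (frag_of \<beta>)) (orbit_hom H K z)
    = orbit_hom H K' (\<beta> z) [^]\<^bsub>Hom HC H K'\<^esub> int (card (stab H (\<beta> z)) div card (stab H z))"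
proof -
  have HOb: "H \<in> Ob HC" using H by simp
  have bz: "\<beta> z \<subseteq> carrier G" using lcosets_sub[OF G_maps_act(1)[OF \<beta> z] fam_sub[OF K(2)]] .
  let ?S = "stab H z" and ?T = "stab H (\<beta> z)"
  note S = stab_sub[OF H fam_sub[OF K(1)] z] and T = stab_sub[OF H fam_sub[OF K(2)] G_maps_act(1)[OF \<beta> z]]
  \<comment> \<open>With the trivial translate h = 1 the coset y is \<open>?T\<close> itself, so on
    orbits \<beta> becomes the projection from G/\<open>?S\<close> to G/\<open>?T\<close>.\<close>
  note tl = stab_translate[OF H K \<beta> subgroup.one_closed[OF fam_sub[OF H]] z, simplified lcos_mult_one[OF bz] inv_one lcos_mult_one[OF subgroup.subset[OF T(1)]]]
  note cS = coset_map_G_maps[OF S(1) T(1) tl(2,4)]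
  note pi = pi_sigma_closed
  have "Comp HC H K K' (pi_sigma G K K' (frag_of \<beta>)) (orbit_hom H K z)
      = Comp HC H ?S K' (Comp HC ?S K K' (pi_sigma G K K' (frag_of \<beta>)) (pi_sigma G ?S K (frag_of (coset_map ?S z)))) (transfer H ?S)"
    unfolding orbit_hom_def
    by (rule D.Comp_assoc[symmetric]) (use H K S transfer_closed pi[OF \<beta> K] pi[OF stab_map[OF H K(1) z] S(3) K(1)] in auto)
  also have "\<dots> = Comp HC H ?S K' (Comp HC ?S ?T K' (pi_sigma G ?T K' (frag_of (coset_map ?T (\<beta> z)))) (pi_sigma G ?S ?T (frag_of (coset_map ?S ?T)))) (transfer H ?S)"
    using pi_sigma_compose[OF S(3) K stab_map[OF H K(1) z] \<beta>] pi_sigma_compose[OF S(3) T(3) K(2) cS stab_map[OF H K(2) tl(1)]] tl(5) by simp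
  also have "\<dots> = Comp HC H ?T K' (pi_sigma G ?T K' (frag_of (coset_map ?T (\<beta> z)))) (Comp HC H ?S ?T (pi_sigma G ?S ?T (frag_of (coset_map ?S ?T))) (transfer H ?S))"
    by (rule D.Comp_assoc) (use H K S T transfer_closed pi[OF cS S(3) T(3)] pi[OF stab_map[OF H K(2) tl(1)] T(3) K(2)] in auto)
  also have "\<dots> = Comp HC H ?T K' (pi_sigma G ?T K' (frag_of (coset_map ?T (\<beta> z)))) (transfer H ?T [^]\<^bsub>Hom HC H ?T\<^esub> int (card ?T div card ?S))"
    using comp_transfer(2)[OF H S(3,2) T(3,2) tl(2,3,4)] by simp
  also have "\<dots> = orbit_hom H K' (\<beta> z) [^]\<^bsub>Hom HC H K'\<^esub> int (card ?T div card ?S)"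
    unfolding orbit_hom_def
    by (rule hom_int_pow[where h = "Comp HC H ?T K' (pi_sigma G ?T K' (frag_of (coset_map ?T (\<beta> z))))"]) (use H K(2) T transfer_closed[OF H T(3,2)] pi[OF stab_map[OF H K(2) tl(1)] T(3) K(2)] in \<open>auto intro!: D.Comp_right_hom comm_group.axioms(2) D.Hom_comm_group\<close>)
  finally show ?thesis .
qed

text \<open>The induced map is forced to send \<open>m \<otimes> f\<close>, for \<open>f\<close> the sum of the orbit of \<open>z\<close> with stabiliser
  \<open>S\<close>, to \<open>s\<^sub>S(m|\<^sub>S) \<otimes> N\<^sub>S\<close> with \<open>N\<^sub>S\<close> the transfer. Orbit representatives make this a function of \<open>f\<close>;
  balancedness over a \<open>G\<close>-map \<open>\<beta>\<close> holds because both \<open>\<beta>\<close> and the transfer contribute the index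
  of the stabilisers.\<close>

lemma H_natural_induces:
  assumes P: "contra_module R OC P" and Q: "contra_module R OC Q" and H: "H \<in> \<F>" and s: "H_natural R H P Q s"
  shows "\<exists>\<sigma>\<in>mod_hom R (IV P H) (IV Q H). \<forall>L\<in>\<F>. L \<subseteq> H \<longrightarrow> (\<forall>m\<in>carrier (Val P L).
    \<sigma> (ind_tensor P H L m (transfer H L)) = ind_tensor Q H L (s L m) (transfer H L))"
proof -
  have HOb: "H \<in> Ob HC" using H by simp
  let ?W = "IV Q H"
  interpret W: module R ?W by (rule module_IV[OF Q HOb])
  note Wc = W.M.a_comm_group
  note Pm = orbit_module[OF P]
  have sm: "s L \<in> mod_hom R (Val P L) (Val Q L)" if "L \<in> \<F>" "L \<subseteq> H" for L
    using s that by (simp add: H_natural_def)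
  have HKg: "group (Hom HC H K)" if "K \<in> \<F>" for K
    using comm_group.axioms(2)[OF D.Hom_comm_group] H that by simp
  \<comment> \<open>The value forced on \<open>m\<close> tensor the orbit sum of \<open>z\<close>:
    restrict \<open>m\<close> to the stabiliser, apply \<open>s\<close>, and tensor with the
    transfer.\<close>
  define e where "e K m z = ind_tensor Q H (stab H z) (s (stab H z) (Act P (stab H z) K (frag_of (coset_map (stab H z) z)) m)) (transfer H (stab H z))" for K m z
  note S = stab_sub[OF H fam_sub]
  have em: "(\<lambda>m. e K m z) \<in> mod_hom R (Val P K) ?W" if K: "K \<in> \<F>" and z: "z \<in> lcosets K" for K z
  proof -
    have "(\<lambda>m. ind_tensor Q H (stab H z) m (transfer H (stab H z))) \<in> mod_hom R (Val Q (stab H z)) ?W"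
      by (rule mod_homI) (use S[OF K z] transfer_closed[OF H, of "stab H z"] in \<open>simp_all add: ind_tensor[OF Q HOb] del: Hom_OC\<close>)
    from mod_hom_compose[OF mod_hom_compose[OF Pm(2)[OF S(3)[OF K z] K stab_map[OF H K z]] sm[OF S(3)[OF K z] S(2)[OF K z]]] this]
    show ?thesis by (simp add: e_def)
  qed
  \<comment> \<open>The two special cases matter: \<beta> the identity gives invariance of
    \<open>e\<close> along orbits, and h = 1 gives balancedness over \<beta>.\<close>
  have key: "card (stab H z) dvd card (stab H (h <# \<beta> z))"
    "e K (Act P K K' (frag_of \<beta>) m) z = [int (card (stab H (h <# \<beta> z)) div card (stab H z))] \<cdot>\<^bsub>?W\<^esub> e K' m (h <# \<beta> z)"
    if K: "K \<in> \<F>" "K' \<in> \<F>" and \<beta>: "\<beta> \<in> G_maps G K K'" and h: "h \<in> H" and z: "z \<in> lcosets K" and m: "m \<in> carrier (Val P K')"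
    for K K' \<beta> h z m
  proof -
    let ?w = "h <# \<beta> z" let ?S = "stab H z" and ?T = "stab H ?w" let ?y = "inv h <# ?T" let ?q = "int (card ?T div card ?S)"
    note tl = stab_translate[OF H K \<beta> h z]
    note Sz = S[OF K(1) z] and Tw = S[OF K(2) tl(1)]
    note ct = comp_transfer[OF H Sz(3,2) Tw(3,2) tl(2,3,4)]
    note cS = coset_map_G_maps[OF Sz(1) Tw(1) tl(2,4)] and cT = stab_map[OF H K(2) tl(1)]
    show "card ?S dvd card ?T" by (rule ct(1))
    define n where "n = Act P ?T K' (frag_of (coset_map ?T ?w)) m"
    have n: "n \<in> carrier (Val P ?T)" unfolding n_def by (rule mod_homD(2)[OF Pm(2)[OF Tw(3) K(2) cT] m])
    have sn: "s ?T n \<in> carrier (Val Q ?T)" by (rule mod_homD(2)[OF sm[OF Tw(3,2)] n])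
    have "Act P ?S K (frag_of (coset_map ?S z)) (Act P K K' (frag_of \<beta>) m) = Act P ?S ?T (frag_of (coset_map ?S ?y)) n"
      unfolding n_def using Pm(5)[OF Sz(3) K stab_map[OF H K(1) z] \<beta> m] Pm(5)[OF Sz(3) Tw(3) K(2) cS cT m] tl(5) by simp
    moreover have "s ?S (Act P ?S ?T (frag_of (coset_map ?S ?y)) n) = Act Q ?S ?T (frag_of (coset_map ?S ?y)) (s ?T n)"
    proof -
      have "\<forall>m\<in>carrier (Val P ?T). s ?S (Act P ?S ?T (frag_of (coset_map ?S ?y)) m) = Act Q ?S ?T (frag_of (coset_map ?S ?y)) (s ?T m)"
        using s[unfolded H_natural_def, THEN conjunct2, rule_format, OF Sz(3) Tw(3) tl(2)] Sz(2) Tw(2) tl(3,4) by simp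
      then show ?thesis using n by simp
    qed
    moreover have "ind_tensor Q H ?S (Act Q ?S ?T (frag_of (coset_map ?S ?y)) (s ?T n)) (transfer H ?S)
        = ind_tensor Q H ?T (s ?T n) (transfer H ?T [^]\<^bsub>Hom HC H ?T\<^esub> ?q)"
      using ind_tensor_balanced[OF Q HOb _ _ _ sn transfer_closed[OF H Sz(3,2)], of "frag_of (coset_map ?S ?y)"] cS Sz Tw ct(2) by simp
    moreover have "ind_tensor Q H ?T (s ?T n) (transfer H ?T [^]\<^bsub>Hom HC H ?T\<^esub> ?q) = [?q] \<cdot>\<^bsub>?W\<^esub> ind_tensor Q H ?T (s ?T n) (transfer H ?T)"
      unfolding add_pow_def
      by (rule hom_int_pow[OF _ transfer_closed[OF H Tw(3,2)] HKg[OF Tw(3)] W.M.a_group])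
         (use sn Tw(3) in \<open>simp add: hom_def ind_tensor[OF Q HOb]\<close>)
    ultimately show "e K (Act P K K' (frag_of \<beta>) m) z = [?q] \<cdot>\<^bsub>?W\<^esub> e K' m ?w"
      by (simp add: e_def n_def)
  qed
  have einv: "e K m (h <# z) = e K m z" if K: "K \<in> \<F>" and h: "h \<in> H" and z: "z \<in> lcosets K" and m: "m \<in> carrier (Val P K)" for K h z m
  proof -
    have hc: "h \<in> carrier G" "inv h \<in> H" "inv h \<in> carrier G"
      using h fam_carrier[OF H] subgroup.m_inv_closed[OF fam_sub[OF H] h] by auto
    have hz: "h <# z \<in> lcosets K" by (rule lcosets_act[OF is_group fam_carrier[OF K] hc(1) z])
    have zz: "inv h <# (h <# z) = z" using hc lcosets_sub[OF z fam_sub[OF K]] by (simp add: lcos_m_assoc lcos_mult_one)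
    note k1 = key[OF K K id_G_map[OF K] h z m] and k2 = key(1)[OF K K id_G_map[OF K] hc(2) hz m]
    \<comment> \<open>Applied to h and to its inverse, \<open>key\<close> makes each order divide
      the other; the index in \<open>key\<close> is then one.\<close>
    have "card (stab H z) = card (stab H (h <# z))" using k1(1) k2 z hz zz by (intro dvd_antisym) auto
    moreover have "card (stab H z) > 0"
      using fam_fin[OF S(3)[OF K z]] subgroup.one_closed[OF S(1)[OF K z]] by (auto simp: card_gt_0_iff)
    moreover have "e K m (h <# z) \<in> carrier ?W" by (rule mod_homD(2)[OF em[OF K hz] m])
    ultimately show ?thesis using k1(2) z Pm(4)[OF K m] by (simp add: W.M.add.int_pow_1)
  qed
  define rep where "rep = orbit_rep H"
  have rep: "rep z \<in> (\<lambda>h. h <# z) ` H" for z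
    unfolding rep_def by (rule orbit_rep_in[OF H])
  \<comment> \<open>\<open>e\<close> is placed on the representative of each orbit and zero on its
    other points, so that an orbit sum receives the value of \<open>e\<close> exactly once.
    Invariance along the orbit makes this value independent of the representative.\<close>
  define E where "E K m = frag_lift (add_monoid ?W) (lcosets K) (\<lambda>z. if rep z = z then e K m z else \<zero>\<^bsub>?W\<^esub>)" for K m
  have Eg: "(\<lambda>z. if rep z = z then e K m z else \<zero>\<^bsub>?W\<^esub>) \<in> lcosets K \<rightarrow> carrier (add_monoid ?W)" if "K \<in> \<F>" "m \<in> carrier (Val P K)" for K m
    using mod_homD(2)[OF em] that by auto
  note Eh = frag_lift_hom[OF Wc Eg, folded E_def] and Eof = frag_lift_of[OF Wc Eg, folded E_def, rotated 2]
  have b: "frag_of H \<in> carrier (perm_module G H)" using sub_lcosets[OF fam_sub[OF H]] by simp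
  define \<beta> where "\<beta> K m f = E K m (f (frag_of H))" for K m and f :: "('g set \<Rightarrow>\<^sub>0 int) \<Rightarrow> ('g set \<Rightarrow>\<^sub>0 int)"
  have \<beta>_hom: "\<beta> K m \<in> hom (Hom HC H K) (add_monoid ?W)" if "K \<in> \<F>" "m \<in> carrier (Val P K)" for K m
    using hom_chain[OF HC_value_hom[OF b] Eh[OF that]] by (simp add: \<beta>_def[abs_def])
  have \<beta>_orbit: "\<beta> K m (orbit_hom H K z) = e K m z" if K: "K \<in> \<F>" and m: "m \<in> carrier (Val P K)" and z: "z \<in> lcosets K" for K m z
  proof -
    let ?O = "(\<lambda>h. h <# z) ` H"
    have zc: "z \<subseteq> carrier G" by (rule lcosets_sub[OF z fam_sub[OF K]])
    have O: "?O \<subseteq> lcosets K" using lcosets_act[OF is_group fam_carrier[OF K] _ z] fam_carrier[OF H] by auto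
    have rO: "rep z' = rep z" if "z' \<in> ?O" for z' using that orbit_rep_act[OF H _ zc] by (auto simp: rep_def)
    have fin: "finite ?O" using fam_fin[OF H] by simp
    have keys: "Poly_Mapping.keys (\<Sum>z'\<in>A. frag_of z') \<subseteq> lcosets K" if "A \<subseteq> ?O" for A
      using O that by (intro order_trans[OF keys_sum]) auto
    have zero: "E K m (\<Sum>z'\<in>A. frag_of z') = \<zero>\<^bsub>?W\<^esub>" if "finite A" "A \<subseteq> ?O - {rep z}" for A
      using that
    proof (induction A rule: finite_induct)
      case empty show ?case using hom_one[OF Eh[OF K m]] W.M.a_group by simp
    next
      case (insert x A)
      have "E K m (frag_of x + (\<Sum>z'\<in>A. frag_of z')) = E K m (frag_of x) \<oplus>\<^bsub>?W\<^esub> E K m (\<Sum>z'\<in>A. frag_of z')"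
        using hom_mult[OF Eh[OF K m], of "frag_of x" "\<Sum>z'\<in>A. frag_of z'"] keys[of A] insert.prems O by auto
      moreover have "E K m (frag_of x) = \<zero>\<^bsub>?W\<^esub>"
      proof -
        have x: "x \<in> ?O" "x \<noteq> rep z" using insert.prems by auto
        then show ?thesis using Eof[OF _ K m, of x] rO[OF x(1)] subsetD[OF O x(1)] by simp
      qed
      ultimately show ?case using insert by simp
    qed
    have "(\<Sum>z'\<in>?O. frag_of z') = frag_of (rep z) + (\<Sum>z'\<in>?O - {rep z}. frag_of z')"
      by (rule sum.remove[OF fin rep])
    then have "\<beta> K m (orbit_hom H K z) = E K m (frag_of (rep z)) \<oplus>\<^bsub>?W\<^esub> E K m (\<Sum>z'\<in>?O - {rep z}. frag_of z')"
      using hom_mult[OF Eh[OF K m], of "frag_of (rep z)" "\<Sum>z'\<in>?O - {rep z}. frag_of z'"] subsetD[OF O rep] keys[of "?O - {rep z}"]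
      by (simp add: \<beta>_def orbit_hom_base[OF H K z] Diff_subset)
    also have "\<dots> = e K m (rep z)"
      using zero[of "?O - {rep z}"] fin Eof[OF _ K m, of "rep z"] rO[OF rep] subsetD[OF O rep] mod_homD(2)[OF em[OF K] m, of "rep z"] by simp
    also have "\<dots> = e K m z"
      using rep[of z] einv[OF K _ z m] by auto
    finally show ?thesis .
  qed
  \<comment> \<open>Identities that are additive in the Hecke morphism need checking only on orbit
    sums.\<close>
  have \<beta>_eqI: "F f = J f" if K: "K \<in> \<F>" and F: "F \<in> hom (Hom HC H K) (add_monoid ?W)" "J \<in> hom (Hom HC H K) (add_monoid ?W)"
    and eq: "\<And>z. z \<in> lcosets K \<Longrightarrow> F (orbit_hom H K z) = J (orbit_hom H K z)" and f: "f \<in> carrier (Hom HC H K)" for K F J f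
    using orbit_homs_generate[OF H K subgroup_equalizer[OF HKg[OF K] W.M.a_group F] _ f] eq orbit_hom_closed[OF H K] by blast
  have \<beta>_add: "\<beta> K (m \<oplus>\<^bsub>Val P K\<^esub> m') f = \<beta> K m f \<oplus>\<^bsub>?W\<^esub> \<beta> K m' f"
    if KF: "K \<in> \<F>" and m: "m \<in> carrier (Val P K)" and m': "m' \<in> carrier (Val P K)" and f: "f \<in> carrier (Hom HC H K)" for K m m' f
  proof -
    interpret PK: module R "Val P K" by (rule Pm(1)[OF KF])
    show ?thesis
    proof (rule \<beta>_eqI[of _ _ "\<lambda>f. \<beta> K m f \<oplus>\<^bsub>?W\<^esub> \<beta> K m' f", OF KF \<beta>_hom[OF KF PK.M.a_closed[OF m m']] _ _ f])
      show "(\<lambda>f. \<beta> K m f \<oplus>\<^bsub>?W\<^esub> \<beta> K m' f) \<in> hom (Hom HC H K) (add_monoid ?W)"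
        using hom_in_carrier[OF \<beta>_hom[OF KF m]] hom_in_carrier[OF \<beta>_hom[OF KF m']]
          hom_mult[OF \<beta>_hom[OF KF m]] hom_mult[OF \<beta>_hom[OF KF m']] by (simp add: hom_def W.M.a_ac)
    qed (simp add: \<beta>_orbit KF m m' mod_homD[OF em[OF KF]])
  qed
  have "\<exists>\<sigma>\<in>mod_hom R (IV P H) ?W. \<forall>K\<in>Ob OC. \<forall>m\<in>carrier (Val P K). \<forall>f\<in>carrier (Hom HC H K). \<sigma> (ind_tensor P H K m f) = \<beta> K m f"
  proof (rule Ind_universal[OF P HOb W.module_axioms])
    fix K m f assume K: "K \<in> Ob OC" and m: "m \<in> carrier (Val P K)" and f: "f \<in> carrier (Hom HC H K)"
    have KF: "K \<in> \<F>" using K by simp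
    interpret PK: module R "Val P K" by (rule Pm(1)[OF KF])
    note eK = mod_homD[OF em[OF KF]]
    show "\<beta> K m f \<in> carrier ?W" using hom_in_carrier[OF \<beta>_hom[OF KF m] f] by simp
    show "\<beta> K m (f \<otimes>\<^bsub>Hom HC H K\<^esub> f') = \<beta> K m f \<oplus>\<^bsub>?W\<^esub> \<beta> K m f'" if "f' \<in> carrier (Hom HC H K)" for f'
      using hom_mult[OF \<beta>_hom[OF KF m] f that] by simp
    show "\<beta> K (m \<oplus>\<^bsub>Val P K\<^esub> m') f = \<beta> K m f \<oplus>\<^bsub>?W\<^esub> \<beta> K m' f" if "m' \<in> carrier (Val P K)" for m'
      by (rule \<beta>_add[OF KF m that f])
    show "\<beta> K (r \<odot>\<^bsub>Val P K\<^esub> m) f = r \<odot>\<^bsub>?W\<^esub> \<beta> K m f" if r: "r \<in> carrier R" for r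
    proof (rule \<beta>_eqI[of _ _ "\<lambda>f. r \<odot>\<^bsub>?W\<^esub> \<beta> K m f", OF KF \<beta>_hom[OF KF PK.smult_closed[OF r m]] _ _ f])
      show "(\<lambda>f. r \<odot>\<^bsub>?W\<^esub> \<beta> K m f) \<in> hom (Hom HC H K) (add_monoid ?W)"
        using hom_in_carrier[OF \<beta>_hom[OF KF m]] hom_mult[OF \<beta>_hom[OF KF m]] r by (auto simp: hom_def W.smult_r_distr)
    qed (simp add: \<beta>_orbit KF m r eK)
  next
    fix K K' \<alpha> m f assume K: "K \<in> Ob OC" "K' \<in> Ob OC" and \<alpha>: "\<alpha> \<in> carrier (Hom OC K K')" and m: "m \<in> carrier (Val P K')" and f: "f \<in> carrier (Hom HC H K)"
    have KF: "K \<in> \<F>" "K' \<in> \<F>" using K by simp_all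
    have KO: "K \<in> Ob HC" "K' \<in> Ob HC" using KF by simp_all
    let ?F = "free_Abelian_group (G_maps G K K')"
    note A = orbit_act_hom[OF P KF m]
    have 1: "(\<lambda>\<alpha>. \<beta> K (Act P K K' \<alpha> m) f) \<in> hom ?F (add_monoid ?W)"
      using hom_in_carrier[OF A] hom_mult[OF A] hom_in_carrier[OF \<beta>_hom[OF KF(1)] f] \<beta>_add[OF KF(1) _ _ f] by (simp add: hom_def)
    have "(\<lambda>\<alpha>. Comp HC H K K' (pi_sigma G K K' \<alpha>) f) \<in> hom ?F (Hom HC H K')"
      using hom_chain[OF Fm[OF K] D.Comp_left_hom[OF HOb KO f]] by simp
    from hom_chain[OF this \<beta>_hom[OF KF(2) m]]
    have 2: "(\<lambda>\<alpha>. \<beta> K' m (Comp HC H K K' (pi_sigma G K K' \<alpha>) f)) \<in> hom ?F (add_monoid ?W)" by simp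
    \<comment> \<open>Balancedness is additive in the orbit morphism and in \<open>f\<close>, so a
      single G-map \<open>g\<close> and an orbit sum suffice. There \<open>key\<close> and
      \<open>pi_sigma_orbit_hom\<close> produce the same integer multiple of
      \<open>e K' m (g z)\<close>.\<close>
    have "\<beta> K (Act P K K' (frag_of g) m) f = \<beta> K' m (Comp HC H K K' (pi_sigma G K K' (frag_of g)) f)" if g: "g \<in> G_maps G K K'" for g
    proof (rule \<beta>_eqI[of _ _ "\<lambda>f. \<beta> K' m (Comp HC H K K' (pi_sigma G K K' (frag_of g)) f)", OF KF(1) _ _ _ f])
      note Am = mod_homD(2)[OF Pm(2)[OF KF g] m]
      note pg = pi_sigma_closed[OF g KF]
      show "\<beta> K (Act P K K' (frag_of g) m) \<in> hom (Hom HC H K) (add_monoid ?W)" by (rule \<beta>_hom[OF KF(1) Am])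
      show "(\<lambda>f. \<beta> K' m (Comp HC H K K' (pi_sigma G K K' (frag_of g)) f)) \<in> hom (Hom HC H K) (add_monoid ?W)"
        using hom_chain[OF D.Comp_right_hom[OF HOb KO pg] \<beta>_hom[OF KF(2) m]] by simp
      fix z assume z: "z \<in> lcosets K"
      have gz: "g z \<in> lcosets K'" by (rule G_maps_act(1)[OF g z])
      have "\<beta> K' m (Comp HC H K K' (pi_sigma G K K' (frag_of g)) (orbit_hom H K z))
          = [int (card (stab H (g z)) div card (stab H z))] \<cdot>\<^bsub>?W\<^esub> e K' m (g z)"
        using hom_int_pow[OF \<beta>_hom[OF KF(2) m] orbit_hom_closed[OF H KF(2) gz] HKg[OF KF(2)] W.M.a_group]
        by (simp add: pi_sigma_orbit_hom[OF H KF g z] \<beta>_orbit[OF KF(2) m gz] add_pow_def)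
      also have "\<dots> = e K (Act P K K' (frag_of g) m) z"
        using key(2)[OF KF g subgroup.one_closed[OF fam_sub[OF H]] z m] lcos_mult_one[OF lcosets_sub[OF gz fam_sub[OF KF(2)]]] by simp
      finally show "\<beta> K (Act P K K' (frag_of g) m) (orbit_hom H K z) = \<beta> K' m (Comp HC H K K' (pi_sigma G K K' (frag_of g)) (orbit_hom H K z))"
        by (simp add: \<beta>_orbit[OF KF(1) Am z])
    qed
    then show "\<beta> K (Act P K K' \<alpha> m) f = \<beta> K' m (Comp HC H K K' (pi_sigma G K K' \<alpha>) f)"
      using frag_hom_eqI[OF W.M.a_group 1 2] \<alpha> by simp
  qed
  then obtain \<sigma> where \<sigma>: "\<sigma> \<in> mod_hom R (IV P H) ?W"
    and \<sigma>_it: "\<And>K m f. K \<in> \<F> \<Longrightarrow> m \<in> carrier (Val P K) \<Longrightarrow> f \<in> carrier (Hom HC H K) \<Longrightarrow> \<sigma> (ind_tensor P H K m f) = \<beta> K m f"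
    by auto
  have "\<sigma> (ind_tensor P H L m (transfer H L)) = ind_tensor Q H L (s L m) (transfer H L)"
    if L: "L \<in> \<F>" "L \<subseteq> H" and m: "m \<in> carrier (Val P L)" for L m
  proof -
    have LL: "L \<in> lcosets L" by (rule sub_lcosets[OF fam_sub[OF L(1)]])
    show ?thesis
      using \<beta>_orbit[OF L(1) m LL] orbit_hom_self[OF H L] stab_self[OF H L] coset_map_self[OF L(1)] Pm(4)[OF L(1) m]
        \<sigma>_it[OF L(1) m transfer_closed[OF H L]]
      by (simp add: e_def)
  qed
  then show ?thesis using \<sigma> by blast
qed

end


section \<open>Projective modules and lifting\<close>

text \<open>Carries a module into another type along maps that are injective on its values. It is
  needed because \<open>projective\<close> quantifies only over test modules of one fixed element
  type.\<close>

definition transport :: "('o \<Rightarrow> 'm \<Rightarrow> 'u) \<Rightarrow> ('o, 'a, 'r, 'm) cat_module \<Rightarrow> ('o, 'a, 'r, 'u) cat_module" where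
  "transport e M = \<lparr>Val = (\<lambda>x. let b = inv_into (carrier (Val M x)) (e x) in
       \<lparr>carrier = e x ` carrier (Val M x), monoid.mult = undefined, one = undefined, zero = e x \<zero>\<^bsub>Val M x\<^esub>,
        add = (\<lambda>u v. e x (b u \<oplus>\<^bsub>Val M x\<^esub> b v)), smult = (\<lambda>r u. e x (r \<odot>\<^bsub>Val M x\<^esub> b u))\<rparr>),
     Act = (\<lambda>x y \<alpha> u. e x (Act M x y \<alpha> (inv_into (carrier (Val M y)) (e y) u)))\<rparr>"

lemma contra_moduleD:
  assumes "contra_module R C M" "x \<in> Ob C"
  shows "module R (Val M x)"
    and "y \<in> Ob C \<Longrightarrow> \<alpha> \<in> carrier (Hom C x y) \<Longrightarrow> Act M x y \<alpha> \<in> mod_hom R (Val M y) (Val M x)"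
    and "y \<in> Ob C \<Longrightarrow> \<alpha> \<in> carrier (Hom C x y) \<Longrightarrow> \<beta> \<in> carrier (Hom C x y) \<Longrightarrow> m \<in> carrier (Val M y) \<Longrightarrow>
      Act M x y (\<alpha> \<otimes>\<^bsub>Hom C x y\<^esub> \<beta>) m = Act M x y \<alpha> m \<oplus>\<^bsub>Val M x\<^esub> Act M x y \<beta> m"
    and "m \<in> carrier (Val M x) \<Longrightarrow> Act M x x (Ident C x) m = m"
    and "y \<in> Ob C \<Longrightarrow> z \<in> Ob C \<Longrightarrow> \<alpha> \<in> carrier (Hom C x y) \<Longrightarrow> \<beta> \<in> carrier (Hom C y z) \<Longrightarrow> m \<in> carrier (Val M z) \<Longrightarrow>
      Act M x z (Comp C x y z \<beta> \<alpha>) m = Act M x y \<alpha> (Act M y z \<beta> m)"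
  using assms unfolding contra_module_def by blast+

lemma transport:
  assumes M: "contra_module R C M" and inj: "\<And>x. x \<in> Ob C \<Longrightarrow> inj_on (e x) (carrier (Val M x))"
  shows contra_module_transport: "contra_module R C (transport e M)"
    and transport_hom: "e \<in> cat_hom R C M (transport e M)"
    and transport_inv: "(\<lambda>x. inv_into (carrier (Val M x)) (e x)) \<in> cat_hom R C (transport e M) M"
proof -
  have b: "inv_into (carrier (Val M x)) (e x) (e x m) = m" if "x \<in> Ob C" "m \<in> carrier (Val M x)" for x m
    by (rule inv_into_f_f[OF inj]) (use that in auto)
  note M' = contra_moduleD[OF M]
  note A = mod_homD(2-4)[OF M'(2)]
  have cl: "m \<oplus>\<^bsub>Val M x\<^esub> m' \<in> carrier (Val M x)" "r \<in> carrier R \<Longrightarrow> r \<odot>\<^bsub>Val M x\<^esub> m \<in> carrier (Val M x)"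
    if "x \<in> Ob C" "m \<in> carrier (Val M x)" "m' \<in> carrier (Val M x)" for x m m' r
  proof -
    interpret module R "Val M x" by (rule M'(1)[OF that(1)])
    show "m \<oplus>\<^bsub>Val M x\<^esub> m' \<in> carrier (Val M x)" "r \<in> carrier R \<Longrightarrow> r \<odot>\<^bsub>Val M x\<^esub> m \<in> carrier (Val M x)" using that by auto
  qed
  have c: "carrier (Val (transport e M) x) = e x ` carrier (Val M x)" "\<zero>\<^bsub>Val (transport e M) x\<^esub> = e x \<zero>\<^bsub>Val M x\<^esub>" for x
    by (simp_all add: transport_def Let_def)
  have ops: "e x m \<oplus>\<^bsub>Val (transport e M) x\<^esub> e x m' = e x (m \<oplus>\<^bsub>Val M x\<^esub> m')"
    if "x \<in> Ob C" "m \<in> carrier (Val M x)" "m' \<in> carrier (Val M x)" for x m m'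
    using that by (simp add: transport_def Let_def b)
  have ops': "r \<odot>\<^bsub>Val (transport e M) x\<^esub> e x m = e x (r \<odot>\<^bsub>Val M x\<^esub> m)" if "x \<in> Ob C" "m \<in> carrier (Val M x)" for x m r
    using that by (simp add: transport_def Let_def b)
  have act: "Act (transport e M) x y \<alpha> (e y m) = e x (Act M x y \<alpha> m)" if "y \<in> Ob C" "m \<in> carrier (Val M y)" for x y \<alpha> m
    using that by (simp add: transport_def b)
  have md: "module R (Val (transport e M) x)" if x: "x \<in> Ob C" for x
  proof -
    interpret module R "Val M x" by (rule M'(1)[OF x])
    show ?thesis
    proof (intro moduleI abelian_groupI R.is_cring, goal_cases)
      case (6 u)
      then obtain m where "m \<in> carrier (Val M x)" "u = e x m" by (auto simp: c)
      then show ?case by (intro bexI[of _ "e x (\<ominus>\<^bsub>Val M x\<^esub> m)"]) (auto simp: c ops ops' x M.l_neg)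
    next
      case (4 u v) then show ?case by (auto simp: c ops ops' x M.a_comm)
    qed (auto simp: c ops ops' x M.a_assoc smult_l_distr smult_r_distr smult_assoc1)
  qed
  show "contra_module R C (transport e M)"
    unfolding contra_module_def
  proof (intro conjI ballI, goal_cases)
    case (1 x) then show ?case by (rule md)
  next
    case (2 x y \<alpha>)
    show ?case by (rule mod_homI) (use 2 in \<open>auto simp: c act ops ops' A cl\<close>)
  next
    case (3 x y \<alpha> \<beta> m)
    then show ?case by (auto simp: c act ops A M'(3))
  next
    case (4 x m) then show ?case by (auto simp: c act M'(4))
  next
    case (5 x y z \<alpha> \<beta> m) then show ?case by (auto simp: c act M'(5) A)
  qed
  show "e \<in> cat_hom R C M (transport e M)"
    by (auto simp: cat_hom_def c ops ops' act intro!: mod_homI)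
  show "(\<lambda>x. inv_into (carrier (Val M x)) (e x)) \<in> cat_hom R C (transport e M) M"
    by (auto simp: cat_hom_def c ops ops' act b A cl intro!: mod_homI)
qed

lemma cat_hom_compose:
  assumes "f \<in> cat_hom R C M N" "g \<in> cat_hom R C N K"
  shows "(\<lambda>x m. g x (f x m)) \<in> cat_hom R C M K"
proof -
  have f: "f x \<in> mod_hom R (Val M x) (Val N x)" and g: "g x \<in> mod_hom R (Val N x) (Val K x)" if "x \<in> Ob C" for x
    using assms that by (simp_all add: cat_hom_def)
  show ?thesis
    using assms mod_homD(2)[OF f] mod_hom_compose[OF f g] by (simp add: cat_hom_def)
qed

context orbit_to_hecke
begin

text \<open>The morphism groups are free on the G-maps, and both sides of the naturality equation
  are additive in the morphism.\<close>

lemma natural_from_G_maps: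
  assumes M: "contra_module R OC M" and N: "contra_module R OC N"
    and h: "\<And>x. x \<in> \<F> \<Longrightarrow> h x \<in> mod_hom R (Val M x) (Val N x)"
    and nat: "\<And>x y \<gamma> m. x \<in> \<F> \<Longrightarrow> y \<in> \<F> \<Longrightarrow> \<gamma> \<in> G_maps G x y \<Longrightarrow> m \<in> carrier (Val M y) \<Longrightarrow>
      h x (Act M x y (frag_of \<gamma>) m) = Act N x y (frag_of \<gamma>) (h y m)"
  shows "h \<in> cat_hom R OC M N"
  unfolding cat_hom_def mem_Collect_eq
proof (intro conjI ballI)
  show "h x \<in> mod_hom R (Val M x) (Val N x)" if "x \<in> Ob OC" for x using h that by simp
  fix x y u m assume "x \<in> Ob OC" "y \<in> Ob OC" and u: "u \<in> carrier (Hom OC x y)" and m: "m \<in> carrier (Val M y)"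
  then have x: "x \<in> \<F>" and y: "y \<in> \<F>" by simp_all
  show "h x (Act M x y u m) = Act N x y u (h y m)"
    by (rule frag_hom_eqI[OF _ hom_chain[OF orbit_act_hom[OF M x y m] mod_homD(1)[OF h[OF x]]]
          orbit_act_hom[OF N x y mod_homD(2)[OF h[OF y] m]]])
       (use u nat x y m abelian_group.a_group[OF module.axioms(2)[OF orbit_module_mod[OF N x]]] in simp_all)
qed

section \<open>The canonical free module over a module P\<close>

context
  fixes P :: "('g set, ('g set \<Rightarrow> 'g set) \<Rightarrow>\<^sub>0 int, 'r, 'm) cat_module"
  assumes P: "contra_module R OC P"
begin

text \<open>A basis at \<open>x\<close> of the direct sum of the R-modules spanned by the G-maps
  from \<open>x\<close> to K, over all K and all m in P(K). The third component is
  \<open>frag_of \<alpha>\<close> rather than \<open>\<alpha>\<close> because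
  \<open>free_cover\<close> indexes by morphisms of the orbit category.\<close>

definition free_basis :: "'g set \<Rightarrow> ('g set \<times> 'm \<times> (('g set \<Rightarrow> 'g set) \<Rightarrow>\<^sub>0 int)) set" where
  "free_basis x = {(K, m, frag_of \<alpha>) | K m \<alpha>. K \<in> \<F> \<and> m \<in> carrier (Val P K) \<and> \<alpha> \<in> G_maps G x K}"

abbreviation "FV x \<equiv> direct_sum (free_basis x) (\<lambda>_. regular_module R)"
abbreviation "\<delta> x K m \<alpha> r \<equiv> direct_sum_inj (free_basis x) (\<lambda>_. regular_module R) (K, m, frag_of \<alpha>) r"

interpretation FV: module_family R "free_basis x" "\<lambda>_. regular_module R" for x
  by (rule module_family.intro) (simp_all add: cring module_regular)

interpretation R: cring R by (rule cring)

lemma free_basisI: "K \<in> \<F> \<Longrightarrow> m \<in> carrier (Val P K) \<Longrightarrow> \<alpha> \<in> G_maps G x K \<Longrightarrow> (K, m, frag_of \<alpha>) \<in> free_basis x"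
  by (auto simp: free_basis_def)

lemmas module_FV = FV.module_DS

lemma \<delta>_hom: "K \<in> \<F> \<Longrightarrow> m \<in> carrier (Val P K) \<Longrightarrow> \<alpha> \<in> G_maps G x K \<Longrightarrow> \<delta> x K m \<alpha> \<in> mod_hom R (regular_module R) (FV x)"
  by (rule FV.inj_hom) (auto simp: free_basis_def)

lemma \<delta>_closed: "K \<in> \<F> \<Longrightarrow> m \<in> carrier (Val P K) \<Longrightarrow> \<alpha> \<in> G_maps G x K \<Longrightarrow> r \<in> carrier R \<Longrightarrow> \<delta> x K m \<alpha> r \<in> carrier (FV x)"
  using mod_homD(2)[OF \<delta>_hom] by simp

lemma \<delta>_smult: "K \<in> \<F> \<Longrightarrow> m \<in> carrier (Val P K) \<Longrightarrow> \<alpha> \<in> G_maps G x K \<Longrightarrow> r \<in> carrier R \<Longrightarrow>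
  r \<odot>\<^bsub>FV x\<^esub> \<delta> x K m \<alpha> \<one>\<^bsub>R\<^esub> = \<delta> x K m \<alpha> r"
  using mod_homD(4)[OF \<delta>_hom, of K m \<alpha> x r "\<one>\<^bsub>R\<^esub>"] by simp

lemma FV_hom_eqI:
  assumes "module R W" "f \<in> mod_hom R (FV x) W" "g \<in> mod_hom R (FV x) W"
    and "\<And>K m \<alpha> r. K \<in> \<F> \<Longrightarrow> m \<in> carrier (Val P K) \<Longrightarrow> \<alpha> \<in> G_maps G x K \<Longrightarrow> r \<in> carrier R \<Longrightarrow> f (\<delta> x K m \<alpha> r) = g (\<delta> x K m \<alpha> r)"
    and "w \<in> carrier (FV x)"
  shows "f w = g w"
  by (rule FV.DS_hom_eqI[OF module.axioms(2)[OF assms(1)] mod_homD(1)[OF assms(2)] mod_homD(1)[OF assms(3)] _ assms(5)])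
     (use assms(4) in \<open>unfold free_basis_def, fastforce\<close>)

lemma FV_universal:
  assumes W: "module R W" and q: "\<And>K m \<alpha>. K \<in> \<F> \<Longrightarrow> m \<in> carrier (Val P K) \<Longrightarrow> \<alpha> \<in> G_maps G x K \<Longrightarrow> q K m \<alpha> \<in> carrier W"
  shows "\<exists>\<Phi>\<in>mod_hom R (FV x) W. \<forall>K\<in>\<F>. \<forall>m\<in>carrier (Val P K). \<forall>\<alpha>\<in>G_maps G x K. \<forall>r\<in>carrier R. \<Phi> (\<delta> x K m \<alpha> r) = r \<odot>\<^bsub>W\<^esub> q K m \<alpha>"
proof -
  interpret W: module R W by (rule W)
  \<comment> \<open>Since \<open>frag_of\<close> is injective, the description recovers the G-map
    from the basis index.\<close>
  define \<phi> where "\<phi> i = (case i of (K, m, a) \<Rightarrow> \<lambda>r. r \<odot>\<^bsub>W\<^esub> q K m (THE \<alpha>. a = frag_of \<alpha>))" for i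
  have \<phi>: "\<phi> (K, m, frag_of \<alpha>) = (\<lambda>r. r \<odot>\<^bsub>W\<^esub> q K m \<alpha>)" for K m \<alpha>
  proof -
    have "(THE \<alpha>'. (frag_of \<alpha> :: _ \<Rightarrow>\<^sub>0 int) = frag_of \<alpha>') = \<alpha>" by (rule the_equality) (simp_all add: frag_of_eq)
    then show ?thesis by (simp add: \<phi>_def)
  qed
  have "\<phi> i \<in> mod_hom R (regular_module R) W" if "i \<in> free_basis x" for i
    using that by (auto simp: free_basis_def \<phi> q W.smult_l_distr W.smult_assoc1 intro!: mod_homI)
  then have "\<exists>\<Phi>\<in>mod_hom R (FV x) W. \<forall>i\<in>free_basis x. \<forall>r\<in>carrier (regular_module R).
      \<Phi> (direct_sum_inj (free_basis x) (\<lambda>_. regular_module R) i r) = \<phi> i r"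
    by (rule FV.DS_universal[OF W])
  then obtain \<Phi> where "\<Phi> \<in> mod_hom R (FV x) W"
    and "\<And>i r. i \<in> free_basis x \<Longrightarrow> r \<in> carrier R \<Longrightarrow> \<Phi> (direct_sum_inj (free_basis x) (\<lambda>_. regular_module R) i r) = \<phi> i r"
    by auto
  then show ?thesis by (intro bexI[of _ \<Phi>]) (auto simp: free_basisI \<phi>)
qed

text \<open>The summand at (K, m) of the free module, as an additive function of the morphism from
  \<open>x\<close> to K.\<close>

definition free_elem :: "'g set \<Rightarrow> 'g set \<Rightarrow> 'm \<Rightarrow> (('g set \<Rightarrow> 'g set) \<Rightarrow>\<^sub>0 int) \<Rightarrow> 'g set \<times> 'm \<times> (('g set \<Rightarrow> 'g set) \<Rightarrow>\<^sub>0 int) \<Rightarrow> 'r" where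
  "free_elem x K m = frag_lift (add_monoid (FV x)) (G_maps G x K) (\<lambda>\<alpha>. \<delta> x K m \<alpha> \<one>\<^bsub>R\<^esub>)"

lemma free_elem:
  assumes "K \<in> \<F>" "m \<in> carrier (Val P K)"
  shows free_elem_hom: "free_elem x K m \<in> hom (free_Abelian_group (G_maps G x K)) (add_monoid (FV x))"
    and free_elem_of: "\<alpha> \<in> G_maps G x K \<Longrightarrow> free_elem x K m (frag_of \<alpha>) = \<delta> x K m \<alpha> \<one>\<^bsub>R\<^esub>"
proof -
  have c: "comm_group (add_monoid (FV x))" by (rule abelian_group.a_comm_group[OF module.axioms(2)[OF module_FV]])
  have p: "(\<lambda>\<alpha>. \<delta> x K m \<alpha> \<one>\<^bsub>R\<^esub>) \<in> G_maps G x K \<rightarrow> carrier (add_monoid (FV x))" using \<delta>_closed[OF assms] by auto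
  show "free_elem x K m \<in> hom (free_Abelian_group (G_maps G x K)) (add_monoid (FV x))"
    "\<alpha> \<in> G_maps G x K \<Longrightarrow> free_elem x K m (frag_of \<alpha>) = \<delta> x K m \<alpha> \<one>\<^bsub>R\<^esub>"
    unfolding free_elem_def by (rule frag_lift_hom[OF c p], rule frag_lift_of[OF c p])
qed

text \<open>Precomposition with \<open>u\<close>. It passes through \<open>free_elem\<close> because
  the composite of a basis map with \<open>u\<close> is a combination of G-maps, not a single
  one.\<close>

definition free_act where
  "free_act x y u = (SOME \<Phi>. \<Phi> \<in> mod_hom R (FV y) (FV x) \<and> (\<forall>K\<in>\<F>. \<forall>m\<in>carrier (Val P K). \<forall>\<alpha>\<in>G_maps G y K. \<forall>r\<in>carrier R.
     \<Phi> (\<delta> y K m \<alpha> r) = r \<odot>\<^bsub>FV x\<^esub> free_elem x K m (Comp OC x y K (frag_of \<alpha>) u)))"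

definition free_module where
  "free_module = \<lparr>Val = (\<lambda>x. FV x), Act = free_act\<rparr>"

lemma Comp_OC_closed:
  assumes "x \<in> \<F>" "y \<in> \<F>" "z \<in> \<F>" "u \<in> carrier (Hom OC x y)" "v \<in> carrier (Hom OC y z)"
  shows "Comp OC x y z v u \<in> carrier (Hom OC x z)"
  using hom_in_carrier[OF C.Comp_right_hom[of x y z v] assms(4)] assms by (simp del: Hom_OC)

lemma free_act:
  assumes x: "x \<in> \<F>" and y: "y \<in> \<F>" and u: "u \<in> carrier (Hom OC x y)"
  shows free_act_hom: "free_act x y u \<in> mod_hom R (FV y) (FV x)"
    and free_act_\<delta>: "K \<in> \<F> \<Longrightarrow> m \<in> carrier (Val P K) \<Longrightarrow> \<alpha> \<in> G_maps G y K \<Longrightarrow> r \<in> carrier R \<Longrightarrow>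
      free_act x y u (\<delta> y K m \<alpha> r) = r \<odot>\<^bsub>FV x\<^esub> free_elem x K m (Comp OC x y K (frag_of \<alpha>) u)"
proof -
  have "free_elem x K m (Comp OC x y K (frag_of \<alpha>) u) \<in> carrier (FV x)"
    if "K \<in> \<F>" "m \<in> carrier (Val P K)" "\<alpha> \<in> G_maps G y K" for K m \<alpha>
    using hom_in_carrier[OF free_elem_hom[OF that(1,2)]] Comp_OC_closed[OF x y that(1) u, of "frag_of \<alpha>"] that(3) by simp
  then have "\<exists>\<Phi>\<in>mod_hom R (FV y) (FV x). \<forall>K\<in>\<F>. \<forall>m\<in>carrier (Val P K). \<forall>\<alpha>\<in>G_maps G y K. \<forall>r\<in>carrier R.
     \<Phi> (\<delta> y K m \<alpha> r) = r \<odot>\<^bsub>FV x\<^esub> free_elem x K m (Comp OC x y K (frag_of \<alpha>) u)"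
    by (rule FV_universal[OF module_FV])
  from someI_ex[OF this[unfolded Bex_def], folded free_act_def]
  show "free_act x y u \<in> mod_hom R (FV y) (FV x)"
    "K \<in> \<F> \<Longrightarrow> m \<in> carrier (Val P K) \<Longrightarrow> \<alpha> \<in> G_maps G y K \<Longrightarrow> r \<in> carrier R \<Longrightarrow>
      free_act x y u (\<delta> y K m \<alpha> r) = r \<odot>\<^bsub>FV x\<^esub> free_elem x K m (Comp OC x y K (frag_of \<alpha>) u)"
    by blast+
qed

lemma free_act_of:
  assumes "x \<in> \<F>" "y \<in> \<F>" "\<gamma> \<in> G_maps G x y" "K \<in> \<F>" "m \<in> carrier (Val P K)" "\<alpha> \<in> G_maps G y K" "r \<in> carrier R"
  shows "free_act x y (frag_of \<gamma>) (\<delta> y K m \<alpha> r) = \<delta> x K m (compose (lcosets x) \<alpha> \<gamma>) r"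
proof -
  have "compose (lcosets x) \<alpha> \<gamma> \<in> G_maps G x K"
    by (rule compose_G_maps[OF assms(3,6) is_group fam_carrier[OF assms(1)]])
  then show ?thesis
    using free_act_\<delta>[OF assms(1,2) _ assms(4-7), of "frag_of \<gamma>"] assms(3)
    by (simp add: Comp_OC_of free_elem_of[OF assms(4,5)] \<delta>_smult[OF assms(4,5) _ assms(7)])
qed

text \<open>This extends the defining formula from G-maps to all morphisms \<open>w\<close> by
  additivity, which is what functoriality of the free module requires.\<close>

lemma free_act_elem:
  assumes x: "x \<in> \<F>" and y: "y \<in> \<F>" and K: "K \<in> \<F>" and u: "u \<in> carrier (Hom OC x y)" and m: "m \<in> carrier (Val P K)"
    and w: "w \<in> carrier (Hom OC y K)"
  shows "free_act x y u (free_elem y K m w) = free_elem x K m (Comp OC x y K w u)"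
proof (rule frag_hom_eqI[where S = "G_maps G y K" and V = "add_monoid (FV x)" and f = "\<lambda>w. free_act x y u (free_elem y K m w)"
      and g = "\<lambda>w. free_elem x K m (Comp OC x y K w u)"])
  show "Group.group (add_monoid (FV x))" using module.axioms(2)[OF module_FV] by (rule abelian_group.a_group)
  show "(\<lambda>w. free_act x y u (free_elem y K m w)) \<in> hom (free_Abelian_group (G_maps G y K)) (add_monoid (FV x))"
    by (rule hom_chain[OF free_elem_hom[OF K m] mod_homD(1)[OF free_act_hom[OF x y u]]])
  show "(\<lambda>w. free_elem x K m (Comp OC x y K w u)) \<in> hom (free_Abelian_group (G_maps G y K)) (add_monoid (FV x))"
    using hom_chain[OF C.Comp_left_hom[of x y K u, unfolded HC_simps, OF x y K u] free_elem_hom[OF K m, of x, folded Hom_OC]] by simp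
  fix \<alpha> assume \<alpha>: "\<alpha> \<in> G_maps G y K"
  have "Comp OC x y K (frag_of \<alpha>) u \<in> carrier (Hom OC x K)" using Comp_OC_closed[OF x y K u] \<alpha> by simp
  then have "free_elem x K m (Comp OC x y K (frag_of \<alpha>) u) \<in> carrier (FV x)"
    using hom_in_carrier[OF free_elem_hom[OF K m, of x]] by simp
  then show "free_act x y u (free_elem y K m (frag_of \<alpha>)) = free_elem x K m (Comp OC x y K (frag_of \<alpha>) u)"
    using module.smult_one[OF module_FV] by (simp add: free_elem_of[OF K m \<alpha>] free_act_\<delta>[OF x y u K m \<alpha>])
qed (use w in simp)

lemma contra_module_free: "contra_module R OC free_module"
  unfolding contra_module_def free_module_def cat_module.simps HC_simps
proof (intro conjI ballI)
  fix x assume x: "x \<in> \<F>"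
  interpret Fx: module R "FV x" by (rule module_FV)
  show "module R (FV x)" by (rule module_FV)
  have Id: "Ident OC x \<in> carrier (Hom OC x x)" using C.Ident_in_Hom[of x] x by simp
  have el: "free_elem x K m w \<in> carrier (FV x)" if "K \<in> \<F>" "m \<in> carrier (Val P K)" "w \<in> carrier (Hom OC x K)" for K m w
    using hom_in_carrier[OF free_elem_hom[OF that(1,2)]] that(3) by simp
  show "free_act x x (Ident OC x) w = w" if w: "w \<in> carrier (FV x)" for w
  proof (rule FV_hom_eqI[OF module_FV free_act_hom[OF x x Id] mod_hom_id _ w])
    fix K m \<alpha> r assume *: "K \<in> \<F>" "m \<in> carrier (Val P K)" "\<alpha> \<in> G_maps G x K" "r \<in> carrier R"
    have "Comp OC x x K (frag_of \<alpha>) (Ident OC x) = frag_of \<alpha>" using C.Comp_Ident_right[of x K "frag_of \<alpha>"] x * by simp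
    then show "free_act x x (Ident OC x) (\<delta> x K m \<alpha> r) = \<delta> x K m \<alpha> r"
      by (simp add: free_act_\<delta>[OF x x Id *] free_elem_of * \<delta>_smult)
  qed
  fix y u assume y: "y \<in> \<F>" and u: "u \<in> carrier (Hom OC x y)"
  show "free_act x y u \<in> mod_hom R (FV y) (FV x)" by (rule free_act_hom[OF x y u])
  show "free_act x y (u \<otimes>\<^bsub>Hom OC x y\<^esub> v) w = free_act x y u w \<oplus>\<^bsub>FV x\<^esub> free_act x y v w"
    if v: "v \<in> carrier (Hom OC x y)" and w: "w \<in> carrier (FV y)" for v w
  proof -
    have uv: "u \<otimes>\<^bsub>Hom OC x y\<^esub> v \<in> carrier (Hom OC x y)"
      using u v by (simp add: keys_add_closed)
    have sum: "(\<lambda>w. free_act x y u w \<oplus>\<^bsub>FV x\<^esub> free_act x y v w) \<in> mod_hom R (FV y) (FV x)"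
      by (rule mod_homI) (simp_all add: mod_homD(2-4)[OF free_act_hom[OF x y u]] mod_homD(2-4)[OF free_act_hom[OF x y v]] Fx.smult_r_distr Fx.M.a_ac)
    show ?thesis
    proof (rule FV_hom_eqI[OF module_FV free_act_hom[OF x y uv] sum _ w])
      fix K m \<alpha> r assume *: "K \<in> \<F>" "m \<in> carrier (Val P K)" "\<alpha> \<in> G_maps G y K" "r \<in> carrier R"
      have \<alpha>: "frag_of \<alpha> \<in> carrier (Hom OC y K)" using * by simp
      note cu = Comp_OC_closed[OF x y *(1) u \<alpha>] and cv = Comp_OC_closed[OF x y *(1) v \<alpha>]
      have "Comp OC x y K (frag_of \<alpha>) (u \<otimes>\<^bsub>Hom OC x y\<^esub> v) = Comp OC x y K (frag_of \<alpha>) u \<otimes>\<^bsub>Hom OC x K\<^esub> Comp OC x y K (frag_of \<alpha>) v"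
        using hom_mult[OF C.Comp_right_hom[unfolded HC_simps, OF x y *(1) \<alpha>] u v] .
      then have "free_elem x K m (Comp OC x y K (frag_of \<alpha>) (u \<otimes>\<^bsub>Hom OC x y\<^esub> v))
          = free_elem x K m (Comp OC x y K (frag_of \<alpha>) u) \<oplus>\<^bsub>FV x\<^esub> free_elem x K m (Comp OC x y K (frag_of \<alpha>) v)"
        using hom_mult[OF free_elem_hom[OF *(1,2), of x, folded Hom_OC] cu cv] by simp
      then show "free_act x y (u \<otimes>\<^bsub>Hom OC x y\<^esub> v) (\<delta> y K m \<alpha> r) = free_act x y u (\<delta> y K m \<alpha> r) \<oplus>\<^bsub>FV x\<^esub> free_act x y v (\<delta> y K m \<alpha> r)"
        using el[OF *(1,2) cu] el[OF *(1,2) cv] *(4)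
        by (simp only: free_act_\<delta>[OF x y u *] free_act_\<delta>[OF x y v *] free_act_\<delta>[OF x y uv *] Fx.smult_r_distr)
    qed
  qed
  fix z v w assume z: "z \<in> \<F>" and v: "v \<in> carrier (Hom OC y z)" and w: "w \<in> carrier (FV z)"
  note vu = Comp_OC_closed[OF x y z u v]
  show "free_act x z (Comp OC x y z v u) w = free_act x y u (free_act y z v w)"
  proof (rule FV_hom_eqI[OF module_FV free_act_hom[OF x z vu] mod_hom_compose[OF free_act_hom[OF y z v] free_act_hom[OF x y u]] _ w])
    fix K m \<alpha> r assume *: "K \<in> \<F>" "m \<in> carrier (Val P K)" "\<alpha> \<in> G_maps G z K" "r \<in> carrier R"
    have \<alpha>: "frag_of \<alpha> \<in> carrier (Hom OC z K)" using * by simp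
    note cv = Comp_OC_closed[OF y z *(1) v \<alpha>]
    have "free_elem y K m (Comp OC y z K (frag_of \<alpha>) v) \<in> carrier (FV y)"
      using hom_in_carrier[OF free_elem_hom[OF *(1,2), of y, folded Hom_OC] cv] by simp
    then show "free_act x z (Comp OC x y z v u) (\<delta> z K m \<alpha> r) = free_act x y u (free_act y z v (\<delta> z K m \<alpha> r))"
      using C.Comp_assoc[unfolded HC_simps, OF x y z *(1) u v \<alpha>]
      by (simp only: free_act_\<delta>[OF x z vu *] free_act_\<delta>[OF y z v *] mod_homD(4)[OF free_act_hom[OF x y u] *(4)]
          free_act_elem[OF x y *(1) u *(2) cv])
  qed
qed

text \<open>By Yoneda an element m of P(K) is the same as a map from the free module on K to P;
  \<open>\<pi>\<close> combines these maps over all K and m.\<close>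

lemma counit:
  obtains \<pi> where "\<pi> \<in> cat_hom R OC free_module P"
    and "\<And>x K m \<alpha> r. x \<in> \<F> \<Longrightarrow> K \<in> \<F> \<Longrightarrow> m \<in> carrier (Val P K) \<Longrightarrow> \<alpha> \<in> G_maps G x K \<Longrightarrow> r \<in> carrier R \<Longrightarrow>
      \<pi> x (\<delta> x K m \<alpha> r) = r \<odot>\<^bsub>Val P x\<^esub> Act P x K (frag_of \<alpha>) m"
proof -
  have "\<exists>\<Phi>\<in>mod_hom R (FV x) (Val P x). \<forall>K\<in>\<F>. \<forall>m\<in>carrier (Val P K). \<forall>\<alpha>\<in>G_maps G x K. \<forall>r\<in>carrier R.
      \<Phi> (\<delta> x K m \<alpha> r) = r \<odot>\<^bsub>Val P x\<^esub> Act P x K (frag_of \<alpha>) m" if x: "x \<in> \<F>" for x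
    by (rule FV_universal[OF orbit_module_mod[OF P x]]) (rule mod_homD(2)[OF orbit_act[OF P x]])
  then obtain \<pi> where \<pi>: "\<And>x. x \<in> \<F> \<Longrightarrow> \<pi> x \<in> mod_hom R (FV x) (Val P x)"
    and \<pi>_\<delta>: "\<And>x K m \<alpha> r. x \<in> \<F> \<Longrightarrow> K \<in> \<F> \<Longrightarrow> m \<in> carrier (Val P K) \<Longrightarrow> \<alpha> \<in> G_maps G x K \<Longrightarrow> r \<in> carrier R \<Longrightarrow>
      \<pi> x (\<delta> x K m \<alpha> r) = r \<odot>\<^bsub>Val P x\<^esub> Act P x K (frag_of \<alpha>) m"
    by metis
  have "\<pi> \<in> cat_hom R OC free_module P"
  proof (rule natural_from_G_maps[OF contra_module_free P])
    show "\<pi> x \<in> mod_hom R (Val free_module x) (Val P x)" if "x \<in> \<F>" for x using \<pi>[OF that] by (simp add: free_module_def)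
    fix x y \<gamma> w assume x: "x \<in> \<F>" and y: "y \<in> \<F>" and \<gamma>: "\<gamma> \<in> G_maps G x y" and w: "w \<in> carrier (Val free_module y)"
    have \<gamma>': "frag_of \<gamma> \<in> carrier (Hom OC x y)" using \<gamma> by simp
    note A = orbit_act[OF P x y \<gamma>]
    have "\<pi> x (free_act x y (frag_of \<gamma>) w) = Act P x y (frag_of \<gamma>) (\<pi> y w)"
    proof (rule FV_hom_eqI[OF orbit_module_mod[OF P x] mod_hom_compose[OF free_act_hom[OF x y \<gamma>'] \<pi>[OF x]] mod_hom_compose[OF \<pi>[OF y] A]])
      fix K m \<alpha> r assume *: "K \<in> \<F>" "m \<in> carrier (Val P K)" "\<alpha> \<in> G_maps G y K" "r \<in> carrier R"
      show "\<pi> x (free_act x y (frag_of \<gamma>) (\<delta> y K m \<alpha> r)) = Act P x y (frag_of \<gamma>) (\<pi> y (\<delta> y K m \<alpha> r))"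
        using compose_G_maps[OF \<gamma> *(3) is_group fam_carrier[OF x]]
        by (simp add: free_act_of[OF x y \<gamma> *] \<pi>_\<delta>[OF x] \<pi>_\<delta>[OF y *] * mod_homD(4)[OF A *(4)] mod_homD(2)[OF orbit_act[OF P y]]
            orbit_act_comp[OF P x y *(1) \<gamma> *(3,2)])
    qed (use w in \<open>simp add: free_module_def\<close>)
    then show "\<pi> x (Act free_module x y (frag_of \<gamma>) w) = Act P x y (frag_of \<gamma>) (\<pi> y w)" by (simp add: free_module_def)
  qed
  then show thesis using \<pi>_\<delta> by (rule that)
qed

text \<open>The basis element at (x, m, identity) lies over m, so \<open>\<pi>\<close> is onto, and
  the splitting is a lift of the identity of \<open>P\<close> along it.\<close>

lemma projective_retract:
  assumes proj: "projective TYPE(('g set, ('g set \<Rightarrow> 'g set) \<Rightarrow>\<^sub>0 int, 'r, 'm) free_cover) R OC P"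
    and \<pi>: "\<pi> \<in> cat_hom R OC free_module P"
    and \<pi>_\<delta>: "\<And>x K m \<alpha> r. x \<in> \<F> \<Longrightarrow> K \<in> \<F> \<Longrightarrow> m \<in> carrier (Val P K) \<Longrightarrow> \<alpha> \<in> G_maps G x K \<Longrightarrow> r \<in> carrier R \<Longrightarrow>
      \<pi> x (\<delta> x K m \<alpha> r) = r \<odot>\<^bsub>Val P x\<^esub> Act P x K (frag_of \<alpha>) m"
  obtains s where "s \<in> cat_hom R OC P free_module" and "\<And>x m. x \<in> \<F> \<Longrightarrow> m \<in> carrier (Val P x) \<Longrightarrow> \<pi> x (s x m) = m"
proof -
  \<comment> \<open>Embeddings into the type of the test modules: the free module by singletons, \<open>P\<close> by the fibres
    of \<open>\<pi>\<close>.\<close>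
  define e1 where "e1 = (\<lambda>(x :: 'g set) (\<phi> :: 'g set \<times> 'm \<times> (('g set \<Rightarrow> 'g set) \<Rightarrow>\<^sub>0 int) \<Rightarrow> 'r). {\<phi>})"
  define e2 where "e2 x m = {\<phi> \<in> carrier (FV x). \<pi> x \<phi> = m}" for x m
  have \<pi>h: "\<pi> x \<in> mod_hom R (FV x) (Val P x)" if "x \<in> \<F>" for x
    using \<pi> that by (simp add: cat_hom_def free_module_def)
  have sur: "\<exists>\<phi>\<in>carrier (FV x). \<pi> x \<phi> = m" if x: "x \<in> \<F>" and m: "m \<in> carrier (Val P x)" for x m
    using \<pi>_\<delta>[OF x x m id_G_map[OF x] R.one_closed] \<delta>_closed[OF x m id_G_map[OF x] R.one_closed]
      orbit_act_id[OF P x m] module.smult_one[OF orbit_module_mod[OF P x] m] by force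
  have i1: "inj_on (e1 x) (carrier (Val free_module x))" for x by (auto simp: e1_def inj_on_def)
  have i2: "inj_on (e2 x) (carrier (Val P x))" if x: "x \<in> Ob OC" for x
  proof (rule inj_onI)
    fix m m' assume m: "m \<in> carrier (Val P x)" and eq: "e2 x m = e2 x m'"
    obtain \<phi> where "\<phi> \<in> e2 x m" using sur[OF _ m] x by (auto simp: e2_def)
    then show "m = m'" using eq by (auto simp: e2_def)
  qed
  note t1 = transport[OF contra_module_free i1] and t2 = transport[OF P i2]
  let ?M = "transport e1 free_module" and ?N = "transport e2 P"
  let ?b = "\<lambda>x. inv_into (carrier (Val free_module x)) (e1 x)"
  define p where "p = (\<lambda>x u. e2 x (\<pi> x (?b x u)))"
  have p: "p \<in> cat_hom R OC ?M ?N"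
    unfolding p_def by (rule cat_hom_compose[OF cat_hom_compose[OF t1(3) \<pi>] t2(2)]) simp_all
  have c: "carrier (Val (transport e M) x) = e x ` carrier (Val M x)" for e x and M :: "('g set, ('g set \<Rightarrow> 'g set) \<Rightarrow>\<^sub>0 int, 'r, 'v) cat_module"
    by (simp add: transport_def Let_def)
  have psur: "p x ` carrier (Val ?M x) = carrier (Val ?N x)" if x: "x \<in> Ob OC" for x
  proof -
    have "p x ` carrier (Val ?M x) = (\<lambda>\<phi>. e2 x (\<pi> x \<phi>)) ` carrier (FV x)"
      unfolding c image_image p_def by (intro image_cong) (simp_all add: free_module_def inv_into_f_f[OF i1, unfolded free_module_def cat_module.simps])
    also have "\<dots> = e2 x ` carrier (Val P x)"
      using sur x mod_homD(2)[OF \<pi>h] by (auto simp: image_iff)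
    finally show ?thesis by (simp add: c)
  qed
  obtain h where h: "h \<in> cat_hom R OC P ?M" and ph: "\<And>x m. x \<in> \<F> \<Longrightarrow> m \<in> carrier (Val P x) \<Longrightarrow> p x (h x m) = e2 x m"
    using proj[unfolded projective_def, THEN conjunct2, rule_format, of ?M ?N p e2] t1(1) t2(1,2) p psur by auto
  show thesis
  proof (rule that[of "\<lambda>x m. ?b x (h x m)"])
    show s: "(\<lambda>x m. ?b x (h x m)) \<in> cat_hom R OC P free_module"
      by (rule cat_hom_compose[OF h t1(3)])
    fix x m assume x: "x \<in> \<F>" and m: "m \<in> carrier (Val P x)"
    have "?b x (h x m) \<in> carrier (FV x)"
      using s x m mod_homD(2)[of "\<lambda>m. ?b x (h x m)" R "Val P x" "FV x" m] by (auto simp: cat_hom_def free_module_def)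
    then have "\<pi> x (?b x (h x m)) \<in> carrier (Val P x)" by (rule mod_homD(2)[OF \<pi>h[OF x]])
    then show "\<pi> x (?b x (h x m)) = m"
      using ph[OF x m] m i2[of x] x by (simp add: p_def inj_on_eq_iff)
  qed
qed

text \<open>A lift is determined by values on the free basis; \<open>D\<close> and the class of maps \<open>\<gamma>\<close> for which it
  is natural are left open, so that the lemma covers lifts over the orbit category of \<open>G\<close> as well
  as over that of a subgroup.\<close>

lemma projective_lift:
  assumes proj: "projective TYPE(('g set, ('g set \<Rightarrow> 'g set) \<Rightarrow>\<^sub>0 int, 'r, 'm) free_cover) R OC P"
    and D: "D \<subseteq> \<F>"
    and M: "\<And>x. x \<in> D \<Longrightarrow> module R (M x)" and N: "\<And>x. x \<in> D \<Longrightarrow> module R (N x)"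
    and p: "\<And>x. x \<in> D \<Longrightarrow> p x \<in> mod_hom R (M x) (N x)" and f: "\<And>x. x \<in> D \<Longrightarrow> f x \<in> mod_hom R (Val P x) (N x)"
    and q: "\<And>x K m \<alpha>. x \<in> D \<Longrightarrow> K \<in> \<F> \<Longrightarrow> m \<in> carrier (Val P K) \<Longrightarrow> \<alpha> \<in> G_maps G x K \<Longrightarrow> q x K m \<alpha> \<in> carrier (M x)"
    and pq: "\<And>x K m \<alpha>. x \<in> D \<Longrightarrow> K \<in> \<F> \<Longrightarrow> m \<in> carrier (Val P K) \<Longrightarrow> \<alpha> \<in> G_maps G x K \<Longrightarrow>
      p x (q x K m \<alpha>) = f x (Act P x K (frag_of \<alpha>) m)"
  obtains h where "\<And>x. x \<in> D \<Longrightarrow> h x \<in> mod_hom R (Val P x) (M x)"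
    and "\<And>x m. x \<in> D \<Longrightarrow> m \<in> carrier (Val P x) \<Longrightarrow> p x (h x m) = f x m"
    and "\<And>x y \<gamma> A m. x \<in> D \<Longrightarrow> y \<in> D \<Longrightarrow> \<gamma> \<in> G_maps G x y \<Longrightarrow> A \<in> mod_hom R (M y) (M x) \<Longrightarrow>
      (\<And>K m \<alpha>. K \<in> \<F> \<Longrightarrow> m \<in> carrier (Val P K) \<Longrightarrow> \<alpha> \<in> G_maps G y K \<Longrightarrow> q x K m (compose (lcosets x) \<alpha> \<gamma>) = A (q y K m \<alpha>)) \<Longrightarrow>
      m \<in> carrier (Val P y) \<Longrightarrow> h x (Act P x y (frag_of \<gamma>) m) = A (h y m)"
proof -
  obtain \<pi> where \<pi>: "\<pi> \<in> cat_hom R OC free_module P"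
    and \<pi>_\<delta>: "\<And>x K m \<alpha> r. x \<in> \<F> \<Longrightarrow> K \<in> \<F> \<Longrightarrow> m \<in> carrier (Val P K) \<Longrightarrow> \<alpha> \<in> G_maps G x K \<Longrightarrow> r \<in> carrier R \<Longrightarrow>
      \<pi> x (\<delta> x K m \<alpha> r) = r \<odot>\<^bsub>Val P x\<^esub> Act P x K (frag_of \<alpha>) m"
    using counit by blast
  obtain s where s: "s \<in> cat_hom R OC P free_module" and \<pi>s: "\<And>x m. x \<in> \<F> \<Longrightarrow> m \<in> carrier (Val P x) \<Longrightarrow> \<pi> x (s x m) = m"
    using projective_retract[OF proj \<pi> \<pi>_\<delta>] by blast
  have \<pi>h: "\<pi> x \<in> mod_hom R (FV x) (Val P x)" if "x \<in> \<F>" for x using \<pi> that by (simp add: cat_hom_def free_module_def)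
  have sh: "s x \<in> mod_hom R (Val P x) (FV x)" if "x \<in> \<F>" for x using s that by (simp add: cat_hom_def free_module_def)
  have "\<exists>\<Phi>\<in>mod_hom R (FV x) (M x). \<forall>K\<in>\<F>. \<forall>m\<in>carrier (Val P K). \<forall>\<alpha>\<in>G_maps G x K. \<forall>r\<in>carrier R. \<Phi> (\<delta> x K m \<alpha> r) = r \<odot>\<^bsub>M x\<^esub> q x K m \<alpha>"
    if x: "x \<in> D" for x
    by (rule FV_universal[OF M[OF x]]) (rule q[OF x])
  then obtain \<Phi> where \<Phi>: "\<And>x. x \<in> D \<Longrightarrow> \<Phi> x \<in> mod_hom R (FV x) (M x)"
    and \<Phi>_\<delta>: "\<And>x K m \<alpha> r. x \<in> D \<Longrightarrow> K \<in> \<F> \<Longrightarrow> m \<in> carrier (Val P K) \<Longrightarrow> \<alpha> \<in> G_maps G x K \<Longrightarrow> r \<in> carrier R \<Longrightarrow>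
      \<Phi> x (\<delta> x K m \<alpha> r) = r \<odot>\<^bsub>M x\<^esub> q x K m \<alpha>"
    by metis
  \<comment> \<open>The lift is the splitting \<open>s\<close> followed by the linear extension
    \<open>\<Phi>\<close> of the prescribed values. As \<open>s\<close> is natural for all G-maps,
    the lift is natural for every \<open>\<gamma>\<close> for which the prescription
    \<open>q\<close> is.\<close>
  show thesis
  proof (rule that[of "\<lambda>x m. \<Phi> x (s x m)"])
    fix x assume x: "x \<in> D"
    then have xF: "x \<in> \<F>" using D by auto
    show "(\<lambda>m. \<Phi> x (s x m)) \<in> mod_hom R (Val P x) (M x)" by (rule mod_hom_compose[OF sh[OF xF] \<Phi>[OF x]])
    show "p x (\<Phi> x (s x m)) = f x m" if m: "m \<in> carrier (Val P x)" for m
    proof -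
      have "p x (\<Phi> x (s x m)) = f x (\<pi> x (s x m))"
        by (rule FV_hom_eqI[OF N[OF x] mod_hom_compose[OF \<Phi>[OF x] p[OF x]] mod_hom_compose[OF \<pi>h[OF xF] f[OF x]] _ mod_homD(2)[OF sh[OF xF] m]])
           (simp add: \<Phi>_\<delta> \<pi>_\<delta> x xF mod_homD(4)[OF p[OF x]] mod_homD(4)[OF f[OF x]] q pq mod_homD(2)[OF orbit_act[OF P]])
      then show ?thesis by (simp add: \<pi>s xF m)
    qed
  next
    fix x y \<gamma> A m
    assume x: "x \<in> D" and y: "y \<in> D" and \<gamma>: "\<gamma> \<in> G_maps G x y" and A: "A \<in> mod_hom R (M y) (M x)" and m: "m \<in> carrier (Val P y)"
      and nat: "\<And>K m \<alpha>. K \<in> \<F> \<Longrightarrow> m \<in> carrier (Val P K) \<Longrightarrow> \<alpha> \<in> G_maps G y K \<Longrightarrow> q x K m (compose (lcosets x) \<alpha> \<gamma>) = A (q y K m \<alpha>)"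
    have xF: "x \<in> \<F>" and yF: "y \<in> \<F>" using D x y by auto
    have \<gamma>': "frag_of \<gamma> \<in> carrier (Hom OC x y)" using \<gamma> by simp
    have "s x (Act P x y (frag_of \<gamma>) m) = free_act x y (frag_of \<gamma>) (s y m)"
      using s xF yF \<gamma>' m by (simp add: cat_hom_def free_module_def)
    moreover have "\<Phi> x (free_act x y (frag_of \<gamma>) (s y m)) = A (\<Phi> y (s y m))"
      by (rule FV_hom_eqI[OF M[OF x] mod_hom_compose[OF free_act_hom[OF xF yF \<gamma>'] \<Phi>[OF x]] mod_hom_compose[OF \<Phi>[OF y] A] _ mod_homD(2)[OF sh[OF yF] m]])
         (use compose_G_maps[OF \<gamma> _ is_group fam_carrier[OF xF]] in
           \<open>simp add: free_act_of[OF xF yF \<gamma>] \<Phi>_\<delta> x y mod_homD(4)[OF A] q nat\<close>)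
    ultimately show "\<Phi> x (s x (Act P x y (frag_of \<gamma>) m)) = A (\<Phi> y (s y m))" by simp
  qed
qed

end

end

lemma a_kernel_eq: "a_kernel M N f = {x \<in> carrier M. f x = \<zero>\<^bsub>N\<^esub>}"
  by (simp add: a_kernel_def kernel_def)

context orbit_to_hecke
begin

text \<open>A lift is prescribed by choosing, for every m in P(K), a preimage of
  \<open>f K m\<close> under \<open>p\<close> and pulling it back along the G-maps into K. This uses
  only that \<open>P\<close> is a retract of its free module, so the type of the test modules no
  longer matters.\<close>

lemma projective_any:
  fixes P :: "('g set, ('g set \<Rightarrow> 'g set) \<Rightarrow>\<^sub>0 int, 'r, 'm) cat_module"
  assumes proj: "projective TYPE(('g set, ('g set \<Rightarrow> 'g set) \<Rightarrow>\<^sub>0 int, 'r, 'm) free_cover) R OC P"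
  shows "projective TYPE('w) R OC P"
proof -
  have P: "contra_module R OC P" using proj by (simp add: projective_def)
  have lift: "\<exists>h\<in>cat_hom R OC P M. \<forall>x\<in>Ob OC. \<forall>m\<in>carrier (Val P x). p x (h x m) = f x m"
    if M: "contra_module R OC M" and N: "contra_module R OC N" and p: "p \<in> cat_hom R OC M N"
      and sur: "\<And>x. x \<in> Ob OC \<Longrightarrow> p x ` carrier (Val M x) = carrier (Val N x)" and f: "f \<in> cat_hom R OC P N"
    for M N :: "('g set, ('g set \<Rightarrow> 'g set) \<Rightarrow>\<^sub>0 int, 'r, 'w) cat_module" and p f
  proof -
    have ph: "p x \<in> mod_hom R (Val M x) (Val N x)" and fh: "f x \<in> mod_hom R (Val P x) (Val N x)" if "x \<in> \<F>" for x
      using p f that by (simp_all add: cat_hom_def)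
    define c where "c K m = (SOME n. n \<in> carrier (Val M K) \<and> p K n = f K m)" for K m
    have c: "c K m \<in> carrier (Val M K)" "p K (c K m) = f K m" if K: "K \<in> \<F>" and m: "m \<in> carrier (Val P K)" for K m
    proof -
      have "f K m \<in> p K ` carrier (Val M K)" using sur[of K] mod_homD(2)[OF fh[OF K] m] K by simp
      then have "\<exists>n. n \<in> carrier (Val M K) \<and> p K n = f K m" by force
      from someI_ex[OF this] show "c K m \<in> carrier (Val M K)" "p K (c K m) = f K m" by (simp_all add: c_def)
    qed
    define q where "q x K m \<alpha> = Act M x K (frag_of \<alpha>) (c K m)" for x K m \<alpha>
    have q: "q x K m \<alpha> \<in> carrier (Val M x)" "p x (q x K m \<alpha>) = f x (Act P x K (frag_of \<alpha>) m)"
      if *: "x \<in> \<F>" "K \<in> \<F>" "m \<in> carrier (Val P K)" "\<alpha> \<in> G_maps G x K" for x K m \<alpha>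
    proof -
      show "q x K m \<alpha> \<in> carrier (Val M x)"
        unfolding q_def by (rule mod_homD(2)[OF orbit_act[OF M *(1,2,4)] c(1)[OF *(2,3)]])
      show "p x (q x K m \<alpha>) = f x (Act P x K (frag_of \<alpha>) m)"
        using p f * c[OF *(2,3)] by (simp add: cat_hom_def q_def)
    qed
    obtain h where h: "\<And>x. x \<in> \<F> \<Longrightarrow> h x \<in> mod_hom R (Val P x) (Val M x)"
      and phf: "\<And>x m. x \<in> \<F> \<Longrightarrow> m \<in> carrier (Val P x) \<Longrightarrow> p x (h x m) = f x m"
      and nat: "\<And>x y \<gamma> A m. x \<in> \<F> \<Longrightarrow> y \<in> \<F> \<Longrightarrow> \<gamma> \<in> G_maps G x y \<Longrightarrow> A \<in> mod_hom R (Val M y) (Val M x) \<Longrightarrow>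
        (\<And>K m \<alpha>. K \<in> \<F> \<Longrightarrow> m \<in> carrier (Val P K) \<Longrightarrow> \<alpha> \<in> G_maps G y K \<Longrightarrow>
          q x K m (compose (lcosets x) \<alpha> \<gamma>) = A (q y K m \<alpha>)) \<Longrightarrow>
        m \<in> carrier (Val P y) \<Longrightarrow> h x (Act P x y (frag_of \<gamma>) m) = A (h y m)"
      by (rule projective_lift[OF P proj _ orbit_module_mod[OF M] orbit_module_mod[OF N] ph fh q]) auto
    have "h \<in> cat_hom R OC P M"
      by (rule natural_from_G_maps[OF P M h], assumption, rule nat)
         (simp_all add: orbit_act[OF M] orbit_act_comp[OF M] c q_def)
    then show ?thesis using phf by auto
  qed
  show ?thesis
    unfolding projective_def
  proof (intro conjI allI impI; (elim conjE)?)
    show "contra_module R OC P" by (rule P)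
  qed (rule lift; blast)
qed

section \<open>Lifting over the orbit category of a subgroup\<close>

lemma H_naturalD:
  assumes "H_natural R H P Q s" "L \<in> \<F>" "L \<subseteq> H"
  shows "s L \<in> mod_hom R (Val P L) (Val Q L)"
    and "L' \<in> \<F> \<Longrightarrow> L' \<subseteq> H \<Longrightarrow> y \<in> lcosets L' \<Longrightarrow> y \<subseteq> H \<Longrightarrow> (\<And>l. l \<in> L \<Longrightarrow> l <# y = y) \<Longrightarrow> m \<in> carrier (Val P L') \<Longrightarrow>
      s L (Act P L L' (frag_of (coset_map L y)) m) = Act Q L L' (frag_of (coset_map L y)) (s L' m)"
proof -
  note s = assms(1)[unfolded H_natural_def]
  show "s L \<in> mod_hom R (Val P L) (Val Q L)" using s[THEN conjunct1] assms(2,3) by simp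
  show "s L (Act P L L' (frag_of (coset_map L y)) m) = Act Q L L' (frag_of (coset_map L y)) (s L' m)"
    if "L' \<in> \<F>" "L' \<subseteq> H" "y \<in> lcosets L'" "y \<subseteq> H" "\<And>l. l \<in> L \<Longrightarrow> l <# y = y" "m \<in> carrier (Val P L')"
    using s[THEN conjunct2, rule_format, OF assms(2) that(1,3)] assms(3) that(2,4-6) by simp
qed

lemma H_naturalI:
  assumes "\<And>L. L \<in> \<F> \<Longrightarrow> L \<subseteq> H \<Longrightarrow> s L \<in> mod_hom R (Val P L) (Val Q L)"
    and "\<And>L L' y m. L \<in> \<F> \<Longrightarrow> L \<subseteq> H \<Longrightarrow> L' \<in> \<F> \<Longrightarrow> L' \<subseteq> H \<Longrightarrow> y \<in> lcosets L' \<Longrightarrow> y \<subseteq> H \<Longrightarrow> (\<And>l. l \<in> L \<Longrightarrow> l <# y = y) \<Longrightarrow>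
      m \<in> carrier (Val P L') \<Longrightarrow> s L (Act P L L' (frag_of (coset_map L y)) m) = Act Q L L' (frag_of (coset_map L y)) (s L' m)"
  shows "H_natural R H P Q s"
  unfolding H_natural_def
proof (intro conjI ballI impI)
  show "s L \<in> mod_hom R (Val P L) (Val Q L)" if "L \<in> \<F>" "L \<subseteq> H" for L by (rule assms(1)[OF that])
qed (rule assms(2); simp)

text \<open>As an \<open>H\<close>-set, \<open>G/K\<close> is a union of orbits \<open>H/S\<close>, so a free module over the orbit category of \<open>G\<close>
  is free over that of \<open>H\<close>: a basis element at the coset \<open>z\<close> is pulled back from its orbit
  representative along the coset \<open>w z\<close> of elements moving the representative to \<open>z\<close>.\<close>

lemma H_natural_lift:
  fixes P :: "('g set, ('g set \<Rightarrow> 'g set) \<Rightarrow>\<^sub>0 int, 'r, 'm) cat_module"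
  assumes proj: "projective TYPE(('g set, ('g set \<Rightarrow> 'g set) \<Rightarrow>\<^sub>0 int, 'r, 'm) free_cover) R OC P"
    and M: "contra_module R OC M" and N: "contra_module R OC N" and H: "H \<in> \<F>"
    and p: "p \<in> cat_hom R OC M N" and f: "H_natural R H P N f"
    and sub: "\<And>L m. L \<in> \<F> \<Longrightarrow> L \<subseteq> H \<Longrightarrow> m \<in> carrier (Val P L) \<Longrightarrow> f L m \<in> p L ` carrier (Val M L)"
  shows "\<exists>h. H_natural R H P M h \<and> (\<forall>L\<in>\<F>. L \<subseteq> H \<longrightarrow> (\<forall>m\<in>carrier (Val P L). p L (h L m) = f L m))"
proof -
  have P: "contra_module R OC P" using proj by (simp add: projective_def)
  note Hs = fam_sub[OF H] and Hc = fam_carrier[OF H]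
  have ph: "p x \<in> mod_hom R (Val M x) (Val N x)" if "x \<in> \<F>" for x using p that by (simp add: cat_hom_def)
  have pn: "p x (Act M x y (frag_of \<gamma>) m) = Act N x y (frag_of \<gamma>) (p y m)"
    if "x \<in> \<F>" "y \<in> \<F>" "\<gamma> \<in> G_maps G x y" "m \<in> carrier (Val M y)" for x y \<gamma> m
    using p that by (simp add: cat_hom_def)
  define D where "D = {L \<in> \<F>. L \<subseteq> H}"
  have DF: "L \<in> \<F>" and DH: "L \<subseteq> H" if "L \<in> D" for L using that by (auto simp: D_def)
  define rep where "rep = orbit_rep H"
  define w where "w z = {g \<in> H. g <# rep z = z}" for z
  let ?S = "\<lambda>z. stab H (rep z)"
  have rep: "rep z \<in> (\<lambda>h. h <# z) ` H" for z
    unfolding rep_def by (rule orbit_rep_in[OF H])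
  have rep_K: "rep z \<in> lcosets K" if "K \<in> \<F>" "z \<in> lcosets K" for K z
    using rep[of z] lcosets_act[OF is_group fam_carrier[OF that(1)] _ that(2)] Hc by auto
  have rep_act: "rep (k <# z) = rep z" if "k \<in> H" "z \<subseteq> carrier G" for k z
    unfolding rep_def by (rule orbit_rep_act[OF H that])
  have w: "w z \<in> lcosets (?S z)" "w z \<subseteq> H" "w z <#> rep z = z" if K: "K \<in> \<F>" and z: "z \<in> lcosets K" for K z
  proof -
    have zc: "z \<subseteq> carrier G" "rep z \<subseteq> carrier G" using lcosets_sub z rep_K[OF K z] fam_sub[OF K] by auto
    obtain k where k: "k \<in> H" "rep z = k <# z" using rep[of z] by auto
    then have kc: "k \<in> carrier G" "inv k \<in> H" "inv k \<in> carrier G" using Hc subgroup.m_inv_closed[OF Hs] by auto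
    have ikz: "inv k <# rep z = z" using k kc zc by (simp add: lcos_m_assoc lcos_mult_one)
    note S = stab_sub[OF H fam_sub[OF K] rep_K[OF K z]]
    have "g \<in> inv k <# ?S z" if g: "g \<in> w z" for g
    proof -
      have gH: "g \<in> H" "g \<in> carrier G" "g <# rep z = z" using g Hc by (auto simp: w_def)
      have "(k \<otimes> g) <# rep z = k <# (g <# rep z)" using lcos_m_assoc[OF zc(2) kc(1) gH(2)] by simp
      also have "\<dots> = rep z" by (simp add: gH(3) k(2)[symmetric])
      finally have "k \<otimes> g \<in> ?S z"
        using subgroup.m_closed[OF Hs k(1) gH(1)] by (simp add: stab_def)
      moreover have "g = inv k \<otimes> (k \<otimes> g)" using kc gH(2) by (simp add: m_assoc[symmetric])
      ultimately show ?thesis by (auto simp: l_coset_def)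
    qed
    moreover have "inv k \<otimes> a \<in> w z" if a: "a \<in> ?S z" for a
    proof -
      have aH: "a \<in> H" "a \<in> carrier G" "a <# rep z = rep z" using a Hc by (auto simp: stab_def)
      then show ?thesis
        using lcos_m_assoc[OF zc(2) kc(3) aH(2)] ikz subgroup.m_closed[OF Hs kc(2) aH(1)] by (simp add: w_def)
    qed
    ultimately have w_eq: "w z = inv k <# ?S z" by (auto simp: l_coset_def)
    then show "w z \<in> lcosets (?S z)" using lcosets_I[OF kc(3)] by simp
    show "w z \<subseteq> H" by (auto simp: w_def)
    show "w z <#> rep z = z"
      unfolding w_eq using set_mult_coset[OF S(1) zc(2) _ kc(3)] ikz by (simp add: stab_def)
  qed
  \<comment> \<open>Translation by k in H keeps the orbit representative and multiplies
    \<open>w\<close> by k. This equivariance is what makes the prescription \<open>q\<close> natural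
    for the maps inside H.\<close>
  have w_act: "w (k <# z) = k <# w z" if K: "K \<in> \<F>" and z: "z \<in> lcosets K" and k: "k \<in> H" for K z k
  proof -
    have zc: "z \<subseteq> carrier G" "rep z \<subseteq> carrier G" using lcosets_sub z rep_K[OF K z] fam_sub[OF K] by auto
    have kc: "k \<in> carrier G" "inv k \<in> H" "inv k \<in> carrier G" using k Hc subgroup.m_inv_closed[OF Hs] by auto
    have "g \<in> w (k <# z) \<longleftrightarrow> inv k \<otimes> g \<in> w z" if g: "g \<in> H" for g
    proof -
      have gc: "g \<in> carrier G" using g Hc by auto
      have "inv k \<otimes> g <# rep z = inv k <# (g <# rep z)" using zc kc gc by (simp add: lcos_m_assoc)
      moreover have "inv k <# (g <# rep z) = z \<longleftrightarrow> g <# rep z = k <# z"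
        using zc kc gc lcos_m_assoc[OF l_coset_subset_G[OF zc(2) gc] kc(1,3)] lcos_m_assoc[OF zc(1) kc(3,1)]
        by (metis l_coset_subset_G lcos_mult_one l_inv r_inv)
      ultimately show ?thesis using subgroup.m_closed[OF Hs kc(2) g] g by (simp add: w_def rep_act[OF k zc(1)])
    qed
    note mem = this
    show ?thesis
    proof (intro Set.set_eqI iffI)
      fix g assume g: "g \<in> w (k <# z)"
      then have gH: "g \<in> H" "g \<in> carrier G" using Hc by (auto simp: w_def)
      have "g = k \<otimes> (inv k \<otimes> g)" using kc gH by (simp add: m_assoc[symmetric])
      then show "g \<in> k <# w z" using mem[OF gH(1)] g by (auto simp: l_coset_def)
    next
      fix g assume "g \<in> k <# w z"
      then obtain a where a: "a \<in> w z" "g = k \<otimes> a" by (auto simp: l_coset_def)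
      then have "a \<in> H" "a \<in> carrier G" using Hc by (auto simp: w_def)
      then show "g \<in> w (k <# z)" using mem[of g] a kc subgroup.m_closed[OF Hs k] by (simp add: m_assoc[symmetric])
    qed
  qed
  have w_fix: "l <# w z = w z" if "K \<in> \<F>" "z \<in> lcosets K" "l \<in> H" "l <# z = z" for K z l
    using w_act[OF that(1-3)] that(4) by simp
  \<comment> \<open>In \<open>q\<close> these choices are evaluated only at orbit representatives,
    so one preimage serves a whole H-orbit of cosets.\<close>
  define lf where "lf K m z = (SOME n. n \<in> carrier (Val M (stab H z)) \<and>
      p (stab H z) n = f (stab H z) (Act P (stab H z) K (frag_of (coset_map (stab H z) z)) m))" for K m z
  have lf: "lf K m z \<in> carrier (Val M (stab H z))"
    "p (stab H z) (lf K m z) = f (stab H z) (Act P (stab H z) K (frag_of (coset_map (stab H z) z)) m)"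
    if K: "K \<in> \<F>" and z: "z \<in> lcosets K" and m: "m \<in> carrier (Val P K)" for K m z
  proof -
    note S = stab_sub[OF H fam_sub[OF K] z]
    have "f (stab H z) (Act P (stab H z) K (frag_of (coset_map (stab H z) z)) m) \<in> p (stab H z) ` carrier (Val M (stab H z))"
      by (rule sub[OF S(3,2) mod_homD(2)[OF orbit_act[OF P S(3) K stab_map[OF H K z]] m]])
    then have "\<exists>n. n \<in> carrier (Val M (stab H z)) \<and> p (stab H z) n = f (stab H z) (Act P (stab H z) K (frag_of (coset_map (stab H z) z)) m)"
      by force
    from someI_ex[OF this, folded lf_def] show "lf K m z \<in> carrier (Val M (stab H z))"
      "p (stab H z) (lf K m z) = f (stab H z) (Act P (stab H z) K (frag_of (coset_map (stab H z) z)) m)" by auto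
  qed
  define q where "q L K m \<alpha> = Act M L (?S (\<alpha> L)) (frag_of (coset_map L (w (\<alpha> L)))) (lf K m (rep (\<alpha> L)))" for L K m and \<alpha> :: "'g set \<Rightarrow> 'g set"
  have \<alpha>L: "\<alpha> L \<in> lcosets K" "coset_map L (w (\<alpha> L)) \<in> G_maps G L (?S (\<alpha> L))" "?S (\<alpha> L) \<in> \<F>" "?S (\<alpha> L) \<subseteq> H"
    "\<And>l. l \<in> L \<Longrightarrow> l <# w (\<alpha> L) = w (\<alpha> L)" "\<And>l. l \<in> L \<Longrightarrow> l <# \<alpha> L = \<alpha> L" "\<alpha> = coset_map L (\<alpha> L)" "rep (\<alpha> L) \<in> lcosets K"
    if L: "L \<in> \<F>" "L \<subseteq> H" and K: "K \<in> \<F>" and \<alpha>: "\<alpha> \<in> G_maps G L K" for L K \<alpha>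
  proof -
    note a = G_maps_coset_map[OF \<alpha> fam_sub[OF L(1)] fam_sub[OF K]]
    show z: "\<alpha> L \<in> lcosets K" and fz: "\<And>l. l \<in> L \<Longrightarrow> l <# \<alpha> L = \<alpha> L" and "\<alpha> = coset_map L (\<alpha> L)" by (rule a | assumption)+
    show r: "rep (\<alpha> L) \<in> lcosets K" by (rule rep_K[OF K z])
    note S = stab_sub[OF H fam_sub[OF K] r]
    show "?S (\<alpha> L) \<in> \<F>" "?S (\<alpha> L) \<subseteq> H" by (rule S)+
    show fw: "\<And>l. l \<in> L \<Longrightarrow> l <# w (\<alpha> L) = w (\<alpha> L)" using w_fix[OF K z] fz L(2) by auto
    show "coset_map L (w (\<alpha> L)) \<in> G_maps G L (?S (\<alpha> L))" by (rule coset_map_G_maps[OF fam_sub[OF L(1)] S(1) w(1)[OF K z] fw])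
  qed
  have qq: "q L K m \<alpha> \<in> carrier (Val M L)" "p L (q L K m \<alpha>) = f L (Act P L K (frag_of \<alpha>) m)"
    if L: "L \<in> D" and K: "K \<in> \<F>" and m: "m \<in> carrier (Val P K)" and \<alpha>: "\<alpha> \<in> G_maps G L K" for L K m \<alpha>
  proof -
    have LF: "L \<in> \<F>" "L \<subseteq> H" using L by (auto simp: D_def)
    note a = \<alpha>L[OF LF K \<alpha>]
    note l = lf[OF K a(8) m]
    show "q L K m \<alpha> \<in> carrier (Val M L)"
      unfolding q_def by (rule mod_homD(2)[OF orbit_act[OF M LF(1) a(3,2)] l(1)])
    \<comment> \<open>As \<open>w z <#> rep z = z\<close>, the map \<open>\<alpha>\<close> factors
      through the stabiliser of the representative. The first factor is given by a coset inside H,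
      so \<open>f\<close> is natural for it.\<close>
    have "p L (q L K m \<alpha>) = Act N L (?S (\<alpha> L)) (frag_of (coset_map L (w (\<alpha> L)))) (f (?S (\<alpha> L)) (Act P (?S (\<alpha> L)) K (frag_of (coset_map (?S (\<alpha> L)) (rep (\<alpha> L)))) m))"
      unfolding q_def by (simp add: pn[OF LF(1) a(3,2) l(1)] l(2))
    also have "\<dots> = f L (Act P L (?S (\<alpha> L)) (frag_of (coset_map L (w (\<alpha> L)))) (Act P (?S (\<alpha> L)) K (frag_of (coset_map (?S (\<alpha> L)) (rep (\<alpha> L)))) m))"
      by (rule H_naturalD(2)[OF f LF a(3,4) w(1,2)[OF K a(1)] a(5), symmetric])
         (assumption, rule mod_homD(2)[OF orbit_act[OF P a(3) K stab_map[OF H K a(8)]] m])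
    also have "\<dots> = f L (Act P L K (frag_of \<alpha>) m)"
    proof -
      have "compose (lcosets L) (coset_map (?S (\<alpha> L)) (rep (\<alpha> L))) (coset_map L (w (\<alpha> L))) = coset_map L (w (\<alpha> L) <#> rep (\<alpha> L))"
        by (rule compose_coset_map[OF fam_sub[OF LF(1)] fam_sub[OF a(3)] fam_sub[OF K] w(1)[OF K a(1)] a(5) a(8)])
           (simp_all add: stab_def)
      then show ?thesis
        using orbit_act_comp[OF P LF(1) a(3) K a(2) stab_map[OF H K a(8)] m] w(3)[OF K a(1)] a(7) by simp
    qed
    finally show "p L (q L K m \<alpha>) = f L (Act P L K (frag_of \<alpha>) m)" .
  qed
  obtain h where h: "\<And>L. L \<in> D \<Longrightarrow> h L \<in> mod_hom R (Val P L) (Val M L)"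
    and phf: "\<And>L m. L \<in> D \<Longrightarrow> m \<in> carrier (Val P L) \<Longrightarrow> p L (h L m) = f L m"
    and nat: "\<And>x y \<gamma> A m. x \<in> D \<Longrightarrow> y \<in> D \<Longrightarrow> \<gamma> \<in> G_maps G x y \<Longrightarrow> A \<in> mod_hom R (Val M y) (Val M x) \<Longrightarrow>
      (\<And>K m \<alpha>. K \<in> \<F> \<Longrightarrow> m \<in> carrier (Val P K) \<Longrightarrow> \<alpha> \<in> G_maps G y K \<Longrightarrow> q x K m (compose (lcosets x) \<alpha> \<gamma>) = A (q y K m \<alpha>)) \<Longrightarrow>
      m \<in> carrier (Val P y) \<Longrightarrow> h x (Act P x y (frag_of \<gamma>) m) = A (h y m)"
    by (rule projective_lift[OF P proj _ orbit_module_mod[OF M DF] orbit_module_mod[OF N DF] ph[OF DF] H_naturalD(1)[OF f DF DH] qq])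
       (use DF in auto)
  have "H_natural R H P M h"
  proof (rule H_naturalI)
    show "h L \<in> mod_hom R (Val P L) (Val M L)" if "L \<in> \<F>" "L \<subseteq> H" for L using h that by (simp add: D_def)
    fix L L' y m
    assume L: "L \<in> \<F>" "L \<subseteq> H" and L': "L' \<in> \<F>" "L' \<subseteq> H" and y: "y \<in> lcosets L'" "y \<subseteq> H" "\<And>l. l \<in> L \<Longrightarrow> l <# y = y" and m: "m \<in> carrier (Val P L')"
    have cy: "coset_map L y \<in> G_maps G L L'" by (rule coset_map_G_maps[OF fam_sub[OF L(1)] fam_sub[OF L'(1)] y(1,3)])
    obtain k where k: "k \<in> carrier G" "y = k <# L'" using y(1) by (rule lcosets_cases)
    have kH: "k \<in> H" using lcos_self[OF k(1) fam_sub[OF L'(1)]] k(2) y(2) by auto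
    show "h L (Act P L L' (frag_of (coset_map L y)) m) = Act M L L' (frag_of (coset_map L y)) (h L' m)"
    proof (rule nat[OF _ _ cy orbit_act[OF M L(1) L'(1) cy] _ m])
      fix K n \<alpha> assume K: "K \<in> \<F>" and n: "n \<in> carrier (Val P K)" and \<alpha>: "\<alpha> \<in> G_maps G L' K"
      note a = \<alpha>L[OF L' K \<alpha>]
      have zc: "\<alpha> L' \<subseteq> carrier G" by (rule lcosets_sub[OF a(1) fam_sub[OF K]])
      have "\<alpha> y = k <# \<alpha> L'" using \<alpha> sub_lcosets[OF fam_sub[OF L'(1)]] k by (simp add: G_maps_def)
      then have cL: "compose (lcosets L) \<alpha> (coset_map L y) L = k <# \<alpha> L'"
        using coset_map_base[OF fam_sub[OF L(1)] lcosets_sub[OF y(1) fam_sub[OF L'(1)]] y(3)] sub_lcosets[OF fam_sub[OF L(1)]]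
        by (simp add: compose_def)
      have "y <#> w (\<alpha> L') = k <# w (\<alpha> L')"
        unfolding k(2) by (rule set_mult_coset[OF fam_sub[OF L'(1)] _ a(5) k(1)]) (use w(2)[OF K a(1)] Hc in auto)
      then have "compose (lcosets L) (coset_map L' (w (\<alpha> L'))) (coset_map L y) = coset_map L (k <# w (\<alpha> L'))"
        using compose_coset_map[OF fam_sub[OF L(1)] fam_sub[OF L'(1)] fam_sub[OF a(3)] y(1,3) w(1)[OF K a(1)] a(5)] by simp
      then show "q L K n (compose (lcosets L) \<alpha> (coset_map L y)) = Act M L L' (frag_of (coset_map L y)) (q L' K n \<alpha>)"
        using orbit_act_comp[OF M L(1) L'(1) a(3) cy a(2) lf(1)[OF K a(8) n]]
        by (simp add: q_def cL rep_act[OF kH zc] w_act[OF K a(1) kH])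
    qed (use L L' in \<open>simp_all add: D_def\<close>)
  qed
  then show ?thesis using phf by (auto simp: D_def)
qed

subsection \<open>Exactness\<close>

text \<open>Orbit sums generate the Hecke morphisms, and balancing moves the coset map in an orbit
  sum onto \<open>m\<close>, leaving a transfer to a subgroup of H. This is the uniqueness belonging
  to \<open>H_natural_induces\<close>.\<close>

lemma transfer_hom_eqI:
  assumes P: "contra_module R OC P" and H: "H \<in> \<F>" and W: "module R W"
    and F: "F \<in> mod_hom R (IV P H) W" "J \<in> mod_hom R (IV P H) W"
    and eq: "\<And>L m. L \<in> \<F> \<Longrightarrow> L \<subseteq> H \<Longrightarrow> m \<in> carrier (Val P L) \<Longrightarrow>
      F (ind_tensor P H L m (transfer H L)) = J (ind_tensor P H L m (transfer H L))"
    and w: "w \<in> carrier (IV P H)"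
  shows "F w = J w"
proof -
  have HO: "H \<in> Ob HC" using H by simp
  interpret W: module R W by (rule W)
  show ?thesis
  proof (rule Ind_hom_eqI[OF P HO W F _ w])
    fix K m f assume "K \<in> Ob OC" and m: "m \<in> carrier (Val P K)" and f: "f \<in> carrier (Hom HC H K)"
    then have K: "K \<in> \<F>" "K \<in> Ob OC" by simp_all
    have t: "ind_tensor P H K m \<in> hom (Hom HC H K) (add_monoid (IV P H))"
      using m by (auto simp: hom_def ind_tensor[OF P HO K(2)])
    have g: "group (Hom HC H K)" using comm_group.axioms(2)[OF D.Hom_comm_group[OF HO, of K]] K by simp
    have "orbit_hom H K z \<in> {f \<in> carrier (Hom HC H K). F (ind_tensor P H K m f) = J (ind_tensor P H K m f)}" if z: "z \<in> lcosets K" for z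
    proof -
      let ?S = "stab H z"
      note S = stab_sub[OF H fam_sub[OF K(1)] z] and c = stab_map[OF H K(1) z]
      have "ind_tensor P H K m (orbit_hom H K z) = ind_tensor P H ?S (Act P ?S K (frag_of (coset_map ?S z)) m) (transfer H ?S)"
        unfolding orbit_hom_def
        by (rule ind_tensor_balanced[OF P HO _ K(2) _ m transfer_closed[OF H S(3,2)], symmetric]) (use S c in simp_all)
      then show ?thesis
        using eq[OF S(3,2) mod_homD(2)[OF orbit_act[OF P S(3) K(1) c] m]] orbit_hom_closed[OF H K(1) z] by simp
    qed
    then show "F (ind_tensor P H K m f) = J (ind_tensor P H K m f)"
      using orbit_homs_generate[OF H K(1) subgroup_equalizer[OF g W.M.a_group hom_chain[OF t mod_homD(1)[OF F(1)]] hom_chain[OF t mod_homD(1)[OF F(2)]]] _ f]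
      by blast
  qed
qed

text \<open>The map 1 - s e is natural over H and, as e s e = e, takes values in the kernel of e,
  hence in the image of d; s' lifts it along d. Only e s e = e is assumed, not e s = 1, so that the
  same lemma serves at the augmentation and at every later differential.\<close>

lemma homotopy_step:
  fixes P :: "('g set, ('g set \<Rightarrow> 'g set) \<Rightarrow>\<^sub>0 int, 'r, 'm) cat_module"
  assumes proj: "projective TYPE(('g set, ('g set \<Rightarrow> 'g set) \<Rightarrow>\<^sub>0 int, 'r, 'm) free_cover) R OC P"
    and P': "contra_module R OC P'" and B: "contra_module R OC B" and H: "H \<in> \<F>"
    and d: "d \<in> cat_hom R OC P' P" and e: "e \<in> cat_hom R OC P B"
    and ex: "\<And>L. L \<in> \<F> \<Longrightarrow> d L ` carrier (Val P' L) = a_kernel (Val P L) (Val B L) (e L)"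
    and s: "H_natural R H B P s" and ese: "\<And>L m. L \<in> \<F> \<Longrightarrow> L \<subseteq> H \<Longrightarrow> m \<in> carrier (Val P L) \<Longrightarrow> e L (s L (e L m)) = e L m"
  shows "\<exists>s'. H_natural R H P P' s' \<and> (\<forall>L\<in>\<F>. L \<subseteq> H \<longrightarrow> (\<forall>m\<in>carrier (Val P L). d L (s' L m) = m \<ominus>\<^bsub>Val P L\<^esub> s L (e L m)))"
proof -
  have P: "contra_module R OC P" using proj by (simp add: projective_def)
  have eh: "e L \<in> mod_hom R (Val P L) (Val B L)" if "L \<in> \<F>" for L using e that by (simp add: cat_hom_def)
  define f where "f L m = m \<ominus>\<^bsub>Val P L\<^esub> s L (e L m)" for L m
  have se: "(\<lambda>m. s L (e L m)) \<in> mod_hom R (Val P L) (Val P L)" if "L \<in> \<F>" "L \<subseteq> H" for L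
    by (rule mod_hom_compose[OF eh[OF that(1)] H_naturalD(1)[OF s that]])
  have fh: "f L \<in> mod_hom R (Val P L) (Val P L)" if L: "L \<in> \<F>" "L \<subseteq> H" for L
  proof -
    interpret PL: module R "Val P L" by (rule orbit_module_mod[OF P L(1)])
    note se' = mod_homD(2-4)[OF se[OF L]]
    show ?thesis
      unfolding f_def
      by (rule mod_homI) (simp_all add: se' a_minus_def PL.M.minus_add PL.M.a_ac PL.smult_r_distr PL.smult_r_minus)
  qed
  have "H_natural R H P P f"
  proof (rule H_naturalI[OF fh])
    fix L L' y m
    assume L: "L \<in> \<F>" "L \<subseteq> H" and L': "L' \<in> \<F>" "L' \<subseteq> H" and y: "y \<in> lcosets L'" "y \<subseteq> H" "\<And>l. l \<in> L \<Longrightarrow> l <# y = y" and m: "m \<in> carrier (Val P L')"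
    have c: "coset_map L y \<in> G_maps G L L'" by (rule coset_map_G_maps[OF fam_sub[OF L(1)] fam_sub[OF L'(1)] y(1,3)])
    have em: "e L (Act P L L' (frag_of (coset_map L y)) m) = Act B L L' (frag_of (coset_map L y)) (e L' m)"
      using e L(1) L'(1) c m by (simp add: cat_hom_def)
    show "f L (Act P L L' (frag_of (coset_map L y)) m) = Act P L L' (frag_of (coset_map L y)) (f L' m)"
      using mod_hom_diff[OF orbit_module_mod[OF P L'(1)] orbit_module_mod[OF P L(1)] orbit_act[OF P L(1) L'(1) c] m mod_homD(2)[OF se[OF L'] m]]
        H_naturalD(2)[OF s L L' y mod_homD(2)[OF eh[OF L'(1)] m]]
      by (simp add: f_def em)
  qed
  moreover have "f L m \<in> d L ` carrier (Val P' L)" if L: "L \<in> \<F>" "L \<subseteq> H" and m: "m \<in> carrier (Val P L)" for L m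
  proof -
    interpret BL: module R "Val B L" by (rule orbit_module_mod[OF B L(1)])
    have "e L (f L m) = e L m \<ominus>\<^bsub>Val B L\<^esub> e L m"
      using mod_hom_diff[OF orbit_module_mod[OF P L(1)] BL.module_axioms eh[OF L(1)] m mod_homD(2)[OF se[OF L] m]] ese[OF L m]
      by (simp add: f_def)
    then show ?thesis
      using ex[OF L(1)] mod_homD(2)[OF fh[OF L] m] mod_homD(2)[OF eh[OF L(1)] m] by (simp add: a_kernel_eq a_minus_def BL.M.r_neg)
  qed
  ultimately show ?thesis unfolding f_def by (rule H_natural_lift[OF proj P' P H d])
qed

lemma H_natural_inducesE:
  assumes "contra_module R OC P" "contra_module R OC Q" "H \<in> \<F>" "H_natural R H P Q s"
  obtains \<sigma> where "\<sigma> \<in> mod_hom R (IV P H) (IV Q H)"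
    and "\<And>L m. L \<in> \<F> \<Longrightarrow> L \<subseteq> H \<Longrightarrow> m \<in> carrier (Val P L) \<Longrightarrow>
      \<sigma> (ind_tensor P H L m (transfer H L)) = ind_tensor Q H L (s L m) (transfer H L)"
proof -
  from H_natural_induces[OF assms] obtain \<sigma> where \<sigma>: "\<sigma> \<in> mod_hom R (IV P H) (IV Q H)"
    "\<forall>L\<in>\<F>. L \<subseteq> H \<longrightarrow> (\<forall>m\<in>carrier (Val P L). \<sigma> (ind_tensor P H L m (transfer H L)) = ind_tensor Q H L (s L m) (transfer H L))"
    by (rule bexE)
  show thesis by (rule that[OF \<sigma>(1)]) (use \<sigma>(2) in simp)
qed

text \<open>The homotopy d s' + s e = 1 survives induction at G/H although s and s' are natural only
  over H: both induce maps there, and the identity need only be tested on transfers.\<close>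

lemma Ind_exact:
  assumes P': "contra_module R OC P'" and P: "contra_module R OC P" and B: "contra_module R OC B" and H: "H \<in> \<F>"
    and d: "d \<in> cat_hom R OC P' P" and e: "e \<in> cat_hom R OC P B"
    and ed: "\<And>L m. L \<in> \<F> \<Longrightarrow> m \<in> carrier (Val P' L) \<Longrightarrow> e L (d L m) = \<zero>\<^bsub>Val B L\<^esub>"
    and s: "H_natural R H B P s" and s': "H_natural R H P P' s'"
    and hom: "\<And>L m. L \<in> \<F> \<Longrightarrow> L \<subseteq> H \<Longrightarrow> m \<in> carrier (Val P L) \<Longrightarrow> d L (s' L m) = m \<ominus>\<^bsub>Val P L\<^esub> s L (e L m)"
  shows "Ind_pi_sigma_map R G \<F> P d H ` carrier (IV P' H) = a_kernel (IV P H) (IV B H) (Ind_pi_sigma_map R G \<F> B e H)"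
proof -
  have HO: "H \<in> Ob HC" using H by simp
  note mP = module_IV[OF P HO] and mP' = module_IV[OF P' HO] and mB = module_IV[OF B HO]
  interpret PH: module R "IV P H" by (rule mP)
  let ?d = "Ind_pi_sigma_map R G \<F> P d H" and ?e = "Ind_pi_sigma_map R G \<F> B e H"
  note dh = Ind_map[OF P' P d HO] and eh = Ind_map[OF P B e HO]
  obtain \<sigma> where \<sigma>: "\<sigma> \<in> mod_hom R (IV B H) (IV P H)"
    and \<sigma>_t: "\<And>L m. L \<in> \<F> \<Longrightarrow> L \<subseteq> H \<Longrightarrow> m \<in> carrier (Val B L) \<Longrightarrow> \<sigma> (ind_tensor B H L m (transfer H L)) = ind_tensor P H L (s L m) (transfer H L)"
    by (fact H_natural_inducesE[OF B P H s])
  obtain \<sigma>' where \<sigma>': "\<sigma>' \<in> mod_hom R (IV P H) (IV P' H)"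
    and \<sigma>'_t: "\<And>L m. L \<in> \<F> \<Longrightarrow> L \<subseteq> H \<Longrightarrow> m \<in> carrier (Val P L) \<Longrightarrow> \<sigma>' (ind_tensor P H L m (transfer H L)) = ind_tensor P' H L (s' L m) (transfer H L)"
    by (fact H_natural_inducesE[OF P P' H s'])
  have eL: "e L \<in> mod_hom R (Val P L) (Val B L)" and dL: "d L \<in> mod_hom R (Val P' L) (Val P L)" if "L \<in> \<F>" for L
    using e d that by (simp_all add: cat_hom_def)
  have ed0: "?e (?d w) = \<zero>\<^bsub>IV B H\<^esub>" if w: "w \<in> carrier (IV P' H)" for w
  proof (rule Ind_hom_eqI[OF P' HO mB mod_hom_compose[OF dh(1) eh(1)] _ _ w, where g = "\<lambda>_. \<zero>\<^bsub>IV B H\<^esub>"])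
    interpret BH: module R "IV B H" by (rule mB)
    show "(\<lambda>_. \<zero>\<^bsub>IV B H\<^esub>) \<in> mod_hom R (IV P' H) (IV B H)" by (rule mod_homI) simp_all
    fix K m f assume *: "K \<in> Ob OC" "m \<in> carrier (Val P' K)" "f \<in> carrier (Hom HC H K)"
    have K: "K \<in> \<F>" using * by simp
    have mB: "module R (Val B K)" by (rule orbit_module_mod[OF B K])
    interpret BK: module R "Val B K" by (rule mB)
    have "(\<lambda>n. ind_tensor B H K n f) \<in> mod_hom R (Val B K) (IV B H)"
      by (rule mod_homI) (simp_all add: ind_tensor[OF B HO *(1)] *(3))
    then have "ind_tensor B H K \<zero>\<^bsub>Val B K\<^esub> f = \<zero>\<^bsub>IV B H\<^esub>" using mod_hom_zero[OF mB BH.module_axioms] by blast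
    then show "?e (?d (ind_tensor P' H K m f)) = \<zero>\<^bsub>IV B H\<^esub>"
      using dh(2)[OF *] eh(2)[OF *(1) mod_homD(2)[OF dL[OF K] *(2)] *(3)] ed[OF K *(2)] by simp
  qed
  \<comment> \<open>An element killed by \<open>?e\<close> is therefore \<open>?d\<close> applied to
    its image under \<open>\<sigma>'\<close>.\<close>
  have id: "?d (\<sigma>' w) \<oplus>\<^bsub>IV P H\<^esub> \<sigma> (?e w) = w" if w: "w \<in> carrier (IV P H)" for w
  proof -
    note ds = mod_hom_compose[OF \<sigma>' dh(1)] and es = mod_hom_compose[OF eh(1) \<sigma>]
    have sum: "(\<lambda>w. ?d (\<sigma>' w) \<oplus>\<^bsub>IV P H\<^esub> \<sigma> (?e w)) \<in> mod_hom R (IV P H) (IV P H)"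
      by (rule mod_homI) (simp_all add: mod_homD(2-4)[OF ds] mod_homD(2-4)[OF es] PH.smult_r_distr PH.M.a_ac)
    show ?thesis
    proof (rule transfer_hom_eqI[OF P H mP sum mod_hom_id _ w])
      fix L m assume L: "L \<in> \<F>" "L \<subseteq> H" and m: "m \<in> carrier (Val P L)"
      have LO: "L \<in> Ob OC" using L by simp
      interpret PL: module R "Val P L" by (rule orbit_module_mod[OF P L(1)])
      note t = transfer_closed[OF H L]
      have s'm: "s' L m \<in> carrier (Val P' L)" by (rule mod_homD(2)[OF H_naturalD(1)[OF s' L] m])
      have em: "e L m \<in> carrier (Val B L)" by (rule mod_homD(2)[OF eL[OF L(1)] m])
      have sem: "s L (e L m) \<in> carrier (Val P L)" by (rule mod_homD(2)[OF H_naturalD(1)[OF s L] em])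
      have "?d (\<sigma>' (ind_tensor P H L m (transfer H L))) \<oplus>\<^bsub>IV P H\<^esub> \<sigma> (?e (ind_tensor P H L m (transfer H L)))
          = ind_tensor P H L (m \<ominus>\<^bsub>Val P L\<^esub> s L (e L m)) (transfer H L) \<oplus>\<^bsub>IV P H\<^esub> ind_tensor P H L (s L (e L m)) (transfer H L)"
        by (simp only: \<sigma>'_t[OF L m] dh(2)[OF LO s'm t] hom[OF L m] eh(2)[OF LO m t] \<sigma>_t[OF L em])
      also have "\<dots> = ind_tensor P H L ((m \<ominus>\<^bsub>Val P L\<^esub> s L (e L m)) \<oplus>\<^bsub>Val P L\<^esub> s L (e L m)) (transfer H L)"
        using m sem by (intro ind_tensor_add_left[OF P HO LO _ sem t, symmetric]) simp
      also have "(m \<ominus>\<^bsub>Val P L\<^esub> s L (e L m)) \<oplus>\<^bsub>Val P L\<^esub> s L (e L m) = m"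
        using m sem by (simp add: a_minus_def PL.M.a_assoc PL.M.l_neg)
      finally show "?d (\<sigma>' (ind_tensor P H L m (transfer H L))) \<oplus>\<^bsub>IV P H\<^esub> \<sigma> (?e (ind_tensor P H L m (transfer H L)))
          = ind_tensor P H L m (transfer H L)" .
    qed
  qed
  show ?thesis
  proof (intro equalityI subsetI)
    fix w assume "w \<in> ?d ` carrier (IV P' H)"
    then show "w \<in> a_kernel (IV P H) (IV B H) ?e" using ed0 mod_homD(2)[OF dh(1)] by (auto simp: a_kernel_eq)
  next
    fix w assume "w \<in> a_kernel (IV P H) (IV B H) ?e"
    then have w: "w \<in> carrier (IV P H)" "?e w = \<zero>\<^bsub>IV B H\<^esub>" by (simp_all add: a_kernel_eq)
    have s'w: "\<sigma>' w \<in> carrier (IV P' H)" by (rule mod_homD(2)[OF \<sigma>' w(1)])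
    have "?d (\<sigma>' w) = w"
      using id[OF w(1)] w(2) mod_hom_zero[OF mB mP \<sigma>] mod_homD(2)[OF dh(1) s'w] by simp
    then show "w \<in> ?d ` carrier (IV P' H)" using s'w by (metis imageI)
  qed
qed

end


section \<open>The constant module and the fixed point functor\<close>

lemma frag_total_image: "frag_total (frag_extend (\<lambda>x. frag_of (h x)) u) = frag_total u"
  using subset_UNIV[of "Poly_Mapping.keys u"]
  by (induction u rule: frag_induction) (auto simp: frag_extend_diff frag_total_diff)

context orbit_to_hecke
begin

abbreviation "CM \<equiv> const_module R"
abbreviation "FP \<equiv> fixed_point_module R G"

lemma contra_CM: "contra_module R OC CM"
  by (rule contra_const_module[OF cring])

lemma contra_FP: "contra_module R HC FP"
  by (rule contra_fixed_point_module[OF cring is_group family])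

lemma CM_simps [simp]: "Val CM K = regular_module R" "Act CM K K' u r = [frag_total u] \<cdot>\<^bsub>R\<^esub> r"
  by (simp_all add: const_module_def)

lemma FP_simps:
  "carrier (Val FP H) = {\<phi> \<in> hom (perm_module G H) (add_monoid R) \<inter> extensional (carrier (perm_module G H)).
     \<forall>g\<in>carrier G. \<forall>v\<in>carrier (perm_module G H). \<phi> (perm_act G g v) = \<phi> v}"
  "\<phi> \<oplus>\<^bsub>Val FP H\<^esub> \<psi> = (\<lambda>v\<in>carrier (perm_module G H). \<phi> v \<oplus>\<^bsub>R\<^esub> \<psi> v)"
  "r \<odot>\<^bsub>Val FP H\<^esub> \<phi> = (\<lambda>v\<in>carrier (perm_module G H). r \<otimes>\<^bsub>R\<^esub> \<phi> v)"
  "Act FP H K f \<phi> = compose (carrier (perm_module G H)) \<phi> f"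
  by (simp_all add: fixed_point_module_def)

section \<open>The induced constant module as the fixed point functor\<close>

definition total_map :: "'g set \<Rightarrow> 'r \<Rightarrow> (('g set \<Rightarrow>\<^sub>0 int) \<Rightarrow> ('g set \<Rightarrow>\<^sub>0 int)) \<Rightarrow> ('g set \<Rightarrow>\<^sub>0 int) \<Rightarrow> 'r" where
  "total_map H r f = (\<lambda>v\<in>carrier (perm_module G H). [frag_total (f v)] \<cdot>\<^bsub>R\<^esub> r)"

interpretation R: cring R by (rule cring)

text \<open>Composing with \<open>pi_sigma G K K' \<alpha>\<close> multiplies the coefficient sum by
  \<open>frag_total \<alpha>\<close>, and this is also how \<open>\<alpha>\<close> acts on the
  constant module; hence the map is balanced.\<close>

lemma total_map_induces:
  assumes H: "H \<in> \<F>"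
  shows "\<exists>\<Phi>\<in>mod_hom R (IV CM H) (Val FP H). \<forall>K\<in>Ob OC. \<forall>r\<in>carrier (Val CM K). \<forall>f\<in>carrier (Hom HC H K).
    \<Phi> (ind_tensor CM H K r f) = total_map H r f"
proof (rule Ind_universal[OF contra_CM])
  show HO: "H \<in> Ob HC" using H by simp
  show "module R (Val FP H)" by (rule contra_moduleD(1)[OF contra_FP HO])
  note pc = perm_act_closed[OF is_group fam_carrier[OF H]]
  fix K r f assume "K \<in> Ob OC" and r: "r \<in> carrier (Val CM K)" and f: "f \<in> carrier (Hom HC H K)"
  then have rR: "r \<in> carrier R" by simp
  have fh: "f (u + v) = f u + f v" if "Poly_Mapping.keys u \<subseteq> lcosets H" "Poly_Mapping.keys v \<subseteq> lcosets H" for u v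
    using f that by (simp add: carrier_Hom_HC hom_def)
  have fg: "f (perm_act G g v) = perm_act G g (f v)" if "g \<in> carrier G" "Poly_Mapping.keys v \<subseteq> lcosets H" for g v
    using f that by (simp add: carrier_Hom_HC)
  show "total_map H r f \<in> carrier (Val FP H)"
    using pc rR by (auto del: subsetI simp: total_map_def FP_simps hom_def keys_add_closed fh fg frag_total_add R.add.int_pow_mult)
       (simp add: perm_act_def frag_total_image)
  show "total_map H (r \<oplus>\<^bsub>Val CM K\<^esub> r') f = total_map H r f \<oplus>\<^bsub>Val FP H\<^esub> total_map H r' f" if "r' \<in> carrier (Val CM K)" for r'
    using that rR by (auto simp: total_map_def FP_simps R.add.int_pow_distrib fun_eq_iff)
  show "total_map H r (f \<otimes>\<^bsub>Hom HC H K\<^esub> f') = total_map H r f \<oplus>\<^bsub>Val FP H\<^esub> total_map H r f'" for f'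
    using rR by (auto simp: total_map_def FP_simps hecke_category_def frag_total_add R.add.int_pow_mult fun_eq_iff)
  show "total_map H (s \<odot>\<^bsub>Val CM K\<^esub> r) f = s \<odot>\<^bsub>Val FP H\<^esub> total_map H r f" if "s \<in> carrier R" for s
    using that rR by (auto simp: total_map_def FP_simps R.add_pow_rdistr_int fun_eq_iff)
next
  fix K K' \<alpha> r f assume K: "K \<in> Ob OC" "K' \<in> Ob OC" and r: "r \<in> carrier (Val CM K')" and f: "f \<in> carrier (Hom HC H K)"
  have fv: "Poly_Mapping.keys (f v) \<subseteq> lcosets K" if "Poly_Mapping.keys v \<subseteq> lcosets H" for v
    using hom_in_carrier[OF HC_value_hom f] that by simp
  show "total_map H (Act CM K K' \<alpha> r) f = total_map H r (Comp HC H K K' (pi_sigma G K K' \<alpha>) f)"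
    using r fv by (auto del: subsetI simp: total_map_def fun_eq_iff hecke_category_def compose_def pi_sigma_def frag_total_comp R.add.int_pow_pow)
qed

lemma transfer_self:
  assumes "H \<in> \<F>" shows "transfer H H = Ident HC H"
proof (rule HC_eqI[OF assms assms])
  have "(\<lambda>h. h <# H) ` H = {H}"
  proof -
    have "h <# H = H" if "h \<in> H" for h using coset_join3[OF _ fam_sub[OF assms] that] fam_carrier[OF assms] that by auto
    then have "(\<lambda>h. h <# H) ` H = (\<lambda>_. H) ` H" by (rule image_cong[OF refl])
    then show ?thesis using subgroup.one_closed[OF fam_sub[OF assms]] by (simp add: image_constant_conv) blast
  qed
  then show "transfer H H (frag_of H) = Ident HC H (frag_of H)"
    using sub_lcosets[OF fam_sub[OF assms]] sub_cosets_base[OF assms assms order_refl]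
    by (simp add: transfer_base[OF assms] hecke_category_def)
qed (use assms transfer_closed D.Ident_in_Hom in auto)

text \<open>On the constant module, \<open>r\<close> at L is the restriction of \<open>r\<close> at
  H along L |-> H. Balancing moves it to H, where the transfer has become card H / card L times the
  identity. The witness \<open>r'\<close> is this multiple of \<open>r\<close>.\<close>

lemma const_ind_tensor:
  assumes H: "H \<in> \<F>" and L: "L \<in> \<F>" "L \<subseteq> H" and r: "r \<in> carrier R"
  obtains r' where "r' \<in> carrier R" and "ind_tensor CM H L r (transfer H L) = ind_tensor CM H H r' (Ident HC H)"
proof -
  have HO: "H \<in> Ob HC" "H \<in> Ob OC" "L \<in> Ob OC" using H L by simp_all
  have fixH: "l <# H = H" if "l \<in> L" for l using coset_join3[OF _ fam_sub[OF H]] that L(2) fam_carrier[OF H] by auto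
  note HH = sub_lcosets[OF fam_sub[OF H]]
  have c: "coset_map L H \<in> G_maps G L H" by (rule coset_map_G_maps[OF fam_sub[OF L(1)] fam_sub[OF H] HH fixH])
  let ?q = "int (card H div card L)"
  note Id = D.Ident_in_Hom[OF HO(1)]
  interpret W: module R "IV CM H" by (rule module_IV[OF contra_CM HO(1)])
  have g: "group (Hom HC H H)" using comm_group.axioms(2)[OF D.Hom_comm_group] H by simp
  have "ind_tensor CM H L r (transfer H L) = ind_tensor CM H L (Act CM L H (frag_of (coset_map L H)) r) (transfer H L)"
    using r by simp
  also have "\<dots> = ind_tensor CM H H r (transfer H H [^]\<^bsub>Hom HC H H\<^esub> ?q)"
    using ind_tensor_balanced[OF contra_CM HO(1,3,2), of "frag_of (coset_map L H)" r "transfer H L"] c r transfer_closed[OF H L]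
      comp_transfer(2)[OF H L H order_refl HH order_refl fixH] by simp
  also have "\<dots> = [?q] \<cdot>\<^bsub>IV CM H\<^esub> ind_tensor CM H H r (Ident HC H)"
    unfolding add_pow_def transfer_self[OF H]
    by (rule hom_int_pow[OF _ Id g W.M.a_group]) (use r in \<open>simp add: hom_def ind_tensor[OF contra_CM HO(1,2)]\<close>)
  also have "\<dots> = ind_tensor CM H H ([?q] \<cdot>\<^bsub>R\<^esub> r) (Ident HC H)"
  proof -
    have "(\<lambda>r. ind_tensor CM H H r (Ident HC H)) \<in> hom (add_monoid R) (add_monoid (IV CM H))"
      using ind_tensor_closed[OF contra_CM HO(1,2) _ Id] ind_tensor_add_left[OF contra_CM HO(1,2) _ _ Id] by (simp add: hom_def)
    from hom_int_pow[OF this _ R.a_group W.M.a_group, of r ?q] show ?thesis using r by (simp add: add_pow_def)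
  qed
  finally show thesis using that r by blast
qed

lemma Ind_const_iso_fixed_points: "\<exists>\<theta>. \<theta> \<in> cat_iso R HC (Ind_pi_sigma R G \<F> CM) FP"
proof -
  obtain \<theta> where \<theta>: "\<And>H. H \<in> \<F> \<Longrightarrow> \<theta> H \<in> mod_hom R (IV CM H) (Val FP H)"
    and \<theta>_t: "\<And>H K r f. H \<in> \<F> \<Longrightarrow> K \<in> \<F> \<Longrightarrow> r \<in> carrier R \<Longrightarrow> f \<in> carrier (Hom HC H K) \<Longrightarrow> \<theta> H (ind_tensor CM H K r f) = total_map H r f"
  proof -
    have "\<forall>H\<in>\<F>. \<exists>\<Phi>. \<Phi> \<in> mod_hom R (IV CM H) (Val FP H) \<and> (\<forall>K\<in>\<F>. \<forall>r\<in>carrier R. \<forall>f\<in>carrier (Hom HC H K). \<Phi> (ind_tensor CM H K r f) = total_map H r f)"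
      using total_map_induces by (simp add: Bex_def)
    from bchoice[OF this] show thesis using that by blast
  qed
  have "\<theta> \<in> cat_hom R HC (Ind_pi_sigma R G \<F> CM) FP"
    unfolding cat_hom_def mem_Collect_eq
  proof (intro conjI ballI)
    show "\<theta> H \<in> mod_hom R (IV CM H) (Val FP H)" if "H \<in> Ob HC" for H using \<theta> that by simp
    fix H H' \<beta> w assume H: "H \<in> Ob HC" and H': "H' \<in> Ob HC" and \<beta>: "\<beta> \<in> carrier (Hom HC H H')" and w: "w \<in> carrier (IV CM H')"
    have HF: "H \<in> \<F>" "H' \<in> \<F>" using H H' by simp_all
    show "\<theta> H (Act (Ind_pi_sigma R G \<F> CM) H H' \<beta> w) = Act FP H H' \<beta> (\<theta> H' w)"
    proof (rule Ind_hom_eqI[OF contra_CM H' contra_moduleD(1)[OF contra_FP H]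
          mod_hom_compose[OF Ind_Act_hom[OF contra_CM H H' \<beta>] \<theta>[OF HF(1)]]
          mod_hom_compose[OF \<theta>[OF HF(2)] contra_moduleD(2)[OF contra_FP H H' \<beta>]] _ w])
      fix K r f assume *: "K \<in> Ob OC" "r \<in> carrier (Val CM K)" "f \<in> carrier (Hom HC H' K)"
      have K: "K \<in> \<F>" "r \<in> carrier R" using * by simp_all
      have "\<beta> v \<in> carrier (perm_module G H')" if "v \<in> carrier (perm_module G H)" for v
        using hom_in_carrier[OF HC_value_hom[OF that] \<beta>] .
      then have "total_map H r (Comp HC H H' K f \<beta>) = Act FP H H' \<beta> (total_map H' r f)"
        by (auto simp: total_map_def FP_simps hecke_category_def compose_def fun_eq_iff)
      then show "\<theta> H (Act (Ind_pi_sigma R G \<F> CM) H H' \<beta> (ind_tensor CM H' K r f)) = Act FP H H' \<beta> (\<theta> H' (ind_tensor CM H' K r f))"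
        using HC_Comp_closed[OF HF K(1) \<beta> *(3)]
        by (simp only: Ind_Act_tensor[OF contra_CM H H' \<beta> *] \<theta>_t[OF HF(1) K] \<theta>_t[OF HF(2) K *(3)])
    qed
  qed
  moreover have "bij_betw (\<theta> H) (carrier (IV CM H)) (carrier (Val FP H))" if H: "H \<in> \<F>" for H
  proof -
    have HO: "H \<in> Ob HC" "H \<in> Ob OC" using H by simp_all
    note Id = D.Ident_in_Hom[OF HO(1)]
    have b: "frag_of H \<in> carrier (perm_module G H)" using sub_lcosets[OF fam_sub[OF H]] by simp
    \<comment> \<open>The inverse: a fixed point is determined by its value at the base
      coset.\<close>
    define \<rho> where "\<rho> \<phi> = ind_tensor CM H H (\<phi> (frag_of H)) (Ident HC H)" for \<phi>
    have \<phi>b: "\<phi> (frag_of H) \<in> carrier R" if "\<phi> \<in> carrier (Val FP H)" for \<phi>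
      using hom_in_carrier[of \<phi> "perm_module G H" "add_monoid R" "frag_of H"] that b by (simp add: FP_simps)
    have \<rho>: "\<rho> \<in> mod_hom R (Val FP H) (IV CM H)"
    proof (rule mod_homI)
      fix \<phi> assume p: "\<phi> \<in> carrier (Val FP H)"
      show "\<rho> \<phi> \<in> carrier (IV CM H)" using \<phi>b[OF p] ind_tensor_closed[OF contra_CM HO _ Id] by (simp add: \<rho>_def)
      show "\<rho> (\<phi> \<oplus>\<^bsub>Val FP H\<^esub> \<psi>) = \<rho> \<phi> \<oplus>\<^bsub>IV CM H\<^esub> \<rho> \<psi>" if "\<psi> \<in> carrier (Val FP H)" for \<psi>
        using b \<phi>b[OF p] \<phi>b[OF that] ind_tensor_add_left[OF contra_CM HO _ _ Id, of "\<phi> (frag_of H)" "\<psi> (frag_of H)"]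
        by (simp add: \<rho>_def FP_simps)
      show "\<rho> (r \<odot>\<^bsub>Val FP H\<^esub> \<phi>) = r \<odot>\<^bsub>IV CM H\<^esub> \<rho> \<phi>" if "r \<in> carrier R" for r
        using b \<phi>b[OF p] that ind_tensor_smult[OF contra_CM HO that _ Id, of "\<phi> (frag_of H)"] by (simp add: \<rho>_def FP_simps)
    qed
    have tb: "total_map H r (Ident HC H) = (\<lambda>v\<in>carrier (perm_module G H). [frag_total v] \<cdot>\<^bsub>R\<^esub> r)" for r
      by (auto simp: total_map_def hecke_category_def fun_eq_iff)
    \<comment> \<open>It suffices to test transfers, and by \<open>const_ind_tensor\<close> such an
      element is a tensor with the identity of H, from which evaluation at the base coset recovers
      the scalar.\<close>
    have \<rho>\<theta>: "\<rho> (\<theta> H w) = w" if w: "w \<in> carrier (IV CM H)" for w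
    proof (rule transfer_hom_eqI[OF contra_CM H module_IV[OF contra_CM HO(1)] mod_hom_compose[OF \<theta>[OF H] \<rho>] mod_hom_id _ w])
      fix L r assume L: "L \<in> \<F>" "L \<subseteq> H" and "r \<in> carrier (Val CM L)"
      then have r: "r \<in> carrier R" by simp
      obtain r' where r': "r' \<in> carrier R" and eq: "ind_tensor CM H L r (transfer H L) = ind_tensor CM H H r' (Ident HC H)"
        by (fact const_ind_tensor[OF H L r])
      have "\<theta> H (ind_tensor CM H H r' (Ident HC H)) (frag_of H) = r'"
        using b r' by (simp add: \<theta>_t[OF H H r' Id] tb)
      then show "\<rho> (\<theta> H (ind_tensor CM H L r (transfer H L))) = ind_tensor CM H L r (transfer H L)"
        by (simp add: eq \<rho>_def)
    qed
    have \<theta>\<rho>: "\<theta> H (\<rho> \<phi>) = \<phi>" if p: "\<phi> \<in> carrier (Val FP H)" for \<phi>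
    proof -
      let ?r = "\<phi> (frag_of H)"
      have p': "\<phi> \<in> hom (perm_module G H) (add_monoid R)" "\<phi> \<in> extensional (carrier (perm_module G H))"
        "\<And>g v. g \<in> carrier G \<Longrightarrow> v \<in> carrier (perm_module G H) \<Longrightarrow> \<phi> (perm_act G g v) = \<phi> v"
        using p unfolding FP_simps by blast+
      have t: "(\<lambda>v. [frag_total v] \<cdot>\<^bsub>R\<^esub> ?r) \<in> hom (perm_module G H) (add_monoid R)"
        using \<phi>b[OF p] by (simp add: hom_def frag_total_add R.add.int_pow_mult)
      \<comment> \<open>An invariant function has the same value on all cosets, because G permutes
        them transitively.\<close>
      have "[frag_total v] \<cdot>\<^bsub>R\<^esub> ?r = \<phi> v" if "v \<in> carrier (perm_module G H)" for v
      proof (rule frag_hom_eqI[OF R.a_group t p'(1)])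
        fix X assume "X \<in> lcosets H"
        then obtain g where g: "g \<in> carrier G" "X = g <# H" by (rule lcosets_cases)
        then have "\<phi> (frag_of X) = ?r" using p'(3)[OF g(1) b] by (simp add: perm_act_def)
        then show "[frag_total (frag_of X)] \<cdot>\<^bsub>R\<^esub> ?r = \<phi> (frag_of X)" using \<phi>b[OF p] by simp
      qed (use that in simp)
      then have "total_map H ?r (Ident HC H) = \<phi>"
        unfolding tb by (intro extensionalityI[OF _ p'(2)]) auto
      then show ?thesis by (simp add: \<rho>_def \<theta>_t[OF H H \<phi>b[OF p] Id])
    qed
    show ?thesis
      by (rule bij_betwI[where g = \<rho>]) (use mod_homD(2)[OF \<theta>[OF H]] mod_homD(2)[OF \<rho>] \<rho>\<theta> \<theta>\<rho> in auto)
  qed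
  ultimately have iso: "\<theta> \<in> cat_iso R HC (Ind_pi_sigma R G \<F> CM) FP" by (simp add: cat_iso_def)
  show ?thesis by (rule exI[of _ \<theta>]) (rule iso)
qed

text \<open>Over the orbit category of H the constant module is free on H, so a section is given by
  a preimage \<open>u\<close> of one at H: it sends \<open>r\<close> at L to \<open>r\<close> times
  the restriction of \<open>u\<close>. Naturality holds because L -> L' -> H and L -> H agree, every
  coset inside H having product H with H.\<close>

lemma const_section:
  assumes P: "contra_module R OC P" and H: "H \<in> \<F>" and \<epsilon>: "\<epsilon> \<in> cat_hom R OC P CM"
    and sur: "\<epsilon> H ` carrier (Val P H) = carrier (Val CM H)"
  obtains s where "H_natural R H CM P s" and "\<And>L r. L \<in> \<F> \<Longrightarrow> L \<subseteq> H \<Longrightarrow> r \<in> carrier R \<Longrightarrow> \<epsilon> L (s L r) = r"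
proof -
  have "\<one>\<^bsub>R\<^esub> \<in> \<epsilon> H ` carrier (Val P H)" by (simp add: sur)
  then obtain u where u: "u \<in> carrier (Val P H)" "\<epsilon> H u = \<one>\<^bsub>R\<^esub>" by (metis imageE)
  note HH = sub_lcosets[OF fam_sub[OF H]]
  have fixH: "l <# H = H" if "l \<in> L" "L \<subseteq> H" for l L using coset_join3[OF _ fam_sub[OF H]] that fam_carrier[OF H] by auto
  have c: "coset_map L H \<in> G_maps G L H" if "L \<in> \<F>" "L \<subseteq> H" for L
    using coset_map_G_maps[OF fam_sub[OF that(1)] fam_sub[OF H] HH] fixH that(2) by blast
  define s where "s L r = r \<odot>\<^bsub>Val P L\<^esub> Act P L H (frag_of (coset_map L H)) u" for L r
  have uL: "Act P L H (frag_of (coset_map L H)) u \<in> carrier (Val P L)" if "L \<in> \<F>" "L \<subseteq> H" for L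
    by (rule mod_homD(2)[OF orbit_act[OF P that(1) H c[OF that]] u(1)])
  have "H_natural R H CM P s"
  proof (rule H_naturalI)
    fix L assume L: "L \<in> \<F>" "L \<subseteq> H"
    interpret PL: module R "Val P L" by (rule orbit_module_mod[OF P L(1)])
    show "s L \<in> mod_hom R (Val CM L) (Val P L)"
      by (rule mod_homI) (simp_all add: s_def uL[OF L] PL.smult_l_distr PL.smult_assoc1)
    fix L' y r
    assume L': "L' \<in> \<F>" "L' \<subseteq> H" and y: "y \<in> lcosets L'" "y \<subseteq> H" "\<And>l. l \<in> L \<Longrightarrow> l <# y = y" and "r \<in> carrier (Val CM L')"
    then have r: "r \<in> carrier R" by simp
    have cy: "coset_map L y \<in> G_maps G L L'" by (rule coset_map_G_maps[OF fam_sub[OF L(1)] fam_sub[OF L'(1)] y(1,3)])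
    obtain k where k: "k \<in> carrier G" "y = k <# L'" using y(1) by (rule lcosets_cases)
    have kH: "k \<in> H" using lcos_self[OF k(1) fam_sub[OF L'(1)]] k(2) y(2) by auto
    have "y <#> H = H"
      using set_mult_coset[OF fam_sub[OF L'(1)] fam_carrier[OF H] _ k(1)] fixH L'(2) coset_join3[OF k(1) fam_sub[OF H] kH] k(2) by simp
    then have "compose (lcosets L) (coset_map L' H) (coset_map L y) = coset_map L H"
      using compose_coset_map[OF fam_sub[OF L(1)] fam_sub[OF L'(1)] fam_sub[OF H] y(1,3) HH] fixH L'(2) by simp
    then show "s L (Act CM L L' (frag_of (coset_map L y)) r) = Act P L L' (frag_of (coset_map L y)) (s L' r)"
      using orbit_act_comp[OF P L(1) L'(1) H cy c[OF L'] u(1)] mod_homD(4)[OF orbit_act[OF P L(1) L'(1) cy] r uL[OF L']] r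
      by (simp add: s_def)
  qed
  moreover have "\<epsilon> L (s L r) = r" if L: "L \<in> \<F>" "L \<subseteq> H" and r: "r \<in> carrier R" for L r
  proof -
    have "\<epsilon> L \<in> mod_hom R (Val P L) (Val CM L)" using \<epsilon> L(1) by (simp add: cat_hom_def)
    from mod_homD(4)[OF this r uL[OF L]]
    have "\<epsilon> L (s L r) = r \<otimes>\<^bsub>R\<^esub> \<epsilon> L (Act P L H (frag_of (coset_map L H)) u)" by (simp add: s_def)
    also have "\<epsilon> L (Act P L H (frag_of (coset_map L H)) u) = \<one>\<^bsub>R\<^esub>"
      using \<epsilon> L(1) H c[OF L] u by (simp add: cat_hom_def)
    finally show ?thesis using r by simp
  qed
  ultimately show thesis by (rule that)
qed

text \<open>The second conclusion restates the hypothesis \<open>ese\<close> for the next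
  differential, so the contraction can be continued degree by degree. It follows from the homotopy
  because e d = 0.\<close>

lemma exactness_step:
  fixes P :: "('g set, ('g set \<Rightarrow> 'g set) \<Rightarrow>\<^sub>0 int, 'r, 'm) cat_module"
  assumes proj: "projective TYPE(('g set, ('g set \<Rightarrow> 'g set) \<Rightarrow>\<^sub>0 int, 'r, 'm) free_cover) R OC P"
    and P': "contra_module R OC P'" and B: "contra_module R OC B" and H: "H \<in> \<F>"
    and d: "d \<in> cat_hom R OC P' P" and e: "e \<in> cat_hom R OC P B"
    and ex: "\<And>L. L \<in> \<F> \<Longrightarrow> d L ` carrier (Val P' L) = a_kernel (Val P L) (Val B L) (e L)"
    and s: "H_natural R H B P s" and ese: "\<And>L m. L \<in> \<F> \<Longrightarrow> L \<subseteq> H \<Longrightarrow> m \<in> carrier (Val P L) \<Longrightarrow> e L (s L (e L m)) = e L m"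
  shows "Ind_pi_sigma_map R G \<F> P d H ` carrier (IV P' H) = a_kernel (IV P H) (IV B H) (Ind_pi_sigma_map R G \<F> B e H)"
    and "\<exists>s'. H_natural R H P P' s' \<and> (\<forall>L\<in>\<F>. L \<subseteq> H \<longrightarrow> (\<forall>m\<in>carrier (Val P' L). d L (s' L (d L m)) = d L m))"
proof -
  have P: "contra_module R OC P" using proj by (simp add: projective_def)
  obtain s' where s': "H_natural R H P P' s'"
    and hom: "\<And>L m. L \<in> \<F> \<Longrightarrow> L \<subseteq> H \<Longrightarrow> m \<in> carrier (Val P L) \<Longrightarrow> d L (s' L m) = m \<ominus>\<^bsub>Val P L\<^esub> s L (e L m)"
  proof -
    from homotopy_step[OF proj P' B H d e ex s ese] obtain s'
      where s': "H_natural R H P P' s' \<and> (\<forall>L\<in>\<F>. L \<subseteq> H \<longrightarrow> (\<forall>m\<in>carrier (Val P L). d L (s' L m) = m \<ominus>\<^bsub>Val P L\<^esub> s L (e L m)))"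
      by (rule exE)
    show thesis by (rule that[OF s'[THEN conjunct1]]) (use s'[THEN conjunct2] in simp)
  qed
  have ed: "d L m \<in> carrier (Val P L)" "e L (d L m) = \<zero>\<^bsub>Val B L\<^esub>" if "L \<in> \<F>" "m \<in> carrier (Val P' L)" for L m
    using ex[OF that(1)] that(2) by (auto simp: a_kernel_eq set_eq_iff)
  show "Ind_pi_sigma_map R G \<F> P d H ` carrier (IV P' H) = a_kernel (IV P H) (IV B H) (Ind_pi_sigma_map R G \<F> B e H)"
    by (rule Ind_exact[OF P' P B H d e ed(2) s s' hom])
  have "d L (s' L (d L m)) = d L m" if L: "L \<in> \<F>" "L \<subseteq> H" and m: "m \<in> carrier (Val P' L)" for L m
  proof -
    interpret PL: module R "Val P L" by (rule orbit_module_mod[OF P L(1)])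
    show ?thesis
      using hom[OF L ed(1)[OF L(1) m]] ed[OF L(1) m]
        mod_hom_zero[OF orbit_module_mod[OF B L(1)] PL.module_axioms H_naturalD(1)[OF s L]]
      by (simp add: a_minus_def)
  qed
  then show "\<exists>s'. H_natural R H P P' s' \<and> (\<forall>L\<in>\<F>. L \<subseteq> H \<longrightarrow> (\<forall>m\<in>carrier (Val P' L). d L (s' L (d L m)) = d L m))"
    using s' by (intro exI[of _ s'] conjI) simp_all
qed

text \<open>Exactness is objectwise, so the contraction may be chosen for each H separately.\<close>

lemma projective_resolution_Ind:
  fixes P :: "nat \<Rightarrow> ('g set, ('g set \<Rightarrow> 'g set) \<Rightarrow>\<^sub>0 int, 'r, 'm) cat_module"
  assumes \<theta>: "\<theta> \<in> cat_iso R HC (Ind_pi_sigma R G \<F> CM) FP"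
    and res: "projective_resolution TYPE(('g set, ('g set \<Rightarrow> 'g set) \<Rightarrow>\<^sub>0 int, 'r, 'm) free_cover) R OC CM P d \<epsilon>"
  shows "projective_resolution TYPE('w) R HC FP (\<lambda>n. Ind_pi_sigma R G \<F> (P n))
    (\<lambda>n. Ind_pi_sigma_map R G \<F> (P n) (d n)) (\<lambda>H. \<theta> H \<circ> Ind_pi_sigma_map R G \<F> CM \<epsilon> H)"
proof -
  have proj: "projective TYPE(('g set, ('g set \<Rightarrow> 'g set) \<Rightarrow>\<^sub>0 int, 'r, 'm) free_cover) R OC (P n)" for n
    using res by (simp add: projective_resolution_def)
  have P: "contra_module R OC (P n)" for n using proj by (simp add: projective_def)
  have d: "d n \<in> cat_hom R OC (P (Suc n)) (P n)" for n
    using res by (simp add: projective_resolution_def resolution_def)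
  have \<epsilon>: "\<epsilon> \<in> cat_hom R OC (P 0) CM"
    using res by (simp add: projective_resolution_def resolution_def)
  have sur: "\<epsilon> L ` carrier (Val (P 0) L) = carrier (Val CM L)"
    and ex0: "d 0 L ` carrier (Val (P (Suc 0)) L) = a_kernel (Val (P 0) L) (Val CM L) (\<epsilon> L)"
    and exS: "d (Suc n) L ` carrier (Val (P (Suc (Suc n))) L) = a_kernel (Val (P (Suc n)) L) (Val (P n) L) (d n L)" if "L \<in> \<F>" for L n
    using res that by (auto simp: projective_resolution_def resolution_def)
  have \<theta>h: "\<theta> \<in> cat_hom R HC (Ind_pi_sigma R G \<F> CM) FP"
    and \<theta>b: "\<And>H. H \<in> \<F> \<Longrightarrow> bij_betw (\<theta> H) (carrier (IV CM H)) (carrier (Val FP H))"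
    using \<theta> by (simp_all add: cat_iso_def)
  have \<epsilon>': "(\<lambda>H. \<theta> H \<circ> Ind_pi_sigma_map R G \<F> CM \<epsilon> H) \<in> cat_hom R HC (Ind_pi_sigma R G \<F> (P 0)) FP"
    using cat_hom_compose[OF cat_hom_Ind_map[OF P contra_CM \<epsilon>] \<theta>h] by (simp add: comp_def)
  have main: "(\<theta> H \<circ> Ind_pi_sigma_map R G \<F> CM \<epsilon> H) ` carrier (IV (P 0) H) = carrier (Val FP H)"
    "Ind_pi_sigma_map R G \<F> (P 0) (d 0) H ` carrier (IV (P (Suc 0)) H) = a_kernel (IV (P 0) H) (Val FP H) (\<theta> H \<circ> Ind_pi_sigma_map R G \<F> CM \<epsilon> H)"
    "\<And>n. Ind_pi_sigma_map R G \<F> (P (Suc n)) (d (Suc n)) H ` carrier (IV (P (Suc (Suc n))) H) =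
      a_kernel (IV (P (Suc n)) H) (IV (P n) H) (Ind_pi_sigma_map R G \<F> (P n) (d n) H)"
    if H: "H \<in> \<F>" for H
  proof -
    have HO: "H \<in> Ob HC" using H by simp
    let ?e = "Ind_pi_sigma_map R G \<F> CM \<epsilon> H"
    note eh = Ind_map[OF P contra_CM \<epsilon> HO]
    have \<theta>H: "\<theta> H \<in> mod_hom R (IV CM H) (Val FP H)" using \<theta>h H by (simp add: cat_hom_def)
    have mC: "module R (IV CM H)" by (rule module_IV[OF contra_CM HO])
    have mF: "module R (Val FP H)" by (rule contra_moduleD(1)[OF contra_FP HO])
    obtain s where s: "H_natural R H CM (P 0) s" and \<epsilon>s: "\<And>L r. L \<in> \<F> \<Longrightarrow> L \<subseteq> H \<Longrightarrow> r \<in> carrier R \<Longrightarrow> \<epsilon> L (s L r) = r"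
      by (fact const_section[OF P H \<epsilon> sur[OF H]])
    have \<epsilon>L: "\<epsilon> L \<in> mod_hom R (Val (P 0) L) (Val CM L)" if "L \<in> \<F>" for L using \<epsilon> that by (simp add: cat_hom_def)
    have ese: "\<epsilon> L (s L (\<epsilon> L m)) = \<epsilon> L m" if "L \<in> \<F>" "L \<subseteq> H" "m \<in> carrier (Val (P 0) L)" for L m
      using \<epsilon>s[OF that(1,2)] mod_homD(2)[OF \<epsilon>L[OF that(1)] that(3)] by simp
    obtain \<sigma> where \<sigma>: "\<sigma> \<in> mod_hom R (IV CM H) (IV (P 0) H)"
      and \<sigma>_t: "\<And>L m. L \<in> \<F> \<Longrightarrow> L \<subseteq> H \<Longrightarrow> m \<in> carrier (Val CM L) \<Longrightarrow> \<sigma> (ind_tensor CM H L m (transfer H L)) = ind_tensor (P 0) H L (s L m) (transfer H L)"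
      by (fact H_natural_inducesE[OF contra_CM P H s])
    \<comment> \<open>The section of the augmentation over H induces a section at G/H, which shows
      that the induced augmentation is onto.\<close>
    have "?e (\<sigma> w) = w" if w: "w \<in> carrier (IV CM H)" for w
    proof (rule transfer_hom_eqI[OF contra_CM H mC mod_hom_compose[OF \<sigma> eh(1)] mod_hom_id _ w])
      fix L m assume L: "L \<in> \<F>" "L \<subseteq> H" and m: "m \<in> carrier (Val CM L)"
      have LO: "L \<in> Ob OC" using L by simp
      show "?e (\<sigma> (ind_tensor CM H L m (transfer H L))) = ind_tensor CM H L m (transfer H L)"
        using eh(2)[OF LO mod_homD(2)[OF H_naturalD(1)[OF s L] m] transfer_closed[OF H L]] m
        by (simp add: \<sigma>_t[OF L m] \<epsilon>s[OF L])
    qed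
    then have "?e ` carrier (IV (P 0) H) = carrier (IV CM H)"
      using mod_homD(2)[OF eh(1)] mod_homD(2)[OF \<sigma>] by (auto simp: image_iff) metis
    then show "(\<theta> H \<circ> ?e) ` carrier (IV (P 0) H) = carrier (Val FP H)"
      using bij_betw_imp_surj_on[OF \<theta>b[OF H]] unfolding image_comp[symmetric] by simp
    note st0 = exactness_step[OF proj P contra_CM H d \<epsilon> ex0 s ese]
    \<comment> \<open>As \<open>\<theta> H\<close> is injective, composing with it does not change
      the kernel of the augmentation.\<close>
    have "\<theta> H w = \<zero>\<^bsub>Val FP H\<^esub> \<longleftrightarrow> w = \<zero>\<^bsub>IV CM H\<^esub>" if "w \<in> carrier (IV CM H)" for w
    proof -
      interpret C: module R "IV CM H" by (rule mC)
      show ?thesis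
        using mod_hom_zero[OF mC mF \<theta>H] bij_betw_imp_inj_on[OF \<theta>b[OF H]] that C.M.zero_closed by (metis inj_on_eq_iff)
    qed
    then show "Ind_pi_sigma_map R G \<F> (P 0) (d 0) H ` carrier (IV (P (Suc 0)) H) = a_kernel (IV (P 0) H) (Val FP H) (\<theta> H \<circ> ?e)"
      using mod_homD(2)[OF eh(1)] by (auto simp: st0(1) a_kernel_eq)
    \<comment> \<open>Partial contractions t with d t d = d in all degrees; degree zero starts from
      the section of the augmentation.\<close>
    have C: "\<exists>s. H_natural R H (P n) (P (Suc n)) s \<and> (\<forall>L\<in>\<F>. L \<subseteq> H \<longrightarrow> (\<forall>m\<in>carrier (Val (P (Suc n)) L). d n L (s L (d n L m)) = d n L m))" for n
    proof (induction n)
      case 0 show ?case by (rule st0(2))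
    next
      case (Suc n)
      then obtain t where t: "H_natural R H (P n) (P (Suc n)) t \<and> (\<forall>L\<in>\<F>. L \<subseteq> H \<longrightarrow> (\<forall>m\<in>carrier (Val (P (Suc n)) L). d n L (t L (d n L m)) = d n L m))"
        by (rule exE)
      show ?case
        by (rule exactness_step(2)[OF proj P P H d d exS t[THEN conjunct1]]) (use t[THEN conjunct2] in simp_all)
    qed
    show "Ind_pi_sigma_map R G \<F> (P (Suc n)) (d (Suc n)) H ` carrier (IV (P (Suc (Suc n))) H) =
      a_kernel (IV (P (Suc n)) H) (IV (P n) H) (Ind_pi_sigma_map R G \<F> (P n) (d n) H)" for n
    proof -
      obtain t where t: "H_natural R H (P n) (P (Suc n)) t \<and> (\<forall>L\<in>\<F>. L \<subseteq> H \<longrightarrow> (\<forall>m\<in>carrier (Val (P (Suc n)) L). d n L (t L (d n L m)) = d n L m))"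
        using C[of n] by (rule exE)
      show ?thesis
        by (rule exactness_step(1)[OF proj P P H d d exS t[THEN conjunct1]]) (use t[THEN conjunct2] in simp_all)
    qed
  qed
  have "resolution R HC FP (\<lambda>n. Ind_pi_sigma R G \<F> (P n)) (\<lambda>n. Ind_pi_sigma_map R G \<F> (P n) (d n)) (\<lambda>H. \<theta> H \<circ> Ind_pi_sigma_map R G \<F> CM \<epsilon> H)"
    unfolding resolution_def HC_simps One_nat_def
    by (intro conjI allI ballI contra_FP contra_module_Ind P cat_hom_Ind_map d \<epsilon>' main)
  \<comment> \<open>The test type is changed before inducing, because \<open>projective_Ind\<close>
    keeps the test type fixed.\<close>
  moreover have "projective TYPE('w) R HC (Ind_pi_sigma R G \<F> (P n))" for n
    by (rule projective_Ind[OF projective_any[OF proj]])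
  ultimately show ?thesis by (simp add: projective_resolution_def)
qed

end

theorem mainTheorem15:
  fixes R :: "('r, 'k) ring_scheme" and G :: "('g, 'l) monoid_scheme" and \<F> :: "'g set set"
  assumes "cring R" and "group G" and "subgroup_family G \<F>"
  shows "\<exists>\<theta> \<in> cat_iso R (hecke_category G \<F>) (Ind_pi_sigma R G \<F> (const_module R)) (fixed_point_module R G).
    \<forall>(P :: nat \<Rightarrow> ('g set, ('g set \<Rightarrow> 'g set) \<Rightarrow>\<^sub>0 int, 'r, 'm) cat_module) d \<epsilon>.
      projective_resolution TYPE(('g set, ('g set \<Rightarrow> 'g set) \<Rightarrow>\<^sub>0 int, 'r, 'm) free_cover)
        R (orbit_category G \<F>) (const_module R) P d \<epsilon> \<longrightarrow>
      projective_resolution TYPE('w)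
        R (hecke_category G \<F>) (fixed_point_module R G)
        (\<lambda>n. Ind_pi_sigma R G \<F> (P n))
        (\<lambda>n. Ind_pi_sigma_map R G \<F> (P n) (d n))
        (\<lambda>H. \<theta> H \<circ> Ind_pi_sigma_map R G \<F> (const_module R) \<epsilon> H)"
proof -
  interpret F: subgroup_family_group G \<F>
    using assms(2,3) by (intro subgroup_family_group.intro subgroup_family_group_axioms.intro)
  interpret orbit_to_hecke G \<F> R
    by (intro orbit_to_hecke.intro F.subgroup_family_group_axioms F.additive_functor_pi_sigma[OF assms(1)])
  from Ind_const_iso_fixed_points obtain \<theta> where "\<theta> \<in> cat_iso R F.HC (Ind_pi_sigma R G \<F> CM) FP" by (rule exE)
  then show ?thesis by (intro bexI[of _ \<theta>] allI impI projective_resolution_Ind)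
qed

end
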